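(* Let $k \geq 2$ and $s \in \{0,1,2\}$ be integers. The maximum number $f_3(3k+s)$ of subgraphs isomorphic to $K_3$ in a $1$-planar graph with $3k+s$ vertices is given by \[ f_3(3k+s) = \begin{cases} 32 & \text{if } 3k+s = 8,\\ 19k+5s-18 & \text{otherwise.}\end{cases} \]
   Context: Graphs are finite and simple. For a graph $G$, let $|G|$ be its simplicial $1$-complex as a topological space. A drawing of $G$ is a continuous map $\phi\colon |G| \to \mathbb{S}^2$ (the $2$-sphere) such that: for every vertex $v$ and every point $x\in|G|$, $\phi(v)=\phi(x)$ implies $x=v$; only finitely many points $x\in\mathbb{S}^2$ (the crossings) satisfy $|\phi^{-1}(x)|\ge 2$; each crossing has exactly two preimages, which are inner points of distinct edges (these two edges are said to cross); and for each crossing $x$ there is an open set $D\ni x$ such that for every open $D'\subseteq D$ with $x\in D'$, removing the image of one of the two edges involved in $x$ disconnects $D'$ such that multiple components contain image points of the other edge (so the edges really cross rather than touch). A $1$-drawing is a drawing in which no edge is involved in more than one crossing. A graph is $1$-planar if it has a $1$-drawing. *)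

theory Defs
  imports "HOL-Analysis.Analysis"
begin

record 'a sgraph =
  verts :: "'a set"
  edges :: "'a set set"

definition sgraph :: "'a sgraph \<Rightarrow> bool" where
  "sgraph G \<longleftrightarrow> finite (verts G) \<and> (\<forall>e \<in> edges G. e \<subseteq> verts G \<and> card e = 2)"

definition subgraph :: "'a sgraph \<Rightarrow> 'a sgraph \<Rightarrow> bool" where
  "subgraph H G \<longleftrightarrow> sgraph H \<and> verts H \<subseteq> verts G \<and> edges H \<subseteq> edges G"

definition isomorphic :: "'a sgraph \<Rightarrow> 'b sgraph \<Rightarrow> bool" where
  "isomorphic G H \<longleftrightarrow>
     (\<exists>f. bij_betw f (verts G) (verts H) \<and>
          (\<forall>u \<in> verts G. \<forall>v \<in> verts G. {u, v} \<in> edges G \<longleftrightarrow> {f u, f v} \<in> edges H))"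

definition complete_graph :: "nat \<Rightarrow> nat sgraph" where
  "complete_graph n = \<lparr>verts = {..<n}, edges = {e. e \<subseteq> {..<n} \<and> card e = 2}\<rparr>"

definition num_subgraphs_iso :: "'b sgraph \<Rightarrow> 'a sgraph \<Rightarrow> nat" where
  "num_subgraphs_iso F G = card {H. subgraph H G \<and> isomorphic H F}"


text \<open>
  The geometric realization of a graph as a simplicial 1-complex, in barycentric coordinates.
  It carries the subspace topology of the product topology on functions; as graphs are finite,
  this is the usual topology of the complex.
\<close>

definition supp :: "('a \<Rightarrow> real) \<Rightarrow> 'a set" where
  "supp x = {v. x v \<noteq> 0}"

definition simplices :: "'a sgraph \<Rightarrow> 'a set set" where
  "simplices G = (\<lambda>v. {v}) ` verts G \<union> edges G"

definition realization :: "'a sgraph \<Rightarrow> ('a \<Rightarrow> real) set" where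
  "realization G = {x. (\<forall>v. 0 \<le> x v) \<and> (\<Sum>v \<in> verts G. x v) = 1 \<and> supp x \<in> simplices G}"

definition vertex_point :: "'a \<Rightarrow> 'a \<Rightarrow> real" where
  "vertex_point v = (\<lambda>w. if w = v then 1 else 0)"

definition edge_points :: "'a sgraph \<Rightarrow> 'a set \<Rightarrow> ('a \<Rightarrow> real) set" where
  "edge_points G e = {x \<in> realization G. supp x \<subseteq> e}"

definition inner_points :: "'a sgraph \<Rightarrow> 'a set \<Rightarrow> ('a \<Rightarrow> real) set" where
  "inner_points G e = {x \<in> realization G. supp x = e}"


abbreviation S2 :: "(real^3) set" where
  "S2 \<equiv> sphere 0 1"

definition preimages :: "'a sgraph \<Rightarrow> (('a \<Rightarrow> real) \<Rightarrow> real^3) \<Rightarrow> real^3 \<Rightarrow> ('a \<Rightarrow> real) set" where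
  "preimages G \<phi> p = {x \<in> realization G. \<phi> x = p}"

text \<open>
  Having at least two preimages is not expressed by \<^const>\<open>card\<close>, which is 0 on infinite sets.
\<close>

definition crossings :: "'a sgraph \<Rightarrow> (('a \<Rightarrow> real) \<Rightarrow> real^3) \<Rightarrow> (real^3) set" where
  "crossings G \<phi> = {p \<in> S2. \<exists>x \<in> preimages G \<phi> p. \<exists>y \<in> preimages G \<phi> p. x \<noteq> y}"

text \<open>Removing \<open>A\<close> from \<open>D\<close> leaves at least two components that contain points of \<open>B\<close>.\<close>

definition separates :: "(real^3) set \<Rightarrow> (real^3) set \<Rightarrow> (real^3) set \<Rightarrow> bool" where
  "separates D A B \<longleftrightarrow>
     (\<exists>C1 \<in> components (D - A). \<exists>C2 \<in> components (D - A).
        C1 \<noteq> C2 \<and> C1 \<inter> B \<noteq> {} \<and> C2 \<inter> B \<noteq> {})"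

definition cross_at :: "(real^3) set \<Rightarrow> (real^3) set \<Rightarrow> real^3 \<Rightarrow> bool" where
  "cross_at A B p \<longleftrightarrow>
     (\<exists>D. openin (top_of_set S2) D \<and> p \<in> D \<and>
        (\<forall>D'. openin (top_of_set S2) D' \<and> D' \<subseteq> D \<and> p \<in> D' \<longrightarrow>
           separates D' A B \<or> separates D' B A))"

definition is_drawing :: "'a sgraph \<Rightarrow> (('a \<Rightarrow> real) \<Rightarrow> real^3) \<Rightarrow> bool" where
  "is_drawing G \<phi> \<longleftrightarrow>
     continuous_on (realization G) \<phi> \<and> \<phi> ` realization G \<subseteq> S2 \<and>
     (\<forall>v \<in> verts G. \<forall>x \<in> realization G. \<phi> (vertex_point v) = \<phi> x \<longrightarrow> x = vertex_point v) \<and>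
     finite (crossings G \<phi>) \<and>
     (\<forall>p \<in> crossings G \<phi>.
        \<exists>e \<in> edges G. \<exists>f \<in> edges G. \<exists>x \<in> inner_points G e. \<exists>y \<in> inner_points G f.
          e \<noteq> f \<and> preimages G \<phi> p = {x, y} \<and>
          cross_at (\<phi> ` edge_points G e) (\<phi> ` edge_points G f) p)"

definition involved_in :: "'a sgraph \<Rightarrow> (('a \<Rightarrow> real) \<Rightarrow> real^3) \<Rightarrow> 'a set \<Rightarrow> real^3 \<Rightarrow> bool" where
  "involved_in G \<phi> e p \<longleftrightarrow> p \<in> crossings G \<phi> \<and> p \<in> \<phi> ` inner_points G e"

definition is_1_drawing :: "'a sgraph \<Rightarrow> (('a \<Rightarrow> real) \<Rightarrow> real^3) \<Rightarrow> bool" where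
  "is_1_drawing G \<phi> \<longleftrightarrow> is_drawing G \<phi> \<and>
     (\<forall>e \<in> edges G. \<forall>p q. involved_in G \<phi> e p \<and> involved_in G \<phi> e q \<longrightarrow> p = q)"

definition one_planar :: "'a sgraph \<Rightarrow> bool" where
  "one_planar G \<longleftrightarrow> sgraph G \<and> (\<exists>\<phi>. is_1_drawing G \<phi>)"

end

theory Submission
  imports Defs
begin

text \<open>
  Planarity is used only through the duality between cycles and cuts: faces are labels such that the edge sets
  with even degree everywhere are exactly the sets separating two classes of faces. Planarising a 1-drawing gives
  such a labelling (by the Jordan curve theorem and Janiszewski's theorem), and Euler's inequality
  with various weights yields \<open>|E| \<le> 4n - 8\<close>.

  Let \<open>\<delta> = 4n - 8 - |E|\<close>, and let \<open>\<delta>\<^sub>v\<close> be the same quantity for the subgraph induced on the closed neighbourhood of \<open>v\<close>.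
  Summing the number of edges inside the neighbourhoods, three times the number of triangles is
  \<open>20n - 48 - 6\<delta> - (\<Sum>v. \<delta>\<^sub>v)\<close>, so it remains to see that \<open>\<delta>\<close> or many of the \<open>\<delta>\<^sub>v\<close> are large. If \<open>\<delta> \<le> 1\<close>, the faces are almost
  all kites and the uncrossed edges are almost bipartite, the two edges of a crossing lying in opposite classes.
  This forces \<open>\<delta>\<^sub>v \<ge> 1\<close>, and small \<open>\<delta>\<^sub>v\<close> at a vertex not adjacent to all others yields a small
  separating set, which is handled by induction.
  The lower bound nests triangles in the plane, each ring adding 3 vertices and 19 triangles, and for 8 vertices
  draws \<open>K\<^sub>2\<^sub>,\<^sub>2\<^sub>,\<^sub>2\<^sub>,\<^sub>2\<close> on the surface of the cube, a crossing in each face.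
\<close>

section \<open>Cuts, cycles and Euler's inequality\<close>

text \<open>Once a drawing is replaced by labels there are no angles, rotations or local pictures:
  the cyclic order at a crossing, kites and triangular faces all have to be recovered from parities
  of cuts. Euler's formula is available as an inequality only, and structure comes from
  near-equality. This needs crossings of nonadjacent edges with four properly arranged faces. A bad
  crossing is either removed by relabelling or reveals two edges whose removal disconnects the
  graph, which costs too many edges to occur when \<open>\<delta> \<le> 1\<close>. The constant 19
  is 20 - 1: \<open>\<delta>\<^sub>v \<ge> 1\<close> holds at every vertex of degree at least 4, and
  for \<open>\<delta> \<ge> 2\<close> this suffices. For smaller \<open>\<delta>\<close> the rest
  comes from \<open>\<delta>\<^sub>v \<ge> 2\<close> at all vertices but a few dominating ones,
  unless the graph separates. On 8 vertices optimal graphs may exceed the general formula by two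
  triangles; to keep this excess from spreading through gluings along a triangle, the induction
  carries a sharper claim when the number of vertices is a multiple of three and
  \<open>\<delta> \<ge> 2\<close>.\<close>

definition ecut :: "'e set => ('e => 'f) => ('e => 'f) => 'f set => 'e set" where
 "ecut A l r S = {a \<in> A. (l a \<in> S) ~= (r a \<in> S)}"

definition deg :: "('e => 'n) => ('e => 'n) => 'e set => 'n => nat" where
 "deg s t C x = card {a \<in> C. s a = x} + card {a \<in> C. t a = x}"

definition cyc :: "('e => 'n) => ('e => 'n) => 'e set => bool" where
 "cyc s t C \<longleftrightarrow> (\<forall>x. even (deg s t C x))"

text \<open>Whitney's combinatorial duality: the cycle space of the graph with ends
  \<open>s\<close>, \<open>t\<close> is the cut space of the graph on the labels with ends
  \<open>l\<close>, \<open>r\<close>.\<close>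

definition dualpair :: "'e set => ('e => 'n) => ('e => 'n) => ('e => 'f) => ('e => 'f) => bool" where
 "dualpair A s t l r \<longleftrightarrow> (\<forall>C \<subseteq> A. cyc s t C \<longleftrightarrow> (\<exists>S. C = ecut A l r S))"

text \<open>A label counts only if some element has it on exactly one side, so that every face has a
  nonempty boundary and girth arguments apply to it.\<close>

definition faces :: "'e set => ('e => 'f) => ('e => 'f) => 'f set" where
 "faces A l r = {f. ecut A l r {f} ~= {}}"

lemma even_card_sym_diff:
 assumes "finite A" "finite B" shows "even (card (sym_diff A B)) \<longleftrightarrow> (even (card A) \<longleftrightarrow> even (card B))"
proof -
 have "card A = card (A - B) + card (A \<inter> B)" "card B = card (B - A) + card (A \<inter> B)"
  using assms by (metis Int_Diff_disjoint Int_Diff_Un Int_commute add.commute card_Un_disjoint finite_Diff finite_Int)+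
 moreover have "card (sym_diff A B) = card (A - B) + card (B - A)" using assms by (intro card_Un_disjoint) auto
 ultimately show ?thesis by presburger
qed

lemma deg_sym_diff:
 assumes "finite C" "finite D" shows "even (deg s t (sym_diff C D) x) \<longleftrightarrow> (even (deg s t C x) \<longleftrightarrow> even (deg s t D x))"
proof -
 have "{a \<in> sym_diff C D. s a = x} = sym_diff {a \<in> C. s a = x} {a \<in> D. s a = x}"
    "{a \<in> sym_diff C D. t a = x} = sym_diff {a \<in> C. t a = x} {a \<in> D. t a = x}" by auto
 thus ?thesis using assms even_card_sym_diff[of "{a \<in> C. s a = x}" "{a \<in> D. s a = x}"]
   even_card_sym_diff[of "{a \<in> C. t a = x}" "{a \<in> D. t a = x}"] unfolding deg_def by (auto simp: even_add)
qed

lemma deg_empty [simp]: "deg s t {} x = 0" by (simp add: deg_def)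

lemma deg_single: "deg s t {a} x = (if s a = x then 1 else 0) + (if t a = x then 1 else 0)"
proof -
 have "{b \<in> {a}. s b = x} = (if s a = x then {a} else {})"
    "{b \<in> {a}. t b = x} = (if t a = x then {a} else {})" by auto
 thus ?thesis by (simp add: deg_def)
qed

lemma cyc_empty [simp]: "cyc s t {}" by (simp add: cyc_def)

lemma cyc_sym_diff:
 assumes "finite C" "finite D" "cyc s t C" "cyc s t D" shows "cyc s t (sym_diff C D)"
 using assms deg_sym_diff[of C D s t] by (auto simp: cyc_def)

lemma cut_sym_diff: "ecut A l r (sym_diff S T) = sym_diff (ecut A l r S) (ecut A l r T)" by (auto simp: ecut_def)

lemma cut_subset: "ecut A l r S \<subseteq> A" by (auto simp: ecut_def)

lemma dualpairD:
 assumes "dualpair A s t l r" shows "cyc s t (ecut A l r S)"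
 by (metis assms cut_subset dualpair_def)

lemma dualpairE:
 assumes "dualpair A s t l r" "C \<subseteq> A" "cyc s t C"
 obtains S where "C = ecut A l r S" using assms unfolding dualpair_def by blast

lemma sum_deg:
 assumes "finite C" "finite N" "s ` C \<union> t ` C \<subseteq> N" shows "(\<Sum>x\<in>N. deg s t C x) = 2 * card C"
proof -
 have "(\<Sum>x\<in>N. card {a \<in> C. s a = x}) = card C" if "s ` C \<subseteq> N" for s :: "'a => 'b" using sum.group[OF assms(1,2) that, of "\<lambda>_. 1::nat"] by simp
 thus ?thesis using assms(3) by (simp add: deg_def sum.distrib)
qed

text \<open>The degrees sum to twice the number of edges, so a single odd node is
  impossible.\<close>

lemma cyc_if_even_except:
 assumes "finite C" "\<And>x. x ~= x0 ==> even (deg s t C x)" shows "cyc s t C"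
proof -
 let ?N = "insert x0 (s ` C \<union> t ` C)"
 have "(\<Sum>x\<in>?N. deg s t C x) = 2 * card C" using assms by (intro sum_deg) auto
 moreover have "(\<Sum>x\<in>?N. deg s t C x) = deg s t C x0 + (\<Sum>x\<in>?N - {x0}. deg s t C x)" using assms(1) by (subst sum.remove[of _ x0]) auto
 moreover have "even (\<Sum>x\<in>?N - {x0}. deg s t C x)" using assms(2) by (intro dvd_sum) auto
 ultimately show ?thesis by (metis dvd_triv_left even_add assms(2) cyc_def)
qed

text \<open>Subsets of \<open>A\<close> with the same odd nodes differ by a cycle, so every fibre of
  the map to the odd nodes injects into the cycle space. The parity at \<open>x0\<close> is
  determined by the others, which leaves at most \<open>2 ^ (card N - 1)\<close> fibres.\<close>

lemma card_cyc_ge: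
 assumes "finite A" "finite N" "N ~= {}" "s ` A \<union> t ` A \<subseteq> N" shows "2 ^ card A \<le> 2 ^ (card N - 1) * card {C. C \<subseteq> A \<and> cyc s t C}"
proof -
 obtain x0 where x0: "x0 \<in> N" using assms by auto
 let ?od = "\<lambda>C. {x \<in> N - {x0}. odd (deg s t C x)}"
 let ?Z = "{C. C \<subseteq> A \<and> cyc s t C}"
 have finZ: "finite ?Z" using assms(1) by simp
 have fib: "card {C. C \<subseteq> A \<and> ?od C = X} \<le> card ?Z" for X
 proof (cases "{C. C \<subseteq> A \<and> ?od C = X} = {}")
  case False
  then obtain C0 where C0: "C0 \<subseteq> A" "?od C0 = X" by blast
  show ?thesis
  proof (rule card_inj_on_le[where f = "\<lambda>C. sym_diff C C0"])
   show "inj_on (\<lambda>C. sym_diff C C0) {C. C \<subseteq> A \<and> ?od C = X}" by (auto simp: inj_on_def)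
   show "(\<lambda>C. sym_diff C C0) ` {C. C \<subseteq> A \<and> ?od C = X} \<subseteq> ?Z"
   proof (clarify, intro conjI)
    fix C assume C: "C \<subseteq> A" "X = ?od C"
    show "sym_diff C C0 \<subseteq> A" using C C0 by auto
    have fin: "finite C" "finite C0" using C(1) C0(1) assms(1) by (blast intro: finite_subset)+
    show "cyc s t (sym_diff C C0)"
    proof (rule cyc_if_even_except[where ?x0.0 = x0])
     show "finite (sym_diff C C0)" using fin by auto
     fix x assume "x ~= x0"
     show "even (deg s t (sym_diff C C0) x)"
     proof (cases "x \<in> N")
      case True
      hence "odd (deg s t C x) \<longleftrightarrow> odd (deg s t C0 x)" using C C0 \<open>x ~= x0\<close> by blast
      thus ?thesis using deg_sym_diff[OF fin, of s t x] by simp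
     next
      case False
      hence "\<forall>a\<in>A. s a ~= x \<and> t a ~= x" using assms(4) by auto
      hence "{a \<in> sym_diff C C0. s a = x} = {}" "{a \<in> sym_diff C C0. t a = x} = {}" using C(1) C0(1) by blast+
      thus ?thesis by (simp only: deg_def) simp
     qed
    qed
   qed
   show "finite ?Z" by (rule finZ)
  qed
 next
  case True
  thus ?thesis by (simp only: card.empty)
 qed
 have "Pow A = (\<Union>X\<in>Pow (N - {x0}). {C. C \<subseteq> A \<and> ?od C = X})" by (intro equalityI subsetI UN_I[of "?od _"]) auto
 moreover have "card (\<Union>X\<in>Pow (N - {x0}). {C. C \<subseteq> A \<and> ?od C = X})
   \<le> (\<Sum>X\<in>Pow (N - {x0}). card {C. C \<subseteq> A \<and> ?od C = X})" using assms(2) by (intro card_UN_le) simp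
 ultimately have 1: "card (Pow A) \<le> (\<Sum>X\<in>Pow (N - {x0}). card {C. C \<subseteq> A \<and> ?od C = X})" by simp
 have 2: "(\<Sum>X\<in>Pow (N - {x0}). card {C. C \<subseteq> A \<and> ?od C = X}) \<le> card (Pow (N - {x0})) * card ?Z"
  using sum_bounded_above[of "Pow (N - {x0})" "\<lambda>X. card {C. C \<subseteq> A \<and> ?od C = X}" "card ?Z"] fib by (simp only: of_nat_id)
 have 3: "card (Pow (N - {x0})) = 2 ^ (card N - 1)" using assms(2) x0 by (simp add: card_Pow)
 show ?thesis using order_trans[OF 1 2] unfolding 3 card_Pow[OF assms(1)] .
qed

lemma finite_faces: "finite A ==> finite (faces A l r)" by (rule finite_subset[of _ "l ` A \<union> r ` A"]) (auto simp: faces_def ecut_def)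

lemma cut_faces: "ecut A l r S = ecut A l r (S \<inter> faces A l r)"
proof -
 have 1: "l a \<in> faces A l r \<and> r a \<in> faces A l r" if "a \<in> A" "l a ~= r a" for a using that by (auto simp: faces_def ecut_def)
 have "((l a \<in> S) ~= (r a \<in> S)) = ((l a \<in> S \<inter> faces A l r) ~= (r a \<in> S \<inter> faces A l r))"
  if "a \<in> A" for a using 1[OF that] by (cases "l a = r a") simp_all
 thus ?thesis unfolding ecut_def by blast
qed

lemma cut_compl: "ecut A l r (- S) = ecut A l r S"
 unfolding ecut_def by auto

text \<open>A cut depends only on the part of \<open>S\<close> among the faces and does not change
  when \<open>S\<close> is complemented, so one fixed face can be kept out of
  \<open>S\<close>.\<close>

lemma card_cut_le:
 assumes "finite A" "faces A l r ~= {}" shows "card (range (ecut A l r)) \<le> 2 ^ (card (faces A l r) - 1)"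
proof -
 obtain f0 where f0: "f0 \<in> faces A l r" using assms by auto
 have "range (ecut A l r) \<subseteq> ecut A l r ` Pow (faces A l r - {f0})"
 proof clarify
  fix S
  let ?T = "if f0 \<in> S then - S else S"
  have "ecut A l r S = ecut A l r (?T \<inter> faces A l r)" by (metis cut_compl cut_faces)
  moreover have "?T \<inter> faces A l r \<in> Pow (faces A l r - {f0})" by auto
  ultimately show "ecut A l r S \<in> ecut A l r ` Pow (faces A l r - {f0})" by blast
 qed
 moreover have fin: "finite (Pow (faces A l r - {f0}))" using finite_faces[OF assms(1), of l r] by simp
 ultimately have "card (range (ecut A l r)) \<le> card (ecut A l r ` Pow (faces A l r - {f0}))" by (intro card_mono finite_imageI)
 also have "\<dots> \<le> card (Pow (faces A l r - {f0}))" by (rule card_image_le[OF fin])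
 also have "card (Pow (faces A l r - {f0})) = 2 ^ (card (faces A l r) - 1)" using finite_faces[OF assms(1), of l r] f0 by (simp add: card_Pow)
 finally show ?thesis .
qed

lemma range_cut:
 assumes "dualpair A s t l r" shows "range (ecut A l r) = {C. C \<subseteq> A \<and> cyc s t C}"
proof (intro equalityI subsetI)
 fix C assume "C \<in> {C. C \<subseteq> A \<and> cyc s t C}"
 then obtain S where "C = ecut A l r S" using dualpairE[OF assms] by blast
 thus "C \<in> range (ecut A l r)" by (rule range_eqI)
next
 fix C assume "C \<in> range (ecut A l r)"
 then obtain S where "C = ecut A l r S" by (rule rangeE)
 thus "C \<in> {C. C \<subseteq> A \<and> cyc s t C}" by (simp only: mem_Collect_eq cut_subset dualpairD[OF assms] simp_thms)
qed

text \<open>The cycle space has dimension at least \<open>card A - card N + 1\<close>, the cut space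
  at most the number of faces minus 1, and the two spaces are equal.\<close>

lemma dualpair_euler:
 assumes "dualpair A s t l r" "finite A" "finite N" "N ~= {}" "s ` A \<union> t ` A \<subseteq> N"
  "faces A l r ~= {}"
 shows "card A + 2 \<le> card (faces A l r) + card N"
proof -
 have N: "card N > 0" using assms(3,4) by (simp add: card_gt_0_iff)
 have F: "card (faces A l r) > 0" using assms(6) finite_faces[OF assms(2), of l r] by (simp add: card_gt_0_iff)
 have "2 ^ card A \<le> 2 ^ (card N - 1) * card (range (ecut A l r))" unfolding range_cut[OF assms(1)] by (rule card_cyc_ge[OF assms(2-5)])
 also have "\<dots> \<le> 2 ^ (card N - 1) * 2 ^ (card (faces A l r) - 1)" by (rule mult_le_mono2[OF card_cut_le[OF assms(2,6)]])
 also have "\<dots> = 2 ^ (card N - 1 + (card (faces A l r) - 1))" by (rule power_add[symmetric])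
 finally have "(2::nat) ^ card A \<le> 2 ^ (card N - 1 + (card (faces A l r) - 1))" .
 thus ?thesis using N F by simp
qed

lemma dualpair_euler_forest:
 assumes "dualpair A s t l r" "finite A" "finite N" "N ~= {}" "s ` A \<union> t ` A \<subseteq> N"
  "faces A l r = {}"
 shows "card A + 1 \<le> card N"
proof -
 have N: "card N > 0" using assms(3,4) by (simp add: card_gt_0_iff)
 have "ecut A l r S = {}" for S using cut_faces[of A l r S] assms(6) by (simp add: ecut_def)
 hence "range (ecut A l r) = {{}}" by auto
 moreover have "2 ^ card A \<le> 2 ^ (card N - 1) * card (range (ecut A l r))" unfolding range_cut[OF assms(1)] by (rule card_cyc_ge[OF assms(2-5)])
 ultimately have "(2::nat) ^ card A \<le> 2 ^ (card N - 1)" by simp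
 thus ?thesis using N by simp
qed

lemma sum_faces:
 fixes w :: "'e => nat" assumes "finite A" shows "(\<Sum>f\<in>faces A l r. \<Sum>a\<in>ecut A l r {f}. w a) = 2 * (\<Sum>a\<in>{a\<in>A. l a ~= r a}. w a)"
proof -
 let ?F = "faces A l r"
 have fin: "finite ?F" by (rule finite_faces[OF assms])
 have "(\<Sum>f\<in>?F. \<Sum>a\<in>ecut A l r {f}. w a) = (\<Sum>f\<in>?F. \<Sum>a\<in>A. if a \<in> ecut A l r {f} then w a else 0)"
 proof (rule sum.cong[OF refl])
  fix f
  show "(\<Sum>a\<in>ecut A l r {f}. w a) = (\<Sum>a\<in>A. if a \<in> ecut A l r {f} then w a else 0)" using sum.inter_filter assms by (fastforce simp: ecut_def)
 qed
 also have "\<dots> = (\<Sum>a\<in>A. \<Sum>f\<in>?F. if a \<in> ecut A l r {f} then w a else 0)" by (rule sum.swap)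
 also have "\<dots> = (\<Sum>a\<in>A. if l a ~= r a then 2 * w a else 0)"
 proof (rule sum.cong[OF refl])
  fix a assume a: "a \<in> A"
  have "(\<Sum>f\<in>?F. if a \<in> ecut A l r {f} then w a else 0) = (\<Sum>f\<in>?F \<inter> {f. a \<in> ecut A l r {f}}. w a)" by (simp only: sum.inter_restrict[OF fin] mem_Collect_eq)
  also have "?F \<inter> {f. a \<in> ecut A l r {f}} = (if l a ~= r a then {l a, r a} else {})" using a by (auto simp: ecut_def faces_def)
  finally show "(\<Sum>f\<in>?F. if a \<in> ecut A l r {f} then w a else 0) = (if l a ~= r a then 2 * w a else 0)" by (simp split: if_splits)
 qed
 also have "\<dots> = 2 * (\<Sum>a\<in>{a\<in>A. l a ~= r a}. w a)" using assms by (simp add: sum.If_cases Int_def sum_distrib_left)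
 finally show ?thesis .
qed

text \<open>Deleting an element of the graph contracts it in the dual: the labels on its two sides
  are identified.\<close>

lemma dualpair_remove:
 assumes "dualpair A s t l r" "a \<in> A"
 defines "\<mu> == \<lambda>f. if f = l a then r a else f"
 shows "dualpair (A - {a}) s t (\<mu> \<circ> l) (\<mu> \<circ> r)"
 unfolding dualpair_def
proof (intro allI impI iffI)
 fix C assume C: "C \<subseteq> A - {a}" "cyc s t C"
 then obtain S where S: "C = ecut A l r S" using assms(1) by (meson Diff_subset dualpairE order_trans)
 hence "\<mu> f \<in> S \<longleftrightarrow> f \<in> S" for f using C assms(2) by (auto simp: ecut_def \<mu>_def)
 hence "ecut (A - {a}) (\<mu> \<circ> l) (\<mu> \<circ> r) S = ecut A l r S - {a}" by (auto simp: ecut_def)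
 thus "\<exists>S. C = ecut (A - {a}) (\<mu> \<circ> l) (\<mu> \<circ> r) S" using C S by blast
next
 fix C assume C: "C \<subseteq> A - {a}" "\<exists>S. C = ecut (A - {a}) (\<mu> \<circ> l) (\<mu> \<circ> r) S"
 then obtain S where S: "C = ecut (A - {a}) (\<mu> \<circ> l) (\<mu> \<circ> r) S" by blast
 have "\<mu> (l a) = \<mu> (r a)" by (auto simp: \<mu>_def)
 hence "C = ecut A l r (\<mu> -` S)" using S by (auto simp: ecut_def)
 thus "cyc s t C" using dualpairD[OF assms(1)] by blast
qed

lemma dualpair_subset:
 fixes l r :: "'e => 'f" assumes "dualpair A s t l r" "finite A" "B \<subseteq> A" shows "\<exists>\<mu> :: 'f => 'f. dualpair B s t (\<mu> \<circ> l) (\<mu> \<circ> r)"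
proof -
 have "\<exists>\<mu> :: 'f => 'f. dualpair (A - D) s t (\<mu> \<circ> l) (\<mu> \<circ> r)" if "finite D" "D \<subseteq> A" for D using that
 proof (induction D rule: finite_induct)
  case empty
  have "dualpair (A - {}) s t ((id :: 'f => 'f) \<circ> l) (id \<circ> r)" using assms(1) by simp
  from exI[where P = "\<lambda>\<mu> :: 'f => 'f. dualpair _ s t (\<mu> \<circ> l) (\<mu> \<circ> r)", OF this] show ?case .
 next
  case (insert a D)
  obtain \<mu> :: "'f => 'f" where \<mu>: "dualpair (A - D) s t (\<mu> \<circ> l) (\<mu> \<circ> r)" using insert.prems insert.IH by blast
  have "a \<in> A - D" using insert.hyps(2) insert.prems by simp
  note dualpair_remove[OF \<mu> this]
  moreover have "A - D - {a} = A - insert a D" by auto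
  ultimately have "dualpair (A - insert a D) s t
    (((\<lambda>f. if f = (\<mu> \<circ> l) a then (\<mu> \<circ> r) a else f) \<circ> \<mu>) \<circ> l)
    (((\<lambda>f. if f = (\<mu> \<circ> l) a then (\<mu> \<circ> r) a else f) \<circ> \<mu>) \<circ> r)" by (simp only: comp_assoc)
  from exI[where P = "\<lambda>\<mu> :: 'f => 'f. dualpair _ s t (\<mu> \<circ> l) (\<mu> \<circ> r)", OF this] show ?case .
 qed
 from this[of "A - B"] show ?thesis using assms(2,3) by (simp add: double_diff)
qed

section \<open>Graphs without odd cycles are bipartite\<close>

text \<open>Turns a connection between \<open>u\<close> and \<open>w\<close> into an edge set whose
  length has the parity dictated by the colouring; a further edge between equally coloured nodes
  then closes an odd cycle.\<close>

lemma walk_parity: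
 assumes "finite B" "\<And>b. b \<in> B ==> \<kappa> (s b) ~= \<kappa> (t b)"
  "(u, w) \<in> {(x, y). \<exists>b\<in>B. (x = s b \<and> y = t b) \<or> (x = t b \<and> y = s b)}\<^sup>*"
 shows "\<exists>C \<subseteq> B. (\<forall>x. odd (deg s t C x) \<longleftrightarrow> (x = u) ~= (x = w)) \<and>
      (even (card C) \<longleftrightarrow> (\<kappa> u :: bool) = \<kappa> w)" using assms(3)
proof (induction rule: rtrancl_induct)
 case base
 show ?case by (intro exI[of _ "{}"]) simp
next
 case (step y z)
 from step(3) obtain C where C: "C \<subseteq> B" "\<forall>x. odd (deg s t C x) \<longleftrightarrow> (x = u) ~= (x = y)"
  "even (card C) \<longleftrightarrow> \<kappa> u = \<kappa> y" by (elim exE conjE)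
 from step(2) have "\<exists>b\<in>B. (y = s b \<and> z = t b) \<or> (y = t b \<and> z = s b)" by (simp only: mem_Collect_eq case_prod_conv)
 then obtain b where b: "b \<in> B" "(y = s b \<and> z = t b) \<or> (y = t b \<and> z = s b)" by (elim bexE)
 have fin: "finite C" "finite {b}" using finite_subset[OF C(1) assms(1)] by simp_all
 have "odd (deg s t (sym_diff C {b}) x) \<longleftrightarrow> (x = u) ~= (x = z)" for x
 proof -
  have "odd (deg s t {b} x) \<longleftrightarrow> (x = y) ~= (x = z)" using b(2) by (auto simp: deg_single)
  moreover have "odd (deg s t C x) \<longleftrightarrow> (x = u) ~= (x = y)" using C(2) by (rule spec)
  ultimately show ?thesis using deg_sym_diff[OF fin, of s t x] by argo
 qed
 moreover have "even (card (sym_diff C {b})) \<longleftrightarrow> \<kappa> u = \<kappa> z"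
 proof -
  have "\<kappa> y ~= \<kappa> z" using b(2) assms(2)[OF b(1)] by metis
  moreover have "odd (card {b})" by simp
  ultimately show ?thesis using even_card_sym_diff[OF fin] C(3) by argo
 qed
 moreover have "sym_diff C {b} \<subseteq> B" using C(1) b(1) by auto
 ultimately show ?case by (intro exI[of _ "sym_diff C {b}"] conjI allI)
qed

text \<open>Edges are added one at a time. A new edge with equally coloured ends either joins two
  components, one of which is recoloured, or closes an odd cycle.\<close>

lemma two_colourable:
 assumes "finite B" "\<And>C. C \<subseteq> B ==> cyc s t C ==> even (card C)" shows "\<exists>\<kappa> :: 'n => bool. \<forall>b\<in>B. \<kappa> (s b) ~= \<kappa> (t b)"
 using assms
proof (induction B rule: finite_induct)
 case (insert a B)
 have "\<exists>\<kappa> :: 'n => bool. \<forall>b\<in>B. \<kappa> (s b) ~= \<kappa> (t b)" using insert.prems by (intro insert.IH) blast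
 then obtain \<kappa> :: "'n => bool" where \<kappa>: "\<forall>b\<in>B. \<kappa> (s b) ~= \<kappa> (t b)" by (elim exE)
 define R0 where "R0 = {(x, y). \<exists>b\<in>B. (x = s b \<and> y = t b) \<or> (x = t b \<and> y = s b)}"
 define R where "R = R0\<^sup>*"
 consider "\<kappa> (s a) ~= \<kappa> (t a)" | "\<kappa> (s a) = \<kappa> (t a)" "(s a, t a) \<notin> R"
  | "\<kappa> (s a) = \<kappa> (t a)" "(s a, t a) \<in> R" by argo
 thus ?case
 proof cases
  case 1
  show ?thesis by (rule exI[of _ \<kappa>]) (use \<kappa> 1 in simp)
 next
  case 2
  define \<kappa>' where "\<kappa>' x = (\<kappa> x ~= ((s a, x) \<in> R))" for x
  have "(s a, s b) \<in> R \<longleftrightarrow> (s a, t b) \<in> R" if "b \<in> B" for b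
  proof -
   have "(s b, t b) \<in> R0" "(t b, s b) \<in> R0" using that by (auto simp: R0_def)
   thus ?thesis unfolding R_def by (meson rtrancl.rtrancl_into_rtrancl)
  qed
  hence "\<forall>b\<in>B. \<kappa>' (s b) ~= \<kappa>' (t b)" using \<kappa> by (simp add: \<kappa>'_def)
  moreover have "\<kappa>' (s a) ~= \<kappa>' (t a)" using 2 by (simp add: \<kappa>'_def) (simp add: R_def)
  ultimately show ?thesis by (intro exI[of _ \<kappa>']) simp
 next
  case 3
  have "\<exists>C \<subseteq> B. (\<forall>x. odd (deg s t C x) \<longleftrightarrow> (x = s a) ~= (x = t a)) \<and>
      (even (card C) \<longleftrightarrow> \<kappa> (s a) = \<kappa> (t a))" using \<kappa> 3(2) by (intro walk_parity insert(1)) (simp_all add: R_def R0_def)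
  then obtain C where C: "C \<subseteq> B" "\<forall>x. odd (deg s t C x) \<longleftrightarrow> (x = s a) ~= (x = t a)"
   "even (card C)" using 3(1) by blast
  have fin: "finite C" "finite {a}" using finite_subset[OF C(1) insert(1)] by simp_all
  have "a \<notin> C" using C(1) insert(2) by blast
  hence eq: "sym_diff C {a} = insert a C" by blast
  have "even (deg s t (insert a C) x)" for x
  proof -
   have "odd (deg s t {a} x) \<longleftrightarrow> (x = s a) ~= (x = t a)" by (auto simp: deg_single)
   moreover have "odd (deg s t C x) \<longleftrightarrow> (x = s a) ~= (x = t a)" using C(2) by (rule spec)
   ultimately show ?thesis using deg_sym_diff[OF fin, of s t x] unfolding eq by argo
  qed
  hence "cyc s t (insert a C)" by (simp add: cyc_def)
  hence "even (card (insert a C))" by (intro insert.prems) (use C(1) in blast)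
  thus ?thesis using C(3) fin \<open>a \<notin> C\<close> by simp
 qed
qed simp

section \<open>Planarised 1-plane graphs\<close>

text \<open>
 An involution \<open>m\<close> exchanges the two edges of a crossing and fixes uncrossed edges. The piece \<open>(e, u)\<close> is the half of \<open>e\<close>
 at its end \<open>u\<close>; it joins the vertex node \<open>Inl u\<close> to the crossing (or midpoint) node \<open>Inr {e, m e}\<close>.
\<close>

definition pcs :: "'a set set => ('a set \<times> 'a) set" where
 "pcs E = {p. fst p \<in> E \<and> snd p \<in> fst p}"

definition psrc :: "'a set \<times> 'a => 'a + 'a set set" where
 "psrc p = Inl (snd p)"

definition ptgt :: "('a set => 'a set) => 'a set \<times> 'a => 'a + 'a set set" where
 "ptgt m p = Inr {fst p, m (fst p)}"

abbreviation pcyc :: "('a set => 'a set) => ('a set \<times> 'a) set => bool" where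
 "pcyc m == cyc psrc (ptgt m)"

lemma pcs_iff [simp]: "(e, u) \<in> pcs E \<longleftrightarrow> e \<in> E \<and> u \<in> e" by (simp add: pcs_def)

lemma pcs_mono: "E \<subseteq> E' ==> pcs E \<subseteq> pcs E'" by (auto simp: pcs_def)

lemma pcs_Sigma: "pcs E = Sigma E (\<lambda>e. e)" by (auto simp: pcs_def)

lemma deg_Inl: "deg psrc (ptgt m) C (Inl u) = card {p \<in> C. snd p = u}" by (simp add: deg_def psrc_def ptgt_def)

lemma deg_Inr: "deg psrc (ptgt m) C (Inr X) = card {p \<in> C. {fst p, m (fst p)} = X}" by (simp add: deg_def psrc_def ptgt_def)

lemma pcyc_iff0:
 "pcyc m C \<longleftrightarrow> (\<forall>u. even (card {p \<in> C. snd p = u})) \<and>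
   (\<forall>X. even (card {p \<in> C. {fst p, m (fst p)} = X}))" unfolding cyc_def by (simp add: split_sum_all deg_Inl deg_Inr)

locale xgraph =
 fixes V :: "'a set" and E :: "'a set set" and m :: "'a set => 'a set" assumes finV: "finite V"
  and edge: "e \<in> E ==> e \<subseteq> V \<and> card e = 2" and mE: "e \<in> E ==> m e \<in> E" and mm: "e \<in> E ==> m (m e) = e"
begin

lemma finE: "finite E"
 using edge finV by (intro finite_subset[of E "Pow V"]) auto

lemma edge2: "e \<in> E ==> u \<in> e ==> \<exists>w. w ~= u \<and> e = {u, w} \<and> w \<in> V \<and> u \<in> V"
 using edge[of e] by (auto simp: card_2_iff)

lemma edge_ex: "e \<in> E ==> \<exists>u w. u ~= w \<and> e = {u, w}"
 using edge[of e] by (auto simp: card_2_iff)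

lemma fin_edge: "e \<in> E ==> finite e"
 using edge_ex by blast

lemma finP: "finite (pcs E)"
 unfolding pcs_Sigma by (intro finite_SigmaI finE fin_edge)

lemma finC: "C \<subseteq> pcs E ==> finite C" by (rule finite_subset[OF _ finP])

lemma class_eq: "e \<in> E ==> f \<in> E ==> {f, m f} = {e, m e} \<longleftrightarrow> f \<in> {e, m e}" by (metis mm doubleton_eq_iff insert_iff singletonD)

lemma pcyc_iff:
 assumes "C \<subseteq> pcs E" shows "pcyc m C \<longleftrightarrow> (\<forall>u. even (card {p \<in> C. snd p = u})) \<and>
   (\<forall>e\<in>E. even (card {p \<in> C. fst p \<in> {e, m e}}))"
proof -
 have 1: "{p \<in> C. {fst p, m (fst p)} = {e, m e}} = {p \<in> C. fst p \<in> {e, m e}}" if "e \<in> E" for e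
 proof -
  have "{fst p, m (fst p)} = {e, m e} \<longleftrightarrow> fst p \<in> {e, m e}" if "p \<in> C" for p using that assms by (intro class_eq \<open>e \<in> E\<close>) (auto simp: pcs_def)
  thus ?thesis by (intro Collect_cong conj_cong refl)
 qed
 have "(\<forall>X. even (card {p \<in> C. {fst p, m (fst p)} = X})) \<longleftrightarrow>
   (\<forall>e\<in>E. even (card {p \<in> C. fst p \<in> {e, m e}}))"
 proof (intro iffI ballI allI)
  fix e assume *: "\<forall>X. even (card {p \<in> C. {fst p, m (fst p)} = X})" and e: "e \<in> E"
  show "even (card {p \<in> C. fst p \<in> {e, m e}})" unfolding 1[OF e, symmetric] using * by (rule spec)
 next
  fix X assume *: "\<forall>e\<in>E. even (card {p \<in> C. fst p \<in> {e, m e}})"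
  show "even (card {p \<in> C. {fst p, m (fst p)} = X})"
  proof (cases "\<exists>p\<in>C. {fst p, m (fst p)} = X")
   case True
   then obtain p where p: "p \<in> C" "X = {fst p, m (fst p)}" by blast
   have pE: "fst p \<in> E" using p(1) assms by (auto simp: pcs_def)
   show ?thesis unfolding p(2) 1[OF pE] using * pE by (rule bspec)
  next
   case False
   hence "{p \<in> C. {fst p, m (fst p)} = X} = {}" by blast
   thus ?thesis by (simp only: card.empty even_zero)
  qed
 qed
 thus ?thesis by (simp only: pcyc_iff0)
qed

lemma even_other:
 assumes "finite A" "even (card A)" "p \<in> A" shows "\<exists>q\<in>A. q ~= p"
proof (rule ccontr)
 assume "\<not> ?thesis"
 hence "A = {p}" using assms(3) by blast
 thus False using assms(2) by simp
qed

lemma pcyc_V: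
 assumes "C \<subseteq> pcs E" "pcyc m C" "(e, u) \<in> C" shows "\<exists>f. f ~= e \<and> (f, u) \<in> C"
proof -
 have "even (card {p \<in> C. snd p = u})" using assms by (simp add: pcyc_iff)
 hence "\<exists>q\<in>{p \<in> C. snd p = u}. q ~= (e, u)" using assms(3) finC[OF assms(1)] by (intro even_other) auto
 thus ?thesis by auto
qed

lemma pcyc_X:
 assumes "C \<subseteq> pcs E" "pcyc m C" "(e, u) \<in> C" shows "\<exists>f w. (f, w) ~= (e, u) \<and> (f, w) \<in> C \<and> (f = e \<or> f = m e)"
proof -
 have "even (card {p \<in> C. fst p \<in> {e, m e}})" using assms by (auto simp: pcyc_iff)
 hence "\<exists>q\<in>{p \<in> C. fst p \<in> {e, m e}}. q ~= (e, u)" using assms(3) finC[OF assms(1)] by (intro even_other) auto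
 then obtain q where q: "q \<in> C" "fst q \<in> {e, m e}" "q ~= (e, u)" by blast
 show ?thesis by (rule exI[of _ "fst q"], rule exI[of _ "snd q"]) (use q in simp)
qed

text \<open>The midpoint node of an uncrossed edge has only the two halves of that edge, so even
  degree there means both or neither.\<close>

lemma pcyc_unc:
 assumes "C \<subseteq> pcs E" "pcyc m C" "(e, u) \<in> C" "m e = e" "w \<in> e" shows "(e, w) \<in> C"
proof (cases "w = u")
 case False
 obtain v where "(e, v) ~= (e, u)" "(e, v) \<in> C" using pcyc_X[OF assms(1-3)] assms(4) by auto
 moreover have "e \<in> E" "u \<in> e" "v \<in> e" using assms calculation by auto
 moreover obtain x where "e = {u, x}" using edge2[OF calculation(3,4)] by auto
 ultimately show ?thesis using assms(5) False by auto
qed (use assms in auto)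

section \<open>Weights of pieces and light cycles\<close>

text \<open>An uncrossed edge weighs 2 in total, as much as one half of a crossed edge. Hence an
  uncrossed triangle and a kite (two crossed halves and the uncrossed edge between their ends) both
  weigh 6.\<close>

definition wt :: "'a set \<times> 'a => nat" where
 "wt p = (if m (fst p) = fst p then 1 else 2)"

lemma sum_ge:
 assumes "finite C" "D \<subseteq> C" shows "sum wt D \<le> sum wt C"
 using assms by (intro sum_mono2) auto

text \<open>At each end of the uncrossed edge the cycle goes on with a different edge, which
  contributes at least 2: two halves of weight 1 or a crossed half of weight 2. The edge itself
  contributes 2 more.\<close>

lemma girth_unc:
 assumes C: "C \<subseteq> pcs E" "pcyc m C" and e: "(e, u) \<in> C" "m e = e" shows "6 \<le> sum wt C"
proof -
 have eE: "e \<in> E" "u \<in> e" using C e by auto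
 obtain w where w: "w ~= u" "e = {u, w}" using edge2[OF eE] by auto
 have ew: "(e, w) \<in> C" using pcyc_unc[OF C e, of w] w by auto
 obtain f where f: "f ~= e" "(f, u) \<in> C" using pcyc_V[OF C e(1)] by auto
 obtain g where g: "g ~= e" "(g, w) \<in> C" using pcyc_V[OF C ew] by auto
 have fE: "f \<in> E" "u \<in> f" "g \<in> E" "w \<in> g" using C f g by auto
 have fg: "f ~= g" using fE edge2 w f by auto
 define F where "F = (if m f = f then {(f, x) | x. x \<in> f} else {(f, u)})"
 define G where "G = (if m g = g then {(g, x) | x. x \<in> g} else {(g, w)})"
 have F: "F \<subseteq> C" using pcyc_unc[OF C f(2)] f(2) by (auto simp: F_def)
 have G: "G \<subseteq> C" using pcyc_unc[OF C g(2)] g(2) by (auto simp: G_def)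
 have sF: "sum wt F = 2"
 proof (cases "m f = f")
  case True
  obtain y where "y ~= u" "f = {u, y}" using edge2[OF fE(1,2)] by auto
  hence "F = {(f, u), (f, y)}" "u ~= y" using True by (auto simp: F_def)
  thus ?thesis using True by (simp add: wt_def)
 qed (simp add: F_def wt_def)
 have sG: "sum wt G = 2"
 proof (cases "m g = g")
  case True
  obtain y where "y ~= w" "g = {w, y}" using edge2[OF fE(3,4)] by auto
  hence "G = {(g, w), (g, y)}" "w ~= y" using True by (auto simp: G_def)
  thus ?thesis using True by (simp add: wt_def)
 qed (simp add: G_def wt_def)
 have fin: "finite F" "finite G" using F G finC[OF C(1)] finite_subset by blast+
 have d: "F \<inter> G = {}" "({(e, u), (e, w)}) \<inter> (F \<union> G) = {}" using fg f g by (auto simp: F_def G_def split: if_splits)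
 have "sum wt ({(e, u), (e, w)} \<union> (F \<union> G)) = sum wt {(e, u), (e, w)} + (sum wt F + sum wt G)"
  using d fin by (subst sum.union_disjoint, simp, simp, blast, subst sum.union_disjoint, auto)
 also have "\<dots> = 6" using sF sG w(1) e(2) by (simp add: wt_def)
 finally have "sum wt ({(e, u), (e, w)} \<union> (F \<union> G)) = 6" .
 moreover have "{(e, u), (e, w)} \<union> (F \<union> G) \<subseteq> C" using F G e ew by auto
 ultimately show ?thesis using sum_ge[OF finC[OF C(1)]] by metis
qed

text \<open>The pieces of two edges at \<open>u\<close> lead to two crossings, which differ because
  crossing edges share no end. At each of them the cycle has a second piece.\<close>

lemma girth_cr:
 assumes na: "\<And>e. e \<in> E ==> m e ~= e ==> e \<inter> m e = {}"
  and C: "C \<subseteq> pcs E" "pcyc m C" and e: "(e, u) \<in> C" and cr: "\<And>p. p \<in> C ==> m (fst p) ~= fst p"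
 shows "\<exists>D \<subseteq> C. card D = 4"
proof -
 obtain f where f: "f ~= e" "(f, u) \<in> C" using pcyc_V[OF C e(1)] by auto
 obtain e' u' where e': "(e', u') ~= (e, u)" "(e', u') \<in> C" "e' = e \<or> e' = m e" using pcyc_X[OF C e(1)] by auto
 obtain f' v' where f': "(f', v') ~= (f, u)" "(f', v') \<in> C" "f' = f \<or> f' = m f" using pcyc_X[OF C f(2)] by auto
 have E: "e \<in> E" "u \<in> e" "f \<in> E" "u \<in> f" using C e f by auto
 have "f ~= m e" using na[OF E(1)] cr[OF e] E by fastforce
 moreover have "m f ~= e" using calculation mm[OF E(3)] by metis
 moreover have "m f ~= m e" using f(1) mm[OF E(1)] mm[OF E(3)] by metis
 ultimately have "f ~= e'" "f' ~= e" "f' ~= e'" using f(1) e'(3) f'(3) by (elim disjE; simp)+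
 hence "(e, u) ~= (f, u)" "(e, u) ~= (f', v')" "(e', u') ~= (f, u)" "(e', u') ~= (f', v')" using f(1) by (simp_all only: prod.inject) simp_all
 hence "card {(e, u), (e', u'), (f, u), (f', v')} = 4" using not_sym[OF e'(1)] not_sym[OF f'(1)] by (simp del: prod.inject)
 moreover have "{(e, u), (e', u'), (f, u), (f', v')} \<subseteq> C" using e e'(2) f(2) f'(2) by simp
 ultimately show ?thesis by (intro exI[of _ "{(e, u), (e', u'), (f, u), (f', v')}"] conjI)
qed

lemma girth6:
 assumes na: "\<And>e. e \<in> E ==> m e ~= e ==> e \<inter> m e = {}"
  and C: "C \<subseteq> pcs E" "pcyc m C" "C ~= {}"
 shows "6 \<le> sum wt C"
proof (cases "\<exists>p\<in>C. m (fst p) = fst p")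
 case True
 then obtain p where "p \<in> C" "m (fst p) = fst p" by (elim bexE)
 thus ?thesis using girth_unc[OF C(1,2), of "fst p" "snd p"] by simp
next
 case False
 obtain e u where eu: "(e, u) \<in> C" using C(3) by auto
 obtain D where D: "D \<subseteq> C" "card D = 4" by (metis False girth_cr na C(1,2) eu)
 have "sum wt D = sum (\<lambda>_. 2) D" using False D(1) by (intro sum.cong) (auto simp: wt_def)
 thus ?thesis using sum_ge[OF finC[OF C(1)] D(1)] D(2) by simp
qed

lemma card_pcs: "card (pcs E) = 2 * card E"
 unfolding pcs_Sigma using finE edge fin_edge by (subst card_SigmaI) auto

definition unc :: "'a set set" where "unc = {e \<in> E. m e = e}"
definition crs :: "'a set set" where "crs = {e \<in> E. m e ~= e}"
definition q :: nat where "q = card ((\<lambda>e. {e, m e}) ` crs)"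

lemma fin_unc: "finite unc" and fin_crs: "finite crs"
 using finE by (auto simp: unc_def crs_def)

lemma card_crs: "card crs = 2 * q"
proof -
 let ?X = "(\<lambda>e. {e, m e}) ` crs"
 have mcrs: "m e \<in> crs" if "e \<in> crs" for e
 proof -
  have e: "e \<in> E" "m e ~= e" using that by (simp_all add: crs_def)
  show ?thesis unfolding crs_def using mE[OF e(1)] mm[OF e(1)] not_sym[OF e(2)] by simp
 qed
 have U: "\<Union> ?X = crs" using subsetI mcrs by auto
 have "a \<inter> b = {}" if ab: "a \<in> ?X" "b \<in> ?X" "a ~= b" for a b
 proof -
  obtain e where e: "a = {e, m e}" "e \<in> crs" using ab(1) by (rule imageE)
  obtain f where f: "b = {f, m f}" "f \<in> crs" using ab(2) by (rule imageE)
  note ef = e(2) f(2) e(1) f(1)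
  have E: "e \<in> E" "f \<in> E" using ef by (simp_all add: crs_def)
  have 1: "f \<notin> {e, m e}" using ab(3) unfolding ef(3,4) class_eq[OF E, symmetric] by (rule not_sym)
  have 2: "m f \<notin> {e, m e}" by (metis mm E(2) insert_commute ab(3) ef(3,4) class_eq E(1) mE)
  show ?thesis unfolding ef(3,4) using 1 2 by (simp only: Int_insert_right if_False Int_empty_right)
 qed
 hence "disjoint ?X" by (intro disjointI)
 moreover have two: "card x = 2" if x: "x \<in> ?X" for x
 proof -
  obtain e where e: "x = {e, m e}" "e \<in> crs" using x by (rule imageE)
  have "e ~= m e" using e(2) unfolding crs_def mem_Collect_eq by metis
  thus ?thesis unfolding e(1) by simp
 qed
 moreover have "finite x" if "x \<in> ?X" for x using that by (rule imageE) simp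
 ultimately have "card (\<Union> ?X) = sum card ?X" by (intro card_Union_disjoint)
 also have "\<dots> = sum (\<lambda>_. 2) ?X" by (rule sum.cong[OF refl two])
 also have "\<dots> = 2 * q" by (simp add: q_def)
 finally show ?thesis unfolding U .
qed

lemma card_E: "card E = card unc + 2 * q"
proof -
 have "E = unc \<union> crs" "unc \<inter> crs = {}" by (auto simp: unc_def crs_def)
 thus ?thesis using card_Un_disjoint[OF fin_unc fin_crs] card_crs by simp
qed

lemma card_classes: "card (ptgt m ` pcs E) = card unc + q"
proof -
 let ?c = "\<lambda>e. {e, m e}"
 have "e \<in> fst ` pcs E" if e: "e \<in> E" for e
 proof -
  obtain u w where "e = {u, w}" using edge_ex[OF e] by (elim exE conjE)
  hence "(e, u) \<in> pcs E" using e by simp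
  thus ?thesis by (rule rev_image_eqI) simp
 qed
 hence fst: "fst ` pcs E = E" by (auto simp: pcs_def)
 have "ptgt m = Inr \<circ> ?c \<circ> fst" by (rule ext) (simp add: ptgt_def)
 hence "ptgt m ` pcs E = Inr ` ?c ` fst ` pcs E" by (simp only: image_comp comp_assoc)
 hence "card (ptgt m ` pcs E) = card (?c ` E)" unfolding fst by (simp add: card_image)
 also have "?c ` E = ?c ` (unc \<union> crs)" by (rule arg_cong[of E]) (auto simp: unc_def crs_def)
 also have "?c ` (unc \<union> crs) = ?c ` unc \<union> ?c ` crs" by (rule image_Un)
 also have "card \<dots> = card (?c ` unc) + card (?c ` crs)"
 proof (rule card_Un_disjoint)
  have "?c e ~= ?c f" if "e \<in> unc" "f \<in> crs" for e f using that unfolding unc_def crs_def mem_Collect_eq doubleton_eq_iff by metis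
  thus "?c ` unc \<inter> ?c ` crs = {}" by (intro equals0I) (elim IntE imageE, simp)
 qed (use fin_unc fin_crs in simp_all)
 also have "card (?c ` unc) = card unc"
 proof (rule card_image, rule inj_onI)
  fix e f assume "e \<in> unc" "f \<in> unc" "?c e = ?c f"
  thus "e = f" unfolding unc_def by (simp add: doubleton_eq_iff)
 qed
 finally show ?thesis by (simp add: q_def)
qed

lemma sum_wt: "sum wt (pcs E) = 2 * card unc + 8 * q"
proof -
 have "pcs E = pcs unc \<union> pcs crs" "pcs unc \<inter> pcs crs = {}" by (auto simp: unc_def crs_def pcs_def)
 moreover have "finite (pcs unc)" "finite (pcs crs)" using finP calculation by auto
 ultimately have "sum wt (pcs E) = sum wt (pcs unc) + sum wt (pcs crs)" by (simp add: sum.union_disjoint)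
 also have "sum wt (pcs unc) = sum (\<lambda>_. 1) (pcs unc)" by (rule sum.cong) (auto simp: wt_def pcs_def unc_def)
 also have "sum wt (pcs crs) = sum (\<lambda>_. 2) (pcs crs)" by (rule sum.cong) (auto simp: wt_def pcs_def crs_def)
 also have "sum (\<lambda>_. 1) (pcs unc) = card (pcs unc)" by simp
 also have "sum (\<lambda>_. 2) (pcs crs) = 2 * card (pcs crs)" by simp
 also have "card (pcs unc) = 2 * card unc" unfolding pcs_Sigma using fin_unc edge fin_edge by (subst card_SigmaI) (auto simp: unc_def)
 also have "card (pcs crs) = 2 * card crs" unfolding pcs_Sigma using fin_crs edge fin_edge by (subst card_SigmaI) (auto simp: crs_def)
 finally show ?thesis by (simp add: card_crs)
qed

end

text \<open>Every element lies on at most two faces, so \<open>g\<close> times the number of faces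
  is at most twice the total weight; this is combined with Euler's inequality. The second
  alternative is the case without faces.\<close>

lemma euler_weighted:
 fixes w :: "'e => nat" assumes "dualpair A s t l r" "finite A" "finite N" "N ~= {}" "s ` A \<union> t ` A \<subseteq> N"
  and g: "\<And>C. C \<subseteq> A ==> cyc s t C ==> C ~= {} ==> g \<le> sum w C"
 shows "g * (card A + 2) \<le> 2 * sum w A + g * card N \<or> card A + 1 \<le> card N"
proof (cases "faces A l r = {}")
 case True
 thus ?thesis using dualpair_euler_forest[OF assms(1-5)] by simp
next
 case False
 have "g * card (faces A l r) = (\<Sum>f\<in>faces A l r. g)" by simp
 also have "\<dots> \<le> (\<Sum>f\<in>faces A l r. sum w (ecut A l r {f}))" by (intro sum_mono g cut_subset dualpairD[OF assms(1)]) (simp add: faces_def)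
 also have "\<dots> = 2 * (\<Sum>a\<in>{a\<in>A. l a ~= r a}. w a)" by (rule sum_faces[OF assms(2)])
 also have "\<dots> \<le> 2 * sum w A" using assms(2) by (intro mult_le_mono2 sum_mono2) auto
 finally have "g * card (faces A l r) \<le> 2 * sum w A" .
 moreover have "g * (card A + 2) \<le> g * card (faces A l r) + g * card N" by (metis dualpair_euler assms(1-5) False add_mult_distrib2 mult_le_mono2)
 ultimately show ?thesis by linarith
qed

lemma (in xgraph) even_class:
 assumes "C \<subseteq> pcs E" "x \<in> E" shows "even (card {p \<in> C. fst p \<in> {x, m x}}) \<longleftrightarrow>
  (if m x = x then even (card {p \<in> C. fst p = x})
   else even (card {p \<in> C. fst p = x}) = even (card {p \<in> C. fst p = m x}))"
proof (cases "m x = x")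
 case False
 have "{p \<in> C. fst p \<in> {x, m x}} = {p \<in> C. fst p = x} \<union> {p \<in> C. fst p = m x}" unfolding insert_iff empty_iff by blast
 moreover have "{p \<in> C. fst p = x} \<inter> {p \<in> C. fst p = m x} = {}" using False by fastforce
 ultimately show ?thesis using finC assms(1) False by (simp add: card_Un_disjoint)
qed simp

lemma (in xgraph) even_pieces:
 assumes "C \<subseteq> pcs E" "e = {a, b}" "a ~= b" shows "even (card {p \<in> C. fst p = e}) \<longleftrightarrow> ((e, a) \<in> C \<longleftrightarrow> (e, b) \<in> C)"
proof -
 have eq: "{p \<in> C. fst p = e} = C \<inter> {(e, a), (e, b)}" using assms(1,2) by (auto simp: pcs_def)
 show ?thesis unfolding eq using assms(3) by (cases "(e, a) \<in> C"; cases "(e, b) \<in> C") simp_all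
qed

section \<open>Dual labellings of the pieces and their restriction to subgraphs\<close>

locale oneplane = xgraph V E m
 for V :: "'a set" and E :: "'a set set" and m :: "'a set => 'a set" +
 fixes l r :: "'a set \<times> 'a => 'f" assumes dual: "dualpair (pcs E) psrc (ptgt m) l r"

text \<open>The four faces around a crossing occur in the cyclic order \<open>f1, f2, f3, f4\<close>, alternating with the ends \<open>a, c, b, d\<close>.\<close>

definition starred :: "('a set => 'a set) => ('a set \<times> 'a => 'f) => ('a set \<times> 'a => 'f) => 'a set => bool" where
 "starred m l r e \<longleftrightarrow> (\<exists>a b c d f1 f2 f3 f4. a ~= b \<and> c ~= d \<and> e = {a, b} \<and> m e = {c, d} \<and>
   {l (e, a), r (e, a)} = {f4, f1} \<and> {l (m e, c), r (m e, c)} = {f1, f2} \<and>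
   {l (e, b), r (e, b)} = {f2, f3} \<and> {l (m e, d), r (m e, d)} = {f3, f4})"

locale nice = oneplane V E m l r
 for V :: "'a set" and E :: "'a set set" and m :: "'a set => 'a set" and l r :: "'a set \<times> 'a => 'f" +
 assumes nonadj: "e \<in> E ==> m e ~= e ==> e \<inter> m e = {}"
  and star: "e \<in> E ==> m e ~= e ==> starred m l r e"

definition subm :: "('a set => 'a set) => 'a set set => 'a set => 'a set" where
 "subm m E' = (\<lambda>e. if m e \<in> E' then m e else e)"

lemma (in xgraph) xgraph_sub:
 assumes "E' \<subseteq> E" "finite V'" "\<And>e. e \<in> E' ==> e \<subseteq> V'" shows "xgraph V' E' (subm m E')"
proof
 fix e assume e: "e \<in> E'"
 hence eE: "e \<in> E" using assms(1) by (rule rev_subsetD)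
 show "e \<subseteq> V' \<and> card e = 2" using assms(3)[OF e] edge[OF eE] by simp
 show "subm m E' e \<in> E'" using e by (simp add: subm_def)
 show "subm m E' (subm m E' e) = e" using e mm[OF eE] by (simp add: subm_def)
qed (rule assms(2))

text \<open>An edge that loses its partner keeps its crossing node as a midpoint node, so the even
  sets of pieces stay the same.\<close>

lemma (in xgraph) pcyc_sub:
 assumes "E' \<subseteq> E" "finite V'" "\<And>e. e \<in> E' ==> e \<subseteq> V'" and C: "C \<subseteq> pcs E'" shows "pcyc (subm m E') C \<longleftrightarrow> pcyc m C"
proof -
 interpret S: xgraph V' E' "subm m E'" by (rule xgraph_sub[OF assms(1-3)])
 have CE: "C \<subseteq> pcs E" using C pcs_mono[OF assms(1)] by (rule order_trans)
 have fE: "fst p \<in> E'" if "p \<in> C" for p using subsetD[OF C that] by (cases p) simp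
 have h1: "{p \<in> C. fst p \<in> {e, subm m E' e}} = {p \<in> C. fst p \<in> {e, m e}}" if "e \<in> E'" for e
 proof (rule Collect_cong, rule conj_cong[OF refl])
  fix p assume "p \<in> C"
  thus "fst p \<in> {e, subm m E' e} \<longleftrightarrow> fst p \<in> {e, m e}" using fE[of p] that by (cases "m e \<in> E'") (simp_all add: subm_def, metis)
 qed
 have "(\<forall>e\<in>E'. even (card {p \<in> C. fst p \<in> {e, subm m E' e}})) \<longleftrightarrow>
    (\<forall>e\<in>E. even (card {p \<in> C. fst p \<in> {e, m e}}))"
 proof (intro iffI ballI)
  fix e assume *: "\<forall>e\<in>E'. even (card {p \<in> C. fst p \<in> {e, subm m E' e}})" and e: "e \<in> E"
  consider "e \<in> E'" | "m e \<in> E'" | "e \<notin> E'" "m e \<notin> E'" by argo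
  thus "even (card {p \<in> C. fst p \<in> {e, m e}})"
  proof cases
   case 1
   show ?thesis using bspec[OF * 1] unfolding h1[OF 1] .
  next
   case 2
   have "{p \<in> C. fst p \<in> {e, m e}} = {p \<in> C. fst p \<in> {m e, m (m e)}}" unfolding mm[OF e] by (simp only: insert_commute)
   thus ?thesis using bspec[OF * 2] unfolding h1[OF 2] by (simp only:)
  next
   case 3
   have "{p \<in> C. fst p \<in> {e, m e}} = {}"
   proof (rule equals0I)
    fix p assume "p \<in> {p \<in> C. fst p \<in> {e, m e}}"
    thus False using fE[of p] 3 by (simp, metis)
   qed
   thus ?thesis by (simp only: card.empty even_zero)
  qed
 next
  fix e assume *: "\<forall>e\<in>E. even (card {p \<in> C. fst p \<in> {e, m e}})" and e: "e \<in> E'"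
  show "even (card {p \<in> C. fst p \<in> {e, subm m E' e}})" unfolding h1[OF e] using * subsetD[OF assms(1) e] by (rule bspec)
 qed
 thus ?thesis unfolding S.pcyc_iff[OF C] pcyc_iff[OF CE] by simp
qed

lemma (in oneplane) oneplane_sub:
 assumes "E' \<subseteq> E" "finite V'" "\<And>e. e \<in> E' ==> e \<subseteq> V'" shows "\<exists>\<mu> :: 'f => 'f. oneplane V' E' (subm m E') (\<mu> \<circ> l) (\<mu> \<circ> r)"
proof -
 interpret S: xgraph V' E' "subm m E'" by (rule xgraph_sub[OF assms])
 obtain \<mu> :: "'f => 'f" where \<mu>: "dualpair (pcs E') psrc (ptgt m) (\<mu> \<circ> l) (\<mu> \<circ> r)" by (metis dualpair_subset dual finP pcs_mono assms(1))
 have "dualpair (pcs E') psrc (ptgt (subm m E')) (\<mu> \<circ> l) (\<mu> \<circ> r)" using \<mu> pcyc_sub[OF assms] unfolding dualpair_def by simp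
 hence *: "oneplane V' E' (subm m E') (\<mu> \<circ> l) (\<mu> \<circ> r)" by unfold_locales
 show ?thesis by (rule exI[of _ \<mu>], rule *)
qed

lemma (in nice) nice_sub:
 assumes "E' \<subseteq> E" "finite V'" "\<And>e. e \<in> E' ==> e \<subseteq> V'" shows "\<exists>\<mu> :: 'f => 'f. nice V' E' (subm m E') (\<mu> \<circ> l) (\<mu> \<circ> r)"
proof -
 obtain \<mu> :: "'f => 'f" where \<mu>: "oneplane V' E' (subm m E') (\<mu> \<circ> l) (\<mu> \<circ> r)" by (metis oneplane_sub assms)
 interpret S: oneplane V' E' "subm m E'" "\<mu> \<circ> l" "\<mu> \<circ> r" by (rule \<mu>)
 have "e \<inter> subm m E' e = {} \<and> starred (subm m E') (\<mu> \<circ> l) (\<mu> \<circ> r) e"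
  if e: "e \<in> E'" "subm m E' e ~= e" for e
 proof -
  have me: "subm m E' e = m e" "m e ~= e" using e(2) by (simp_all add: subm_def split: if_splits)
  have eE: "e \<in> E" using e(1) assms(1) by (rule rev_subsetD)
  obtain a b c d f1 f2 f3 f4 where s: "a ~= b" "c ~= d" "e = {a, b}" "m e = {c, d}"
   "{l (e, a), r (e, a)} = {f4, f1}" "{l (m e, c), r (m e, c)} = {f1, f2}"
   "{l (e, b), r (e, b)} = {f2, f3}" "{l (m e, d), r (m e, d)} = {f3, f4}" using star[OF eE me(2)] unfolding starred_def by (elim exE conjE)
  have im: "{(\<mu> \<circ> l) p, (\<mu> \<circ> r) p} = {\<mu> f, \<mu> g}" if "{l p, r p} = {f, g}" for p f g using arg_cong[OF that, of "\<lambda>X. \<mu> ` X"] by simp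
  have "starred (subm m E') (\<mu> \<circ> l) (\<mu> \<circ> r) e" unfolding starred_def me(1) by (rule exI[of _ a], rule exI[of _ b], rule exI[of _ c], rule exI[of _ d],
     rule exI[of _ "\<mu> f1"], rule exI[of _ "\<mu> f2"], rule exI[of _ "\<mu> f3"], rule exI[of _ "\<mu> f4"])
    (intro conjI im s)
  thus ?thesis using nonadj[OF eE me(2)] me(1) by simp
 qed
 hence *: "nice V' E' (subm m E') (\<mu> \<circ> l) (\<mu> \<circ> r)" by unfold_locales simp_all
 show ?thesis by (rule exI[of _ \<mu>], rule *)
qed

section \<open>Normal form: removal of bad crossings\<close>

context oneplane
begin

text \<open>Without the crossing, a cycle must contain both halves of \<open>e\<close> or neither.
  By \<open>rep\<close> the cuts with this property are those by sets that do not separate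
  \<open>g\<close> from \<open>g'\<close>, and merging these two labels keeps exactly them.\<close>

lemma uncross:
 assumes e: "e \<in> E" "m e ~= e" "e = {a, b}" "a ~= b"
  and rep: "\<And>S. (((l (e, a) \<in> S) ~= (r (e, a) \<in> S)) ~= ((l (e, b) \<in> S) ~= (r (e, b) \<in> S)))
    = ((g \<in> S) ~= (g' \<in> S))"
 shows "\<exists>m' (l' :: 'a set \<times> 'a => 'f) r'. oneplane V E m' l' r' \<and>
  card {x \<in> E. m' x ~= x} < card {x \<in> E. m x ~= x}"
proof -
 define m' where "m' = m(e := e, m e := m e)"
 define \<mu> where "\<mu> = (\<lambda>x. if x = g' then g else x)"
 have meE: "m e \<in> E" by (rule mE[OF e(1)])
 have m': "m' e = e" "m' (m e) = m e" using e(2) by (simp_all add: m'_def)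
 have m'': "m' x = m x" "m x ~= e" "m x ~= m e" if "x \<in> E" "x ~= e" "x ~= m e" for x using that mm[OF that(1)] mm[OF e(1)] by (simp_all add: m'_def) metis+
 interpret S: xgraph V E m'
 proof
  fix x assume x: "x \<in> E"
  show "x \<subseteq> V \<and> card x = 2" by (rule edge[OF x])
  show "m' x \<in> E" using mE[OF x] x meE e(1) by (simp add: m'_def)
  consider "x = e" | "x = m e" | "x ~= e" "x ~= m e" by argo
  thus "m' (m' x) = x" using m'' x mm by (simp add: m'_def)
 qed (rule finV)
 have cyc: "pcyc m' C \<longleftrightarrow> pcyc m C \<and> ((e, a) \<in> C \<longleftrightarrow> (e, b) \<in> C)" if C: "C \<subseteq> pcs E" for C
 proof -
  let ?K = "\<lambda>x. even (card {p \<in> C. fst p = x})"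
  have "(\<forall>x\<in>E. if m' x = x then ?K x else ?K x = ?K (m' x)) \<longleftrightarrow>
     (\<forall>x\<in>E. if m x = x then ?K x else ?K x = ?K (m x)) \<and> ?K e"
  proof (intro iffI conjI ballI)
   fix x assume *: "\<forall>x\<in>E. if m' x = x then ?K x else ?K x = ?K (m' x)" and x: "x \<in> E"
   have 1: "?K e" using bspec[OF * e(1)] m'(1) by simp
   have 2: "?K (m e)" using bspec[OF * meE] m'(2) by simp
   consider "x = e" | "x = m e" | "x ~= e" "x ~= m e" by argo
   thus "if m x = x then ?K x else ?K x = ?K (m x)"
   proof cases
    case 1 thus ?thesis using \<open>?K e\<close> 2 by simp
   next
    case 2 thus ?thesis using \<open>?K e\<close> \<open>?K (m e)\<close> mm[OF e(1)] by simp
   next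
    case 3 thus ?thesis using bspec[OF * x] m''(1)[OF x 3] by simp
   qed
  next
   assume *: "\<forall>x\<in>E. if m' x = x then ?K x else ?K x = ?K (m' x)"
   show "?K e" using bspec[OF * e(1)] m'(1) by simp
  next
   fix x assume *: "(\<forall>x\<in>E. if m x = x then ?K x else ?K x = ?K (m x)) \<and> ?K e" and x: "x \<in> E"
   have 2: "?K (m e)" using bspec[OF conjunct1[OF *] e(1)] e(2) * by simp
   consider "x = e" | "x = m e" | "x ~= e" "x ~= m e" by argo
   thus "if m' x = x then ?K x else ?K x = ?K (m' x)"
   proof cases
    case 1 thus ?thesis using * m'(1) by simp
   next
    case 2 thus ?thesis using \<open>?K (m e)\<close> m'(2) by simp
   next
    case 3 thus ?thesis using bspec[OF conjunct1[OF *] x] m''(1)[OF x 3] by simp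
   qed
  qed
  thus ?thesis unfolding S.pcyc_iff[OF C] pcyc_iff[OF C] even_pieces[OF C e(3,4), symmetric] using S.even_class[OF C] even_class[OF C] by simp
 qed
 have "dualpair (pcs E) psrc (ptgt m') (\<mu> \<circ> l) (\<mu> \<circ> r)" unfolding dualpair_def
 proof (intro allI impI)
  fix C assume C: "C \<subseteq> pcs E"
  have mem: "((e, a) \<in> ecut (pcs E) l r S \<longleftrightarrow> (e, b) \<in> ecut (pcs E) l r S) \<longleftrightarrow> (g \<in> S \<longleftrightarrow> g' \<in> S)" for S using rep[of S] e(1,3) by (simp add: ecut_def) argo
  show "pcyc m' C \<longleftrightarrow> (\<exists>S. C = ecut (pcs E) (\<mu> \<circ> l) (\<mu> \<circ> r) S)"
  proof
   assume "pcyc m' C"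
   hence 1: "pcyc m C" "(e, a) \<in> C \<longleftrightarrow> (e, b) \<in> C" using cyc[OF C] by simp_all
   obtain S where S: "C = ecut (pcs E) l r S" using dualpairE[OF dual C 1(1)] .
   have "g \<in> S \<longleftrightarrow> g' \<in> S" using 1(2) mem[of S] unfolding S by (rule iffD1[rotated])
   hence "\<mu> x \<in> S \<longleftrightarrow> x \<in> S" for x by (simp add: \<mu>_def)
   hence "C = ecut (pcs E) (\<mu> \<circ> l) (\<mu> \<circ> r) S" unfolding S ecut_def by simp
   thus "\<exists>S. C = ecut (pcs E) (\<mu> \<circ> l) (\<mu> \<circ> r) S" by (rule exI)
  next
   assume "\<exists>S. C = ecut (pcs E) (\<mu> \<circ> l) (\<mu> \<circ> r) S"
   then obtain S where "C = ecut (pcs E) (\<mu> \<circ> l) (\<mu> \<circ> r) S" by (elim exE)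
   hence S: "C = ecut (pcs E) l r {x. \<mu> x \<in> S}" unfolding ecut_def by simp
   have "(e, a) \<in> C \<longleftrightarrow> (e, b) \<in> C" using S mem by (simp add: \<mu>_def)
   moreover have "pcyc m C" unfolding S by (rule dualpairD[OF dual])
   ultimately show "pcyc m' C" using cyc[OF C] by simp
  qed
 qed
 hence "oneplane V E m' (\<mu> \<circ> l) (\<mu> \<circ> r)" by unfold_locales
 moreover have "card {x \<in> E. m' x ~= x} < card {x \<in> E. m x ~= x}"
 proof (rule psubset_card_mono)
  show "finite {x \<in> E. m x ~= x}" using finE by simp
  have "{x \<in> E. m' x ~= x} \<subseteq> {x \<in> E. m x ~= x}" unfolding m'_def by (rule Collect_mono) (simp split: if_splits)
  moreover have "e \<in> {x \<in> E. m x ~= x}" "e \<notin> {x \<in> E. m' x ~= x}" using e m' by simp_all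
  ultimately show "{x \<in> E. m' x ~= x} \<subset> {x \<in> E. m x ~= x}" by (intro psubsetI) metis+
 qed
 ultimately show ?thesis by (intro exI conjI)
qed

end

lemma dualpair_involution:
 assumes "dualpair A s t l r"
  and \<pi>: "\<And>a. a \<in> A ==> \<pi> a \<in> A" "\<And>a. \<pi> (\<pi> a) = a" "\<And>a. a \<in> A ==> s (\<pi> a) = s a" "\<And>a. a \<in> A ==> t (\<pi> a) = t a"
 shows "dualpair A s t (l \<circ> \<pi>) (r \<circ> \<pi>)"
 unfolding dualpair_def
proof (intro allI impI)
 fix C assume C: "C \<subseteq> A"
 have inj: "inj \<pi>" by (rule inj_on_inverseI[where g = \<pi>]) (rule \<pi>(2))
 have sub: "\<pi> ` D \<subseteq> A" if "D \<subseteq> A" for D using that \<pi>(1) by auto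
 have mem: "x \<in> \<pi> ` D \<longleftrightarrow> \<pi> x \<in> D" for x D using \<pi>(2) by (metis image_iff)
 have card1: "card {a \<in> \<pi> ` C. h a = x} = card {a \<in> C. h a = x}"
  if "\<And>a. a \<in> A ==> h (\<pi> a) = h a" for h :: "_ => 'z" and x
 proof -
  have "{a \<in> \<pi> ` C. h a = x} = \<pi> ` {a \<in> C. h a = x}"
  proof (intro set_eqI)
   fix y
   show "y \<in> {a \<in> \<pi> ` C. h a = x} \<longleftrightarrow> y \<in> \<pi> ` {a \<in> C. h a = x}" using that C by fastforce
  qed
  thus ?thesis using card_image[OF inj_on_subset[OF inj subset_UNIV]] by simp
 qed
 have "cyc s t (\<pi> ` C) \<longleftrightarrow> cyc s t C" unfolding cyc_def deg_def using card1[of s, OF \<pi>(3)] card1[of t, OF \<pi>(4)] by simp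
 moreover have "cyc s t (\<pi> ` C) \<longleftrightarrow> (\<exists>S. \<pi> ` C = ecut A l r S)" using assms(1) sub[OF C] unfolding dualpair_def by simp
 moreover have "\<pi> ` C = ecut A l r S \<longleftrightarrow> C = ecut A (l \<circ> \<pi>) (r \<circ> \<pi>) S" for S
 proof -
  have "ecut A (l \<circ> \<pi>) (r \<circ> \<pi>) S = \<pi> ` ecut A l r S" using mem \<pi>(1) \<pi>(2) by (auto simp: ecut_def)
  moreover have "\<pi> ` \<pi> ` D = D" for D using \<pi>(2) by (simp add: image_image)
  ultimately show ?thesis by metis
 qed
 ultimately show "cyc s t C \<longleftrightarrow> (\<exists>S. C = ecut A (l \<circ> \<pi>) (r \<circ> \<pi>) S)" by simp
qed

text \<open>The halves of two crossing edges at a common end are parallel elements of the planarised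
  graph. Exchanging their labels is the combinatorial form of swapping the two tails between the
  common end and the crossing.\<close>

lemma (in oneplane) swap:
 assumes "e \<in> E" "u \<in> e" "u \<in> m e"
 defines "\<pi> == \<lambda>p. if p = (e, u) then (m e, u) else if p = (m e, u) then (e, u) else p"
 shows "oneplane V E m (l \<circ> \<pi>) (r \<circ> \<pi>)"
proof -
 have "dualpair (pcs E) psrc (ptgt m) (l \<circ> \<pi>) (r \<circ> \<pi>)"
 proof (rule dualpair_involution[OF dual])
  fix p assume p: "p \<in> pcs E"
  show "\<pi> p \<in> pcs E" using p assms(1-3) mE[OF assms(1)] by (simp add: \<pi>_def)
  show "psrc (\<pi> p) = psrc p" by (simp add: \<pi>_def psrc_def)
  show "ptgt m (\<pi> p) = ptgt m p" using mm[OF assms(1)] by (simp add: \<pi>_def ptgt_def insert_commute)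
 qed (simp add: \<pi>_def)
 thus ?thesis by unfold_locales
qed

text \<open>By \<open>par\<close> the side pairs of the four pieces at a crossing add up to zero
  modulo 2. If the sum at \<open>a\<close> and \<open>b\<close> is no single pair, their four labels
  are distinct, and the pairs at \<open>c\<close> and \<open>d\<close> split the same four labels:
  either in the same way, or across, which is the cyclic order.\<close>

lemma quad_cases:
 fixes La Ra Lb Rb Lc Rc Ld Rd :: 'f assumes par: "\<And>S. (((La \<in> S) ~= (Ra \<in> S)) ~= ((Lb \<in> S) ~= (Rb \<in> S))) =
   (((Lc \<in> S) ~= (Rc \<in> S)) ~= ((Ld \<in> S) ~= (Rd \<in> S)))" and norep: "\<And>g g'. \<not> (\<forall>S. (((La \<in> S) ~= (Ra \<in> S)) ~= ((Lb \<in> S) ~= (Rb \<in> S))) = ((g \<in> S) ~= (g' \<in> S)))"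
 shows "{Lc, Rc} = {La, Ra} \<or> {Ld, Rd} = {La, Ra} \<or>
  (\<exists>f1 f2 f3 f4. {La, Ra} = {f4, f1} \<and> {Lc, Rc} = {f1, f2} \<and> {Lb, Rb} = {f2, f3} \<and> {Ld, Rd} = {f3, f4})"
proof -
 have ne: "La ~= Ra" "La ~= Lb" "La ~= Rb" "Ra ~= Lb" "Ra ~= Rb" "Lb ~= Rb"
  using norep[of Lb Rb] norep[of Ra Rb] norep[of Ra Lb] norep[of La Rb] norep[of La Lb] norep[of La Ra] by blast+
 have "La \<in> {Lc, Rc, Ld, Rd}" using par[of "{La}"] ne by auto
 moreover have "Ra \<in> {Lc, Rc, Ld, Rd}" using par[of "{Ra}"] ne by auto
 moreover have "Lb \<in> {Lc, Rc, Ld, Rd}" using par[of "{Lb}"] ne by auto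
 moreover have "Rb \<in> {Lc, Rc, Ld, Rd}" using par[of "{Rb}"] ne by auto
 ultimately have "{Lc, Rc} = {La, Ra} \<or> {Ld, Rd} = {La, Ra} \<or>
   ({Lc, Rc} = {La, Lb} \<and> {Ld, Rd} = {Rb, Ra}) \<or> ({Lc, Rc} = {La, Rb} \<and> {Ld, Rd} = {Lb, Ra}) \<or>
   ({Lc, Rc} = {Ra, Lb} \<and> {Ld, Rd} = {Rb, La}) \<or> ({Lc, Rc} = {Ra, Rb} \<and> {Ld, Rd} = {Lb, La})" using ne unfolding insert_iff empty_iff doubleton_eq_iff by metis
 thus ?thesis
 proof (elim disjE conjE)
  assume "{Lc, Rc} = {La, Lb}" "{Ld, Rd} = {Rb, Ra}"
  thus ?thesis by (intro disjI2 exI[of _ La] exI[of _ Lb] exI[of _ Rb] exI[of _ Ra]) (simp add: insert_commute)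
 next
  assume "{Lc, Rc} = {La, Rb}" "{Ld, Rd} = {Lb, Ra}"
  thus ?thesis by (intro disjI2 exI[of _ La] exI[of _ Rb] exI[of _ Lb] exI[of _ Ra]) (simp add: insert_commute)
 next
  assume "{Lc, Rc} = {Ra, Lb}" "{Ld, Rd} = {Rb, La}"
  thus ?thesis by (intro disjI2 exI[of _ Ra] exI[of _ Lb] exI[of _ Rb] exI[of _ La]) (simp add: insert_commute)
 next
  assume "{Lc, Rc} = {Ra, Rb}" "{Ld, Rd} = {Lb, La}"
  thus ?thesis by (intro disjI2 exI[of _ Ra] exI[of _ Rb] exI[of _ Lb] exI[of _ La]) (simp add: insert_commute)
 qed simp_all
qed

lemma (in xgraph) walk_pieces:
 assumes "E0 \<subseteq> E" "(x, y) \<in> {(x, y). {x, y} \<in> E0 \<and> x ~= y}\<^sup>*" shows "\<exists>C \<subseteq> pcs E0. (\<forall>u. odd (card {p \<in> C. snd p = u}) \<longleftrightarrow> (u = x) ~= (u = y)) \<and>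
      (\<forall>g. even (card {p \<in> C. fst p = g}))" using assms(2)
proof (induction rule: rtrancl_induct)
 case base
 show ?case by (rule exI[of _ "{}"]) simp
next
 case (step y z)
 obtain C where C: "C \<subseteq> pcs E0" "\<forall>u. odd (card {p \<in> C. snd p = u}) \<longleftrightarrow> (u = x) ~= (u = y)"
  "\<forall>g. even (card {p \<in> C. fst p = g})" using step.IH by (elim exE conjE)
 have yz: "{y, z} \<in> E0" "y ~= z" using step.hyps(2) by simp_all
 let ?D = "{({y, z}, y), ({y, z}, z)}"
 have finC': "finite C" using C(1) pcs_mono[OF assms(1)] by (intro finC) (rule order_trans)
 show ?case
 proof (rule exI[of _ "sym_diff C ?D"], intro conjI allI)
  show "sym_diff C ?D \<subseteq> pcs E0" using C(1) yz(1) by auto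
 next
  fix u
  have "{p \<in> sym_diff C ?D. snd p = u} = sym_diff {p \<in> C. snd p = u} {p \<in> ?D. snd p = u}" by blast
  moreover have "{p \<in> ?D. snd p = u} = (if u = y then {({y, z}, y)} else if u = z then {({y, z}, z)} else {})" using yz(2) by auto
  hence "odd (card {p \<in> ?D. snd p = u}) \<longleftrightarrow> (u = y) ~= (u = z)" using yz(2) by simp
  moreover have "odd (card {p \<in> C. snd p = u}) \<longleftrightarrow> (u = x) ~= (u = y)" using C(2) by (rule spec)
  ultimately show "odd (card {p \<in> sym_diff C ?D. snd p = u}) \<longleftrightarrow> (u = x) ~= (u = z)"
   using even_card_sym_diff[of "{p \<in> C. snd p = u}" "{p \<in> ?D. snd p = u}"] finC' by simp argo
 next
  fix g
  have "{p \<in> sym_diff C ?D. fst p = g} = sym_diff {p \<in> C. fst p = g} {p \<in> ?D. fst p = g}" by blast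
  moreover have "{p \<in> ?D. fst p = g} = (if g = {y, z} then ?D else {})" by auto
  hence "even (card {p \<in> ?D. fst p = g})" using yz(2) by simp
  moreover have "even (card {p \<in> C. fst p = g})" using C(3) by (rule spec)
  ultimately show "even (card {p \<in> sym_diff C ?D. fst p = g})" using even_card_sym_diff[of "{p \<in> C. fst p = g}" "{p \<in> ?D. fst p = g}"] finC' by simp
 qed
qed

context oneplane
begin

abbreviation side where "side p S == (l p \<in> S) ~= (r p \<in> S)"

text \<open>A walk that avoids the crossing joins the outer ends of \<sigma> and \<tau>, and these
  two pieces close it to a cycle through the crossing. As a cut, this cycle is given by the required
  \<open>S\<close>.\<close>

lemma digon_walk:
 assumes e: "e \<in> E" "m e ~= e"
  and \<sigma>: "\<sigma> \<in> pcs E" "fst \<sigma> \<in> {e, m e}" and \<tau>: "\<tau> \<in> pcs E" "fst \<tau> \<in> {e, m e}" and "\<sigma> ~= \<tau>" and walk: "(snd \<sigma>, snd \<tau>) \<in> {(x, y). {x, y} \<in> E - {e, m e} \<and> x ~= y}\<^sup>*"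
 shows "\<exists>S. \<forall>p\<in>pcs E. fst p \<in> {e, m e} --> (side p S \<longleftrightarrow> p = \<sigma> \<or> p = \<tau>)"
proof -
 let ?E0 = "E - {e, m e}"
 obtain C where C: "C \<subseteq> pcs ?E0" "\<forall>u. odd (card {p \<in> C. snd p = u}) \<longleftrightarrow> (u = snd \<sigma>) ~= (u = snd \<tau>)"
  "\<forall>g. even (card {p \<in> C. fst p = g})" using walk_pieces[OF Diff_subset walk] by (elim exE conjE)
 have fC: "fst p \<in> ?E0" if "p \<in> C" for p using subsetD[OF C(1) that] by (cases p) simp
 have nC: "\<sigma> \<notin> C" "\<tau> \<notin> C" using fC[of \<sigma>] fC[of \<tau>] \<sigma>(2) \<tau>(2) by (simp_all, metis+)
 let ?C = "C \<union> {\<sigma>, \<tau>}"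
 have CE: "C \<subseteq> pcs E" using C(1) pcs_mono[OF Diff_subset] by (rule order_trans)
 hence sub: "?C \<subseteq> pcs E" using \<sigma> \<tau> by simp
 have fin: "finite C" by (rule finC[OF CE])
 have cyc: "pcyc m ?C" unfolding pcyc_iff[OF sub]
 proof (intro conjI allI ballI)
  fix u
  have "{p \<in> ?C. snd p = u} = {p \<in> C. snd p = u} \<union> {p \<in> {\<sigma>, \<tau>}. snd p = u}" by blast
  moreover have "{p \<in> C. snd p = u} \<inter> {p \<in> {\<sigma>, \<tau>}. snd p = u} = {}" using nC by blast
  ultimately have "card {p \<in> ?C. snd p = u} = card {p \<in> C. snd p = u} + card {p \<in> {\<sigma>, \<tau>}. snd p = u}" using fin by (simp add: card_Un_disjoint)
  moreover have "{p \<in> {\<sigma>, \<tau>}. snd p = u} = (if snd \<sigma> = u then {\<sigma>} else {}) \<union> (if snd \<tau> = u then {\<tau>} else {})" by auto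
  hence "odd (card {p \<in> {\<sigma>, \<tau>}. snd p = u}) \<longleftrightarrow> (u = snd \<sigma>) ~= (u = snd \<tau>)" using \<open>\<sigma> ~= \<tau>\<close> by auto
  moreover have "odd (card {p \<in> C. snd p = u}) \<longleftrightarrow> (u = snd \<sigma>) ~= (u = snd \<tau>)" using C(2) by (rule spec)
  ultimately show "even (card {p \<in> ?C. snd p = u})" by simp argo
 next
  fix x assume x: "x \<in> E"
  show "even (card {p \<in> ?C. fst p \<in> {x, m x}})"
  proof (cases "x \<in> {e, m e}")
   case True
   hence xe: "{x, m x} = {e, m e}" using mm[OF e(1)] by (simp, metis insert_commute)
   have "{p \<in> ?C. fst p \<in> {e, m e}} = {\<sigma>, \<tau>}" using fC \<sigma>(2) \<tau>(2) by fastforce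
   thus ?thesis unfolding xe using \<open>\<sigma> ~= \<tau>\<close> by simp
  next
   case False
   hence "m x \<notin> {e, m e}" using mm[OF x] mm[OF e(1)] by (simp, metis)
   hence "{p \<in> ?C. fst p \<in> {x, m x}} = {p \<in> C. fst p \<in> {x, m x}}" using False \<sigma>(2) \<tau>(2) by (intro Collect_cong) (simp, metis)
   moreover have "even (card {p \<in> C. fst p \<in> {x, m x}})" unfolding even_class[OF CE x] using C(3) by simp
   ultimately show ?thesis by (simp only:)
  qed
 qed
 obtain S where S: "?C = ecut (pcs E) l r S" using dualpairE[OF dual sub cyc] .
 have "side p S \<longleftrightarrow> p = \<sigma> \<or> p = \<tau>" if p: "p \<in> pcs E" "fst p \<in> {e, m e}" for p
 proof -
  have "side p S \<longleftrightarrow> p \<in> ?C" unfolding S using p by (simp add: ecut_def)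
  moreover have "p \<notin> C" using fC[of p] p(2) by (simp, metis)
  ultimately show ?thesis by simp
 qed
 thus ?thesis by (intro exI[of _ S] ballI impI)
qed

text \<open>Two pieces with equal sides belong to the same cuts. A walk from \<open>a\<close> or
  \<open>c\<close> to \<open>b\<close> around the crossing would by \<open>digon_walk\<close> give a
  cut that contains just one of them. So the set reachable from \<open>a\<close> and
  \<open>c\<close> without the two edges misses \<open>b\<close>.\<close>

lemma digon_disconnect:
 assumes e: "e \<in> E" "m e ~= e" "e = {a, b}" "m e = {c, d}" "a ~= b" "c ~= d"
  and dig: "\<And>S. side (e, a) S \<longleftrightarrow> side (m e, c) S"
 shows "\<exists>V1 \<subseteq> V. V1 ~= {} \<and> V1 ~= V \<and> (\<forall>g\<in>E - {e, m e}. g \<subseteq> V1 \<or> g \<inter> V1 = {})"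
proof -
 define R where "R = {(x, y). {x, y} \<in> E - {e, m e} \<and> x ~= y}"
 define V1 where "V1 = {y \<in> V. (a, y) \<in> R\<^sup>* \<or> (c, y) \<in> R\<^sup>*}"
 have meE: "m e \<in> E" by (rule mE[OF e(1)])
 have "{a, b} \<subseteq> V" using conjunct1[OF edge[OF e(1)]] by (simp only: e(3))
 moreover have "{c, d} \<subseteq> V" using conjunct1[OF edge[OF meE]] by (simp only: e(4))
 ultimately have V: "a \<in> V" "b \<in> V" "c \<in> V" "d \<in> V" by simp_all
 have P: "(e, a) \<in> pcs E" "(e, b) \<in> pcs E" "(m e, c) \<in> pcs E" "(m e, d) \<in> pcs E" using e(1,3,4) meE by simp_all
 have no: "(snd \<sigma>, b) \<notin> R\<^sup>*" if \<sigma>: "\<sigma> = (e, a) \<or> \<sigma> = (m e, c)" for \<sigma>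
 proof
  assume w: "(snd \<sigma>, b) \<in> R\<^sup>*"
  have "\<sigma> \<in> pcs E" "fst \<sigma> \<in> {e, m e}" "\<sigma> ~= (e, b)" using \<sigma> P e(2,5) by (elim disjE; simp)+
  hence "\<exists>S. \<forall>p\<in>pcs E. fst p \<in> {e, m e} --> (side p S \<longleftrightarrow> p = \<sigma> \<or> p = (e, b))" using digon_walk[OF e(1,2), of \<sigma> "(e, b)"] P(2) w unfolding R_def by simp
  then obtain S where S: "\<forall>p\<in>pcs E. fst p \<in> {e, m e} --> (side p S \<longleftrightarrow> p = \<sigma> \<or> p = (e, b))" by (elim exE)
  show False using bspec[OF S P(1)] bspec[OF S P(3)] dig[of S] \<sigma> e(2,5) by (elim disjE) (simp_all add: not_sym[OF e(2)])
 qed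
 have V1: "b \<notin> V1" using no[of "(e, a)"] no[of "(m e, c)"] by (simp add: V1_def)
 show ?thesis
 proof (rule exI[of _ V1], intro conjI ballI)
  show "V1 \<subseteq> V" by (auto simp: V1_def)
  show "V1 ~= {}" using V by (auto simp: V1_def)
  show "V1 ~= V" using V1 V by auto
  fix g assume g: "g \<in> E - {e, m e}"
  then obtain x y where xy: "x ~= y" "g = {x, y}" using edge_ex[of g] by auto
  have R: "(x, y) \<in> R" "(y, x) \<in> R" using g xy by (auto simp: R_def insert_commute)
  have "x \<in> V" "y \<in> V" using edge[of g] g xy by auto
  hence "x \<in> V1 \<longleftrightarrow> y \<in> V1" using R unfolding V1_def by (auto intro: rtrancl_into_rtrancl)
  thus "g \<subseteq> V1 \<or> g \<inter> V1 = {}" using xy(2) by auto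
 qed
qed

lemma pair_side: "{l p, r p} = {f, g} ==> side p S \<longleftrightarrow> ((f \<in> S) ~= (g \<in> S))"
 unfolding doubleton_eq_iff by metis

lemma crossing_parity:
 assumes e: "e \<in> E" "m e ~= e" "e = {a, b}" "m e = {c, d}" "a ~= b" "c ~= d" shows "(side (e, a) S ~= side (e, b) S) = (side (m e, c) S ~= side (m e, d) S)"
proof -
 let ?C = "ecut (pcs E) l r S"
 have sub: "?C \<subseteq> pcs E" by (rule cut_subset)
 have "even (card {p \<in> ?C. fst p \<in> {e, m e}})" using dualpairD dual pcyc_iff sub e(1) by blast
 hence "even (card {p \<in> ?C. fst p = e}) = even (card {p \<in> ?C. fst p = m e})" unfolding even_class[OF sub e(1)] using e(2) by simp
 thus ?thesis unfolding even_pieces[OF sub e(3,5)] even_pieces[OF sub e(4,6)] using e(1,3,4) mE[OF e(1)] by (simp add: ecut_def)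
qed

lemma crossing_cases:
 assumes e: "e \<in> E" "m e ~= e" shows "(\<exists>m' (l' :: 'a set \<times> 'a => 'f) r'. oneplane V E m' l' r' \<and>
   card {x \<in> E. m' x ~= x} < card {x \<in> E. m x ~= x}) \<or>
  (\<exists>V1 \<subseteq> V. V1 ~= {} \<and> V1 ~= V \<and> (\<forall>g\<in>E - {e, m e}. g \<subseteq> V1 \<or> g \<inter> V1 = {})) \<or>
  (e \<inter> m e = {} \<and> starred m l r e)" (is "?A \<or> ?B \<or> ?C")
proof -
 have meE: "m e \<in> E" by (rule mE[OF e(1)])
 have "\<exists>a b c d. e = {a, b} \<and> m e = {c, d} \<and> a ~= b \<and> c ~= d \<and> (e \<inter> m e ~= {} --> a = c)"
 proof (cases "e \<inter> m e = {}")
  case True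
  thus ?thesis using edge_ex[OF e(1)] edge_ex[OF meE] by blast
 next
  case False
  then obtain u where u: "u \<in> e" "u \<in> m e" by auto
  obtain b where "b ~= u" "e = {u, b}" using edge2[OF e(1) u(1)] by auto
  moreover obtain d where "d ~= u" "m e = {u, d}" using edge2[OF meE u(2)] by auto
  ultimately show ?thesis by (intro exI[of _ u] exI[of _ b] exI[of _ u] exI[of _ d]) simp
 qed
 then obtain a b c d where n: "e = {a, b}" "m e = {c, d}" "a ~= b" "c ~= d" "e \<inter> m e ~= {} --> a = c" by (elim exE conjE)
 show ?thesis
 proof (cases "\<exists>g g'. \<forall>S. (side (e, a) S ~= side (e, b) S) = ((g \<in> S) ~= (g' \<in> S))")
  case True
  then obtain g g' where "\<And>S. (side (e, a) S ~= side (e, b) S) = ((g \<in> S) ~= (g' \<in> S))" by (elim exE) simp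
  hence ?A by (rule uncross[OF e n(1,3)])
  thus ?thesis by (rule disjI1)
 next
  case False
  have "{l (m e, c), r (m e, c)} = {l (e, a), r (e, a)} \<or> {l (m e, d), r (m e, d)} = {l (e, a), r (e, a)} \<or>
   (\<exists>f1 f2 f3 f4. {l (e, a), r (e, a)} = {f4, f1} \<and> {l (m e, c), r (m e, c)} = {f1, f2} \<and>
    {l (e, b), r (e, b)} = {f2, f3} \<and> {l (m e, d), r (m e, d)} = {f3, f4})" by (rule quad_cases[OF crossing_parity[OF e n(1-4)]]) (use False in simp)
  thus ?thesis
  proof (elim disjE exE conjE)
   assume *: "{l (m e, c), r (m e, c)} = {l (e, a), r (e, a)}"
   have "side (e, a) S \<longleftrightarrow> side (m e, c) S" for S using pair_side[OF *, of S] by (rule sym)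
   hence ?B by (rule digon_disconnect[OF e n(1-4)])
   thus ?thesis by simp
  next
   assume *: "{l (m e, d), r (m e, d)} = {l (e, a), r (e, a)}"
   have "m e = {d, c}" using n(2) by (simp add: insert_commute)
   have "side (e, a) S \<longleftrightarrow> side (m e, d) S" for S using pair_side[OF *, of S] by (rule sym)
   hence ?B by (rule digon_disconnect[OF e n(1) \<open>m e = {d, c}\<close> n(3) not_sym[OF n(4)]])
   thus ?thesis by simp
  next
   fix f1 f2 f3 f4
   assume f: "{l (e, a), r (e, a)} = {f4, f1}" "{l (m e, c), r (m e, c)} = {f1, f2}"
    "{l (e, b), r (e, b)} = {f2, f3}" "{l (m e, d), r (m e, d)} = {f3, f4}"
   show ?thesis
   proof (cases "e \<inter> m e = {}")
    case True
    have "starred m l r e" unfolding starred_def by (rule exI[of _ a], rule exI[of _ b], rule exI[of _ c], rule exI[of _ d],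
      rule exI[of _ f1], rule exI[of _ f2], rule exI[of _ f3], rule exI[of _ f4]) (intro conjI n(1-4) f)
    thus ?thesis using True by simp
   next
    case False
    hence ac: "a = c" using n(5) by simp
    define \<pi> where "\<pi> = (\<lambda>p. if p = (e, a) then (m e, a) else if p = (m e, a) then (e, a) else p)"
    have "a \<in> e" "a \<in> m e" using n(1,2) ac by simp_all
    then interpret W: oneplane V E m "l \<circ> \<pi>" "r \<circ> \<pi>" unfolding \<pi>_def by (rule swap[OF e(1)])
    have \<pi>: "\<pi> (e, a) = (m e, c)" "\<pi> (e, b) = (e, b)" using ac n(3) e(2) by (simp_all add: \<pi>_def)
    \<comment> \<open>After the exchange the half of \<open>e\<close> at \<open>a\<close> has the
      sides \<open>f1\<close>, \<open>f2\<close>, while the half at \<open>b\<close> has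
      \<open>f2\<close>, \<open>f3\<close>. Their sum is the single pair \<open>f1\<close>,
      \<open>f3\<close>, so the crossing of adjacent edges can be removed.\<close>
    have ?A using pair_side[OF f(2)] pair_side[OF f(3)] by (intro W.uncross[OF e n(1,3), of f1 f3]) (simp add: \<pi>, argo)
    thus ?thesis by (rule disjI1)
   qed
  qed
 qed
qed

end

text \<open>Induction on the number of crossed edges: a bad crossing is removed unless its two edges
  form a small edge cut.\<close>

lemma normalise:
 assumes "oneplane V E m (l :: 'a set \<times> 'a => 'f) r" shows "(\<exists>m (l :: 'a set \<times> 'a => 'f) r. nice V E m l r) \<or>
  (\<exists>e\<in>E. \<exists>f\<in>E. e ~= f \<and> (\<exists>V1 \<subseteq> V. V1 ~= {} \<and> V1 ~= V \<and> (\<forall>g\<in>E - {e, f}. g \<subseteq> V1 \<or> g \<inter> V1 = {})))" using assms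
proof (induction "card {x \<in> E. m x ~= x}" arbitrary: m l r rule: less_induct)
 case less
 interpret oneplane V E m l r by (rule less.prems)
 show ?case
 proof (cases "\<forall>e\<in>E. m e ~= e --> e \<inter> m e = {} \<and> starred m l r e")
  case True
  have "nice V E m l r" by unfold_locales (use True in simp_all)
  thus ?thesis by (intro disjI1 exI)
 next
  case False
  then obtain e where e: "e \<in> E" "m e ~= e" "\<not> (e \<inter> m e = {} \<and> starred m l r e)" by auto
  from crossing_cases[OF e(1,2)] e(3) consider
   (A) "\<exists>m' (l' :: 'a set \<times> 'a => 'f) r'. oneplane V E m' l' r' \<and>
    card {x \<in> E. m' x ~= x} < card {x \<in> E. m x ~= x}"
   | (B) "\<exists>V1 \<subseteq> V. V1 ~= {} \<and> V1 ~= V \<and> (\<forall>g\<in>E - {e, m e}. g \<subseteq> V1 \<or> g \<inter> V1 = {})" by argo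
  thus ?thesis
  proof cases
   case A
   then obtain m' r' and l' :: "'a set \<times> 'a => 'f" where
    "oneplane V E m' l' r'" "card {x \<in> E. m' x ~= x} < card {x \<in> E. m x ~= x}" by (elim exE conjE)
   thus ?thesis using less.hyps by simp
  next
   case B
   thus ?thesis using e(1) mE[OF e(1)] not_sym[OF e(2)] by (intro disjI2 bexI[of _ e] bexI[of _ "m e"] conjI)
  qed
 qed
qed

section \<open>Bounds for edges and crossings from Euler's inequality\<close>

lemma (in xgraph) nodes:
 "finite (Inl ` V \<union> ptgt m ` pcs E)" "psrc ` pcs E \<union> ptgt m ` pcs E \<subseteq> Inl ` V \<union> ptgt m ` pcs E"
 "card (Inl ` V \<union> ptgt m ` pcs E) = card V + card unc + q"
proof -
 show "finite (Inl ` V \<union> ptgt m ` pcs E)" using finV finP by simp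
 have "psrc p \<in> Inl ` V" if "p \<in> pcs E" for p using that edge[of "fst p"] by (auto simp: psrc_def pcs_def)
 thus "psrc ` pcs E \<union> ptgt m ` pcs E \<subseteq> Inl ` V \<union> ptgt m ` pcs E" by blast
 have "Inl ` V \<inter> ptgt m ` pcs E = {}" by (auto simp: ptgt_def)
 hence "card (Inl ` V \<union> ptgt m ` pcs E) = card (Inl ` V :: ('a + 'a set set) set) + card (ptgt m ` pcs E)" using finV finP by (intro card_Un_disjoint) simp_all
 thus "card (Inl ` V \<union> ptgt m ` pcs E) = card V + card unc + q" by (simp add: card_image card_classes)
qed

context nice
begin

text \<open>With 6 as the least weight of a cycle, Euler's inequality for the whole planarised graph
  gives what the planar bound 3n - 6 would give after deleting one edge of each crossing.\<close>

lemma planar_bound: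
 assumes "3 \<le> card V" shows "card unc + q + 6 \<le> 3 * card V"
proof -
 have "V ~= {}" using assms by auto
 hence "6 * (card (pcs E) + 2) \<le> 2 * sum wt (pcs E) + 6 * card (Inl ` V \<union> ptgt m ` pcs E) \<or>
  card (pcs E) + 1 \<le> card (Inl ` V \<union> ptgt m ` pcs E)" using nodes by (intro euler_weighted[OF dual finP]) (simp_all add: girth6[OF nonadj])
 thus ?thesis using assms unfolding nodes(3) sum_wt card_pcs card_E by (simp only: distrib_left) (elim disjE; simp)
qed

lemma pcs_crs: "card (pcs crs) = 4 * q" "pcs crs \<subseteq> pcs E" "card (ptgt m ` pcs crs) \<le> q"
proof -
 show sub: "pcs crs \<subseteq> pcs E" by (rule pcs_mono) (simp add: crs_def)
 have "card (pcs crs) = 2 * card crs" unfolding pcs_Sigma using fin_crs edge fin_edge by (subst card_SigmaI) (auto simp: crs_def)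
 thus "card (pcs crs) = 4 * q" by (simp add: card_crs)
 have "ptgt m ` pcs crs \<subseteq> Inr ` (\<lambda>e. {e, m e}) ` crs" by (auto simp: ptgt_def pcs_def)
 hence "card (ptgt m ` pcs crs) \<le> card (Inr ` (\<lambda>e. {e, m e}) ` crs :: ('a + 'a set set) set)" using fin_crs by (intro card_mono) simp_all
 also have "\<dots> = q" by (simp add: q_def card_image)
 finally show "card (ptgt m ` pcs crs) \<le> q" .
qed

text \<open>Only crossed pieces are kept: \<open>4 * q\<close> of them on at most
  \<open>card V + q\<close> nodes, with no cycle of fewer than four pieces.\<close>

lemma cross_bound:
 assumes "3 \<le> card V" shows "q + 2 \<le> card V"
proof -
 obtain \<mu> :: "'f => 'f" where \<mu>: "dualpair (pcs crs) psrc (ptgt m) (\<mu> \<circ> l) (\<mu> \<circ> r)" by (metis dualpair_subset dual finP pcs_crs(2))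
 let ?N = "Inl ` V \<union> ptgt m ` pcs crs"
 have fin: "finite (pcs crs)" by (rule finC[OF pcs_crs(2)])
 have ne: "V ~= {}" using assms by auto
 have "card ?N \<le> card (Inl ` V :: ('a + 'a set set) set) + card (ptgt m ` pcs crs)" by (rule card_Un_le)
 hence cN: "card ?N \<le> card V + q" using pcs_crs(3) by (simp add: card_image)
 have g: "4 \<le> sum (\<lambda>_. 1::nat) C" if C: "C \<subseteq> pcs crs" "pcyc m C" "C ~= {}" for C
 proof -
  obtain e u where eu: "(e, u) \<in> C" using C(3) by auto
  have "m (fst p) ~= fst p" if "p \<in> C" for p using subsetD[OF C(1) that] by (cases p) (simp add: crs_def)
  hence "\<exists>D\<subseteq>C. card D = 4" using C(1) pcs_crs(2) by (intro girth_cr[OF nonadj _ C(2) eu]) simp_all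
  then obtain D where "D \<subseteq> C" "card D = 4" by (elim exE conjE)
  thus ?thesis using card_mono[OF finite_subset[OF C(1) fin], of D] by simp
 qed
 have "psrc p \<in> Inl ` V" if "p \<in> pcs crs" for p using that edge[of "fst p"] by (auto simp: psrc_def pcs_def crs_def)
 hence sub: "psrc ` pcs crs \<union> ptgt m ` pcs crs \<subseteq> ?N" by blast
 have "4 * (card (pcs crs) + 2) \<le> 2 * sum (\<lambda>_. 1::nat) (pcs crs) + 4 * card ?N \<or>
  card (pcs crs) + 1 \<le> card ?N" using ne finV fin by (intro euler_weighted[OF \<mu> fin _ _ sub g]) simp_all
 thus ?thesis using cN assms unfolding sum_constant pcs_crs(1) by (elim disjE) simp_all
qed

lemma edge_bound:
 assumes "3 \<le> card V" shows "card E + 8 \<le> 4 * card V"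
 using planar_bound[OF assms] cross_bound[OF assms] unfolding card_E by linarith

end

text \<open>A definition cannot quantify over the type of labels. Since only finitely many labels
  matter, natural numbers can represent all of them.\<close>

definition op1 :: "'a set => 'a set set => bool" where
 "op1 V E \<longleftrightarrow> (\<exists>m (l :: 'a set \<times> 'a => nat) r. oneplane V E m l r)"

lemma op1_sub:
 assumes "op1 V E" "E' \<subseteq> E" "finite V'" "\<And>e. e \<in> E' ==> e \<subseteq> V'" shows "op1 V' E'"
proof -
 obtain m l r where "oneplane V E m (l :: 'a set \<times> 'a => nat) r" using assms(1) unfolding op1_def by (elim exE)
 then interpret oneplane V E m l r .
 show ?thesis by (metis oneplane_sub assms(2-4) op1_def)
qed

definition ind :: "'a set set => 'a set => 'a set set" where
 "ind E W = {e \<in> E. e \<subseteq> W}"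

lemma op1_graph:
 assumes "op1 V E" shows "finite V" "finite E" "e \<in> E ==> e \<subseteq> V" "e \<in> E ==> card e = 2"
proof -
 obtain m l r where "oneplane V E m (l :: 'a set \<times> 'a => nat) r" using assms unfolding op1_def by (elim exE)
 then interpret oneplane V E m l r .
 show "finite V" "finite E" "e \<in> E ==> e \<subseteq> V" "e \<in> E ==> card e = 2" using finV finE edge by simp_all
qed

lemma op1_ind:
 assumes "op1 V E" "W \<subseteq> V" shows "op1 W (ind E W)"
 using finite_subset[OF assms(2) op1_graph(1)[OF assms(1)]] by (intro op1_sub[OF assms(1)]) (auto simp: ind_def)

lemma op1_nice_or_disconnected:
 assumes "op1 V E" shows "(\<exists>m (l :: 'a set \<times> 'a => nat) r. nice V E m l r) \<or>
  (\<exists>e\<in>E. \<exists>f\<in>E. e ~= f \<and> (\<exists>V1 \<subseteq> V. V1 ~= {} \<and> V1 ~= V \<and> (\<forall>g\<in>E - {e, f}. g \<subseteq> V1 \<or> g \<inter> V1 = {})))" by (metis assms normalise op1_def)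

lemma card_edges_le_choose:
 assumes "finite V" "\<And>e. e \<in> E ==> e \<subseteq> V \<and> card e = 2" shows "card E \<le> card V choose 2"
proof -
 have "E \<subseteq> {e. e \<subseteq> V \<and> card e = 2}" using assms(2) by auto
 hence "card E \<le> card {e. e \<subseteq> V \<and> card e = 2}" using assms(1) by (intro card_mono) simp_all
 thus ?thesis using n_subsets[OF assms(1)] by simp
qed

text \<open>Without a normal form the graph consists of two parts joined by at most two edges. The
  worst case is a single vertex attached to the rest: 4(n - 1) - 8 + 2 = 4n - 10. Any larger number
  of edges therefore forces a normal form.\<close>

lemma op1_edge_bound_aux:
 assumes "op1 V E" "4 \<le> card V" shows "card E + 8 \<le> 4 * card V \<and>
  ((\<exists>m (l :: 'a set \<times> 'a => nat) r. nice V E m l r) \<or> card E + 10 \<le> 4 * card V)" using assms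
proof (induction "card V" arbitrary: V E rule: less_induct)
 case less
 note G = op1_graph[OF less.prems(1)]
 from op1_nice_or_disconnected[OF less.prems(1)] show ?case
 proof (elim disjE)
  assume "\<exists>m (l :: 'a set \<times> 'a => nat) r. nice V E m l r"
  then obtain m r and l :: "'a set \<times> 'a => nat" where n: "nice V E m l r" by (elim exE)
  show ?thesis using nice.edge_bound n less.prems(2) by fastforce
 next
  assume "\<exists>e\<in>E. \<exists>f\<in>E. e ~= f \<and> (\<exists>V1 \<subseteq> V. V1 ~= {} \<and> V1 ~= V \<and> (\<forall>g\<in>E - {e, f}. g \<subseteq> V1 \<or> g \<inter> V1 = {}))"
  then obtain e f V1 where V1: "V1 \<subseteq> V" "V1 ~= {}" "V1 ~= V" "\<forall>g\<in>E - {e, f}. g \<subseteq> V1 \<or> g \<inter> V1 = {}" by (elim bexE exE conjE)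
  let ?V2 = "V - V1"
  \<comment> \<open>The bound 4n - 8 is too small for one and two vertices, so such parts are
    counted separately; with three vertices it holds because there are only three pairs.\<close>
  have bnd: "(card W = 1 --> card (ind E W) = 0) \<and> (card W = 2 --> card (ind E W) \<le> 1) \<and>
   (3 \<le> card W --> card (ind E W) + 8 \<le> 4 * card W)" if W: "W \<subseteq> V" "card W < card V" for W
  proof -
   have op: "op1 W (ind E W)" by (rule op1_ind[OF less.prems(1) W(1)])
   have c: "card (ind E W) \<le> card W choose 2" using op1_graph[OF op] by (intro card_edges_le_choose) simp_all
   have c4: "card (ind E W) + 8 \<le> 4 * card W" if "4 \<le> card W" using less.hyps[OF W(2) op that] by simp
   have "card W = 3 \<or> 4 \<le> card W" if "3 \<le> card W" using that by linarith
   thus ?thesis using c c4 by (auto simp: choose_two)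
  qed
  have fin: "finite V1" "finite ?V2" using finite_subset[OF V1(1) G(1)] G(1) by simp_all
  have cV: "card V = card V1 + card ?V2" using card_Diff_subset[OF fin(1) V1(1)] card_mono[OF G(1) V1(1)] by simp
  have pos: "card V1 > 0" "card ?V2 > 0" using fin V1 by (auto simp: card_gt_0_iff)
  have "E \<subseteq> ind E V1 \<union> ind E ?V2 \<union> {e, f}" using V1(4) G(3) unfolding ind_def by blast
  hence "card E \<le> card (ind E V1 \<union> ind E ?V2 \<union> {e, f})" using G(2) by (intro card_mono) (simp_all add: ind_def)
  also have "\<dots> \<le> card (ind E V1 \<union> ind E ?V2) + card {e, f}" by (rule card_Un_le)
  also have "card (ind E V1 \<union> ind E ?V2) \<le> card (ind E V1) + card (ind E ?V2)" by (rule card_Un_le)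
  also have "card {e, f} \<le> 2" by (simp add: card_insert_if)
  finally have "card E \<le> card (ind E V1) + card (ind E ?V2) + 2" by simp
  moreover have "card V1 = 1 \<or> card V1 = 2 \<or> 3 \<le> card V1" "card ?V2 = 1 \<or> card ?V2 = 2 \<or> 3 \<le> card ?V2" using pos by linarith+
  moreover have "card V1 < card V" "card ?V2 < card V" using cV pos by linarith+
  ultimately have "card E + 10 \<le> 4 * card V" using bnd[OF V1(1)] bnd[of ?V2] cV less.prems(2) by auto
  thus ?thesis by (intro conjI disjI2) linarith+
 qed
qed

lemma op1_edge_bound:
 assumes "op1 V E" "3 \<le> card V" shows "card E + 8 \<le> 4 * card V"
proof (cases "4 \<le> card V")
 case True
 thus ?thesis using op1_edge_bound_aux[OF assms(1)] by simp
next
 case False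
 hence 3: "card V = 3" using assms(2) by simp
 have "card E \<le> card V choose 2" using op1_graph[OF assms(1)] by (intro card_edges_le_choose) simp_all
 thus ?thesis using 3 by (simp add: choose_two)
qed

lemma op1_nice:
 assumes "op1 V E" "4 \<le> card V" "4 * card V < card E + 10"
 obtains m r and l :: "'a set \<times> 'a => nat" where "nice V E m l r" using op1_edge_bound_aux assms(1,2) assms(3) by fastforce

lemma sum_faces_in:
 fixes w :: "'e => nat" assumes "finite A" shows "(\<Sum>f\<in>faces A l r \<inter> S. \<Sum>a\<in>ecut A l r {f}. w a) =
  (\<Sum>a\<in>{a\<in>A. l a ~= r a}. w a * (of_bool (l a \<in> S) + of_bool (r a \<in> S)))"
proof -
 let ?F = "faces A l r \<inter> S"
 have fin: "finite ?F" using finite_faces[OF assms, of l r] by simp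
 have "(\<Sum>f\<in>?F. \<Sum>a\<in>ecut A l r {f}. w a) = (\<Sum>f\<in>?F. \<Sum>a\<in>A. if a \<in> ecut A l r {f} then w a else 0)"
 proof (rule sum.cong[OF refl])
  fix f
  show "(\<Sum>a\<in>ecut A l r {f}. w a) = (\<Sum>a\<in>A. if a \<in> ecut A l r {f} then w a else 0)" using sum.inter_filter assms by (fastforce simp: ecut_def)
 qed
 also have "\<dots> = (\<Sum>a\<in>A. \<Sum>f\<in>?F. if a \<in> ecut A l r {f} then w a else 0)" by (rule sum.swap)
 also have "\<dots> = (\<Sum>a\<in>A. if l a ~= r a then w a * (of_bool (l a \<in> S) + of_bool (r a \<in> S)) else 0)"
 proof (rule sum.cong[OF refl])
  fix a assume a: "a \<in> A"
  have "(\<Sum>f\<in>?F. if a \<in> ecut A l r {f} then w a else 0) = (\<Sum>f\<in>?F \<inter> {f. a \<in> ecut A l r {f}}. w a)" by (simp only: sum.inter_restrict[OF fin] mem_Collect_eq)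
  also have "?F \<inter> {f. a \<in> ecut A l r {f}} = (if l a ~= r a then {l a, r a} \<inter> S else {})" using a by (auto simp: ecut_def faces_def)
  finally show "(\<Sum>f\<in>?F. if a \<in> ecut A l r {f} then w a else 0) =
    (if l a ~= r a then w a * (of_bool (l a \<in> S) + of_bool (r a \<in> S)) else 0)" by (cases "l a \<in> S"; cases "r a \<in> S") (simp_all split: if_splits)
 qed
 also have "\<dots> = (\<Sum>a\<in>{a\<in>A. l a ~= r a}. w a * (of_bool (l a \<in> S) + of_bool (r a \<in> S)))" using assms by (rule sum.inter_filter[symmetric])
 finally show ?thesis .
qed

section \<open>Nearly optimal 1-plane graphs\<close>

lemma (in xgraph) card_pcs_sub: "D \<subseteq> E ==> card (pcs D) = 2 * card D"
 unfolding pcs_Sigma using finite_subset[OF _ finE] edge fin_edge by (subst card_SigmaI) (auto simp: subset_iff)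

lemma (in xgraph) even_card_closed:
 assumes "D \<subseteq> crs" "\<And>e. e \<in> D ==> m e \<in> D" shows "even (card D)"
proof -
 have DE: "D \<subseteq> E" using assms(1) unfolding crs_def by (rule order_trans) (rule Collect_subset)
 interpret D: xgraph V D m by unfold_locales (use finV edge mm assms(2) subsetD[OF DE] in simp_all)
 have "D.crs = D" unfolding D.crs_def using assms(1) unfolding crs_def by (intro equalityI subsetI) (simp_all add: subset_iff)
 thus ?thesis using D.card_crs by simp
qed

lemma (in xgraph) pcyc_pcs:
 assumes "C \<subseteq> unc" "\<And>u. even (card {e \<in> C. u \<in> e})" shows "pcyc m (pcs C)"
proof -
 have CE: "C \<subseteq> E" using assms(1) unfolding unc_def by (rule order_trans) (rule Collect_subset)
 have sub: "pcs C \<subseteq> pcs E" by (rule pcs_mono[OF CE])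
 show ?thesis unfolding pcyc_iff[OF sub]
 proof (intro conjI allI ballI)
  fix u
  have "{p \<in> pcs C. snd p = u} = (\<lambda>e. (e, u)) ` {e \<in> C. u \<in> e}" by (auto simp: pcs_def)
  thus "even (card {p \<in> pcs C. snd p = u})" using assms(2) by (simp add: card_image inj_on_def)
 next
  fix e assume e: "e \<in> E"
  show "even (card {p \<in> pcs C. fst p \<in> {e, m e}})"
  proof (cases "e \<in> C")
   case True
   hence me: "m e = e" using assms(1) by (auto simp: unc_def)
   obtain a b where ab: "a ~= b" "e = {a, b}" using edge_ex[OF e] by (elim exE conjE)
   show ?thesis unfolding me using even_pieces[OF sub ab(2,1)] True ab(2) by simp
  next
   case False
   have "m e \<notin> C"
   proof
    assume me: "m e \<in> C"
    thus False using assms(1) mm e False by (auto simp: unc_def)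
   qed
   hence "{p \<in> pcs C. fst p \<in> {e, m e}} = {}" using False by (intro equals0I) (simp add: pcs_def, metis)
   thus ?thesis by (simp only: card.empty even_zero)
  qed
 qed
qed

section \<open>Faces of nearly optimal graphs and the bipartite colouring\<close>

context nice
begin

definition FF :: "'f set" where "FF = faces (pcs E) l r"
definition bd :: "'f => ('a set \<times> 'a) set" where "bd f = ecut (pcs E) l r {f}"
definition ws :: "'f => nat" where "ws f = sum wt (bd f)"
definition xp :: "('a set \<times> 'a) set => ('a set \<times> 'a) set" where "xp C = {p \<in> C. m (fst p) ~= fst p}"
definition ue :: "('a set \<times> 'a) set => 'a set set" where "ue C = {e \<in> unc. \<exists>u. (e, u) \<in> C}"

lemma finFF: "finite FF"
 unfolding FF_def by (rule finite_faces[OF finP])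

lemma bd_sub: "bd f \<subseteq> pcs E" and bd_cyc: "pcyc m (bd f)"
 unfolding bd_def by (rule cut_subset, rule dualpairD[OF dual])

lemma bd_ne: "f \<in> FF ==> bd f ~= {}" by (simp add: FF_def faces_def bd_def)

lemma ws_ge: "f \<in> FF ==> 6 \<le> ws f"
 unfolding ws_def by (rule girth6[OF nonadj bd_sub bd_cyc bd_ne])

lemma unc_side:
 assumes "e \<in> E" "m e = e" "u \<in> e" "w \<in> e" shows "side (e, u) S \<longleftrightarrow> side (e, w) S"
proof -
 have imp: "side (e, u) S --> side (e, w) S" if "u \<in> e" "w \<in> e" for u w
 proof
  assume "side (e, u) S"
  hence "(e, u) \<in> ecut (pcs E) l r S" using assms(1) that by (simp add: ecut_def)
  hence "(e, w) \<in> ecut (pcs E) l r S" by (rule pcyc_unc[OF cut_subset dualpairD[OF dual] _ assms(2) that(2)])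
  thus "side (e, w) S" by (simp add: ecut_def)
 qed
 show ?thesis using imp[OF assms(3,4)] imp[OF assms(4,3)] by argo
qed

lemma ue_pcs:
 assumes "C \<subseteq> pcs E" "pcyc m C" shows "C = pcs (ue C) \<union> xp C" "ue C \<subseteq> unc" "pcs (ue C) \<inter> xp C = {}"
proof -
 show "ue C \<subseteq> unc" by (auto simp: ue_def)
 show "pcs (ue C) \<inter> xp C = {}" by (auto simp: ue_def xp_def unc_def)
 have "pcs (ue C) \<subseteq> C" using pcyc_unc assms by (auto simp: ue_def unc_def)
 moreover have "p \<in> pcs (ue C)" if "p \<in> C" "p \<notin> xp C" for p
 proof -
  obtain e u where p: "p = (e, u)" by (cases p)
  have "(e, u) \<in> pcs E" using that(1) assms(1) p by blast
  thus ?thesis using that p by (auto simp: ue_def xp_def unc_def)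
 qed
 ultimately show "C = pcs (ue C) \<union> xp C" unfolding xp_def by blast
qed

lemma sum_wt_ue_xp:
 assumes "C \<subseteq> pcs E" "pcyc m C" shows "sum wt C = 2 * card (ue C) + 2 * card (xp C)"
proof -
 note U = ue_pcs[OF assms]
 have ucE: "ue C \<subseteq> E" using U(2) unfolding unc_def by (rule order_trans) (rule Collect_subset)
 have fin: "finite (pcs (ue C))" "finite (xp C)" using finC[OF assms(1)] finC[OF pcs_mono[OF ucE]] by (simp_all add: xp_def)
 have "sum wt C = sum wt (pcs (ue C) \<union> xp C)" using U(1) by simp
 also have "\<dots> = sum wt (pcs (ue C)) + sum wt (xp C)" by (rule sum.union_disjoint[OF fin U(3)])
 also have "sum wt (pcs (ue C)) = sum (\<lambda>_. 1) (pcs (ue C))" using U(2) by (intro sum.cong) (auto simp: wt_def pcs_def unc_def)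
 also have "sum wt (xp C) = sum (\<lambda>_. 2) (xp C)" by (rule sum.cong) (simp_all add: wt_def xp_def)
 finally show ?thesis using card_pcs_sub[OF ucE] by simp
qed

lemma even_xp:
 assumes "C \<subseteq> pcs E" "pcyc m C" shows "even (card (xp C))"
proof -
 let ?g = "\<lambda>p :: 'a set \<times> 'a. {fst p, m (fst p)}"
 have fin: "finite (xp C)" using finC[OF assms(1)] by (simp add: xp_def)
 have "card (xp C) = (\<Sum>Y\<in>?g ` xp C. card {p \<in> xp C. ?g p = Y})" using sum.group[OF fin, of "?g ` xp C" ?g "\<lambda>_. 1::nat"] fin by simp
 moreover have "even (card {p \<in> xp C. ?g p = Y})" if Y: "Y \<in> ?g ` xp C" for Y
 proof -
  obtain p where p: "p \<in> xp C" "Y = ?g p" using Y by blast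
  have "card Y = 2" using p unfolding xp_def by (simp add: eq_commute)
  have "{p \<in> xp C. ?g p = Y} = {p \<in> C. ?g p = Y}"
  proof (rule Collect_cong)
   fix s
   have "m (fst s) ~= fst s" if "?g s = Y"
   proof
    assume "m (fst s) = fst s"
    hence "Y = {fst s}" using that by simp
    thus False using \<open>card Y = 2\<close> by simp
   qed
   thus "s \<in> xp C \<and> ?g s = Y \<longleftrightarrow> s \<in> C \<and> ?g s = Y" by (simp add: xp_def) blast
  qed
  thus ?thesis using assms(2) unfolding pcyc_iff0 by (simp only:)
 qed
 ultimately show ?thesis by (metis (no_types, lifting) dvd_sum)
qed

lemma ws_eq: "ws f = 2 * card (ue (bd f)) + 2 * card (xp (bd f))"
 unfolding ws_def by (rule sum_wt_ue_xp[OF bd_sub bd_cyc])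

text \<open>Euler's lower bound for the number of faces and the least weight 6 leave a slack of
  \<open>2 * x\<close> in the total face weight. An element with equal sides would waste weight 4,
  since its edge or half weighs 2 and is seen from two sides; this is too much for
  \<open>x \<le> 1\<close>.\<close>

lemma tight:
 assumes "4 \<le> card V" "card unc + q + 6 + x = 3 * card V" "x \<le> 1" shows "\<forall>p\<in>pcs E. l p ~= r p" "card FF + card V = card unc + 3 * q + 2"
  "(\<Sum>f\<in>FF. ws f) = 6 * card FF + 2 * x"
proof -
 let ?N = "Inl ` V \<union> ptgt m ` pcs E :: ('a + 'a set set) set"
 have ne: "?N ~= {}" using assms(1) by auto
 have "FF ~= {}"
 proof
  assume "FF = {}"
  hence "card (pcs E) + 1 \<le> card ?N" unfolding FF_def by (intro dualpair_euler_forest[OF dual finP nodes(1) ne nodes(2)])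
  thus False using assms unfolding nodes(3) card_pcs card_E by simp
 qed
 hence "card (pcs E) + 2 \<le> card FF + card ?N" unfolding FF_def by (intro dualpair_euler[OF dual finP nodes(1) ne nodes(2)])
 hence F1: "card unc + 3 * q + 2 \<le> card FF + card V" unfolding nodes(3) card_pcs card_E by simp
 have F2: "6 * card FF \<le> (\<Sum>f\<in>FF. ws f)" using sum_bounded_below[of FF 6 ws] ws_ge by simp
 let ?L = "{p \<in> pcs E. l p ~= r p}"
 have F3: "(\<Sum>f\<in>FF. ws f) = 2 * sum wt ?L" unfolding FF_def ws_def bd_def by (rule sum_faces[OF finP])
 show nl: "\<forall>p\<in>pcs E. l p ~= r p"
 proof (rule ccontr)
  assume "\<not> ?thesis"
  then obtain e u where eu: "(e, u) \<in> pcs E" "l (e, u) = r (e, u)" by auto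
  hence eE: "e \<in> E" "u \<in> e" by simp_all
  obtain w where w: "w ~= u" "e = {u, w}" using edge2[OF eE] by auto
  define D where "D = (if m e = e then {(e, u), (e, w)} else {(e, u)})"
  have D: "D \<subseteq> pcs E - ?L" "sum wt D = 2"
  proof -
   have "l (e, w) = r (e, w)" if me: "m e = e" using unc_side[OF eE(1) me eE(2), of w "{l (e, w)}"] w eu(2) by simp
   thus "D \<subseteq> pcs E - ?L" using eu eE w by (simp add: D_def)
   show "sum wt D = 2" using w(1) by (simp add: D_def wt_def)
  qed
  have "sum wt D \<le> sum wt (pcs E - ?L)" using finP D(1) by (intro sum_mono2) simp_all
  moreover have "sum wt (pcs E) = sum wt ?L + sum wt (pcs E - ?L)" using finP by (subst sum.subset_diff[of ?L]) auto
  ultimately show False using D(2) sum_wt F1 F2 F3 assms by simp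
 qed
 hence "?L = pcs E" by auto
 hence F4: "(\<Sum>f\<in>FF. ws f) = 4 * card unc + 16 * q" using F3 sum_wt by simp
 show F5: "card FF + card V = card unc + 3 * q + 2" using F1 F2 F4 assms by linarith
 show "(\<Sum>f\<in>FF. ws f) = 6 * card FF + 2 * x" using F4 F5 assms by linarith
qed

lemma sum_xp:
 "(\<Sum>f\<in>FF \<inter> S. card (xp (bd f))) =
  (\<Sum>p\<in>{p\<in>pcs E. l p ~= r p}. (if m (fst p) ~= fst p then 1 else 0) * (of_bool (l p \<in> S) + of_bool (r p \<in> S)))"
proof -
 have "card (xp (bd f)) = (\<Sum>p\<in>bd f. if m (fst p) ~= fst p then 1 else 0)" for f
  unfolding xp_def using finC[OF bd_sub[of f]] by (simp add: sum.inter_filter[symmetric])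
 thus ?thesis unfolding FF_def bd_def using sum_faces_in[OF finP, where l = l and r = r and S = S and w = "\<lambda>p. if m (fst p) ~= fst p then 1 else 0"] by simp
qed

lemma sum_ue:
 "(\<Sum>f\<in>FF \<inter> S. 2 * card (ue (bd f))) =
  (\<Sum>p\<in>{p\<in>pcs E. l p ~= r p}. (if m (fst p) = fst p then 1 else 0) * (of_bool (l p \<in> S) + of_bool (r p \<in> S)))"
proof -
 have "2 * card (ue (bd f)) = (\<Sum>p\<in>bd f. if m (fst p) = fst p then 1 else 0)" for f
 proof -
  note U = ue_pcs[OF bd_sub[of f] bd_cyc[of f]]
  have ucE: "ue (bd f) \<subseteq> E" using U(2) unfolding unc_def by (rule order_trans) (rule Collect_subset)
  have "(\<Sum>p\<in>bd f. if m (fst p) = fst p then 1 else 0) = card {p \<in> bd f. m (fst p) = fst p}" using finC[OF bd_sub[of f]] by (simp add: sum.inter_filter[symmetric])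
  also have "{p \<in> bd f. m (fst p) = fst p} = pcs (ue (bd f))" using U(1,3) by (auto simp: xp_def)
  finally show ?thesis using card_pcs_sub[OF ucE] by simp
 qed
 thus ?thesis unfolding FF_def bd_def using sum_faces_in[OF finP, where l = l and r = r and S = S and w = "\<lambda>p. if m (fst p) = fst p then 1 else 0"] by simp
qed

text \<open>Consecutive faces around the crossing are separated by a crossed piece, and no crossed
  piece leads out of \<open>S\<close>.\<close>

lemma crossing_sides:
 assumes "e \<in> E" "m e ~= e" and sat: "\<And>p. p \<in> pcs E ==> m (fst p) ~= fst p ==> l p \<in> S \<longleftrightarrow> r p \<in> S" shows "\<exists>b. \<forall>p\<in>pcs E. fst p \<in> {e, m e} --> (l p \<in> S \<longleftrightarrow> b)"
proof -
 obtain a b c d f1 f2 f3 f4 where s: "a ~= b" "c ~= d" "e = {a, b}" "m e = {c, d}"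
  "{l (e, a), r (e, a)} = {f4, f1}" "{l (m e, c), r (m e, c)} = {f1, f2}"
  "{l (e, b), r (e, b)} = {f2, f3}" "{l (m e, d), r (m e, d)} = {f3, f4}" using star[OF assms(1,2)] unfolding starred_def by (elim exE conjE)
 have P: "(e, a) \<in> pcs E" "(e, b) \<in> pcs E" "(m e, c) \<in> pcs E" "(m e, d) \<in> pcs E" using assms(1) mE[OF assms(1)] s(3,4) by simp_all
 have mm': "m (m e) ~= m e" using mm[OF assms(1)] assms(2) by simp
 have st: "l p \<in> S \<longleftrightarrow> f \<in> S" "l p \<in> S \<longleftrightarrow> g \<in> S"
  if "p \<in> pcs E" "m (fst p) ~= fst p" "{l p, r p} = {f, g}" for p f g using sat[OF that(1,2)] that(3) unfolding doubleton_eq_iff by metis+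
 have a: "l (e, a) \<in> S \<longleftrightarrow> f1 \<in> S" using st(2)[OF P(1) _ s(5)] assms(2) by simp
 have c: "l (m e, c) \<in> S \<longleftrightarrow> f1 \<in> S" "l (m e, c) \<in> S \<longleftrightarrow> f2 \<in> S" using st[OF P(3) _ s(6)] mm' by simp_all
 have b: "l (e, b) \<in> S \<longleftrightarrow> f2 \<in> S" "l (e, b) \<in> S \<longleftrightarrow> f3 \<in> S" using st[OF P(2) _ s(7)] assms(2) by simp_all
 have d: "l (m e, d) \<in> S \<longleftrightarrow> f3 \<in> S" using st(1)[OF P(4) _ s(8)] mm' by simp
 have "l p \<in> S \<longleftrightarrow> f1 \<in> S" if "p \<in> pcs E" "fst p \<in> {e, m e}" for p
 proof -
  have "snd p \<in> fst p" using that(1) by (simp add: pcs_def)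
  hence "p = (e, a) \<or> p = (e, b) \<or> p = (m e, c) \<or> p = (m e, d)" using that(2) s(3,4) by (cases p) auto
  thus ?thesis using a b c d by (elim disjE) simp_all
 qed
 thus ?thesis by (intro exI[of _ "f1 \<in> S"]) simp
qed

text \<open>The surroundings of a crossing lie in \<open>S\<close> entirely or not at all. In the
  first case its four pieces are counted from both sides, which makes 8.\<close>

lemma saturated_xp:
 assumes nl: "\<forall>p\<in>pcs E. l p ~= r p"
  and sat: "\<And>p. p \<in> pcs E ==> m (fst p) ~= fst p ==> l p \<in> S \<longleftrightarrow> r p \<in> S"
 shows "\<exists>k. (\<Sum>f\<in>FF \<inter> S. card (xp (bd f))) = 8 * k"
proof -
 define D where "D = {e \<in> crs. \<exists>u\<in>e. l (e, u) \<in> S}"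
 have Dp: "p \<in> pcs D \<longleftrightarrow> p \<in> pcs crs \<and> l p \<in> S" for p
 proof
  assume p: "p \<in> pcs D"
  hence eD: "fst p \<in> D" "snd p \<in> fst p" by (simp_all add: pcs_def)
  hence e: "fst p \<in> E" "m (fst p) ~= fst p" by (simp_all add: D_def crs_def)
  obtain u where u: "u \<in> fst p" "l (fst p, u) \<in> S" using eD(1) by (auto simp: D_def)
  obtain b where b: "\<forall>x\<in>pcs E. fst x \<in> {fst p, m (fst p)} --> (l x \<in> S \<longleftrightarrow> b)" by (metis crossing_sides e sat)
  have "(fst p, u) \<in> pcs E" "p \<in> pcs E" using e(1) u(1) eD(2) by (simp_all add: pcs_def)
  hence "l p \<in> S" using bspec[OF b, of "(fst p, u)"] bspec[OF b, of p] u(2) by simp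
  thus "p \<in> pcs crs \<and> l p \<in> S" using e eD(2) by (simp add: pcs_def crs_def)
 next
  assume "p \<in> pcs crs \<and> l p \<in> S"
  thus "p \<in> pcs D" by (cases p) (auto simp: D_def)
 qed
 have Dcrs: "D \<subseteq> crs" by (auto simp: D_def)
 hence DE: "D \<subseteq> E" by (auto simp: crs_def)
 have Dm: "m e \<in> D" if eD: "e \<in> D" for e
 proof -
  have e: "e \<in> E" "m e ~= e" using eD by (simp_all add: D_def crs_def)
  obtain u where u: "u \<in> e" "l (e, u) \<in> S" using eD by (auto simp: D_def)
  obtain b where b: "\<forall>x\<in>pcs E. fst x \<in> {e, m e} --> (l x \<in> S \<longleftrightarrow> b)" by (metis crossing_sides e sat)
  obtain w w' where w: "m e = {w, w'}" using edge_ex[OF mE[OF e(1)]] by (elim exE conjE)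
  have "l (m e, w) \<in> S" using mE e(1) w u(1) b u(2) by fastforce
  moreover have "m e \<in> crs" using e mE[OF e(1)] mm[OF e(1)] by (simp add: crs_def)
  moreover have "w \<in> m e" using w by simp
  ultimately show ?thesis unfolding D_def by blast
 qed
 obtain k where k: "card D = 2 * k" by (metis even_card_closed Dcrs Dm evenE)
 have "{p \<in> pcs E. l p ~= r p} = pcs E" using nl by auto
 hence "(\<Sum>f\<in>FF \<inter> S. card (xp (bd f))) =
  (\<Sum>p\<in>pcs E. (if m (fst p) ~= fst p then 1 else 0) * (of_bool (l p \<in> S) + of_bool (r p \<in> S)))" using sum_xp by simp
 also have "\<dots> = (\<Sum>p\<in>pcs E. if p \<in> pcs D then 2 else 0)"
 proof (rule sum.cong[OF refl])
  fix p assume p: "p \<in> pcs E"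
  have c: "p \<in> pcs crs \<longleftrightarrow> m (fst p) ~= fst p" using p by (simp add: pcs_def crs_def)
  show "(if m (fst p) ~= fst p then 1 else 0) * (of_bool (l p \<in> S) + of_bool (r p \<in> S)) =
   (if p \<in> pcs D then 2 else 0 :: nat)" using sat[OF p] unfolding Dp c by (cases "m (fst p) = fst p"; cases "l p \<in> S") simp_all
 qed
 also have "\<dots> = (\<Sum>p\<in>pcs E \<inter> pcs D. 2)" by (simp only: sum.inter_restrict[OF finP])
 also have "pcs E \<inter> pcs D = pcs D" using pcs_mono[OF DE] by blast
 also have "(\<Sum>p\<in>pcs D. 2) = 8 * k" using card_pcs_sub[OF DE] k by simp
 finally show ?thesis by (rule exI)
qed

text \<open>An uncrossed edge on the boundary of \<open>S\<close> is counted once, one with both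
  sides in \<open>S\<close> twice.\<close>

lemma saturated_ue:
 assumes nl: "\<forall>p\<in>pcs E. l p ~= r p" and C: "C \<subseteq> unc" "ecut (pcs E) l r S = pcs C" shows "\<exists>k. (\<Sum>f\<in>FF \<inter> S. card (ue (bd f))) = card C + 2 * k"
proof -
 define D where "D = {e \<in> unc. \<forall>u\<in>e. l (e, u) \<in> S \<and> r (e, u) \<in> S}"
 have "C \<subseteq> E" "D \<subseteq> E" using C(1) by (auto simp: D_def unc_def)
 have st: "{l (e, u), r (e, u)} = {l (e, w), r (e, w)}" if "e \<in> unc" "u \<in> e" "w \<in> e" for e u w
 proof -
  have e: "e \<in> E" "m e = e" using that(1) by (simp_all add: unc_def)
  have "l (e, u) ~= r (e, u)" "l (e, w) ~= r (e, w)" using nl e(1) that by simp_all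
  thus ?thesis using unc_side[OF e that(2,3), of "{l (e, u)}"] unc_side[OF e that(2,3), of "{r (e, u)}"] unfolding doubleton_eq_iff by auto
 qed
 have Dp: "p \<in> pcs D \<longleftrightarrow> p \<in> pcs unc \<and> l p \<in> S \<and> r p \<in> S" for p
 proof
  assume "p \<in> pcs D" thus "p \<in> pcs unc \<and> l p \<in> S \<and> r p \<in> S" by (cases p) (auto simp: D_def)
 next
  assume p: "p \<in> pcs unc \<and> l p \<in> S \<and> r p \<in> S"
  obtain e u where eu: "p = (e, u)" by (cases p)
  have eu': "e \<in> unc" "u \<in> e" using p eu by simp_all
  have "{l (e, w), r (e, w)} \<subseteq> S" if "w \<in> e" for w unfolding st[OF eu' that, symmetric] using p eu by simp
  thus "p \<in> pcs D" using p eu by (auto simp: D_def)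
 qed
 have "{p \<in> pcs E. l p ~= r p} = pcs E" using nl by auto
 hence "(\<Sum>f\<in>FF \<inter> S. 2 * card (ue (bd f))) =
  (\<Sum>p\<in>pcs E. (if m (fst p) = fst p then 1 else 0) * (of_bool (l p \<in> S) + of_bool (r p \<in> S)))" using sum_ue by simp
 also have "\<dots> = (\<Sum>p\<in>pcs E. (if p \<in> pcs C then 1 else 0) + (if p \<in> pcs D then 2 else 0))"
 proof (rule sum.cong[OF refl])
  fix p assume p: "p \<in> pcs E"
  have c: "p \<in> pcs unc \<longleftrightarrow> m (fst p) = fst p" using p by (simp add: pcs_def unc_def)
  have d: "p \<in> pcs C \<longleftrightarrow> (l p \<in> S) ~= (r p \<in> S)" unfolding C(2)[symmetric] using p by (simp add: ecut_def)
  show "(if m (fst p) = fst p then 1 else 0) * (of_bool (l p \<in> S) + of_bool (r p \<in> S)) =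
   (if p \<in> pcs C then 1 else 0) + (if p \<in> pcs D then 2 else 0 :: nat)" using pcs_mono C(1) Dp c d by auto
 qed
 also have "\<dots> = (\<Sum>p\<in>pcs E \<inter> pcs C. 1) + (\<Sum>p\<in>pcs E \<inter> pcs D. 2)" by (simp only: sum.distrib sum.inter_restrict[OF finP])
 also have "pcs E \<inter> pcs C = pcs C" using pcs_mono[OF \<open>C \<subseteq> E\<close>] by blast
 also have "pcs E \<inter> pcs D = pcs D" using pcs_mono[OF \<open>D \<subseteq> E\<close>] by blast
 also have "(\<Sum>p\<in>pcs C. 1) + (\<Sum>p\<in>pcs D. 2) = 2 * card C + 2 * (2 * card D)" using card_pcs_sub[OF \<open>C \<subseteq> E\<close>] card_pcs_sub[OF \<open>D \<subseteq> E\<close>] by simp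
 finally have "2 * (\<Sum>f\<in>FF \<inter> S. card (ue (bd f))) = 2 * card C + 2 * (2 * card D)" by (simp add: sum_distrib_left)
 thus ?thesis by (intro exI[of _ "card D"]) simp
qed

text \<open>A cycle in \<open>B\<close> bounds a set \<open>S\<close> of faces. Modulo 2 its length
  is the number of uncrossed edges around these faces; the crossed pieces around them number a
  multiple of 8, and adding them turns the count into the sum of the half weights.\<close>

lemma uncrossed_colouring:
 assumes nl: "\<forall>p\<in>pcs E. l p ~= r p" and B: "B \<subseteq> unc"
  and par: "\<And>S. ecut (pcs E) l r S \<subseteq> pcs B ==> even (\<Sum>f\<in>FF \<inter> S. ws f div 2)"
 shows "\<exists>\<kappa> :: 'a => bool. \<forall>e\<in>B. \<forall>u\<in>e. \<forall>w\<in>e. u ~= w --> \<kappa> u ~= \<kappa> w"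
proof -
 define s where "s e = (SOME u. u \<in> e)" for e :: "'a set"
 define t where "t e = (SOME w. w \<in> e \<and> w ~= s e)" for e :: "'a set"
 have BE: "B \<subseteq> E" using B by (auto simp: unc_def)
 have st: "s e ~= t e" "e = {s e, t e}" if eB: "e \<in> B" for e
 proof -
  have eE: "e \<in> E" by (rule subsetD[OF BE eB])
  define x where "x = s e"
  define z where "z = t e"
  obtain u w where uw: "u ~= w" "e = {u, w}" using edge_ex[OF eE] by (elim exE conjE)
  have "u \<in> e" by (simp add: uw(2))
  hence xe: "x \<in> e" unfolding x_def s_def by (rule someI)
  obtain y where y: "y ~= x" "e = {x, y}" using edge2[OF eE xe] by (elim exE conjE)
  have "y \<in> e \<and> y ~= s e" unfolding x_def[symmetric] using y(1) by (simp add: y(2))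
  hence z: "z \<in> e \<and> z ~= s e" unfolding z_def t_def by (rule someI)
  hence "z = y" unfolding x_def[symmetric] by (simp add: y(2)) blast
  thus "s e ~= t e" "e = {s e, t e}" unfolding x_def[symmetric] z_def[symmetric] using y by simp_all
 qed
 have "\<exists>\<kappa> :: 'a => bool. \<forall>b\<in>B. \<kappa> (s b) ~= \<kappa> (t b)"
 proof (rule two_colourable)
  show "finite B" using BE finE by (rule finite_subset)
  fix C assume C: "C \<subseteq> B" "cyc s t C"
  have finC': "finite C" by (rule finite_subset[OF order_trans[OF C(1) BE] finE])
  have Cu: "C \<subseteq> unc" using C(1) B by (rule order_trans)
  have "even (card {e \<in> C. u \<in> e})" for u
  proof -
   have "u \<in> e \<longleftrightarrow> s e = u \<or> t e = u" if "e \<in> C" for e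
   proof -
    have "u \<in> {s e, t e} \<longleftrightarrow> s e = u \<or> t e = u" by auto
    thus ?thesis using st(2)[OF subsetD[OF C(1) that]] by simp
   qed
   hence "{e \<in> C. u \<in> e} = {e \<in> C. s e = u} \<union> {e \<in> C. t e = u}" by blast
   moreover have "{e \<in> C. s e = u} \<inter> {e \<in> C. t e = u} = {}" using st(1) C(1) by fastforce
   ultimately show ?thesis using finC' C(2) by (simp add: card_Un_disjoint cyc_def deg_def)
  qed
  hence cy: "pcyc m (pcs C)" by (rule pcyc_pcs[OF Cu])
  have CE: "pcs C \<subseteq> pcs E" using C(1) BE by (intro pcs_mono) (rule order_trans)
  obtain S where S: "pcs C = ecut (pcs E) l r S" using dualpairE[OF dual CE cy] .
  have ev: "even (\<Sum>f\<in>FF \<inter> S. ws f div 2)" by (metis S pcs_mono C(1) par)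
  have sat: "l p \<in> S \<longleftrightarrow> r p \<in> S" if "p \<in> pcs E" "m (fst p) ~= fst p" for p
  proof -
   have "p \<notin> pcs C" using that(2) subsetD[OF pcs_mono[OF Cu], of p] by (cases p) (auto simp: unc_def)
   thus ?thesis unfolding S using that(1) by (simp add: ecut_def)
  qed
  obtain k where k: "(\<Sum>f\<in>FF \<inter> S. card (xp (bd f))) = 8 * k" by (metis saturated_xp nl sat)
  obtain k' where k': "(\<Sum>f\<in>FF \<inter> S. card (ue (bd f))) = card C + 2 * k'" using saturated_ue[OF nl Cu S[symmetric]] by (elim exE)
  have "(\<Sum>f\<in>FF \<inter> S. ws f div 2) = (\<Sum>f\<in>FF \<inter> S. card (ue (bd f)) + card (xp (bd f)))" unfolding ws_eq by simp
  also have "\<dots> = card C + 2 * k' + 8 * k" unfolding sum.distrib k k' ..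
  finally show "even (card C)" using ev by simp
 qed
 then obtain \<kappa> :: "'a => bool" where \<kappa>: "\<forall>b\<in>B. \<kappa> (s b) ~= \<kappa> (t b)" by (elim exE)
 show ?thesis
 proof (rule exI[of _ \<kappa>], intro ballI impI)
  fix e u w assume e: "e \<in> B" "u \<in> e" "w \<in> e" "u ~= w"
  have "u = s e \<or> u = t e" "w = s e \<or> w = t e" using st(2)[OF e(1)] e(2,3) by auto
  thus "\<kappa> u ~= \<kappa> w" using bspec[OF \<kappa> e(1)] e(4) by auto
 qed
qed

end

lemma sum_tight_upper:
 fixes g :: "'b => nat" assumes "finite F" "\<And>f. f \<in> F ==> g f \<le> c" "c * card F \<le> (\<Sum>f\<in>F. g f)" "f \<in> F" shows "g f = c"
proof (rule ccontr)
 assume "g f ~= c"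
 hence "g f < c" using assms(2)[OF assms(4)] by simp
 hence "(\<Sum>f\<in>F. g f) < (\<Sum>f\<in>F. c)" using assms by (intro sum_strict_mono_ex1) auto
 thus False using assms(3) by (simp add: mult.commute)
qed

lemma sum_tight_lower:
 fixes g :: "'b => nat" assumes "finite F" "\<And>f. f \<in> F ==> c \<le> g f" "(\<Sum>f\<in>F. g f) \<le> c * card F" "f \<in> F" shows "g f = c"
proof (rule ccontr)
 assume "g f ~= c"
 hence "c < g f" using assms(2)[OF assms(4)] by simp
 hence "(\<Sum>f\<in>F. c) < (\<Sum>f\<in>F. g f)" using assms by (intro sum_strict_mono_ex1) auto
 thus False using assms(3) by (simp add: mult.commute)
qed

lemma sum_one_exception:
 fixes g :: "'b => nat" assumes "finite F" "\<And>f. f \<in> F ==> 6 \<le> g f" "\<And>f. f \<in> F ==> even (g f)"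
  "(\<Sum>f\<in>F. g f) = 6 * card F + 2"
 shows "\<exists>Y\<in>F. g Y = 8 \<and> (\<forall>f\<in>F. f ~= Y --> g f = 6)"
proof -
 have "\<exists>Y\<in>F. g Y ~= 6"
 proof (rule ccontr)
  assume "\<not> ?thesis"
  thus False using assms(4) by simp
 qed
 then obtain Y where Y: "Y \<in> F" "g Y ~= 6" by (elim bexE)
 have Y8: "8 \<le> g Y" using assms(2,3)[OF Y(1)] Y(2) by presburger
 have cF: "card F = card (F - {Y}) + 1" using assms(1) Y(1) by (metis Suc_eq_plus1 card.remove)
 have S: "(\<Sum>f\<in>F. g f) = g Y + (\<Sum>f\<in>F - {Y}. g f)" using assms(1) Y(1) by (rule sum.remove)
 have "(\<Sum>f\<in>F - {Y}. 6) \<le> (\<Sum>f\<in>F - {Y}. g f)" using assms(2) by (intro sum_mono) simp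
 hence L: "6 * card (F - {Y}) \<le> (\<Sum>f\<in>F - {Y}. g f)" by simp
 have "g Y = 8" "(\<Sum>f\<in>F - {Y}. g f) \<le> 6 * card (F - {Y})" using S L Y8 cF assms(4) by linarith+
 thus ?thesis using Y(1) assms(1,2) by (intro bexI[of _ Y] conjI ballI impI sum_tight_lower[of "F - {Y}" 6 g]) simp_all
qed

text \<open>Here \<open>a\<close> and \<open>w\<close> are the number of crossed pieces and the half
  weight of the one exceptional face, \<open>n\<close> is the number of kites besides it, and
  \<open>t\<close> is the total half weight.\<close>

lemma parity_arith:
 "a + 2 * n = 8 * k ==> t = w + 3 * n ==> (w = 3 \<and> a = 2) \<or> (w = 4 \<and> a = 4) ==> even (t :: nat)" by presburger

context nice
begin

lemma side_bd:
 assumes "p \<in> pcs E" "l p ~= r p" "{l p, r p} = {f, g}" shows "p \<in> bd f" "p \<in> bd g" "f ~= g" "f \<in> FF" "g \<in> FF"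
proof -
 have c: "l p = f \<and> r p = g \<or> l p = g \<and> r p = f" using assms(3) by (simp only: doubleton_eq_iff)
 show b: "p \<in> bd f" "p \<in> bd g" using assms(1,2) c by (auto simp: bd_def ecut_def)
 show "f ~= g" using assms(2) c by auto
 show "f \<in> FF" "g \<in> FF" using b by (auto simp: FF_def faces_def bd_def)
qed

lemma xp_le: "finite (xp (bd f))"
 using finC[OF bd_sub[of f]] by (simp add: xp_def)

lemma xs6:
 assumes "ws f = 6" shows "card (xp (bd f)) = 0 \<or> card (xp (bd f)) = 2"
proof -
 obtain k where k: "card (xp (bd f)) = 2 * k" using even_xp[OF bd_sub[of f] bd_cyc[of f]] by (elim evenE)
 hence "card (ue (bd f)) + 2 * k = 3" using ws_eq[of f] assms by simp
 thus ?thesis using k by auto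
qed

lemma even_ws: "even (ws f)"
 using ws_eq[of f] by simp

text \<open>Two crossed pieces leave room for a single uncrossed edge in weight 6. Since the
  boundary must go on at both outer ends, this edge contains both of them.\<close>

lemma kite:
 assumes e: "e \<in> E" "m e ~= e" and f: "(e, a) \<in> bd f" "(m e, c) \<in> bd f" "ws f = 6" shows "{a, c} \<in> unc" "a ~= c" "ue (bd f) = {{a, c}}"
proof -
 note U = ue_pcs[OF bd_sub[of f] bd_cyc[of f]]
 have meE: "m e \<in> E" "m (m e) ~= m e" using e mE mm not_sym[OF e(2)] by simp_all
 have ac: "a \<in> e" "c \<in> m e" using subsetD[OF bd_sub f(1)] subsetD[OF bd_sub f(2)] by simp_all
 thus "a ~= c" using nonadj[OF e] by blast
 have sub: "{(e, a), (m e, c)} \<subseteq> xp (bd f)" using f e meE by (simp add: xp_def)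
 hence c2: "card (xp (bd f)) = 2" using xp_le xs6 f(3) by fastforce
 hence xp: "xp (bd f) = {(e, a), (m e, c)}" using card_subset_eq[OF xp_le sub] not_sym[OF e(2)] by simp
 obtain g where g: "ue (bd f) = {g}" using ws_eq c2 f(3) by (auto simp: card_1_singleton_iff)
 have gu: "g \<in> unc" using U(2) g by simp
 have other: "u \<in> g" if "(e', u) \<in> xp (bd f)" "\<And>e''. (e'', u) \<in> xp (bd f) ==> e'' = e'" for e' u
 proof -
  have "(e', u) \<in> bd f" using that(1) by (simp add: xp_def)
  then obtain h where h: "h ~= e'" "(h, u) \<in> bd f" by (metis pcyc_V bd_sub bd_cyc)
  hence "(h, u) \<notin> xp (bd f)" using that(2) by blast
  hence "(h, u) \<in> pcs (ue (bd f))" using h(2) U(1) by blast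
  thus ?thesis unfolding g by auto
 qed
 have "a \<in> g" using \<open>a ~= c\<close> by (intro other[of e a]) (simp_all add: xp)
 moreover have "c \<in> g" using \<open>a ~= c\<close> by (intro other[of "m e" c]) (simp_all add: xp)
 ultimately have "{a, c} = g" using edge2[of g a] gu \<open>a ~= c\<close> by (auto simp: unc_def)
 thus "{a, c} \<in> unc" "ue (bd f) = {{a, c}}" using gu g by simp_all
qed

text \<open>The four pieces weigh 8. If they were the whole boundary, it could not continue at
  \<open>a\<close>, because crossing edges share no end.\<close>

lemma corner4:
 assumes e: "e \<in> E" "m e ~= e" "e = {a, b}" "m e = {c, d}" "a ~= b" "c ~= d"
  and f: "(e, a) \<in> bd f" "(e, b) \<in> bd f" "(m e, c) \<in> bd f" "(m e, d) \<in> bd f"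
 shows "8 < ws f"
proof (rule ccontr)
 assume ws: "\<not> 8 < ws f"
 note U = ue_pcs[OF bd_sub[of f] bd_cyc[of f]]
 let ?D = "{(e, a), (e, b), (m e, c), (m e, d)}"
 have sub: "?D \<subseteq> xp (bd f)" using mm e(1) e(2) f by (simp add: xp_def)
 have c4: "card ?D = 4" using e(2,5,6) not_sym[OF e(2)] by simp
 have "4 \<le> card (xp (bd f))" using card_mono[OF xp_le sub] c4 by simp
 hence "card (xp (bd f)) = 4" "card (ue (bd f)) = 0" using ws_eq[of f] ws by linarith+
 hence xp: "xp (bd f) = ?D" using card_subset_eq[OF xp_le sub] c4 by simp
 have "finite (ue (bd f))" using U(2) fin_unc by (rule finite_subset)
 hence "ue (bd f) = {}" using \<open>card (ue (bd f)) = 0\<close> by simp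
 hence bd: "bd f = ?D" using U(1) xp by (simp add: pcs_def)
 obtain h where h: "h ~= e" "(h, a) \<in> bd f" using pcyc_V[OF bd_sub bd_cyc f(1)] by (elim exE conjE)
 hence "a = c \<or> a = d" unfolding bd using e(5) by auto
 moreover have "a \<in> e" "c \<in> m e" "d \<in> m e" using e(3,4) by simp_all
 ultimately show False using nonadj[OF e(1,2)] by blast
qed

lemma crossing_corners:
 assumes nl: "\<forall>p\<in>pcs E. l p ~= r p" and e: "e \<in> E" "m e ~= e"
 obtains a b c d f1 f2 f3 f4 where "a ~= b" "c ~= d" "e = {a, b}" "m e = {c, d}"
  "(e, a) \<in> bd f1" "(m e, c) \<in> bd f1" "(m e, c) \<in> bd f2" "(e, b) \<in> bd f2"
  "(e, b) \<in> bd f3" "(m e, d) \<in> bd f3" "(m e, d) \<in> bd f4" "(e, a) \<in> bd f4"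
  "f1 ~= f2" "f2 ~= f3" "f3 ~= f4" "f4 ~= f1" "{f1, f2, f3, f4} \<subseteq> FF"
proof -
 obtain a b c d f1 f2 f3 f4 where s: "a ~= b" "c ~= d" "e = {a, b}" "m e = {c, d}"
  "{l (e, a), r (e, a)} = {f4, f1}" "{l (m e, c), r (m e, c)} = {f1, f2}"
  "{l (e, b), r (e, b)} = {f2, f3}" "{l (m e, d), r (m e, d)} = {f3, f4}" using star[OF e] unfolding starred_def by (elim exE conjE)
 have P: "(e, a) \<in> pcs E" "(e, b) \<in> pcs E" "(m e, c) \<in> pcs E" "(m e, d) \<in> pcs E" using e(1) mE[OF e(1)] s(3,4) by simp_all
 note a = side_bd[OF P(1) bspec[OF nl P(1)] s(5)]
 note b = side_bd[OF P(2) bspec[OF nl P(2)] s(7)]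
 note c = side_bd[OF P(3) bspec[OF nl P(3)] s(6)]
 note d = side_bd[OF P(4) bspec[OF nl P(4)] s(8)]
 show ?thesis by (rule that[OF s(1-4) a(2) c(1) c(2) b(1) b(2) d(1) d(2) a(1) c(3) b(3) d(3) a(3)]) (use a b d in simp)
qed

text \<open>\<open>Y\<close> is the only face that may weigh more than 6. Neighbouring corners are
  different faces, and by \<open>corner4\<close> opposite corners cannot both be \<open>Y\<close>,
  so at least three corners are kites. Three colour changes along the circle \<open>a\<close>,
  \<open>c\<close>, \<open>b\<close>, \<open>d\<close> imply the fourth.\<close>

lemma crossing_colours:
 assumes nl: "\<forall>p\<in>pcs E. l p ~= r p" and Y: "ws Y \<le> 8" "\<forall>f\<in>FF. f ~= Y --> ws f = 6"
  and \<kappa>: "\<And>g u w. g \<in> B ==> u \<in> g ==> w \<in> g ==> u ~= w ==> \<kappa> u ~= (\<kappa> w :: bool)" and B: "\<And>f. f \<in> FF ==> ws f = 6 ==> xp (bd f) ~= {} ==> ue (bd f) \<subseteq> B"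
  and e: "e \<in> E" "m e ~= e" "u \<in> e" "w \<in> m e"
 shows "\<kappa> u ~= \<kappa> w"
proof -
 obtain a b c d f1 f2 f3 f4 where s: "a ~= b" "c ~= d" "e = {a, b}" "m e = {c, d}"
  "(e, a) \<in> bd f1" "(m e, c) \<in> bd f1" "(m e, c) \<in> bd f2" "(e, b) \<in> bd f2"
  "(e, b) \<in> bd f3" "(m e, d) \<in> bd f3" "(m e, d) \<in> bd f4" "(e, a) \<in> bd f4"
  "f1 ~= f2" "f2 ~= f3" "f3 ~= f4" "f4 ~= f1" "{f1, f2, f3, f4} \<subseteq> FF" by (rule crossing_corners[OF nl e(1,2)])
 have 13: "f1 ~= f3 \<or> f1 ~= Y" using corner4[OF e(1,2) s(3,4,1,2), of f1] s Y(1) by auto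
 have 24: "f2 ~= f4 \<or> f2 ~= Y" using corner4[OF e(1,2) s(3,4,1,2), of f2] s Y(1) by auto
 have k: "\<kappa> x ~= \<kappa> y" if "(e, x) \<in> bd f" "(m e, y) \<in> bd f" "f \<in> FF" "f ~= Y" for x y f
 proof -
  have ws: "ws f = 6" using Y(2) that by simp
  note K = kite[OF e(1,2) that(1,2) ws]
  have "(e, x) \<in> xp (bd f)" using that(1) e(2) by (simp add: xp_def)
  thus ?thesis using B that(3) ws K(3) K(2) \<kappa> by blast
 qed
 have "f1 ~= Y --> \<kappa> a ~= \<kappa> c" "f2 ~= Y --> \<kappa> b ~= \<kappa> c" "f3 ~= Y --> \<kappa> b ~= \<kappa> d" "f4 ~= Y --> \<kappa> a ~= \<kappa> d" using k s by simp_all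
 hence "\<kappa> a ~= \<kappa> c \<and> \<kappa> b ~= \<kappa> c \<and> \<kappa> b ~= \<kappa> d \<and> \<kappa> a ~= \<kappa> d" using 13 24 s(13-16) by argo
 moreover have "u = a \<or> u = b" "w = c \<or> w = d" using e(3,4) s(3,4) by simp_all
 ultimately show ?thesis by auto
qed

lemma sum_xp_all:
 assumes nl: "\<forall>p\<in>pcs E. l p ~= r p" shows "(\<Sum>f\<in>FF. card (xp (bd f))) = 8 * q"
proof -
 have "{p \<in> pcs E. l p ~= r p} = pcs E" using nl by auto
 hence "(\<Sum>f\<in>FF. card (xp (bd f))) =
  (\<Sum>p\<in>pcs E. (if m (fst p) ~= fst p then 1 else 0) * (of_bool (l p \<in> UNIV) + of_bool (r p \<in> UNIV)))" using sum_xp[of UNIV] by (simp only: Int_UNIV_right)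
 also have "\<dots> = (\<Sum>p\<in>pcs E. if p \<in> pcs crs then 2 else 0)" by (rule sum.cong[OF refl]) (simp add: pcs_def crs_def)
 also have "\<dots> = (\<Sum>p\<in>pcs E \<inter> pcs crs. 2)" by (simp only: sum.inter_restrict[OF finP])
 also have "pcs E \<inter> pcs crs = pcs crs" using pcs_crs(2) by blast
 finally show ?thesis by (simp add: pcs_crs(1))
qed

lemma saturated:
 assumes nl: "\<forall>p\<in>pcs E. l p ~= r p" and "ecut (pcs E) l r S \<subseteq> pcs unc" shows "\<exists>k. (\<Sum>f\<in>FF \<inter> S. card (xp (bd f))) = 8 * k"
proof (rule saturated_xp[OF nl])
 fix p assume p: "p \<in> pcs E" "m (fst p) ~= fst p"
 have "p \<notin> ecut (pcs E) l r S" using assms(2) p(2) by (cases p) (auto simp: unc_def)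
 thus "l p \<in> S \<longleftrightarrow> r p \<in> S" using p(1) by (simp add: ecut_def)
qed

text \<open>There are \<open>4 * q - x\<close> faces and \<open>8 * q\<close> incidences of crossed
  pieces with faces. A face of weight 6 takes at most two, one of weight 8 at most four. So all
  faces are kites, except that for \<open>x = 1\<close> one face has weight 8 and four crossed
  pieces.\<close>

theorem bipartite_colouring:
 assumes n: "4 \<le> card V" "q + 2 = card V" "card unc + q + 6 + x = 3 * card V" "x \<le> 1" shows "\<exists>\<kappa> :: 'a => bool. (\<forall>e\<in>unc. \<forall>u\<in>e. \<forall>w\<in>e. u ~= w --> \<kappa> u ~= \<kappa> w) \<and>
  (\<forall>e\<in>crs. \<forall>u\<in>e. \<forall>w\<in>m e. \<kappa> u ~= \<kappa> w)"
proof -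
 note T = tight[OF n(1,3,4)]
 have types: "\<exists>Y. ws Y \<le> 8 \<and> (\<forall>f\<in>FF. f ~= Y --> ws f = 6 \<and> card (xp (bd f)) = 2) \<and>
   (Y \<in> FF --> (ws Y = 6 \<and> card (xp (bd Y)) = 2) \<or> (ws Y = 8 \<and> card (xp (bd Y)) = 4))"
 proof (cases "x = 0")
  case True
  have 6: "ws f = 6" if "f \<in> FF" for f using T(3) True by (intro sum_tight_lower[OF finFF ws_ge _ that]) simp_all
  have cF: "card FF = 4 * q" using T(2) n True by linarith
  have 2: "card (xp (bd f)) = 2" if "f \<in> FF" for f
  proof (rule sum_tight_upper[OF finFF _ _ that])
   show "card (xp (bd f)) \<le> 2" if "f \<in> FF" for f using xs6[OF 6[OF that]] by auto
   show "2 * card FF \<le> (\<Sum>f\<in>FF. card (xp (bd f)))" using sum_xp_all[OF T(1)] cF by simp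
  qed
  obtain Y where "Y \<in> FF" using cF n(1,2) by fastforce
  thus ?thesis using 6 2 by (intro exI[of _ Y]) simp
 next
  case False
  hence x: "x = 1" using n(4) by simp
  have "\<exists>Y\<in>FF. ws Y = 8 \<and> (\<forall>f\<in>FF. f ~= Y --> ws f = 6)" using T(3) x by (intro sum_one_exception[OF finFF ws_ge even_ws]) simp_all
  then obtain Y where Y: "Y \<in> FF" "ws Y = 8" "\<forall>f\<in>FF. f ~= Y --> ws f = 6" by (elim bexE conjE)
  have cF: "card (FF - {Y}) + 2 = 4 * q" using T(2) n x Y(1) by simp
  have le2: "card (xp (bd f)) \<le> 2" if "f \<in> FF - {Y}" for f using xs6[of f] Y(3) that by auto
  have le4: "card (xp (bd Y)) \<le> 4" using ws_eq[of Y] Y(2) by simp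
  have S: "card (xp (bd Y)) + (\<Sum>f\<in>FF - {Y}. card (xp (bd f))) = 8 * q" using sum_xp_all[OF T(1)] sum.remove[OF finFF Y(1), of "\<lambda>f. card (xp (bd f))"] by simp
  have "(\<Sum>f\<in>FF - {Y}. card (xp (bd f))) \<le> (\<Sum>f\<in>FF - {Y}. 2)" by (rule sum_mono[OF le2])
  hence S2: "(\<Sum>f\<in>FF - {Y}. card (xp (bd f))) \<le> 2 * card (FF - {Y})" by simp
  have "card (xp (bd Y)) = 4" "2 * card (FF - {Y}) \<le> (\<Sum>f\<in>FF - {Y}. card (xp (bd f)))" using S S2 le4 cF by linarith+
  moreover have "card (xp (bd f)) = 2" if "f \<in> FF - {Y}" for f using finFF by (intro sum_tight_upper[OF _ le2 calculation(2) that]) simp_all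
  ultimately show ?thesis using Y by (intro exI[of _ Y]) simp
 qed
 then obtain Y where Y: "ws Y \<le> 8" "\<forall>f\<in>FF. f ~= Y --> ws f = 6 \<and> card (xp (bd f)) = 2"
   "Y \<in> FF --> (ws Y = 6 \<and> card (xp (bd Y)) = 2) \<or> (ws Y = 8 \<and> card (xp (bd Y)) = 4)" by (elim exE conjE)
 have par: "even (\<Sum>f\<in>FF \<inter> S. ws f div 2)" if S: "ecut (pcs E) l r S \<subseteq> pcs unc" for S
 proof -
  obtain k where k: "(\<Sum>f\<in>FF \<inter> S. card (xp (bd f))) = 8 * k" using saturated[OF T(1) S] by (elim exE)
  have *: "(\<Sum>f\<in>FF \<inter> S - {Y}. card (xp (bd f))) = 2 * card (FF \<inter> S - {Y})"
   "(\<Sum>f\<in>FF \<inter> S - {Y}. ws f div 2) = 3 * card (FF \<inter> S - {Y})" using Y(2) by simp_all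
  have fin: "finite (FF \<inter> S)" using finFF by simp
  show ?thesis
  proof (cases "Y \<in> FF \<inter> S")
   case True
   have "card (xp (bd Y)) + 2 * card (FF \<inter> S - {Y}) = 8 * k" using k sum.remove[OF fin True, of "\<lambda>f. card (xp (bd f))"] *(1) by simp
   moreover have "(\<Sum>f\<in>FF \<inter> S. ws f div 2) = ws Y div 2 + 3 * card (FF \<inter> S - {Y})" using sum.remove[OF fin True, of "\<lambda>f. ws f div 2"] *(2) by simp
   moreover have "(ws Y div 2 = 3 \<and> card (xp (bd Y)) = 2) \<or> (ws Y div 2 = 4 \<and> card (xp (bd Y)) = 4)" using Y(3) True by auto
   ultimately show ?thesis by (rule parity_arith)
  next
   case False
   hence "FF \<inter> S - {Y} = FF \<inter> S" by blast
   hence "card (FF \<inter> S) = 4 * k" "(\<Sum>f\<in>FF \<inter> S. ws f div 2) = 3 * card (FF \<inter> S)" using * k by simp_all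
   thus ?thesis by simp
  qed
 qed
 obtain \<kappa> :: "'a => bool" where \<kappa>: "\<forall>e\<in>unc. \<forall>u\<in>e. \<forall>w\<in>e. u ~= w --> \<kappa> u ~= \<kappa> w" using uncrossed_colouring[OF T(1) subset_refl] par by blast
 have "\<kappa> u ~= \<kappa> w" if "e \<in> crs" "u \<in> e" "w \<in> m e" for e u w
 proof (rule crossing_colours[OF T(1) Y(1), where B = unc])
  show "\<forall>f\<in>FF. f ~= Y --> ws f = 6" using Y(2) by simp
  show "e \<in> E" "m e ~= e" using that(1) by (simp_all add: crs_def)
  show "ue (bd f) \<subseteq> unc" for f by (rule ue_pcs(2)[OF bd_sub bd_cyc])
  show "\<kappa> u ~= \<kappa> w" if "g \<in> unc" "u \<in> g" "w \<in> g" "u ~= w" for g u w using bspec[OF bspec[OF bspec[OF \<kappa> that(1)] that(2)] that(3)] that(4) by (rule mp)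
 qed (use that in simp_all)
 hence "\<forall>e\<in>crs. \<forall>u\<in>e. \<forall>w\<in>m e. \<kappa> u ~= \<kappa> w" by (intro ballI)
 show ?thesis by (rule exI[of _ \<kappa>], rule conjI, rule \<kappa>, fact)
qed

end

section \<open>The neighbourhood of a vertex in a nearly optimal graph\<close>

definition nb :: "'a set set => 'a => 'a set" where
 "nb E v = {u. u ~= v \<and> {u, v} \<in> E}"

context xgraph
begin

definition spk :: "'a => 'a set set" where "spk v = {e \<in> unc. v \<in> e}"
definition cpk :: "'a => 'a set set" where "cpk v = {e \<in> crs. v \<in> e}"

lemma fin_spk: "finite (spk v)" and fin_cpk: "finite (cpk v)"
 using fin_unc fin_crs by (simp_all add: spk_def cpk_def)

lemma other_end:
 assumes "e \<in> E" "v \<in> e" shows "\<exists>!u. u ~= v \<and> e = {u, v}"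
proof -
 obtain w where w: "w ~= v" "e = {v, w}" using edge2[OF assms] by (elim exE conjE)
 show ?thesis using w by (auto simp: doubleton_eq_iff)
qed

lemma card_nb_sub:
 assumes "D \<subseteq> E" shows "card {u. u ~= v \<and> {u, v} \<in> D} = card {e \<in> D. v \<in> e}"
proof (rule bij_betw_same_card[of "\<lambda>u. {u, v}"], rule bij_betw_imageI)
 show "inj_on (\<lambda>u. {u, v}) {u. u ~= v \<and> {u, v} \<in> D}" by (rule inj_onI) (auto simp: doubleton_eq_iff)
 show "(\<lambda>u. {u, v}) ` {u. u ~= v \<and> {u, v} \<in> D} = {e \<in> D. v \<in> e}"
 proof (intro equalityI subsetI)
  fix e assume "e \<in> {e \<in> D. v \<in> e}"
  hence e: "e \<in> D" "v \<in> e" by simp_all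
  obtain u where "u ~= v" "e = {u, v}" using other_end[OF subsetD[OF assms e(1)] e(2)] by (elim ex1E conjE)
  thus "e \<in> (\<lambda>u. {u, v}) ` {u. u ~= v \<and> {u, v} \<in> D}" using e by (intro image_eqI[of _ _ u]) simp_all
 qed auto
qed

lemma card_nb: "card (nb E v) = card (spk v) + card (cpk v)"
proof -
 have "card (nb E v) = card {e \<in> E. v \<in> e}" unfolding nb_def by (rule card_nb_sub) simp
 also have "{e \<in> E. v \<in> e} = spk v \<union> cpk v" by (auto simp: spk_def cpk_def unc_def crs_def)
 also have "card \<dots> = card (spk v) + card (cpk v)" using fin_spk fin_cpk by (intro card_Un_disjoint) (auto simp: spk_def cpk_def unc_def crs_def)
 finally show ?thesis .
qed

end

context nice
begin

lemma girth_spokes: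
 assumes C: "C \<subseteq> {p \<in> pcs crs. snd p ~= v} \<union> pcs (spk v)" "pcyc m C" "C ~= {}" shows "8 \<le> sum wt C"
proof -
 have CE: "C \<subseteq> pcs E" using C(1) by (auto simp: pcs_def crs_def spk_def unc_def)
 have spk: "v \<in> e \<and> m e = e" if "(e, u) \<in> C" "m e = e" for e u using subsetD[OF C(1) that(1)] that(2) by (auto simp: spk_def crs_def)
 have notv: "u ~= v" if "(e, u) \<in> C" "m e ~= e" for e u using subsetD[OF C(1) that(1)] that(2) by (auto simp: spk_def unc_def)
 have fin: "finite C" by (rule finC[OF CE])
 show ?thesis
 proof (cases "\<exists>p\<in>C. m (fst p) = fst p")
  case False
  obtain e u where eu: "(e, u) \<in> C" using C(3) by auto
  obtain D where D: "D \<subseteq> C" "card D = 4" by (metis False girth_cr nonadj CE C(2) eu)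
  have "sum wt D = sum (\<lambda>_. 2) D" using False D(1) by (intro sum.cong) (auto simp: wt_def)
  thus ?thesis using sum_ge[OF fin D(1)] D(2) by simp
 next
  case True
  then obtain e x where ex: "(e, x) \<in> C" "m e = e" by auto
  have ve: "v \<in> e" "e \<in> E" using spk[OF ex] subsetD[OF CE ex(1)] by simp_all
  have ev: "(e, v) \<in> C" by (rule pcyc_unc[OF CE C(2) ex ve(1)])
  obtain g where g: "g ~= e" "(g, v) \<in> C" using pcyc_V[OF CE C(2) ev] by (elim exE conjE)
  have mg: "m g = g" using notv[OF g(2)] by blast
  have vg: "v \<in> g" "g \<in> E" using subsetD[OF CE g(2)] by simp_all
  obtain u where u: "u ~= v" "e = {v, u}" using edge2[OF ve(2,1)] by (elim exE conjE)
  obtain w where w: "w ~= v" "g = {v, w}" using edge2[OF vg(2,1)] by (elim exE conjE)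
  have uw: "u ~= w" using g(1) u(2) w(2) by auto
  have eu: "(e, u) \<in> C" using u(2) by (intro pcyc_unc[OF CE C(2) ex]) simp
  have gw: "(g, w) \<in> C" using w(2) by (intro pcyc_unc[OF CE C(2) g(2) mg]) simp
  have third: "\<exists>f. (f, y) \<in> C \<and> m f ~= f" if h: "(h, y) \<in> C" "y ~= v" "h = {v, y}" for h y
  proof -
   obtain f where f: "f ~= h" "(f, y) \<in> C" using pcyc_V[OF CE C(2) h(1)] by (elim exE conjE)
   show ?thesis using spk CE edge2 f h(2) h(3) by fastforce
  qed
  obtain f where f: "(f, u) \<in> C" "m f ~= f" using third[OF eu u] by (elim exE conjE)
  obtain f' where f': "(f', w) \<in> C" "m f' ~= f'" using third[OF gw w] by (elim exE conjE)
  let ?D = "{(e, v), (e, u), (g, v), (g, w), (f, u), (f', w)}"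
  have "e ~= f" "e ~= f'" "g ~= f" "g ~= f'" using ex(2) mg f(2) f'(2) by auto
  hence "sum wt ?D = 8" using u(1) w(1) uw not_sym[OF u(1)] not_sym[OF w(1)] not_sym[OF g(1)] ex(2) mg f(2) f'(2) by (simp add: wt_def)
  moreover have "?D \<subseteq> C" using ev eu g gw f f' by simp
  ultimately show ?thesis using sum_ge[OF fin] by metis
 qed
qed

text \<open>Euler's inequality with least weight 8 for the spokes and the crossed pieces not at
  \<open>v\<close>. For q = n - 2 it says that at most half of the edges at \<open>v\<close> are
  uncrossed.\<close>

lemma spokes_bound:
 assumes "3 \<le> card V" "v \<in> V" shows "card (spk v) + 2 * q + 4 \<le> card (cpk v) + 2 * card V"
proof -
 define A where "A = {p \<in> pcs crs. snd p ~= v} \<union> pcs (spk v)"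
 have spkE: "spk v \<subseteq> E" "spk v \<subseteq> unc" by (auto simp: spk_def unc_def)
 have AE: "A \<subseteq> pcs E" unfolding A_def using pcs_crs(2) pcs_mono[OF spkE(1)] by blast
 have fin: "finite A" by (rule finC[OF AE])
 have fin1: "finite (pcs crs)" "finite (pcs (spk v))" using finC[OF pcs_crs(2)] finC[OF pcs_mono[OF spkE(1)]] .
 obtain \<mu> :: "'f => 'f" where \<mu>: "dualpair A psrc (ptgt m) (\<mu> \<circ> l) (\<mu> \<circ> r)" by (metis dualpair_subset dual finP AE)
 have split: "pcs crs = {p \<in> pcs crs. snd p ~= v} \<union> {p \<in> pcs crs. snd p = v}" by blast
 have "{p \<in> pcs crs. snd p = v} = (\<lambda>e. (e, v)) ` cpk v" by (auto simp: cpk_def pcs_def)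
 hence c2: "card {p \<in> pcs crs. snd p = v} = card (cpk v)" by (simp add: card_image inj_on_def)
 have "card (pcs crs) = card {p \<in> pcs crs. snd p ~= v} + card {p \<in> pcs crs. snd p = v}" by (subst split, rule card_Un_disjoint) (use fin1 in auto)
 hence c3: "card {p \<in> pcs crs. snd p ~= v} + card (cpk v) = 4 * q" using c2 pcs_crs(1) by simp
 have disj: "{p \<in> pcs crs. snd p ~= v} \<inter> pcs (spk v) = {}" by (auto simp: spk_def unc_def crs_def pcs_def)
 have cA: "card A = card {p \<in> pcs crs. snd p ~= v} + 2 * card (spk v)" unfolding A_def using fin1 disj card_pcs_sub[OF spkE(1)] by (simp add: card_Un_disjoint)
 have "sum wt A = sum wt {p \<in> pcs crs. snd p ~= v} + sum wt (pcs (spk v))" unfolding A_def using fin1 disj by (simp add: sum.union_disjoint)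
 also have "sum wt {p \<in> pcs crs. snd p ~= v} = sum (\<lambda>_. 2) {p \<in> pcs crs. snd p ~= v}" by (rule sum.cong[OF refl]) (auto simp: wt_def pcs_def crs_def)
 also have "sum wt (pcs (spk v)) = sum (\<lambda>_. 1) (pcs (spk v))" by (rule sum.cong[OF refl]) (auto simp: wt_def pcs_def spk_def unc_def)
 finally have wA: "sum wt A = 2 * card {p \<in> pcs crs. snd p ~= v} + 2 * card (spk v)" using card_pcs_sub[OF spkE(1)] by simp
 let ?N = "Inl ` V \<union> ptgt m ` A :: ('a + 'a set set) set"
 have "ptgt m ` A \<subseteq> ptgt m ` pcs crs \<union> (\<lambda>e. Inr {e}) ` spk v" unfolding A_def by (auto simp: ptgt_def pcs_def spk_def unc_def)
 hence "card (ptgt m ` A) \<le> card (ptgt m ` pcs crs \<union> (\<lambda>e. Inr {e}) ` spk v)" using fin1 fin_spk by (intro card_mono) simp_all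
 also have "\<dots> \<le> card (ptgt m ` pcs crs) + card ((\<lambda>e. Inr {e}) ` spk v :: ('a + 'a set set) set)" by (rule card_Un_le)
 also have "\<dots> \<le> q + card (spk v)" using pcs_crs(3) fin_spk by (intro add_mono card_image_le)
 finally have "card (ptgt m ` A) \<le> q + card (spk v)" .
 moreover have "card ?N \<le> card (Inl ` V :: ('a + 'a set set) set) + card (ptgt m ` A)" by (rule card_Un_le)
 moreover have "card (Inl ` V :: ('a + 'a set set) set) = card V" by (simp add: card_image)
 ultimately have N: "card ?N \<le> card V + q + card (spk v)" by linarith
 have sub: "psrc ` A \<union> ptgt m ` A \<subseteq> ?N"
  using AE nodes(2) by (auto simp: psrc_def) (metis (no_types, lifting) Inl_inject UnE edge fst_conv image_iff pcs_iff snd_conv subsetD)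
 have "8 * (card A + 2) \<le> 2 * sum wt A + 8 * card ?N \<or> card A + 1 \<le> card ?N"
 proof (rule euler_weighted[OF \<mu> fin _ _ sub])
  show "finite ?N" using finV fin by simp
  show "?N ~= {}" using assms by auto
  show "8 \<le> sum wt C" if "C \<subseteq> A" "pcyc m C" "C ~= {}" for C using girth_spokes[of C v] that unfolding A_def by simp
 qed
 thus ?thesis using N c3 cA wA assms(1) by fastforce
qed

lemma mono_crossing:
 assumes "\<forall>e\<in>crs. \<forall>u\<in>e. \<forall>w\<in>m e. \<kappa> u ~= (\<kappa> w :: bool)" "e \<in> crs" "u \<in> e" "u' \<in> e" shows "\<kappa> u = \<kappa> u'"
proof -
 obtain w where "w \<in> m e" using assms(2) mE edge_ex by (fastforce simp: crs_def)
 thus ?thesis using assms by (metis (full_types))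
qed

text \<open>The two edges of a crossing have opposite colours, so exactly one of them is coloured
  unlike \<open>v\<close>.\<close>

lemma white_half:
 fixes \<kappa> :: "'a => bool" and v :: 'a assumes \<kappa>: "\<forall>e\<in>crs. \<forall>u\<in>e. \<forall>w\<in>m e. \<kappa> u ~= \<kappa> w"
 defines "D == {e \<in> crs. \<forall>u\<in>e. \<kappa> u ~= \<kappa> v}"
 shows "card D = q" "e \<in> D ==> m e \<notin> D"
proof -
 have SE: "e \<in> E" "m e \<in> E" "m e ~= e" if "e \<in> crs" for e using that mE by (simp_all add: crs_def)
 have me: "m e \<in> crs" if "e \<in> crs" for e using SE[OF that] mm[OF SE(1)[OF that]] not_sym[OF SE(3)[OF that]] by (simp add: crs_def)
 have Dk: "e \<in> D \<longleftrightarrow> \<kappa> u ~= \<kappa> v" if e: "e \<in> crs" and u: "u \<in> e" for e u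
 proof
  assume "e \<in> D"
  thus "\<kappa> u ~= \<kappa> v" using u by (simp add: D_def)
 next
  assume "\<kappa> u ~= \<kappa> v"
  hence "\<kappa> u' ~= \<kappa> v" if "u' \<in> e" for u' using mono_crossing[OF \<kappa> e u that] by simp
  thus "e \<in> D" unfolding D_def using e by simp
 qed
 have Dm: "m e \<in> D \<longleftrightarrow> e \<notin> D" if e: "e \<in> crs" for e
 proof -
  obtain u where u: "u \<in> e" using edge_ex[OF SE(1)[OF e]] by blast
  obtain w where w: "w \<in> m e" using edge_ex[OF SE(2)[OF e]] by blast
  show ?thesis using \<kappa> e u w Dk me by simp
 qed
 show "card D = q"
 proof -
  have "card crs = card D + card (m ` D)"
  proof -
   have "crs = D \<union> m ` D"
   proof (intro equalityI subsetI)
    fix e assume e: "e \<in> crs"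
    show "e \<in> D \<union> m ` D" using Dm e mm SE(1) by blast
   next
    fix e assume "e \<in> D \<union> m ` D"
    thus "e \<in> crs" using me unfolding D_def by blast
   qed
   moreover have "D \<inter> m ` D = {}" using Dm unfolding D_def by blast
   moreover have "finite D" using fin_crs by (simp add: D_def)
   ultimately show ?thesis by (simp add: card_Un_disjoint)
  qed
  moreover have "card (m ` D) = card D"
  proof (rule card_image, rule inj_onI)
   fix e f assume "e \<in> D" "f \<in> D" "m e = m f"
   moreover have "e \<in> E" "f \<in> E" using calculation SE(1) by (simp_all add: D_def)
   ultimately show "e = f" using mm by metis
  qed
  ultimately show ?thesis using card_crs by simp
 qed
 show "m e \<notin> D" if "e \<in> D" using that Dm[of e] unfolding D_def by blast
qed

text \<open>At most one edge of each crossing is in \<open>D\<close>, so \<open>D\<close> and the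
  spokes form a planar graph on \<open>card (spk v) + 1\<close> vertices, to which the bound 3n - 6
  applies.\<close>

lemma colour_class_bound:
 assumes v: "v \<in> V" and D: "D \<subseteq> crs" "\<And>e. e \<in> D ==> m e \<notin> D"
   "\<And>e u. e \<in> D ==> u \<in> e ==> {u, v} \<in> spk v \<and> u ~= v"
 shows "card D = 0 \<or> card D + 3 \<le> 2 * card (spk v)"
proof (cases "D = {}")
 case False
 define U where "U = {u. u ~= v \<and> {u, v} \<in> spk v}"
 have spkE: "spk v \<subseteq> E" "spk v \<subseteq> unc" by (auto simp: spk_def unc_def)
 have cU: "card U = card (spk v)"
 proof -
  have "{e \<in> spk v. v \<in> e} = spk v" by (auto simp: spk_def)
  thus ?thesis unfolding U_def using card_nb_sub[OF spkE(1), of v] by simp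
 qed
 have UV: "U \<subseteq> V" using spkE(1) edge by (auto simp: U_def)
 have finU: "finite U" by (rule finite_subset[OF UV finV])
 have DE: "D \<subseteq> E" using D(1) by (auto simp: crs_def)
 have finD: "finite D" by (rule finite_subset[OF DE finE])
 let ?E' = "D \<union> spk v"
 have sub: "e \<subseteq> insert v U" if "e \<in> ?E'" for e
 proof (cases "e \<in> D")
  case True
  thus ?thesis using D(3) by (auto simp: U_def)
 next
  case False
  hence e: "e \<in> spk v" using that by simp
  hence "v \<in> e" "e \<in> E" using spkE by (auto simp: spk_def)
  then obtain u where "u ~= v" "e = {u, v}" using other_end by blast
  thus ?thesis using e by (simp add: U_def)
 qed
 obtain \<mu> :: "'f => 'f" where "nice (insert v U) ?E' (subm m ?E') (\<mu> \<circ> l) (\<mu> \<circ> r)" using DE spkE(1) finU sub nice_sub by fastforce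
 then interpret S: nice "insert v U" ?E' "subm m ?E'" "\<mu> \<circ> l" "\<mu> \<circ> r" .
 have "subm m ?E' e = e" if "e \<in> ?E'" for e
 proof (cases "e \<in> D")
  case True
  have "m e \<notin> spk v"
  proof
   assume "m e \<in> spk v"
   hence "m (m e) = m e" by (simp add: spk_def unc_def)
   moreover have "m (m e) = e" "m e ~= e" using True D(1) mm by (auto simp: crs_def)
   ultimately show False by simp
  qed
  thus ?thesis using D(2)[OF True] by (simp add: subm_def)
 next
  case False
  thus ?thesis using that by (simp add: spk_def unc_def subm_def)
 qed
 hence "S.crs = {}" "S.unc = ?E'" by (auto simp: S.crs_def S.unc_def)
 hence q0: "S.q = 0" "card S.unc = card D + card (spk v)" using S.card_crs finD fin_spk D(1) by (auto simp: spk_def unc_def crs_def intro!: card_Un_disjoint)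
 have cV: "card (insert v U) = card (spk v) + 1" using finU cU by (simp add: U_def)
 obtain e where "e \<in> D" using False by auto
 then obtain a b where ab: "a ~= b" "e = {a, b}" using edge_ex subsetD[OF DE] by metis
 have "{a, b} \<subseteq> U" using D(3)[OF \<open>e \<in> D\<close>] ab by (auto simp: U_def)
 hence "2 \<le> card U" using card_mono[OF finU, of "{a, b}"] ab(1) by simp
 thus ?thesis using cV cU S.planar_bound q0 by simp
qed simp

text \<open>From each crossing in the closed neighbourhood, take the edge coloured unlike
  \<open>v\<close>. Its ends are joined to \<open>v\<close> by uncrossed edges, because crossed
  edges are monochromatic. Since at most half of the edges at \<open>v\<close> are spokes,
  \<open>colour_class_bound\<close> allows only degree minus 3 crossings, two below
  \<open>cross_bound\<close>. The conclusion is \<open>\<delta>\<^sub>v \<ge> 2\<close>.\<close>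

theorem neighbourhood_bound:
 assumes n: "4 \<le> card V" "q + 2 = card V" "card unc + q + 6 + x = 3 * card V" "x \<le> 1"
  and v: "v \<in> V" "3 \<le> card (nb E v)"
 shows "card (ind E (insert v (nb E v))) + 6 \<le> 4 * card (nb E v)"
proof -
 obtain \<kappa> :: "'a => bool" where \<kappa>: "\<forall>e\<in>unc. \<forall>u\<in>e. \<forall>w\<in>e. u ~= w --> \<kappa> u ~= \<kappa> w"
  "\<forall>e\<in>crs. \<forall>u\<in>e. \<forall>w\<in>m e. \<kappa> u ~= \<kappa> w" using bipartite_colouring[OF n] by (elim exE conjE)
 let ?N = "insert v (nb E v)"
 let ?E' = "ind E ?N"
 have NV: "nb E v \<subseteq> V" using edge by (auto simp: nb_def)
 have finN: "finite (nb E v)" by (rule finite_subset[OF NV finV])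
 have E': "?E' \<subseteq> E" by (auto simp: ind_def)
 obtain \<mu> :: "'f => 'f" where "nice ?N ?E' (subm m ?E') (\<mu> \<circ> l) (\<mu> \<circ> r)" using finN nice_sub by (fastforce simp: ind_def)
 then interpret S: nice ?N ?E' "subm m ?E'" "\<mu> \<circ> l" "\<mu> \<circ> r" .
 have Scrs: "e \<in> S.crs \<longleftrightarrow> e \<in> ?E' \<and> m e \<in> ?E' \<and> m e ~= e" for e unfolding S.crs_def mem_Collect_eq by (cases "m e \<in> ?E'") (simp_all add: subm_def)
 have SE: "e \<in> E" "e \<subseteq> ?N" "m e \<in> E" "m e ~= e" if "e \<in> S.crs" for e using iffD1[OF Scrs that] unfolding ind_def by simp_all
 have crs: "e \<in> crs" if "e \<in> S.crs" for e using SE[OF that] by (simp add: crs_def)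
 define D where "D = {e \<in> S.crs. \<forall>u\<in>e. \<kappa> u ~= \<kappa> v}"
 have sm: "subm m ?E' e = m e" if "e \<in> S.crs" for e using iffD1[OF Scrs that] by (simp add: subm_def)
 have S\<kappa>: "\<forall>e\<in>S.crs. \<forall>u\<in>e. \<forall>w\<in>subm m ?E' e. \<kappa> u ~= \<kappa> w" using sm \<kappa>(2) crs by blast
 have "card D = S.q" unfolding D_def by (rule S.white_half(1)[OF S\<kappa>])
 moreover have "card D = 0 \<or> card D + 3 \<le> 2 * card (spk v)"
 proof (rule colour_class_bound[OF v(1)])
  show "D \<subseteq> crs" using crs by (auto simp: D_def)
  show "m e \<notin> D" if e: "e \<in> D" for e using e S.white_half(2) S\<kappa> sm by (simp add: D_def)
  fix e u assume e: "e \<in> D" "u \<in> e"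
  have "\<kappa> u ~= \<kappa> v" using e by (simp add: D_def)
  hence uv: "u ~= v" by auto
  have "u \<in> ?N" using e SE(2)[of e] unfolding D_def by blast
  hence uvE: "{u, v} \<in> E" using uv by (simp add: nb_def)
  have "{u, v} \<notin> crs" using mono_crossing[OF \<kappa>(2), of "{u, v}" u v] \<open>\<kappa> u ~= \<kappa> v\<close> by auto
  thus "{u, v} \<in> spk v \<and> u ~= v" using uvE uv by (simp add: spk_def unc_def crs_def)
 qed
 moreover have "card (spk v) \<le> card (cpk v)" using spokes_bound[OF _ v(1)] n(1,2) by linarith
 moreover have "card (nb E v) = card (spk v) + card (cpk v)" by (rule card_nb)
 ultimately have "S.q + 3 \<le> card (nb E v)" using v(2) by linarith
 moreover have "card ?N = card (nb E v) + 1" using finN by (simp add: nb_def)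
 moreover have "card S.unc + S.q + 6 \<le> 3 * card ?N" using calculation v(2) by (intro S.planar_bound) simp
 ultimately show ?thesis using S.card_E by linarith
qed

end

section \<open>Graphs with q = n - 3: two uncrossed triangles among kites\<close>

context nice
begin

definition pv :: "'a => 'f => nat" where
 "pv v f = card {p \<in> bd f. snd p = v \<and> m (fst p) = fst p}"
definition pc :: "'a => 'f => nat" where
 "pc v f = card {p \<in> bd f. snd p = v \<and> m (fst p) ~= fst p}"

lemma sum_pieces_at:
 assumes nl: "\<forall>p\<in>pcs E. l p ~= r p" shows "(\<Sum>f\<in>FF. pv v f) = 2 * card (spk v)" "(\<Sum>f\<in>FF. pc v f) = 2 * card (cpk v)"
proof -
 have L: "{p \<in> pcs E. l p ~= r p} = pcs E" using nl by auto
 have *: "(\<Sum>f\<in>FF. card {p \<in> bd f. P p}) = 2 * card {p \<in> pcs E. P p}" for P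
 proof -
  have "card {p \<in> bd f. P p} = (\<Sum>p\<in>bd f. if P p then 1 else 0)" for f using finC[OF bd_sub[of f]] by (simp add: sum.inter_filter[symmetric])
  hence "(\<Sum>f\<in>FF. card {p \<in> bd f. P p}) = (\<Sum>f\<in>FF. \<Sum>p\<in>bd f. if P p then 1 else 0)" by simp
  also have "\<dots> = 2 * (\<Sum>p\<in>{p \<in> pcs E. l p ~= r p}. if P p then 1 else 0)" unfolding FF_def bd_def by (rule sum_faces[OF finP])
  finally show ?thesis unfolding L using finP by (simp add: sum.inter_filter[symmetric])
 qed
 have "{p \<in> pcs E. snd p = v \<and> m (fst p) = fst p} = (\<lambda>e. (e, v)) ` spk v" by (auto simp: spk_def unc_def pcs_def)
 thus "(\<Sum>f\<in>FF. pv v f) = 2 * card (spk v)" unfolding pv_def using *[of "\<lambda>p. snd p = v \<and> m (fst p) = fst p"] by (simp add: card_image inj_on_def)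
 have "{p \<in> pcs E. snd p = v \<and> m (fst p) ~= fst p} = (\<lambda>e. (e, v)) ` cpk v" by (auto simp: cpk_def crs_def pcs_def)
 thus "(\<Sum>f\<in>FF. pc v f) = 2 * card (cpk v)" unfolding pc_def using *[of "\<lambda>p. snd p = v \<and> m (fst p) ~= fst p"] by (simp add: card_image inj_on_def)
qed

lemma pieces_at_even: "even (pv v f + pc v f)"
proof -
 have "{p \<in> bd f. snd p = v} = {p \<in> bd f. snd p = v \<and> m (fst p) = fst p} \<union> {p \<in> bd f. snd p = v \<and> m (fst p) ~= fst p}" by blast
 hence "card {p \<in> bd f. snd p = v} = pv v f + pc v f" unfolding pv_def pc_def using finC[OF bd_sub[of f]] by (simp only:) (rule card_Un_disjoint, auto)
 moreover have "even (card {p \<in> bd f. snd p = v})" using bd_cyc[of f] unfolding pcyc_iff[OF bd_sub] by (elim conjE allE)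
 ultimately show ?thesis by simp
qed

lemma bdI: "e \<in> ue (bd f) ==> u \<in> e ==> (e, u) \<in> bd f" by (rule subsetD[OF equalityD2[OF ue_pcs(1)[OF bd_sub bd_cyc]]]) simp

lemma bdD: "(e, u) \<in> bd f ==> (e, u) \<notin> xp (bd f) ==> e \<in> ue (bd f) \<and> u \<in> e" by (drule subsetD[OF equalityD1[OF ue_pcs(1)[OF bd_sub bd_cyc]]]) simp

lemma ueD: "e \<in> ue (bd f) ==> e \<in> E \<and> m e = e" by (drule subsetD[OF ue_pcs(2)[OF bd_sub bd_cyc]]) (simp add: unc_def)

lemma pv_ue: "pv v f = card {e \<in> ue (bd f). v \<in> e}"
proof -
 have "{p \<in> bd f. snd p = v \<and> m (fst p) = fst p} = (\<lambda>e. (e, v)) ` {e \<in> ue (bd f). v \<in> e}"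
 proof (intro equalityI subsetI)
  fix p assume p: "p \<in> {p \<in> bd f. snd p = v \<and> m (fst p) = fst p}"
  hence "(fst p, v) \<in> bd f" "(fst p, v) \<notin> xp (bd f)" by (auto simp: xp_def)
  hence "fst p \<in> ue (bd f)" "v \<in> fst p" using bdD by simp_all
  thus "p \<in> (\<lambda>e. (e, v)) ` {e \<in> ue (bd f). v \<in> e}" using p by (intro image_eqI[of _ _ "fst p"]) auto
 next
  fix p assume "p \<in> (\<lambda>e. (e, v)) ` {e \<in> ue (bd f). v \<in> e}"
  then obtain e where e: "p = (e, v)" "e \<in> ue (bd f)" "v \<in> e" by (elim imageE) simp
  show "p \<in> {p \<in> bd f. snd p = v \<and> m (fst p) = fst p}" using bdI[OF e(2,3)] ueD[OF e(2)] unfolding e(1) by simp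
 qed
 thus ?thesis unfolding pv_def by (simp only:) (simp add: card_image inj_on_def)
qed

lemma fin_ue: "finite (ue (bd f))"
 using ue_pcs(2)[OF bd_sub bd_cyc] fin_unc by (rule finite_subset)

text \<open>A face of weight 6 with crossed pieces is a kite. The two crossed pieces cannot be the
  halves of one edge, for the remaining side would then have the same ends as this edge.\<close>

lemma face6_two:
 assumes "ws f = 6" "xp (bd f) ~= {}"
 obtains h y y' where "h \<in> E" "m h ~= h" "(h, y) \<in> bd f" "(m h, y') \<in> bd f" "xp (bd f) = {(h, y), (m h, y')}"
  "{y, y'} \<in> unc" "y ~= y'" "ue (bd f) = {{y, y'}}" "y \<in> h" "y' \<in> m h"
proof -
 obtain h y where hy: "(h, y) \<in> xp (bd f)" using assms(2) by auto
 have c2: "card (xp (bd f)) = 2" using xs6[OF assms(1)] assms(2) xp_le[of f] by auto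
 have u1: "card (ue (bd f)) = 1" using ws_eq[of f] c2 assms(1) by simp
 have hb: "(h, y) \<in> bd f" "m h ~= h" using hy by (simp_all add: xp_def)
 have hE: "h \<in> E" "y \<in> h" using subsetD[OF bd_sub hb(1)] by simp_all
 obtain g y' where g: "(g, y') ~= (h, y)" "(g, y') \<in> bd f" "g = h \<or> g = m h" using pcyc_X[OF bd_sub bd_cyc hb(1)] by (elim exE conjE)
 have mm': "m (m h) ~= m h" unfolding mm[OF hE(1)] by (rule not_sym[OF hb(2)])
 have gx: "(g, y') \<in> xp (bd f)" using g(2,3) hb(2) mm' by (auto simp: xp_def)
 have xp: "xp (bd f) = {(h, y), (g, y')}"
 proof -
  have "card {(h, y), (g, y')} = 2" using not_sym[OF g(1)] by simp
  thus ?thesis using card_subset_eq[OF xp_le, of "{(h, y), (g, y')}" f] hy gx c2 by simp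
 qed
 have "g = m h"
 proof (rule ccontr)
  assume "g ~= m h"
  hence gh: "g = h" using g(3) by simp
  hence yy: "y' ~= y" using g(1) by simp
  obtain k where k: "ue (bd f) = {k}" using u1 by (auto simp: card_1_singleton_iff)
  have "z \<in> k" if z: "z = y \<or> z = y'" for z
  proof -
   have zb: "(h, z) \<in> bd f" using z hb(1) g(2) gh by auto
   obtain e where e: "e ~= h" "(e, z) \<in> bd f" using pcyc_V[OF bd_sub bd_cyc zb] by (elim exE conjE)
   thus ?thesis using xp gh bdD k by blast
  qed
  hence kk: "y \<in> k" "y' \<in> k" by simp_all
  have kE: "k \<in> E" "m k = k" using ueD[of k f] k by simp_all
  have "h = {y, y'}" using bd_sub g(2) gh edge2 hE yy by fastforce
  moreover have "k = {y, y'}" using edge2[OF kE(1) kk(1)] kk(2) yy by auto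
  ultimately show False using kE(2) hb(2) by simp
 qed
 note gm = this
 have g2: "(m h, y') \<in> bd f" using g(2) gm by simp
 note K = kite[OF hE(1) hb(2) hb(1) g2 assms(1)]
 show ?thesis using bd_sub g2 that hE(1) hb(2) hb(1) K hE(2) xp gm by fastforce
qed

text \<open>In a kite, each of the two outer ends has one crossed and one uncrossed half; in an
  uncrossed triangle there are only uncrossed halves. Summed over all faces this compares the
  crossed and the uncrossed edges at a vertex.\<close>

lemma pc_le_pv:
 assumes "ws f = 6" shows "pc v f \<le> pv v f"
proof (cases "xp (bd f) = {}")
 case True
 hence "{p \<in> bd f. snd p = v \<and> m (fst p) ~= fst p} = {}" by (auto simp: xp_def)
 thus ?thesis unfolding pc_def by (simp only: card.empty)
next
 case False
 obtain h y y' where k: "xp (bd f) = {(h, y), (m h, y')}" "y ~= y'" by (rule face6_two[OF assms False])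
 have "{p \<in> bd f. snd p = v \<and> m (fst p) ~= fst p} = {p \<in> xp (bd f). snd p = v}" by (auto simp: xp_def)
 also have "\<dots> \<subseteq> (if v = y then {(h, y)} else {(m h, y')})" unfolding k(1) using k(2) by auto
 finally have "pc v f \<le> card (if v = y then {(h, y)} else {(m h, y')})" unfolding pc_def by (rule card_mono[rotated]) simp
 hence "pc v f \<le> 1" by (simp split: if_splits)
 hence "pc v f = 0 \<or> pc v f = 1" by linarith
 thus ?thesis using pieces_at_even[of v f] by (cases "pv v f = 0") auto
qed

lemma pv_le_pc:
 assumes "ws f = 6" "xp (bd f) ~= {}" shows "pv v f \<le> pc v f"
proof -
 obtain h y y' where k: "ue (bd f) = {{y, y'}}" by (rule face6_two[OF assms])
 have "pv v f \<le> card (ue (bd f))" unfolding pv_ue by (rule card_mono[OF fin_ue]) blast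
 hence "pv v f \<le> 1" unfolding k by simp
 hence "pv v f = 0 \<or> pv v f = 1" by linarith
 thus ?thesis using pieces_at_even[of v f] by (cases "pc v f = 0") auto
qed

lemma cpk_le_spk:
 assumes nl: "\<forall>p\<in>pcs E. l p ~= r p" and 6: "\<forall>f\<in>FF. ws f = 6" shows "card (cpk v) \<le> card (spk v)"
proof -
 have "(\<Sum>f\<in>FF. pc v f) \<le> (\<Sum>f\<in>FF. pv v f)" by (rule sum_mono) (use 6 pc_le_pv in blast)
 thus ?thesis unfolding sum_pieces_at[OF nl] by simp
qed

lemma spk_le_cpk:
 assumes nl: "\<forall>p\<in>pcs E. l p ~= r p" and 6: "\<forall>f\<in>FF. ws f = 6"
  and no: "\<And>f e. f \<in> FF ==> xp (bd f) = {} ==> e \<in> ue (bd f) ==> v \<notin> e"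
 shows "card (spk v) \<le> card (cpk v)"
proof -
 have "pv v f \<le> pc v f" if f: "f \<in> FF" for f
 proof (cases "xp (bd f) = {}")
  case True
  have "{e \<in> ue (bd f). v \<in> e} = {}" using no[OF f True] by blast
  thus ?thesis unfolding pv_ue by (simp only: card.empty)
 next
  case False
  thus ?thesis using pv_le_pc 6 f by blast
 qed
 hence "(\<Sum>f\<in>FF. pv v f) \<le> (\<Sum>f\<in>FF. pc v f)" by (rule sum_mono)
 thus ?thesis unfolding sum_pieces_at[OF nl] by simp
qed

lemma triangle_face:
 assumes "xp (bd f) = {}" "ws f = 6" "{v, a} \<in> ue (bd f)" "{v, b} \<in> ue (bd f)" "a ~= b" "v ~= a" "v ~= b" shows "ue (bd f) = {{v, a}, {v, b}, {a, b}}"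
proof -
 have c3: "card (ue (bd f)) = 3" using ws_eq[of f] assms(1,2) by simp
 have ne: "{v, a} ~= {v, b}" using assms(5) by (auto simp: doubleton_eq_iff)
 have "card (ue (bd f) - {{v, a}, {v, b}}) = 1" using c3 assms(3,4) ne fin_ue[of f] by (subst card_Diff_subset) auto
 then obtain k where k: "ue (bd f) - {{v, a}, {v, b}} = {k}" by (auto simp: card_1_singleton_iff)
 have ue: "ue (bd f) = {{v, a}, {v, b}, k}" using k assms(3,4) by blast
 have ink: "z \<in> k" if z: "{v, z} \<in> ue (bd f)" "z ~= v" "\<And>z'. {v, z'} \<in> {{v, a}, {v, b}} ==> z \<in> {v, z'} ==> z' = z" for z
 proof -
  have "({v, z}, z) \<in> bd f" using z(1) by (intro bdI) simp_all
  from pcyc_V[OF bd_sub bd_cyc this] obtain e where e: "e ~= {v, z}" "(e, z) \<in> bd f" by (elim exE conjE)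
  hence "e \<in> ue (bd f)" "z \<in> e" using bdD[OF e(2)] assms(1) by simp_all
  hence "e = {v, a} \<or> e = {v, b} \<or> e = k" using ue by simp
  moreover have "e ~= {v, a}" using e(1) \<open>z \<in> e\<close> z(3)[of a] by auto
  moreover have "e ~= {v, b}" using e(1) \<open>z \<in> e\<close> z(3)[of b] by auto
  ultimately show ?thesis using \<open>z \<in> e\<close> by blast
 qed
 have "a \<in> k" using assms(3,5,6,7) by (intro ink) (auto simp: doubleton_eq_iff)
 moreover have "b \<in> k" using assms(4,5,6,7) by (intro ink) (auto simp: doubleton_eq_iff)
 moreover have "k \<in> E" using ueD[of k f] ue by simp
 ultimately have "k = {a, b}" using edge2[of k a] assms(5) by auto
 thus ?thesis using ue by simp
qed

end

lemma card_filter_split: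
 assumes "finite A" shows "card A = card {x \<in> A. P x} + card {x \<in> A. \<not> P x}"
proof -
 have "card ({x \<in> A. P x} \<union> {x \<in> A. \<not> P x}) = card {x \<in> A. P x} + card {x \<in> A. \<not> P x}" using assms by (intro card_Un_disjoint) auto
 moreover have "{x \<in> A. P x} \<union> {x \<in> A. \<not> P x} = A" by blast
 ultimately show ?thesis by simp
qed

context nice
begin

lemma tight0:
 assumes "4 \<le> card V" "card unc + q + 6 = 3 * card V" shows "\<forall>p\<in>pcs E. l p ~= r p" "\<forall>f\<in>FF. ws f = 6"
 using tight assms(1) assms(2) sum_tight_lower finFF ws_ge by fastforce+

text \<open>There are \<open>4 * q + 2\<close> faces, and the \<open>8 * q\<close> incidences of
  crossed pieces make exactly \<open>4 * q\<close> of them kites.\<close>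

lemma two_triangles:
 assumes n: "4 \<le> card V" "card unc + q + 6 = 3 * card V" "q + 3 = card V" shows "card {f \<in> FF. xp (bd f) = {}} = 2"
proof -
 note T = tight0[OF n(1,2)]
 have cF: "card FF = 4 * q + 2" using tight(2)[OF n(1), of 0] n by simp
 have s: "card (xp (bd f)) = (if xp (bd f) = {} then 0 else 2)" if "f \<in> FF" for f using xs6[of f] T(2) that xp_le[of f] by auto
 have "8 * q = (\<Sum>f\<in>FF. if xp (bd f) = {} then 0 else 2)" unfolding sum_xp_all[OF T(1), symmetric] by (rule sum.cong[OF refl s])
 also have "\<dots> = (\<Sum>f\<in>{f\<in>FF. xp (bd f) ~= {}}. 2)" using sum.inter_filter[OF finFF, of "\<lambda>_. 2::nat" "\<lambda>f. xp (bd f) ~= {}"] by (simp only:) (rule sum.cong, simp_all)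
 finally have c: "card {f\<in>FF. xp (bd f) ~= {}} = 4 * q" by simp
 have "card FF = card {f\<in>FF. xp (bd f) = {}} + card {f\<in>FF. xp (bd f) ~= {}}" by (rule card_filter_split[OF finFF])
 thus ?thesis using c cF by linarith
qed

lemma all_kites:
 assumes nl: "\<forall>p\<in>pcs E. l p ~= r p" and 6: "\<forall>f\<in>FF. ws f = 6"
  and e: "e \<in> E" "m e ~= e" "y \<in> e" "y' \<in> m e"
 shows "{y, y'} \<in> unc" "y ~= y'"
proof -
 obtain a b c d f1 f2 f3 f4 where s: "a ~= b" "c ~= d" "e = {a, b}" "m e = {c, d}"
  "(e, a) \<in> bd f1" "(m e, c) \<in> bd f1" "(m e, c) \<in> bd f2" "(e, b) \<in> bd f2"
  "(e, b) \<in> bd f3" "(m e, d) \<in> bd f3" "(m e, d) \<in> bd f4" "(e, a) \<in> bd f4"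
  "f1 ~= f2" "f2 ~= f3" "f3 ~= f4" "f4 ~= f1" "{f1, f2, f3, f4} \<subseteq> FF" by (rule crossing_corners[OF nl e(1,2)])
 have w: "ws f1 = 6" "ws f2 = 6" "ws f3 = 6" "ws f4 = 6" using 6 s(17) by simp_all
 note k = kite[OF e(1,2)]
 show "{y, y'} \<in> unc" "y ~= y'" using e(3,4) s(3,4) k(1) s(5,6) w(1) s(8,7) w(2) s(9,10) w(3) s(12,11) w(4) k(2) by fastforce+
qed

lemma bd_sides:
 assumes "p \<in> bd f" shows "p \<in> pcs E" "f = l p \<or> f = r p"
 using assms by (auto simp: bd_def ecut_def)

lemma bd_intro:
 assumes "\<forall>p\<in>pcs E. l p ~= r p" "p \<in> pcs E" "f = l p \<or> f = r p" shows "p \<in> bd f" "f \<in> FF"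
proof -
 show b: "p \<in> bd f" using assms(1,2) assms(2,3) by (auto simp: bd_def ecut_def)
 thus "f \<in> FF" by (auto simp: FF_def faces_def bd_def)
qed

text \<open>Suppose that no uncrossed triangle touches \<open>v\<close>. A set of faces whose
  boundary avoids \<open>e\<close> contains both triangles or neither, so the parity argument
  colours the graph without \<open>e\<close>. Moreover at most half of the edges at \<open>v\<close>
  are spokes. As \<open>v\<close> dominates, \<open>colour_class_bound\<close> yields q + 3 \<le> n
  - 1, against q + 3 = n.\<close>

lemma triangle_edge_uncoloured:
 assumes n: "4 \<le> card V" "card unc + q + 6 = 3 * card V" "q + 3 = card V" and v: "v \<in> V"
  and dom: "nb E v = V - {v}" and e: "e \<in> unc" "e = {a, b}" "\<And>f. f \<in> FF ==> (e, a) \<in> bd f ==> xp (bd f) = {}" "v \<notin> e"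
 shows "\<exists>f\<in>FF. xp (bd f) = {} \<and> e \<in> ue (bd f) \<and> (\<exists>e1\<in>ue (bd f). v \<in> e1)"
proof -
 note T = tight0[OF n(1,2)]
 have eE: "e \<in> E" "m e = e" using e(1) by (simp_all add: unc_def)
 have ea: "(e, a) \<in> pcs E" using eE e(2) by simp
 define g1 g2 where "g1 = l (e, a)" and "g2 = r (e, a)"
 have g: "(e, a) \<in> bd g1" "(e, a) \<in> bd g2" "g1 \<in> FF" "g2 \<in> FF" "g1 ~= g2" using bd_intro[OF T(1) ea] bspec[OF T(1) ea] by (simp_all add: g1_def g2_def)
 have xg: "xp (bd g1) = {}" "xp (bd g2) = {}" using e(3) g by simp_all
 have two: "{f \<in> FF. xp (bd f) = {}} = {g1, g2}"
 proof (rule card_subset_eq[symmetric])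
  show "finite {f \<in> FF. xp (bd f) = {}}" using finFF by simp
  show "{g1, g2} \<subseteq> {f \<in> FF. xp (bd f) = {}}" using g xg by simp
  show "card {g1, g2} = card {f \<in> FF. xp (bd f) = {}}" using two_triangles[OF n] g(5) by simp
 qed
 have ue: "e \<in> ue (bd g1)" "e \<in> ue (bd g2)" using bdD[OF g(1)] bdD[OF g(2)] xg by simp_all
 show ?thesis
 proof (rule ccontr)
  assume no: "\<not> ?thesis"
  have nov: "v \<notin> e1" if f: "f \<in> FF" "xp (bd f) = {}" "e1 \<in> ue (bd f)" for f e1
  proof
   assume ve: "v \<in> e1"
   have "e \<in> ue (bd f)" using two f(1,2) ue by fastforce
   thus False using f(1) f(3) f(2) ve no by simp
  qed
  have hc: "card (spk v) \<le> card (cpk v)" by (rule spk_le_cpk[OF T]) (rule nov)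
  let ?B = "unc - {e}"
  have par: "even (\<Sum>f\<in>FF \<inter> S. ws f div 2)" if S: "ecut (pcs E) l r S \<subseteq> pcs ?B" for S
  proof -
   have "ecut (pcs E) l r S \<subseteq> pcs unc" using S pcs_mono[of ?B unc] by blast
   from saturated[OF T(1) this] obtain k where k: "(\<Sum>f\<in>FF \<inter> S. card (xp (bd f))) = 8 * k" by (elim exE)
   have "(e, a) \<notin> ecut (pcs E) l r S" using subsetD[OF S, of "(e, a)"] by auto
   hence gS: "g1 \<in> S \<longleftrightarrow> g2 \<in> S" using ea by (simp add: ecut_def g1_def g2_def)
   let ?W0 = "{f \<in> FF \<inter> S. xp (bd f) = {}}" and ?W2 = "{f \<in> FF \<inter> S. xp (bd f) ~= {}}"
   have fin: "finite (FF \<inter> S)" using finFF by simp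
   have "?W0 = {g1, g2} \<inter> S" using two by blast
   moreover have "card ({g1, g2} \<inter> S) = 0 \<or> card ({g1, g2} \<inter> S) = 2" using gS g(5) by (cases "g1 \<in> S") simp_all
   ultimately have W0: "card ?W0 = 0 \<or> card ?W0 = 2" by (simp only:)
   have "(\<Sum>f\<in>FF \<inter> S. card (xp (bd f))) = (\<Sum>f\<in>FF \<inter> S. if xp (bd f) ~= {} then 2 else 0)"
   proof (rule sum.cong[OF refl])
    fix f assume "f \<in> FF \<inter> S"
    thus "card (xp (bd f)) = (if xp (bd f) ~= {} then 2 else 0)" using xs6[of f] T(2) xp_le[of f] by auto
   qed
   hence "2 * card ?W2 = 8 * k" using k sum.inter_filter[OF fin, of "\<lambda>_. 2::nat" "\<lambda>f. xp (bd f) ~= {}"] by simp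
   moreover have "card (FF \<inter> S) = card ?W0 + card ?W2" by (rule card_filter_split[OF fin])
   moreover have "(\<Sum>f\<in>FF \<inter> S. ws f div 2) = 3 * card (FF \<inter> S)" using T(2) by simp
   moreover have "even n" if "w0 = 0 \<or> w0 = 2" "2 * w2 = 8 * k" "c = w0 + w2" "n = 3 * c" for n w0 w2 c :: nat
   proof -
    show ?thesis using that by auto
   qed
   ultimately show ?thesis using W0 by blast
  qed
  obtain \<kappa> :: "'a => bool" where \<kappa>: "\<forall>e\<in>?B. \<forall>u\<in>e. \<forall>w\<in>e. u ~= w --> \<kappa> u ~= \<kappa> w" using uncrossed_colouring T(1) par by fastforce
  have \<kappa>c: "\<kappa> u ~= \<kappa> w" if c: "e' \<in> crs" "u \<in> e'" "w \<in> m e'" for e' u w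
  proof (rule crossing_colours[OF T(1), where B = ?B and Y = g1 and e = e'])
   show "ws g1 \<le> 8" using T(2) g(3) by simp
   show "\<forall>f\<in>FF. f ~= g1 --> ws f = 6" using T(2) by simp
   show "e' \<in> E" "m e' ~= e'" using c(1) by (simp_all add: crs_def)
   show "\<kappa> u ~= \<kappa> w" if "g \<in> ?B" "u \<in> g" "w \<in> g" "u ~= w" for g u w using bspec[OF bspec[OF bspec[OF \<kappa> that(1)] that(2)] that(3)] that(4) by (rule mp)
   show "ue (bd f) \<subseteq> ?B" if f: "f \<in> FF" "ws f = 6" "xp (bd f) ~= {}" for f
   proof
    fix e'' assume e'': "e'' \<in> ue (bd f)"
    show "e'' \<in> ?B" using e'' e(2) bdI e(3) f(1) f(3) ueD by (auto simp: unc_def)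
   qed
  qed (rule c)+
  have \<kappa>c': "\<forall>e\<in>crs. \<forall>u\<in>e. \<forall>w\<in>m e. \<kappa> u ~= \<kappa> w" by (intro ballI) (rule \<kappa>c)
  define D where "D = {e \<in> crs. \<forall>u\<in>e. \<kappa> u ~= \<kappa> v}"
  have "card D = q" unfolding D_def by (rule white_half(1)[OF \<kappa>c'])
  moreover have "card D = 0 \<or> card D + 3 \<le> 2 * card (spk v)"
  proof (rule colour_class_bound[OF v])
   show "D \<subseteq> crs" by (auto simp: D_def)
   show "m e' \<notin> D" if "e' \<in> D" for e' using white_half(2)[OF \<kappa>c' that[unfolded D_def]] unfolding D_def .
   fix e' u assume e': "e' \<in> D" "u \<in> e'"
   have ku: "\<kappa> u ~= \<kappa> v" using e' by (simp add: D_def)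
   hence uv: "u ~= v" by auto
   have "e' \<in> E" using e'(1) by (simp add: D_def crs_def)
   hence uvE: "{u, v} \<in> E" using edge e'(2) uv dom by (auto simp: nb_def)
   have "{u, v} \<notin> crs" using mono_crossing[OF \<kappa>c', of "{u, v}" u v] ku by auto
   thus "{u, v} \<in> spk v \<and> u ~= v" using uvE uv by (simp add: spk_def unc_def crs_def)
  qed
  moreover have "card V = card (nb E v) + 1" unfolding dom using v finV card.remove[of V v] by simp
  ultimately show False using card_nb[of v] hc n(1,3) by linarith
 qed
qed

text \<open>If the partner of \<open>e\<close> left \<open>N\<close>, then \<open>e\<close> would be
  uncrossed inside \<open>N\<close>. Neither face beside it would be a kite, since the rim of a kite
  is uncrossed in the whole graph too. So one of them is an uncrossed triangle at \<open>v\<close>.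
  The corresponding face of the whole graph at \<open>v\<close> is the same triangle, and its side
  \<open>e\<close> would be uncrossed there as well.\<close>

lemma crossing_stays:
 fixes \<mu> :: "'f => 'f" assumes nl: "\<forall>p\<in>pcs E. l p ~= r p" and 6: "\<forall>f\<in>FF. ws f = 6" and v: "v \<in> V"
  and N: "N = insert v (nb E v)" "EN = ind E N" and S: "nice N EN (subm m EN) (\<mu> \<circ> l) (\<mu> \<circ> r)"
  and c: "4 \<le> card N" "card (xgraph.unc EN (subm m EN)) + xgraph.q EN (subm m EN) + 6 = 3 * card N"
   "xgraph.q EN (subm m EN) + 3 = card N" and e: "e \<in> EN"
 shows "m e \<in> EN"
proof (rule ccontr)
 assume me: "m e \<notin> EN"
 interpret S: nice N EN "subm m EN" "\<mu> \<circ> l" "\<mu> \<circ> r" by (rule S)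
 note T = S.tight0[OF c(1,2)]
 have ENE: "EN \<subseteq> E" unfolding N(2) by (auto simp: ind_def)
 have ENI: "g \<in> EN" if "g \<in> E" "g \<subseteq> N" for g using that unfolding N(2) by (simp add: ind_def)
 have inN: "g \<in> EN" if g: "g \<in> E" "v \<in> g" for g using ENI edge2 g N(1) by (auto simp: nb_def)
 \<comment> \<open>An edge crossing an edge at \<open>v\<close> has its ends joined to
   \<open>v\<close> by the rims of the kites, hence stays in \<open>N\<close>.\<close>
 have vstay: "m g \<in> EN" if g: "g \<in> EN" "v \<in> g" for g
 proof (cases "m g = g")
  case False
  have gE: "g \<in> E" by (rule subsetD[OF ENE g(1)])
  show ?thesis
  proof (rule ENI[OF mE[OF gE]], rule subsetI)
   fix y assume "y \<in> m g"
   note k = all_kites[OF nl 6 gE False g(2) this]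
   thus "y \<in> N" unfolding N(1) by (simp add: nb_def unc_def insert_commute)
  qed
 qed (use g in simp)
 have eE: "e \<in> E" by (rule subsetD[OF ENE e])
 have ne: "m e ~= e" using me e by auto
 have sm: "subm m EN e = e" using me by (simp add: subm_def)
 have eS: "e \<in> S.unc" using e sm by (simp add: S.unc_def)
 have ve: "v \<notin> e" using vstay[OF e] me by auto
 obtain a b where ab: "a ~= b" "e = {a, b}" using edge_ex[OF eE] by (elim exE conjE)
 have x0: "S.xp (S.bd f) = {}" if f: "f \<in> S.FF" "(e, a) \<in> S.bd f" for f
 proof (rule ccontr)
  assume x: "S.xp (S.bd f) ~= {}"
  have w6: "S.ws f = 6" using T(2) f(1) by (rule bspec)
  obtain h y y' where h: "h \<in> EN" "subm m EN h ~= h" "S.ue (S.bd f) = {{y, y'}}" "y \<in> h" "y' \<in> subm m EN h"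
   "S.xp (S.bd f) = {(h, y), (subm m EN h, y')}" by (rule S.face6_two[OF w6 x])
  have sh: "subm m EN h = m h" "m h ~= h" using h(2) by (simp_all add: subm_def split: if_splits)
  have "(e, a) \<notin> S.xp (S.bd f)" using sm by (simp add: S.xp_def)
  hence "e = {y, y'}" using S.bdD f(2) h(3) by auto
  moreover have "{y, y'} \<in> unc" using all_kites(1)[OF nl 6 subsetD[OF ENE h(1)] sh(2) h(4)] h(5) sh(1) by simp
  ultimately show False using ne by (simp add: unc_def)
 qed
 have nbN: "nb EN v = N - {v}" using ENE N(1) inN by (auto simp: nb_def)
 have vN: "v \<in> N" unfolding N(1) by simp
 have "\<exists>f\<in>S.FF. S.xp (S.bd f) = {} \<and> e \<in> S.ue (S.bd f) \<and> (\<exists>e1\<in>S.ue (S.bd f). v \<in> e1)" by (rule S.triangle_edge_uncoloured[OF c vN nbN eS ab(2) _ ve]) (rule x0)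
 then obtain f e1 where f: "f \<in> S.FF" "S.xp (S.bd f) = {}" "e \<in> S.ue (S.bd f)" "e1 \<in> S.ue (S.bd f)" "v \<in> e1" by (elim bexE conjE)
 have unc_v: "m g = g \<and> g \<in> EN" if g: "g \<in> S.ue (S.bd f)" "v \<in> g" for g by (metis S.ueD g(1) vstay g(2) subm_def)
 have e1: "m e1 = e1" "e1 \<in> EN" using unc_v[OF f(4,5)] by simp_all
 have e1E: "e1 \<in> E" by (rule subsetD[OF ENE e1(2)])
 obtain u1 where u1: "u1 ~= v" "e1 = {v, u1}" using edge2[OF e1E f(5)] by (elim exE conjE)
 have "(e1, v) \<in> S.bd f" by (rule S.bdI[OF f(4,5)])
 \<comment> \<open>\<open>f\<close> may be a union of faces of the whole graph; \<phi> is the one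
   next to \<open>e1\<close>.\<close>
 then obtain \<phi> where \<phi>: "f = \<mu> \<phi>" "\<phi> = l (e1, v) \<or> \<phi> = r (e1, v)" using S.bd_sides(2) by fastforce
 have e1p: "(e1, v) \<in> pcs E" using e1E f(5) by simp
 note b1 = bd_intro[OF nl e1p \<phi>(2)]
 obtain g where g: "g ~= e1" "(g, v) \<in> bd \<phi>" using pcyc_V[OF bd_sub bd_cyc b1(1)] by (elim exE conjE)
 have gE: "g \<in> E" "v \<in> g" using bd_sides(1)[OF g(2)] by simp_all
 have gEN: "g \<in> EN" by (rule inN[OF gE])
 have "f = (\<mu> \<circ> l) (g, v) \<or> f = (\<mu> \<circ> r) (g, v)" using bd_sides(2)[OF g(2)] \<phi>(1) by auto
 hence gue: "g \<in> S.ue (S.bd f)" using gEN gE S.bd_intro(1) T(1) S.bdD f(2) by fastforce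
 have mg: "m g = g" using unc_v[OF gue gE(2)] by simp
 obtain u2 where u2: "u2 ~= v" "g = {v, u2}" using edge2[OF gE] by (elim exE conjE)
 have u12: "u1 ~= u2" using g(1) u1(2) u2(2) by auto
 have w6: "ws \<phi> = 6" using 6 b1(2) by (rule bspec)
 have ue1: "e1 \<in> ue (bd \<phi>)" using bdD[OF b1(1)] e1(1) by (simp add: xp_def)
 have ue2: "g \<in> ue (bd \<phi>)" using bdD[OF g(2)] mg by (simp add: xp_def)
 have x\<phi>: "xp (bd \<phi>) = {}"
 proof (rule ccontr)
  assume "xp (bd \<phi>) ~= {}"
  then obtain y y' where "ue (bd \<phi>) = {{y, y'}}" using face6_two[OF w6] by metis
  thus False using ue1 ue2 g(1) by simp
 qed
 have "ue (bd \<phi>) = {{v, u1}, {v, u2}, {u1, u2}}" using ue1 ue2 u1 u2 u12 by (intro triangle_face[OF x\<phi> w6]) simp_all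
 moreover have "S.ue (S.bd f) = {{v, u1}, {v, u2}, {u1, u2}}" using f(4) gue u1 u2 u12 bspec[OF T(2) f(1)] by (intro S.triangle_face[OF f(2)]) simp_all
 hence "e = {u1, u2}" using f(3) ve by auto
 ultimately show False using ueD ne by auto
qed

end

section \<open>Separations from attached trees\<close>

lemma deg_Un:
 assumes "finite C" "finite D" "C \<inter> D = {}" shows "deg s t (C \<union> D) x = deg s t C x + deg s t D x"
proof -
 have "{a \<in> C \<union> D. f a = x} = {a \<in> C. f a = x} \<union> {a \<in> D. f a = x}" for f :: "'a => 'b" by auto
 moreover have "card ({a \<in> C. f a = x} \<union> {a \<in> D. f a = x}) = card {a \<in> C. f a = x} + card {a \<in> D. f a = x}"
  for f :: "'a => 'b" using assms by (intro card_Un_disjoint) auto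
 ultimately show ?thesis by (simp add: deg_def)
qed

lemma deg_outside: "s ` C \<union> t ` C \<subseteq> K ==> x \<notin> K ==> deg s t C x = 0"
proof -
 assume K: "s ` C \<union> t ` C \<subseteq> K" "x \<notin> K"
 have "{a \<in> C. s a = x} = {}" "{a \<in> C. t a = x} = {}" using K by auto
 thus ?thesis unfolding deg_def by (simp only: card.empty)
qed

text \<open>The tree grows by one edge at a time. The new node is a leaf, so no cycle contains the
  new edge.\<close>

lemma spanning_tree:
 assumes fin: "finite B" "finite K" and K: "x0 \<in> K" "s ` B \<union> t ` B \<subseteq> K"
  and conn: "\<And>x. x \<in> K ==> (x0, x) \<in> {(x, y). \<exists>b\<in>B. (x = s b \<and> y = t b) \<or> (x = t b \<and> y = s b)}\<^sup>*"
 shows "\<exists>T \<subseteq> B. card T + 1 = card K \<and> (\<forall>C \<subseteq> T. cyc s t C --> C = {})"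
proof -
 let ?R = "{(x, y). \<exists>b\<in>B. (x = s b \<and> y = t b) \<or> (x = t b \<and> y = s b)}"
 have "\<exists>T L. T \<subseteq> B \<and> x0 \<in> L \<and> L \<subseteq> K \<and> card L = Suc k \<and> card T = k \<and> s ` T \<union> t ` T \<subseteq> L \<and> (\<forall>C \<subseteq> T. cyc s t C --> C = {})"
  if "Suc k \<le> card K" for k using that
 proof (induction k)
  case 0
  show ?case using K(1) by (intro exI[of _ "{}"] exI[of _ "{x0}"]) auto
 next
  case (Suc k)
  have "Suc k \<le> card K" using Suc.prems by simp
  from Suc.IH[OF this] obtain T L where TL: "T \<subseteq> B" "x0 \<in> L" "L \<subseteq> K" "card L = Suc k" "card T = k"
   "s ` T \<union> t ` T \<subseteq> L" "\<forall>C \<subseteq> T. cyc s t C --> C = {}" by (elim exE conjE)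
  have finL: "finite L" "finite T" using TL fin finite_subset by blast+
  have "L ~= K" using TL(4) Suc.prems by auto
  then obtain z where z: "z \<in> K" "z \<notin> L" using TL(3) by blast
  have "\<exists>x y. x \<in> L \<and> y \<notin> L \<and> (x, y) \<in> ?R" using conn rtrancl_induct TL(2) z by fastforce
  then obtain x y where xy: "x \<in> L" "y \<notin> L" "(x, y) \<in> ?R" by (elim exE conjE)
  then obtain b where b: "b \<in> B" "(x = s b \<and> y = t b) \<or> (x = t b \<and> y = s b)" by blast
  have bT: "b \<notin> T" using TL(6) b(2) xy(2) by blast
  have yK: "y \<in> K" using K(2) b by blast
  have ac: "C = {}" if C: "C \<subseteq> insert b T" "cyc s t C" for C
  proof (cases "b \<in> C")
   case True
   have finC: "finite (C - {b})" using C(1) finL(2) by (meson finite_Diff finite_insert finite_subset)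
   have "deg s t (C - {b} \<union> {b}) y = deg s t (C - {b}) y + deg s t {b} y" using finC by (intro deg_Un) auto
   moreover have "deg s t (C - {b}) y = 0" by (rule deg_outside[OF _ xy(2)]) (use C(1) TL(6) in blast)
   moreover have "deg s t {b} y = 1"
   proof -
    have "x ~= y" using xy by auto
    moreover have "{a \<in> {b}. f a = y} = (if f b = y then {b} else {})" for f by auto
    ultimately show ?thesis using b(2) by (auto simp: deg_def)
   qed
   moreover have "C - {b} \<union> {b} = C" using True by blast
   ultimately have "odd (deg s t C y)" by simp
   thus ?thesis using C(2) by (simp add: cyc_def)
  next
   case False
   thus ?thesis using C(1) TL(7) C(2) by auto
  qed
  show ?case
  proof (intro exI[of _ "insert b T"] exI[of _ "insert y L"] conjI allI impI)
   show "insert b T \<subseteq> B" "insert y L \<subseteq> K" using TL b(1) yK by simp_all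
   show "x0 \<in> insert y L" using TL by simp
   show "card (insert y L) = Suc (Suc k)" "card (insert b T) = Suc k" using TL(4,5) bT xy(2) finL by simp_all
   show "s ` insert b T \<union> t ` insert b T \<subseteq> insert y L" using TL(6) b(2) xy(1) by auto
  qed (rule ac)
 qed
 note ex = this
 have "card K ~= 0" using K(1) fin(2) by auto
 hence k: "Suc (card K - 1) = card K" by simp
 then obtain T L where TL: "T \<subseteq> B" "card T = card K - 1" "\<forall>C \<subseteq> T. cyc s t C --> C = {}" using ex[of "card K - 1"] by auto
 show ?thesis using TL k by (intro exI[of _ T]) simp
qed

text \<open>Parity bookkeeping for a graph on \<open>N1\<close> to which the tree \<open>T\<close>
  on \<open>K\<close> is attached by the elements of \<open>B\<close>. Summing degrees over
  \<open>K\<close> shows that a cycle uses an even number of attachments; if it uses none, it cannot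
  enter the tree.\<close>

lemma attached_tree:
 assumes fin: "finite A1" "finite T" "finite B"
  and ends: "s ` A1 \<union> t ` A1 \<subseteq> N1" "s ` T \<union> t ` T \<subseteq> K" "s ` B \<subseteq> N1" "t ` B \<subseteq> K" "N1 \<inter> K = {}" "finite K" and ac: "\<forall>C \<subseteq> T. cyc s t C --> C = {}"
  and C: "C \<subseteq> A1 \<union> T \<union> B" "cyc s t C" and dj: "T \<inter> B = {}" "A1 \<inter> T = {}" "A1 \<inter> B = {}"
 shows "even (card (C \<inter> B))" "C \<inter> B = {} ==> C \<subseteq> A1"
  "x \<in> N1 ==> even (deg s t (C \<inter> A1) x) \<longleftrightarrow> even (card {b \<in> C \<inter> B. s b = x})"
proof -
 have fC: "finite (C \<inter> A1)" "finite (C \<inter> T)" "finite (C \<inter> B)" "finite C" using fin finite_subset[OF C(1)] by simp_all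
 have split: "deg s t C x = deg s t (C \<inter> A1) x + (deg s t (C \<inter> T) x + deg s t (C \<inter> B) x)" for x
 proof -
  have "C = C \<inter> A1 \<union> (C \<inter> T \<union> C \<inter> B)" using C(1) by blast
  moreover have "deg s t (C \<inter> A1 \<union> (C \<inter> T \<union> C \<inter> B)) x = deg s t (C \<inter> A1) x + deg s t (C \<inter> T \<union> C \<inter> B) x" using fC dj by (intro deg_Un) auto
  moreover have "deg s t (C \<inter> T \<union> C \<inter> B) x = deg s t (C \<inter> T) x + deg s t (C \<inter> B) x" using fC dj by (intro deg_Un) auto
  ultimately show ?thesis by simp
 qed
 have A0: "deg s t (C \<inter> A1) x = 0" if "x \<in> K" for x by (rule deg_outside[where K = N1]) (use ends that in auto)
 have T0: "deg s t (C \<inter> T) x = 0" if "x \<notin> K" for x by (rule deg_outside[where K = K]) (use ends that in auto)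
 have even: "even (deg s t C x)" for x using C(2) by (simp add: cyc_def)
 have s0: "{b \<in> C \<inter> B. s b = x} = {}" if "x \<in> K" for x using ends that by auto
 have t0: "{b \<in> C \<inter> B. t b = x} = {}" if "x \<in> N1" for x using ends that by auto
 have BK: "deg s t (C \<inter> B) x = card {b \<in> C \<inter> B. t b = x}" if "x \<in> K" for x unfolding deg_def by (simp only: s0[OF that] card.empty add_0)
 have sumT: "(\<Sum>x\<in>K. deg s t (C \<inter> T) x) = 2 * card (C \<inter> T)" by (rule sum_deg) (use fC ends in auto)
 have sumB: "(\<Sum>x\<in>K. card {b \<in> C \<inter> B. t b = x}) = card (C \<inter> B)" using sum.group[OF fC(3) ends(6), of t "\<lambda>_. 1::nat"] ends(4) by (simp add: image_subset_iff)
 have "even (\<Sum>x\<in>K. deg s t (C \<inter> T) x + deg s t (C \<inter> B) x)"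
 proof (rule dvd_sum)
  fix x assume "x \<in> K"
  thus "even (deg s t (C \<inter> T) x + deg s t (C \<inter> B) x)" using even[of x] split[of x] A0 by simp
 qed
 thus "even (card (C \<inter> B))" using sumT sumB BK by (simp add: sum.distrib)
 show "even (deg s t (C \<inter> A1) x) \<longleftrightarrow> even (card {b \<in> C \<inter> B. s b = x})" if x: "x \<in> N1"
 proof -
  have "x \<notin> K" using x ends by auto
  moreover have "deg s t (C \<inter> B) x = card {b \<in> C \<inter> B. s b = x}" unfolding deg_def by (simp only: t0[OF x] card.empty add_0_right)
  ultimately show ?thesis using even[of x] split[of x] T0[of x] by simp
 qed
 show "C \<subseteq> A1" if B: "C \<inter> B = {}"
 proof -
  have "even (deg s t (C \<inter> T) x)" for x
  proof (cases "x \<in> K")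
   case True
   thus ?thesis using even[of x] split[of x] A0[of x] B by simp
  qed (simp add: T0)
  hence "C \<inter> T = {}" using ac by (simp add: cyc_def)
  thus ?thesis using B C(1) by blast
 qed
qed

text \<open>The case of equality in \<open>euler_weighted\<close>: no weight may be lost on elements
  with equal sides or on heavier faces.\<close>

lemma euler_tight:
 fixes w :: "'e => nat" assumes "dualpair A s t l r" "finite A" "finite N" "N ~= {}" "s ` A \<union> t ` A \<subseteq> N"
  and g: "\<And>C. C \<subseteq> A ==> cyc s t C ==> C ~= {} ==> g \<le> sum w C" and nf: "card N \<le> card A" and eq: "2 * sum w A + g * card N \<le> g * (card A + 2)"
 shows "a \<in> A ==> l a = r a ==> w a = 0" "f \<in> faces A l r ==> sum w (ecut A l r {f}) = g"
proof -
 have False: "faces A l r ~= {}" using dualpair_euler_forest[OF assms(1-5)] nf by auto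
 have gf: "g \<le> sum w (ecut A l r {f})" if "f \<in> faces A l r" for f using that by (intro g cut_subset dualpairD[OF assms(1)]) (simp add: faces_def)
 have fin: "finite (faces A l r)" by (rule finite_faces[OF assms(2)])
 have "g * card (faces A l r) = (\<Sum>f\<in>faces A l r. g)" by simp
 also have "\<dots> \<le> (\<Sum>f\<in>faces A l r. sum w (ecut A l r {f}))" by (intro sum_mono gf)
 finally have 1: "g * card (faces A l r) \<le> (\<Sum>f\<in>faces A l r. sum w (ecut A l r {f}))" .
 have 2: "(\<Sum>f\<in>faces A l r. sum w (ecut A l r {f})) = 2 * (\<Sum>a\<in>{a\<in>A. l a ~= r a}. w a)" by (rule sum_faces[OF assms(2)])
 have 3: "sum w {a\<in>A. l a ~= r a} \<le> sum w A" using assms(2) by (intro sum_mono2) auto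
 have 4: "g * (card A + 2) \<le> g * card (faces A l r) + g * card N" by (metis dualpair_euler assms(1-5) False add_mult_distrib2 mult_le_mono2)
 have 5: "sum w {a\<in>A. l a ~= r a} = sum w A" and 6: "(\<Sum>f\<in>faces A l r. sum w (ecut A l r {f})) = g * card (faces A l r)" using 1 2 3 4 eq by linarith+
 show "sum w (ecut A l r {f}) = g" if "f \<in> faces A l r" using 6 by (intro sum_tight_lower[OF fin gf _ that]) (simp_all add: mult.commute)
 show "w a = 0" if "a \<in> A" "l a = r a"
 proof -
  have "w a + sum w {a\<in>A. l a ~= r a} = sum w (insert a {a\<in>A. l a ~= r a})" using assms(2) that by simp
  also have "\<dots> \<le> sum w A" using assms(2) that by (intro sum_mono2) auto
  finally show ?thesis using 5 by simp
 qed
qed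

context nice
begin

text \<open>The model is a vertex placed into a face of a triangulation: it has at most three
  neighbours, and three of them form a triangle. Instead of contracting \<open>Z\<close>, a tree
  through the pieces at \<open>Z\<close> is attached to the pieces of \<open>EN\<close>, with one
  piece leading to each vertex of \<open>J\<close>.\<close>

lemma component_attachments:
 assumes EN: "EN \<subseteq> E" "\<And>e. e \<in> EN ==> m e \<in> EN" "\<And>e. e \<in> EN ==> e \<subseteq> N" and N: "N \<subseteq> V"
  and c: "4 \<le> card N" "card (xgraph.unc EN m) + xgraph.q EN m + 6 = 3 * card N" and Z: "z0 \<in> Z" "Z \<inter> N = {}"
   "\<And>z. z \<in> Z ==> (z0, z) \<in> {(x, y). {x, y} \<in> E \<and> x \<in> Z \<and> y \<in> Z}\<^sup>*" and J: "J = {a \<in> N. \<exists>z\<in>Z. {a, z} \<in> E}" and ZV: "Z \<subseteq> V"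
 shows "card J \<le> 3" "card J = 3 ==> a \<in> J ==> b \<in> J ==> a ~= b ==> {a, b} \<in> EN"
proof -
 let ?t = "ptgt m" and ?A1 = "pcs EN"
 have xg: "xgraph N EN m"
 proof
  show "finite N" by (rule finite_subset[OF N finV])
  fix e assume e: "e \<in> EN"
  show "e \<subseteq> N \<and> card e = 2" using EN(3)[OF e] edge[OF subsetD[OF EN(1) e]] by simp
  show "m e \<in> EN" by (rule EN(2)[OF e])
  show "m (m e) = e" by (rule mm[OF subsetD[OF EN(1) e]])
 qed
 obtain \<mu> :: "'f => 'f" where \<mu>: "dualpair (pcs EN) psrc ?t (\<mu> \<circ> l) (\<mu> \<circ> r)" using dualpair_subset[OF dual finP pcs_mono[OF EN(1)]] by (elim exE)
 interpret S: oneplane N EN m "\<mu> \<circ> l" "\<mu> \<circ> r" using xg \<mu> by (simp add: oneplane_def oneplane_axioms_def)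
 define B where "B = {p \<in> pcs E. snd p \<in> Z}"
 have finB: "finite B" using finP by (simp add: B_def)
 define K where "K = Inl ` Z \<union> ?t ` B"
 have finZ: "finite Z" by (rule finite_subset[OF ZV finV])
 have finK: "finite K" using finB finZ by (simp add: K_def)
 have Bin: "(e, z) \<in> B" if "e \<in> E" "z \<in> e" "z \<in> Z" for e z using that by (simp add: B_def)
 have Bends: "psrc ` B \<union> ?t ` B \<subseteq> K" by (auto simp: K_def B_def psrc_def)
 let ?R = "{(x, y). \<exists>b\<in>B. (x = psrc b \<and> y = ?t b) \<or> (x = ?t b \<and> y = psrc b)}"
 have RI: "(Inl z, ?t (e, z)) \<in> ?R" "(?t (e, z), Inl z) \<in> ?R" if "(e, z) \<in> B" for e z using that by (auto simp: psrc_def intro!: bexI[of _ "(e, z)"])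
 have conn1: "(Inl z0, Inl z) \<in> ?R\<^sup>*" if "z \<in> Z" for z using Z(3)[OF that]
 proof (induction rule: rtrancl_induct)
  case (step x y)
  have xy: "{x, y} \<in> E" "x \<in> Z" "y \<in> Z" using step.hyps(2) by simp_all
  have "(Inl x, ?t ({x, y}, x)) \<in> ?R" by (rule RI(1)[OF Bin[OF xy(1) _ xy(2)]]) simp
  moreover have "(?t ({x, y}, y), Inl y) \<in> ?R" by (rule RI(2)[OF Bin[OF xy(1) _ xy(3)]]) simp
  moreover have "?t ({x, y}, y) = ?t ({x, y}, x)" by (simp add: ptgt_def)
  ultimately show ?case using step.IH by (metis (no_types, lifting) rtrancl.rtrancl_into_rtrancl)
 qed simp
 have conn: "(Inl z0, x) \<in> ?R\<^sup>*" if "x \<in> K" for x using that unfolding K_def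
 proof (elim UnE imageE)
  fix p assume p: "x = ?t p" "p \<in> B"
  have "(Inl (snd p), x) \<in> ?R" using RI(1)[of "fst p" "snd p"] p by simp
  moreover have "snd p \<in> Z" using p(2) by (simp add: B_def)
  ultimately show ?thesis using conn1[of "snd p"] by (metis (no_types, lifting) rtrancl.rtrancl_into_rtrancl)
 qed (use conn1 in simp)
 have z0K: "Inl z0 \<in> K" using Z(1) by (simp add: K_def)
 obtain T where T: "T \<subseteq> B" "card T + 1 = card K" "\<forall>C \<subseteq> T. pcyc m C --> C = {}" using spanning_tree[OF finB finK z0K Bends] conn by blast
 have "\<exists>z. z \<in> Z \<and> {a, z} \<in> E" if "a \<in> J" for a using that unfolding J by blast
 then obtain zf where zf: "\<And>a. a \<in> J ==> zf a \<in> Z" "\<And>a. a \<in> J ==> {a, zf a} \<in> E" by metis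
 define \<alpha> where "\<alpha> = (\<lambda>a. ({a, zf a}, a))"
 define Q where "Q = \<alpha> ` J"
 have JN: "J \<subseteq> N" unfolding J by blast
 have finJ: "finite J" by (rule finite_subset[OF JN S.finV])
 have \<alpha>inj: "\<alpha> a = \<alpha> b \<longleftrightarrow> a = b" for a b by (auto simp: \<alpha>_def)
 have cQ: "card Q = card J" "finite Q" unfolding Q_def using \<alpha>inj finJ by (auto simp: card_image inj_on_def)
 have QE: "p \<in> pcs E" if "p \<in> Q" for p using that zf by (auto simp: Q_def \<alpha>_def)
 have finT: "finite T" by (rule finite_subset[OF T(1) finB])
 have notEN: "e \<notin> EN" if "z \<in> e" "z \<in> Z" for e z using EN(3)[of e] that Z(2) by blast
 have dj: "T \<inter> Q = {}" "?A1 \<inter> T = {}" "?A1 \<inter> Q = {}"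
 proof -
  have "snd p \<in> Z" if "p \<in> T" for p using T(1) that by (auto simp: B_def)
  moreover have "snd p \<in> N" if "p \<in> Q" for p using that JN by (auto simp: Q_def \<alpha>_def)
  ultimately show "T \<inter> Q = {}" using Z(2) by blast
  have "fst p \<notin> EN" if p: "p \<in> T" for p using T(1) p notEN by (auto simp: B_def pcs_def)
  thus "?A1 \<inter> T = {}" by (auto simp: pcs_def)
  have "{a, zf a} \<notin> EN" if "a \<in> J" for a by (rule notEN[OF _ zf(1)[OF that]]) simp
  hence "fst p \<notin> EN" if "p \<in> Q" for p using that by (auto simp: Q_def \<alpha>_def)
  thus "?A1 \<inter> Q = {}" by (auto simp: pcs_def)
 qed
 let ?N1 = "Inl ` N \<union> ?t ` ?A1"
 have ends: "psrc ` ?A1 \<union> ?t ` ?A1 \<subseteq> ?N1" "psrc ` T \<union> ?t ` T \<subseteq> K" "psrc ` Q \<subseteq> ?N1" "?t ` Q \<subseteq> K"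
 proof -
  show "psrc ` ?A1 \<union> ?t ` ?A1 \<subseteq> ?N1" by (rule S.nodes(2))
  show "psrc ` T \<union> ?t ` T \<subseteq> K" using Bends T(1) by blast
  show "psrc ` Q \<subseteq> ?N1" using JN by (auto simp: Q_def \<alpha>_def psrc_def)
  have "?t (\<alpha> a) \<in> ?t ` B" if "a \<in> J" for a
  proof -
   have "({a, zf a}, zf a) \<in> B" using zf[OF that] by (intro Bin) simp_all
   moreover have "?t (\<alpha> a) = ?t ({a, zf a}, zf a)" by (simp add: ptgt_def \<alpha>_def)
   ultimately show ?thesis by (rule rev_image_eqI)
  qed
  thus "?t ` Q \<subseteq> K" by (auto simp: Q_def K_def)
 qed
 have NK: "?N1 \<inter> K = {}"
 proof -
  have "?t p ~= ?t p'" if p: "p \<in> ?A1" "p' \<in> B" for p p'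
  proof
   assume "?t p = ?t p'"
   hence "fst p' \<in> {fst p, m (fst p)}" by (simp add: ptgt_def)
   moreover have "fst p \<in> EN" using p(1) by (simp add: pcs_def)
   ultimately have "fst p' \<in> EN" using EN(2) by (elim insertE emptyE) simp_all
   moreover have "snd p' \<in> fst p'" "snd p' \<in> Z" using p(2) by (auto simp: B_def pcs_def)
   ultimately show False using notEN by simp
  qed
  thus ?thesis using Z(2) by (auto simp: K_def ptgt_def)
 qed
 let ?A = "?A1 \<union> T \<union> Q"
 have AE: "?A \<subseteq> pcs E" using pcs_mono[OF EN(1)] T(1) QE by (auto simp: B_def)
 obtain \<mu>' :: "'f => 'f" where \<mu>': "dualpair ?A psrc ?t (\<mu>' \<circ> l) (\<mu>' \<circ> r)" using dualpair_subset[OF dual finP AE] by (elim exE)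
 \<comment> \<open>The tree is free, so it acts like a single vertex. A cycle through the tree
   passes an even number of attachments; each costs 2, and 1 for a piece of \<open>EN\<close> at the
   same vertex, so two of them already cost 6.\<close>
 define w where "w = (\<lambda>p. if p \<in> Q then 2 else if p \<in> T then 0 else wt p)"
 have finA: "finite ?A" by (rule finite_subset[OF AE finP])
 have sw: "sum w C = sum wt (C \<inter> ?A1) + 2 * card (C \<inter> Q)" if C: "C \<subseteq> ?A" for C
 proof -
  have fC: "finite C" by (rule finite_subset[OF C finA])
  have "C = C \<inter> ?A1 \<union> (C \<inter> T \<union> C \<inter> Q)" using C by blast
  hence "sum w C = sum w (C \<inter> ?A1 \<union> (C \<inter> T \<union> C \<inter> Q))" by simp
  also have "\<dots> = sum w (C \<inter> ?A1) + sum w (C \<inter> T \<union> C \<inter> Q)" using fC dj by (intro sum.union_disjoint) auto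
  also have "sum w (C \<inter> T \<union> C \<inter> Q) = sum w (C \<inter> T) + sum w (C \<inter> Q)" using fC dj by (intro sum.union_disjoint) auto
  also have "sum w (C \<inter> ?A1) = sum wt (C \<inter> ?A1)" using dj by (intro sum.cong) (auto simp: w_def)
  also have "sum w (C \<inter> T) = 0" using dj(1) by (intro sum.neutral) (auto simp: w_def)
  also have "sum w (C \<inter> Q) = (\<Sum>p\<in>C \<inter> Q. 2)" by (intro sum.cong) (auto simp: w_def)
  finally show ?thesis by simp
 qed
 define Jc where "Jc = (\<lambda>C. {a \<in> J. \<alpha> a \<in> C})"
 have cJc: "card (C \<inter> Q) = card (Jc C)" for C
 proof -
  have "C \<inter> Q = \<alpha> ` Jc C" by (auto simp: Q_def Jc_def)
  thus ?thesis using \<alpha>inj by (simp add: card_image inj_on_def)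
 qed
 have at: "\<exists>e. (e, a) \<in> C \<inter> ?A1" if C: "C \<subseteq> ?A" "pcyc m C" and a: "a \<in> J" "\<alpha> a \<in> C" for C a
 proof -
  have aN: "Inl a \<in> ?N1" using a(1) JN by blast
  have "{b \<in> C \<inter> Q. psrc b = Inl a} = {\<alpha> a}" using a by (auto simp: Q_def psrc_def \<alpha>_def)
  hence "odd (deg psrc ?t (C \<inter> ?A1) (Inl a))" using attached_tree(3)[OF S.finP finT cQ(2) ends NK finK T(3) C dj aN] by simp
  hence "card {p \<in> C \<inter> ?A1. snd p = a} ~= 0" unfolding deg_Inl by (intro notI) simp
  hence "{p \<in> C \<inter> ?A1. snd p = a} ~= {}" by (intro notI) (simp only: card.empty)
  thus ?thesis by auto
 qed
 have wt1: "card D \<le> sum wt D" if "finite D" for D using sum_bounded_below[of D 1 wt] by (simp add: wt_def)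
 have big: "3 * card (Jc C) \<le> sum w C" if C: "C \<subseteq> ?A" "pcyc m C" for C
 proof -
  have "Jc C \<subseteq> snd ` (C \<inter> ?A1)"
  proof
   fix a assume "a \<in> Jc C"
   hence "\<exists>e. (e, a) \<in> C \<inter> ?A1" by (intro at[OF C]) (simp_all add: Jc_def)
   thus "a \<in> snd ` (C \<inter> ?A1)" by (auto intro: rev_image_eqI)
  qed
  hence "card (Jc C) \<le> card (C \<inter> ?A1)" using S.finP by (intro surj_card_le) simp_all
  thus ?thesis using sw[OF C(1)] cJc[of C] wt1[of "C \<inter> ?A1"] S.finP by simp
 qed
 have evJ: "even (card (Jc C))" if C: "C \<subseteq> ?A" "pcyc m C" for C using attached_tree(1)[OF S.finP finT cQ(2) ends NK finK T(3) C dj] cJc by simp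
 have girth: "6 \<le> sum w C" if C: "C \<subseteq> ?A" "pcyc m C" "C ~= {}" for C
 proof (cases "card (Jc C) = 0")
  case True
  hence "C \<inter> Q = {}" using cJc[of C] cQ(2) by simp
  hence CA: "C \<subseteq> ?A1" by (rule attached_tree(2)[OF S.finP finT cQ(2) ends NK finK T(3) C(1,2) dj])
  have "6 \<le> sum wt C" using S.girth6 CA C(2,3) nonadj EN(1) by blast
  moreover have "C \<inter> ?A1 = C" using CA by blast
  ultimately show ?thesis using sw[OF C(1)] by simp
 next
  case False
  moreover have "card (Jc C) ~= 1" using evJ[OF C(1,2)] by auto
  ultimately have "2 \<le> card (Jc C)" by linarith
  thus ?thesis using big[OF C(1,2)] by linarith
 qed
 let ?NA = "?N1 \<union> K"
 have NA: "finite ?NA" "?NA ~= {}" "psrc ` ?A \<union> ?t ` ?A \<subseteq> ?NA"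
 proof -
  show "finite ?NA" by (rule finite_UnI[OF S.nodes(1) finK])
  show "?NA ~= {}" using z0K by (intro notI) simp
  show "psrc ` ?A \<union> ?t ` ?A \<subseteq> ?NA" unfolding image_Un using ends by (intro Un_least) (simp_all add: le_supI1 le_supI2)
 qed
 have cNA: "card ?NA = card N + card S.unc + S.q + card K" using S.nodes(1,3) finK NK by (subst card_Un_disjoint) simp_all
 have cA: "card ?A + 1 = 2 * card S.unc + 4 * S.q + card K + card J"
 proof -
  have "card ?A = card ?A1 + card T + card Q" using S.finP finT cQ(2) dj by (subst card_Un_disjoint; auto)+
  thus ?thesis using T(2) cQ(1) S.card_pcs S.card_E by simp
 qed
 have swA: "sum w ?A = 2 * card S.unc + 8 * S.q + 2 * card J"
 proof -
  have "?A \<inter> ?A1 = ?A1" "?A \<inter> Q = Q" by blast+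
  thus ?thesis using sw[OF subset_refl] S.sum_wt cQ(1) by simp
 qed
 have nf: "card ?NA \<le> card ?A" using cNA cA c by linarith
 have "6 * (card ?A + 2) \<le> 2 * sum w ?A + 6 * card ?NA \<or> card ?A + 1 \<le> card ?NA" by (rule euler_weighted[OF \<mu>' finA NA]) (rule girth)
 moreover have six: "6 * (x + 2) = 6 * x + 12" for x :: nat by simp
 ultimately show le3: "card J \<le> 3" using nf cNA cA swA c unfolding six by linarith
 assume J3: "card J = 3"
 \<comment> \<open>Three attachments exhaust Euler's inequality, so every face now weighs exactly
   6.\<close>
 have eq: "2 * sum w ?A + 6 * card ?NA \<le> 6 * (card ?A + 2)" using cNA cA swA c J3 unfolding six by linarith
 let ?l = "\<mu>' \<circ> l" and ?r = "\<mu>' \<circ> r"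
 have nl0: "w a = 0" if "a \<in> ?A" "?l a = ?r a" for a by (rule euler_tight(1)[OF \<mu>' finA NA _ nf eq that]) (rule girth)
 have all6: "sum w (ecut ?A ?l ?r {f}) = 6" if "f \<in> faces ?A ?l ?r" for f by (rule euler_tight(2)[OF \<mu>' finA NA _ nf eq that]) (rule girth)
 let ?bd = "\<lambda>f. ecut ?A ?l ?r {f}"
 have lr: "?l (\<alpha> a) ~= ?r (\<alpha> a)" if "a \<in> J" for a
 proof
  assume "?l (\<alpha> a) = ?r (\<alpha> a)"
  moreover have "\<alpha> a \<in> Q" using that by (simp add: Q_def)
  ultimately show False using nl0 by (fastforce simp: w_def)
 qed
 \<comment> \<open>Two attachments take weight 4 of the face and leave 2 for \<open>EN\<close>: one
   uncrossed half at each of the two vertices. Parity at the midpoint node makes them halves of the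
   same edge.\<close>
 have partner: "\<exists>b\<in>J. b ~= a \<and> Jc (?bd f) = {a, b} \<and> {a, b} \<in> EN" if a: "a \<in> J" "\<alpha> a \<in> ?bd f" for a f
 proof -
  let ?C = "?bd f" let ?D = "?C \<inter> ?A1"
  have C: "?C \<subseteq> ?A" "pcyc m ?C" by (rule cut_subset, rule dualpairD[OF \<mu>'])
  have w6: "sum w ?C = 6" using a(2) all6 by (auto simp: faces_def)
  have aJ: "a \<in> Jc ?C" using a by (simp add: Jc_def)
  have finJc: "finite (Jc ?C)" using finJ by (simp add: Jc_def)
  have "card (Jc ?C) ~= 0" using aJ finJc by auto
  moreover have "card (Jc ?C) ~= 1" using evJ[OF C] by auto
  ultimately have J2: "card (Jc ?C) = 2" using big[OF C] w6 by linarith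
  then obtain b where b: "Jc ?C = {a, b}" "a ~= b"
  proof -
   have "card (Jc ?C - {a}) = 1" using J2 aJ finJc by simp
   then obtain b where "Jc ?C - {a} = {b}" by (rule card_1_singletonE)
   thus ?thesis using aJ that by auto
  qed
  have bJ: "b \<in> J" "\<alpha> b \<in> ?C" using b by (auto simp: Jc_def)
  obtain e where e: "(e, a) \<in> ?D" using at[OF C a] by (elim exE)
  obtain e' where e': "(e', b) \<in> ?D" using at[OF C bJ] by (elim exE)
  have sD: "sum wt ?D = 2" using sw[OF C(1)] cJc[of ?C] J2 w6 by simp
  have finD: "finite ?D" using S.finP by simp
  have eb: "(e, a) ~= (e', b)" using b(2) by simp
  have "sum wt {(e, a), (e', b)} + sum wt (?D - {(e, a), (e', b)}) = sum wt ?D" using finD e e' by (subst add.commute, intro sum.subset_diff[symmetric]) simp_all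
  hence "wt (e, a) + wt (e', b) + sum wt (?D - {(e, a), (e', b)}) = 2" using eb sD by simp
  moreover have "1 \<le> wt (e, a)" "1 \<le> wt (e', b)" by (simp_all add: wt_def)
  ultimately have w1: "wt (e, a) = 1" "sum wt (?D - {(e, a), (e', b)}) = 0" by linarith+
  have "card (?D - {(e, a), (e', b)}) = 0" using wt1[of "?D - {(e, a), (e', b)}"] w1(2) finD by simp
  hence D: "?D = {(e, a), (e', b)}" using finD e e' by auto
  have me: "m e = e" using w1(1) by (simp add: wt_def split: if_splits)
  have eEN: "e \<in> EN" "a \<in> e" "e' \<in> EN" "b \<in> e'" using e e' by simp_all
  have "?t (e, a) \<in> ?N1" using eEN by (intro UnI2 imageI) simp
  hence "Inr {e} \<in> ?N1" by (simp only: ptgt_def fst_conv me insert_absorb2)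
  note par = attached_tree(3)[OF S.finP finT cQ(2) ends NK finK T(3) C dj this]
  have "even (deg psrc ?t ?D (Inr {e}))" using par by (simp add: psrc_def)
  hence ev: "even (card {p \<in> {(e, a), (e', b)}. {fst p, m (fst p)} = {e}})" unfolding deg_Inr D .
  have "e' = e"
  proof (rule ccontr)
   assume ne: "e' ~= e"
   have "{fst p, m (fst p)} = {e} \<longleftrightarrow> p = (e, a)" if p: "p \<in> {(e, a), (e', b)}" for p using p ne by (fastforce simp: me)
   hence "{p \<in> {(e, a), (e', b)}. {fst p, m (fst p)} = {e}} = {p \<in> {(e, a), (e', b)}. p = (e, a)}" by (intro Collect_cong conj_cong refl)
   also have "\<dots> = {(e, a)}" by blast
   finally show False using ev by simp
  qed
  hence "{a, b} \<subseteq> e" using eEN by simp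
  moreover have "card e = 2" using S.edge[OF eEN(1)] by simp
  ultimately have "{a, b} = e" using b(2) by (intro card_subset_eq) (simp_all add: card_ge_0_finite)
  thus ?thesis using b bJ(1) eEN(1) by (intro bexI[of _ b]) simp_all
 qed
 have faces\<alpha>: "\<alpha> a \<in> ?bd f \<longleftrightarrow> f = ?l (\<alpha> a) \<or> f = ?r (\<alpha> a)" if "a \<in> J" for a f
 proof -
  show ?thesis using that lr by (fastforce simp: Q_def ecut_def)
 qed
 assume ab: "a \<in> J" "b \<in> J" "a ~= b"
 show "{a, b} \<in> EN"
 proof (rule ccontr)
  assume no: "{a, b} \<notin> EN"
  obtain c where c: "c ~= a" "c ~= b" "J = {a, b, c}"
  proof -
   have "card (J - {a, b}) = 1" using J3 ab finJ by (simp add: card_Diff_subset)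
   then obtain c where "J - {a, b} = {c}" by (rule card_1_singletonE)
   thus ?thesis using that[of c] ab by blast
  qed
  \<comment> \<open>If \<open>a\<close> and \<open>b\<close> are not adjacent, both faces at
    \<open>a\<close> are shared with \<open>c\<close> and hence are both faces at \<open>c\<close>.
    No face is left for \<open>b\<close>.\<close>
  let ?f1 = "?l (\<alpha> a)" and ?f2 = "?r (\<alpha> a)"
  have p: "Jc (?bd f) = {a, c}" if f: "f = ?f1 \<or> f = ?f2" for f using partner faces\<alpha> f no c(3) by auto
  have cf: "f = ?l (\<alpha> c) \<or> f = ?r (\<alpha> c)" if "f = ?f1 \<or> f = ?f2" for f
  proof -
   show ?thesis using p that faces\<alpha> by (auto simp: Jc_def)
  qed
  let ?g = "?l (\<alpha> b)"
  have bg: "\<alpha> b \<in> ?bd ?g" using faces\<alpha>[OF ab(2)] by blast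
  obtain d where d: "d \<in> J" "d ~= b" "Jc (?bd ?g) = {b, d}" "{b, d} \<in> EN" using partner[OF ab(2) bg] by (elim bexE conjE)
  have dg: "?g = ?l (\<alpha> d) \<or> ?g = ?r (\<alpha> d)" using faces\<alpha> d by (auto simp: Jc_def)
  have "?g = ?f1 \<or> ?g = ?f2"
  proof (cases "d = a")
   case False
   hence "d = c" using d(1,2) c(3) by simp
   thus ?thesis using dg cf[of ?f1] cf[of ?f2] lr[OF ab(1)] by metis
  qed (use dg in simp)
  thus False using p d(3) ab(3) c(2) by fastforce
 qed
qed

text \<open>The hypothesis on \<open>N\<close> is \<open>\<delta>\<^sub>v = 1\<close>. The value q =
  card N - 2 for the graph on \<open>N\<close> is excluded by \<open>neighbourhood_bound\<close>,
  applied inside \<open>N\<close> where \<open>v\<close> dominates. So this graph has card N - 3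
  crossings and attains the planar bound, as \<open>component_attachments\<close> requires.
  \<open>Z\<close> is a component of the graph outside \<open>N\<close>.\<close>

theorem separation:
 assumes n: "4 \<le> card V" "card unc + q + 6 = 3 * card V" and v: "v \<in> V"
  and N: "N = insert v (nb E v)" "4 \<le> card N" "4 * card N = card (ind E N) + 9" "N ~= V"
 shows "\<exists>Z J. Z ~= {} \<and> Z \<subseteq> V \<and> Z \<inter> N = {} \<and> J \<subseteq> N \<and> card J \<le> 3 \<and>
  (\<forall>e\<in>E. \<forall>z\<in>e. z \<in> Z --> e \<subseteq> Z \<union> J) \<and> (card J = 3 --> (\<forall>a\<in>J. \<forall>b\<in>J. a ~= b --> {a, b} \<in> E))"
proof -
 note T = tight0[OF n]
 define EN where "EN = ind E N"
 have ENE: "EN \<subseteq> E" by (auto simp: EN_def ind_def)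
 have ENN: "e \<subseteq> N" if "e \<in> EN" for e using that by (simp add: EN_def ind_def)
 have NV: "N \<subseteq> V" using N(1) v edge by (auto simp: nb_def)
 have finN: "finite N" by (rule finite_subset[OF NV finV])
 obtain \<mu> :: "'f => 'f" where S: "nice N EN (subm m EN) (\<mu> \<circ> l) (\<mu> \<circ> r)" by (metis nice_sub ENE finN ENN)
 interpret S: nice N EN "subm m EN" "\<mu> \<circ> l" "\<mu> \<circ> r" by (rule S)
 have N3: "3 \<le> card N" using N(2) by simp
 have cE: "4 * card N = card S.unc + 2 * S.q + 9" using N(3) S.card_E by (simp add: EN_def)
 have vN: "v \<in> N" by (simp add: N(1))
 have "S.q + 2 ~= card N"
 proof
  assume q2: "S.q + 2 = card N"
  have nbN: "insert v (nb EN v) = N"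
  proof (intro equalityI subsetI)
   fix u assume "u \<in> insert v (nb EN v)"
   thus "u \<in> N" using ENN[of "{u, v}"] vN by (auto simp: nb_def)
  next
   fix u assume u: "u \<in> N"
   show "u \<in> insert v (nb EN v)" using u N(1) by (simp add: EN_def ind_def nb_def)
  qed
  have fnb: "finite (nb EN v)" using finN nbN by (metis finite_insert)
  have "v \<notin> nb EN v" by (simp add: nb_def)
  hence cnb: "card (nb EN v) + 1 = card N" using fnb by (simp add: nbN[symmetric])
  have "card S.unc + S.q + 6 + (3 * card N - 6 - (card S.unc + S.q)) = 3 * card N" using S.planar_bound[OF N3] by simp
  moreover have "3 * card N - 6 - (card S.unc + S.q) \<le> 1" using cE q2 by linarith
  ultimately have "card (ind EN (insert v (nb EN v))) + 6 \<le> 4 * card (nb EN v)" using N(2) cnb by (intro S.neighbourhood_bound[OF N(2) q2 _ _ vN]) simp_all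
  moreover have "ind EN (insert v (nb EN v)) = EN" unfolding nbN using ENN by (auto simp: ind_def)
  ultimately show False using cnb N(3) by (simp add: EN_def)
 qed
 hence qN: "S.q + 3 = card N" "card S.unc + S.q + 6 = 3 * card N" using cE S.planar_bound[OF N3] S.cross_bound[OF N3] by linarith+
 have mEN: "m e \<in> EN" if "e \<in> EN" for e by (rule crossing_stays[OF T v N(1) EN_def S N(2) qN(2,1) that])
 interpret X: xgraph N EN m
 proof
  fix e assume e: "e \<in> EN"
  show "e \<subseteq> N \<and> card e = 2" using ENN[OF e] edge[OF subsetD[OF ENE e]] by simp
  show "m e \<in> EN" by (rule mEN[OF e])
  show "m (m e) = e" by (rule mm[OF subsetD[OF ENE e]])
 qed (rule finN)
 have sm: "subm m EN e = m e" if "e \<in> EN" for e using mEN[OF that] by (simp add: subm_def)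
 have uX: "X.unc = S.unc" using sm by (auto simp: X.unc_def S.unc_def)
 have qX: "X.q = S.q" using X.card_E S.card_E uX by simp
 have "card X.unc + X.q + 6 = 3 * card N" using qN(2) uX qX by simp
 note ca = component_attachments[OF ENE _ _ NV N(2) this]
 obtain z0 where z0: "z0 \<in> V" "z0 \<notin> N" using N(4) NV by blast
 let ?R = "{(x, y). {x, y} \<in> E \<and> x \<notin> N \<and> y \<notin> N}"
 define Z where "Z = {z. (z0, z) \<in> ?R\<^sup>*}"
 have z0Z: "z0 \<in> Z" by (simp add: Z_def)
 have ZV: "z \<in> V \<and> z \<notin> N" if "z \<in> Z" for z using that unfolding Z_def mem_Collect_eq
 proof (induction rule: rtrancl_induct)
  case (step y z)
  thus ?case using edge[of "{y, z}"] by simp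
 qed (use z0 in simp)
 have conn: "(z0, z) \<in> {(x, y). {x, y} \<in> E \<and> x \<in> Z \<and> y \<in> Z}\<^sup>*" if "z \<in> Z" for z
 proof -
  have "(z0, z) \<in> ?R\<^sup>*" using that by (simp add: Z_def)
  thus ?thesis
  proof (induction rule: rtrancl_induct)
   case (step y z)
   have "(z0, z) \<in> ?R\<^sup>*" using step.hyps by (rule rtrancl_into_rtrancl)
   hence "(y, z) \<in> {(x, y). {x, y} \<in> E \<and> x \<in> Z \<and> y \<in> Z}" using step.hyps by (simp add: Z_def)
   thus ?case by (rule rtrancl_into_rtrancl[OF step.IH])
  qed simp
 qed
 define J where "J = {a \<in> N. \<exists>z\<in>Z. {a, z} \<in> E}"
 have ZN: "Z \<inter> N = {}" "Z \<subseteq> V" using ZV by blast+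
 have J3: "card J \<le> 3" by (rule ca(1)[OF _ _ z0Z ZN(1) _ J_def ZN(2)]) (rule mEN ENN conn; assumption)+
 have Jcl: "{a, b} \<in> EN" if "card J = 3" "a \<in> J" "b \<in> J" "a ~= b" for a b by (rule ca(2)[OF _ _ z0Z ZN(1) _ J_def ZN(2) that]) (rule mEN ENN conn; assumption)+
 have ZJ: "e \<subseteq> Z \<union> J" if e: "e \<in> E" "z \<in> e" "z \<in> Z" for e z
 proof -
  obtain y where y: "y ~= z" "e = {z, y}" "y \<in> V" using edge2[OF e(1,2)] by (elim exE conjE)
  have "y \<in> Z \<union> J"
  proof (cases "y \<in> N")
   case True
   show ?thesis using e(1) y(2) True e(3) by (auto simp: insert_commute J_def)
  next
   case False
   have "(z, y) \<in> ?R" using e y(2) False ZV[OF e(3)] by simp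
   moreover have "(z0, z) \<in> ?R\<^sup>*" using e(3) by (simp add: Z_def)
   ultimately have "(z0, y) \<in> ?R\<^sup>*" by (rule rtrancl_into_rtrancl[rotated])
   thus ?thesis by (simp add: Z_def)
  qed
  thus ?thesis using y(2) e(3) by simp
 qed
 show ?thesis
 proof (rule exI[of _ Z], rule exI[of _ J], intro conjI ballI impI)
  show "Z ~= {}" using z0Z by auto
  show "J \<subseteq> N" by (auto simp: J_def)
  fix a b assume "card J = 3" "a \<in> J" "b \<in> J" "a ~= b"
  thus "{a, b} \<in> E" using Jcl ENE by blast
 qed (use ZN J3 ZJ in simp_all)
qed

end

section \<open>Counting triangles\<close>

definition tri :: "'a set set => 'a set set" where
 "tri E = {T. card T = 3 \<and> (\<forall>x\<in>T. \<forall>y\<in>T. x ~= y --> {x, y} \<in> E)}"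

abbreviation dg :: "'a set set => 'a => nat" where "dg E v == card (nb E v)"
abbreviation en :: "'a set set => 'a => nat" where "en E v == card (ind E (nb E v))"

locale fgraph =
 fixes V :: "'a set" and E :: "'a set set" assumes finV: "finite V" and edge: "e \<in> E ==> e \<subseteq> V \<and> card e = 2"
begin

lemma finE: "finite E"
 using edge finV by (intro finite_subset[of E "Pow V"]) auto

lemma nb_sub: "nb E v \<subseteq> V - {v}"
 using edge by (auto simp: nb_def)

lemma fin_nb: "finite (nb E v)" by (rule finite_subset[OF nb_sub]) (simp add: finV)

lemma fgraph_ind: "W \<subseteq> V ==> fgraph W (ind E W)"
 using edge finite_subset[OF _ finV] by (intro fgraph.intro) (auto simp: ind_def)

lemma edge_pair: "e \<in> E ==> v \<in> e ==> \<exists>u. u ~= v \<and> e = {u, v}"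
proof -
 assume e: "e \<in> E" "v \<in> e"
 have "card (e - {v}) = 1" using edge[OF e(1)] e(2) by (simp add: card_Diff_singleton)
 then obtain u where "e - {v} = {u}" by (rule card_1_singletonE)
 thus ?thesis using e(2) by (intro exI[of _ u]) blast
qed

lemma dg_edges: "dg E v = card {e \<in> E. v \<in> e}"
proof (rule bij_betw_same_card[of "\<lambda>u. {u, v}"], rule bij_betw_imageI)
 show "inj_on (\<lambda>u. {u, v}) (nb E v)" by (rule inj_onI) (auto simp: doubleton_eq_iff)
 show "(\<lambda>u. {u, v}) ` nb E v = {e \<in> E. v \<in> e}" using edge_pair by (fastforce simp: nb_def)
qed

lemma sum_dg: "(\<Sum>v\<in>V. dg E v) = 2 * card E"
proof -
 have "(\<Sum>v\<in>V. card {e \<in> E. v \<in> e}) = 2 * card E"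
 proof (rule sum_multicount[OF finV finE], rule ballI)
  fix e assume "e \<in> E"
  hence "{v \<in> V. v \<in> e} = e" "card e = 2" using edge by auto
  thus "card {v \<in> V. v \<in> e} = 2" by simp
 qed
 thus ?thesis by (simp only: dg_edges)
qed

lemma tri_sub: "tri E \<subseteq> {T. T \<subseteq> V \<and> card T = 3}"
proof
 fix T assume T: "T \<in> tri E"
 have "x \<in> V" if x: "x \<in> T" for x
 proof -
  have "card (T - {x}) = 2" using T x by (simp add: tri_def card_Diff_singleton)
  hence "T - {x} ~= {}" by (intro notI) simp
  then obtain y where "y \<in> T" "y ~= x" by blast
  thus ?thesis using T x edge by (auto simp: tri_def)
 qed
 thus "T \<in> {T. T \<subseteq> V \<and> card T = 3}" using T by (auto simp: tri_def)
qed

lemma fin_tri: "finite (tri E)" by (rule finite_subset[OF tri_sub]) (simp add: finV)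

lemma card_tri_choose: "card (tri E) \<le> card V choose 3"
 using card_mono[OF _ tri_sub] finV n_subsets[OF finV, of 3] by simp

lemma tri_at: "card {T \<in> tri E. v \<in> T} = en E v"
proof (rule bij_betw_same_card[symmetric, of "insert v"], rule bij_betw_imageI)
 have v: "v \<notin> e" if "e \<in> ind E (nb E v)" for e using that by (auto simp: ind_def nb_def)
 show "inj_on (insert v) (ind E (nb E v))" by (metis inj_onI insert_ident v)
 show "insert v ` ind E (nb E v) = {T \<in> tri E. v \<in> T}"
 proof (intro equalityI subsetI)
  fix T assume "T \<in> insert v ` ind E (nb E v)"
  then obtain e where e: "e \<in> ind E (nb E v)" "T = insert v e" by blast
  have eE: "e \<in> E" "e \<subseteq> nb E v" using e(1) by (simp_all add: ind_def)
  have c: "finite e" "card e = 2" using edge[OF eE(1)] card_ge_0_finite[of e] by simp_all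
  have "card T = 3" using c v[OF e(1)] e(2) by simp
  moreover have "{x, y} \<in> E" if xy: "x \<in> T" "y \<in> T" "x ~= y" for x y
  proof (cases "x = v \<or> y = v")
   case True
   thus ?thesis using xy eE(2) e(2) by (auto simp: nb_def insert_commute)
  next
   case False
   hence "{x, y} \<subseteq> e" using xy e(2) by simp
   hence "{x, y} = e" using c xy(3) by (intro card_subset_eq) simp_all
   thus ?thesis using eE(1) by simp
  qed
  ultimately show "T \<in> {T \<in> tri E. v \<in> T}" using e(2) by (simp add: tri_def)
 next
  fix T assume "T \<in> {T \<in> tri E. v \<in> T}"
  hence T: "card T = 3" "\<And>x y. x \<in> T ==> y \<in> T ==> x ~= y ==> {x, y} \<in> E" "v \<in> T" by (simp_all add: tri_def)
  have "card (T - {v}) = 2" using T by (simp add: card_Diff_singleton)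
  then obtain x y where xy: "T - {v} = {x, y}" "x ~= y" by (auto simp: card_2_iff)
  have in3: "x \<in> T" "y \<in> T" "x ~= v" "y ~= v" using xy by blast+
  have "{x, y} \<in> E" "{x, v} \<in> E" "{y, v} \<in> E" by (rule T(2)[OF in3(1,2) xy(2)], rule T(2)[OF in3(1) T(3) in3(3)], rule T(2)[OF in3(2) T(3) in3(4)])
  hence "T - {v} \<in> ind E (nb E v)" unfolding xy(1) using in3 by (simp add: ind_def nb_def)
  thus "T \<in> insert v ` ind E (nb E v)" using T(3) by (intro rev_image_eqI) auto
 qed
qed

lemma three_tri: "3 * card (tri E) = (\<Sum>v\<in>V. en E v)"
proof -
 have "(\<Sum>v\<in>V. card {T \<in> tri E. v \<in> T}) = 3 * card (tri E)"
 proof (rule sum_multicount[OF finV fin_tri], rule ballI)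
  fix T assume "T \<in> tri E"
  hence "T \<subseteq> V" "card T = 3" using tri_sub by blast+
  hence "{v \<in> V. v \<in> T} = T" by blast
  thus "card {v \<in> V. v \<in> T} = 3" using \<open>card T = 3\<close> by simp
 qed
 thus ?thesis by (simp only: tri_at)
qed

lemma tri_delete: "card (tri E) \<le> card (tri (ind E (V - {v}))) + en E v"
proof -
 have "tri E \<subseteq> tri (ind E (V - {v})) \<union> {T \<in> tri E. v \<in> T}"
 proof
  fix T assume T: "T \<in> tri E"
  show "T \<in> tri (ind E (V - {v})) \<union> {T \<in> tri E. v \<in> T}" using tri_sub T by (auto simp: tri_def ind_def)
 qed
 moreover interpret D: fgraph "V - {v}" "ind E (V - {v})" by (rule fgraph_ind) blast
 have "finite (tri (ind E (V - {v})) \<union> {T \<in> tri E. v \<in> T})" using D.fin_tri fin_tri by simp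
 ultimately have "card (tri E) \<le> card (tri (ind E (V - {v})) \<union> {T \<in> tri E. v \<in> T})" by (rule card_mono[rotated])
 thus ?thesis using card_Un_le[of "tri (ind E (V - {v}))" "{T \<in> tri E. v \<in> T}"] tri_at[of v] by linarith
qed

lemma card_ind_closed_nb: "card (ind E (insert v (nb E v))) = dg E v + en E v"
proof -
 have "ind E (insert v (nb E v)) = {e \<in> E. v \<in> e} \<union> ind E (nb E v)"
 proof (intro equalityI subsetI)
  fix e assume e: "e \<in> ind E (insert v (nb E v))"
  thus "e \<in> {e \<in> E. v \<in> e} \<union> ind E (nb E v)" by (auto simp: ind_def)
 next
  fix e assume e: "e \<in> {e \<in> E. v \<in> e} \<union> ind E (nb E v)"
  show "e \<in> ind E (insert v (nb E v))" using e edge_pair by (auto simp: ind_def nb_def)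
 qed
 moreover have "{e \<in> E. v \<in> e} \<inter> ind E (nb E v) = {}" by (auto simp: ind_def nb_def)
 moreover have "finite {e \<in> E. v \<in> e}" "finite (ind E (nb E v))" using finE by (simp_all add: ind_def)
 ultimately show ?thesis using dg_edges[of v] by (simp add: card_Un_disjoint)
qed

lemma en_le_choose: "en E v \<le> dg E v choose 2"
 using edge by (intro card_edges_le_choose[OF fin_nb]) (auto simp: ind_def)

text \<open>Two vertices lie outside the closed neighbourhood of \<open>v\<close>. They are incident
  with at least 6 + 6 - 1 edges, none of them inside the neighbourhood.\<close>

lemma en_far:
 assumes v: "v \<in> V" and d: "card V = dg E v + 3" and w: "\<And>w. w \<in> V ==> 6 \<le> dg E w" shows "en E v + dg E v + 11 \<le> card E"
proof -
 have "card (V - insert v (nb E v)) = 2"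
 proof -
  have "v \<notin> nb E v" by (simp add: nb_def)
  moreover have "insert v (nb E v) \<subseteq> V" using v nb_sub[of v] by blast
  ultimately show ?thesis using fin_nb[of v] d by (simp add: card_Diff_subset)
 qed
 then obtain x y where xy: "V - insert v (nb E v) = {x, y}" "x ~= y" by (auto simp: card_2_iff)
 have xyV: "x \<in> V" "y \<in> V" using xy(1) by blast+
 let ?I = "ind E (insert v (nb E v))" and ?X = "{e \<in> E. x \<in> e}" and ?Y = "{e \<in> E. y \<in> e}"
 have fin: "finite ?I" "finite ?X" "finite ?Y" using finE by (simp_all add: ind_def)
 have "?X \<inter> ?Y \<subseteq> {{x, y}}" using edge_pair xy(2) by auto
 hence "card (?X \<inter> ?Y) \<le> 1" using card_mono[of "{{x, y}}" "?X \<inter> ?Y"] by simp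
 moreover have "card (?X \<union> ?Y) + card (?X \<inter> ?Y) = dg E x + dg E y" using card_Un_Int[OF fin(2,3)] dg_edges by simp
 ultimately have "11 \<le> card (?X \<union> ?Y)" using w[OF xyV(1)] w[OF xyV(2)] by linarith
 moreover have "?I \<inter> (?X \<union> ?Y) = {}" using xy(1) by (auto simp: ind_def)
 hence "card (?I \<union> (?X \<union> ?Y)) = card ?I + card (?X \<union> ?Y)" using fin by (intro card_Un_disjoint) simp_all
 moreover have "card (?I \<union> (?X \<union> ?Y)) \<le> card E" using finE by (intro card_mono) (auto simp: ind_def)
 ultimately show ?thesis using card_ind_closed_nb[of v] by linarith
qed

text \<open>Five dominating vertices have degree n - 1 each and give every other vertex degree at
  least 5.\<close>

lemma dominating_card:
 assumes D: "D \<subseteq> V" "\<And>v. v \<in> D ==> nb E v = V - {v}" and 5: "5 \<le> card D" shows "10 * card V \<le> 2 * card E + 30"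
proof -
 obtain D' where D': "D' \<subseteq> D" "card D' = 5" by (rule obtain_subset_with_card_n[OF 5])
 have fD: "finite D'" using D'(2) by (intro card_ge_0_finite) simp
 have DV: "D' \<subseteq> V" using D D' by blast
 have "5 \<le> dg E v" if v: "v \<in> V - D'" for v
 proof -
  have "D' \<subseteq> nb E v" using D'(1) v D(2) by (auto simp: nb_def insert_commute)
  thus ?thesis using card_mono[OF fin_nb, of D' v] D'(2) by simp
 qed
 hence "card (V - D') * 5 \<le> (\<Sum>v\<in>V - D'. dg E v)" using sum_bounded_below[of "V - D'" 5 "dg E"] by simp
 moreover have "(\<Sum>v\<in>D'. dg E v) = (\<Sum>v\<in>D'. card V - 1)"
 proof (rule sum.cong[OF refl])
  fix v assume "v \<in> D'"
  hence "v \<in> D" by (rule subsetD[OF D'(1)])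
  thus "dg E v = card V - 1" using D(2) D(1) by auto
 qed
 moreover have "(\<Sum>v\<in>V. dg E v) = (\<Sum>v\<in>V - D'. dg E v) + (\<Sum>v\<in>D'. dg E v)" by (rule sum.subset_diff[OF DV finV])
 moreover have "card (V - D') + 5 = card V" using card_Diff_subset[OF fD DV] card_mono[OF finV DV] D'(2) by simp
 ultimately show ?thesis using sum_dg D'(2) by simp
qed

end

lemma op1_fgraph: "op1 V E ==> fgraph V E"
 using op1_graph[of V E] by (intro fgraph.intro) simp_all

section \<open>Degrees and local deficits in nearly optimal graphs\<close>

context nice
begin

text \<open>A crossed edge at \<open>v\<close> is crossed by an edge between two outer ends of
  spokes, and different crossed edges have different partners.\<close>

lemma cpk_choose:
 assumes nl: "\<forall>p\<in>pcs E. l p ~= r p" and 6: "\<forall>f\<in>FF. ws f = 6" shows "card (cpk v) \<le> card (spk v) choose 2"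
proof -
 define U where "U = {u. u ~= v \<and> {u, v} \<in> unc}"
 have cU: "card U = card (spk v)" unfolding U_def spk_def by (rule card_nb_sub) (auto simp: unc_def)
 have "U \<subseteq> V" using edge by (auto simp: U_def unc_def)
 hence finU: "finite U" using finV by (rule finite_subset)
 have cp: "e \<in> E" "m e ~= e" "v \<in> e" if "e \<in> cpk v" for e using that by (simp_all add: cpk_def crs_def)
 have "card (cpk v) \<le> card {f. f \<subseteq> U \<and> card f = 2}"
 proof (rule card_inj_on_le[of m])
  show "inj_on m (cpk v)" by (metis inj_onI mm cp(1))
  show "m ` cpk v \<subseteq> {f. f \<subseteq> U \<and> card f = 2}"
  proof (intro image_subsetI CollectI conjI subsetI)
   fix e assume e: "e \<in> cpk v"
   show "card (m e) = 2" using edge[OF mE[OF cp(1)[OF e]]] by simp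
   fix y assume y: "y \<in> m e"
   note k = all_kites[OF nl 6 cp(1,2)[OF e] cp(3)[OF e] y]
   thus "y \<in> U" by (simp add: U_def insert_commute)
  qed
 qed (use finU in simp)
 thus ?thesis using n_subsets[OF finU] cU by simp
qed

text \<open>Half of the edges at each vertex are crossed. Degree 4 would mean two spokes and two
  crossed edges, but two spoke ends admit only one crossing partner.\<close>

lemma tight_vertex:
 assumes n: "4 \<le> card V" "q + 2 = card V" "card unc + q + 6 = 3 * card V"
  and v: "v \<in> V" "4 \<le> dg E v"
 shows "even (dg E v)" "6 \<le> dg E v"
proof -
 note T = tight0[OF n(1,3)]
 have "card (spk v) \<le> card (cpk v)" using spokes_bound[OF _ v(1)] n by simp
 hence hc: "card (spk v) = card (cpk v)" using cpk_le_spk[OF T, of v] by simp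
 thus "even (dg E v)" by (simp add: card_nb)
 have "card (spk v) ~= 2" using cpk_choose[OF T, of v] hc by (auto simp: choose_two)
 thus "6 \<le> dg E v" using v(2) hc by (simp add: card_nb)
qed

lemma sum_spk: "(\<Sum>v\<in>V. card (spk v)) = 2 * card unc" and sum_cpk: "(\<Sum>v\<in>V. card (cpk v)) = 4 * q"
proof -
 have two: "card {v \<in> V. v \<in> e} = 2" if "e \<in> E" for e
 proof -
  have "{v \<in> V. v \<in> e} = e" "card e = 2" using edge[OF that] by auto
  thus ?thesis by simp
 qed
 show "(\<Sum>v\<in>V. card (spk v)) = 2 * card unc" unfolding spk_def by (rule sum_multicount[OF finV fin_unc]) (use two in \<open>simp add: unc_def\<close>)
 have "(\<Sum>v\<in>V. card (cpk v)) = 2 * card crs" unfolding cpk_def by (rule sum_multicount[OF finV fin_crs]) (use two in \<open>simp add: crs_def\<close>)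
 thus "(\<Sum>v\<in>V. card (cpk v)) = 4 * q" using card_crs by simp
qed

end

lemma op1_tight:
 assumes "op1 V E" "4 \<le> card V" "card E + 8 = 4 * card V" "v \<in> V" "4 \<le> dg E v" shows "even (dg E v)" "6 \<le> dg E v" "en E v + 6 \<le> 3 * dg E v"
proof -
 interpret G: fgraph V E by (rule op1_fgraph[OF assms(1)])
 obtain m r and l :: "'a set \<times> 'a => nat" where "nice V E m l r" by (rule op1_nice[OF assms(1,2)]) (use assms(3) in simp)
 then interpret nice V E m l r .
 have n: "q + 2 = card V" "card unc + q + 6 = 3 * card V" using card_E planar_bound cross_bound assms(2,3) by simp_all
 show "even (dg E v)" "6 \<le> dg E v" by (rule tight_vertex[OF assms(2) n assms(4,5)])+
 show "en E v + 6 \<le> 3 * dg E v" using n assms(5) neighbourhood_bound assms(2) assms(4) G.card_ind_closed_nb by simp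
qed

text \<open>The claim is \<open>\<delta>\<^sub>v \<ge> 1\<close>. With
  \<open>\<delta>\<^sub>v = 0\<close> the closed neighbourhood would be an optimal graph, and
  \<open>op1_tight\<close>, applied in it at its dominating vertex \<open>v\<close>, would require
  \<open>\<delta>\<^sub>v \<ge> 2\<close>.\<close>

lemma en_bound:
 assumes "op1 V E" "v \<in> V" "4 \<le> dg E v" shows "en E v + 5 \<le> 3 * dg E v"
proof -
 interpret G: fgraph V E by (rule op1_fgraph[OF assms(1)])
 let ?N = "insert v (nb E v)"
 have vn: "v \<notin> nb E v" by (simp add: nb_def)
 have cN: "card ?N = dg E v + 1" using G.fin_nb vn by simp
 have NV: "?N \<subseteq> V" using G.nb_sub assms(2) by blast
 have op: "op1 ?N (ind E ?N)" by (rule op1_ind[OF assms(1) NV])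
 have le: "en E v + 4 \<le> 3 * dg E v" using op1_edge_bound op cN assms(3) G.card_ind_closed_nb by fastforce
 moreover have "en E v + 4 ~= 3 * dg E v"
 proof
  assume eq: "en E v + 4 = 3 * dg E v"
  have nbN: "nb (ind E ?N) v = nb E v" by (auto simp: nb_def ind_def)
  have "ind (ind E ?N) (nb E v) = ind E (nb E v)" by (auto simp: ind_def)
  moreover have "en (ind E ?N) v + 6 \<le> 3 * dg (ind E ?N) v" using cN assms(3) eq G.card_ind_closed_nb[of v] by (intro op1_tight(3)[OF op]) (simp_all add: nbN)
  ultimately show False using eq by (simp add: nbN)
 qed
 ultimately show ?thesis by simp
qed

definition separable :: "'a set => 'a set set => 'a set => bool" where
 "separable V E N \<longleftrightarrow> (\<exists>Z J. Z ~= {} \<and> Z \<subseteq> V \<and> Z \<inter> N = {} \<and> J \<subseteq> N \<and> card J \<le> 3 \<and>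
  (\<forall>e\<in>E. \<forall>z\<in>e. z \<in> Z --> e \<subseteq> Z \<union> J) \<and> (card J = 3 --> (\<forall>a\<in>J. \<forall>b\<in>J. a ~= b --> {a, b} \<in> E)))"

text \<open>\<open>\<delta> = 1\<close> means either q = n - 2, where
  \<open>neighbourhood_bound\<close> applies to every vertex, or q = n - 3. In the latter case
  \<tau> is the excess of uncrossed over crossed edges at a vertex, and its sum is 2 (2n - 3) - 4 (n
  - 3) = 6.\<close>

lemma op1_near_tight:
 assumes op: "op1 V E" and n4: "4 \<le> card V" and cE: "card E + 9 = 4 * card V" shows "(\<forall>v\<in>V. 4 \<le> dg E v --> en E v + 6 \<le> 3 * dg E v) \<or>
  ((\<exists>\<tau> :: 'a => nat. sum \<tau> V = 6 \<and> (\<forall>v\<in>V. even (\<tau> v + dg E v) \<and> (dg E v = 4 --> \<tau> v ~= 0))) \<and>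
   (\<forall>v\<in>V. 4 \<le> dg E v --> en E v + 5 = 3 * dg E v --> nb E v ~= V - {v} --> separable V E (insert v (nb E v))))"
proof -
 interpret G: fgraph V E by (rule op1_fgraph[OF op])
 obtain m r and l :: "'a set \<times> 'a => nat" where "nice V E m l r" by (rule op1_nice[OF op n4]) (use cE in simp)
 then interpret nice V E m l r .
 have le: "card unc + 2 * q = card E" "q + 2 \<le> card V" "card unc + q + 6 \<le> 3 * card V" using card_E planar_bound cross_bound n4 by simp_all
 show ?thesis
 proof (cases "q + 2 = card V")
  case True
  have "en E v + 6 \<le> 3 * dg E v" if v: "v \<in> V" "4 \<le> dg E v" for v
  proof -
   have "card (ind E (insert v (nb E v))) + 6 \<le> 4 * dg E v" using True le cE v(2) by (intro neighbourhood_bound[OF n4 True, of 1] v(1)) simp_all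
   thus ?thesis using G.card_ind_closed_nb[of v] by simp
  qed
  thus ?thesis by blast
 next
  case False
  hence n: "q + 3 = card V" "card unc + q + 6 = 3 * card V" using le cE by linarith+
  note T = tight0[OF n4 n(2)]
  define \<tau> where "\<tau> = (\<lambda>v. card (spk v) - card (cpk v))"
  have \<tau>: "\<tau> v + card (cpk v) = card (spk v)" for v using cpk_le_spk[OF T, of v] by (simp add: \<tau>_def)
  have "(\<Sum>v\<in>V. \<tau> v + card (cpk v)) = 2 * card unc" by (simp only: \<tau> sum_spk)
  hence s6: "sum \<tau> V = 6" using n le by (simp add: sum.distrib sum_cpk)
  have ev: "even (\<tau> v + dg E v)" for v
  proof -
   have "\<tau> v + dg E v = 2 * card (spk v)" using \<tau>[of v] card_nb[of v] by simp
   thus ?thesis by simp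
  qed
  have t0: "\<tau> v ~= 0" if "dg E v = 4" for v
  proof
   assume "\<tau> v = 0"
   hence "card (spk v) = 2" "card (cpk v) = 2" using \<tau>[of v] card_nb[of v] that by simp_all
   thus False using cpk_choose[OF T, of v] by (simp add: choose_two)
  qed
  have "separable V E (insert v (nb E v))"
   if v: "v \<in> V" "4 \<le> dg E v" "en E v + 5 = 3 * dg E v" "nb E v ~= V - {v}" for v unfolding separable_def
  proof (rule separation[OF n4 n(2) v(1) refl])
   have vn: "v \<notin> nb E v" by (simp add: nb_def)
   have cN: "card (insert v (nb E v)) = dg E v + 1" using G.fin_nb vn by simp
   show "4 \<le> card (insert v (nb E v))" using cN v(2) by simp
   show "4 * card (insert v (nb E v)) = card (ind E (insert v (nb E v))) + 9" using cN v(3) G.card_ind_closed_nb[of v] by simp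
   show "insert v (nb E v) ~= V" using vn v(4) by auto
  qed
  thus ?thesis using s6 ev t0 by (intro disjI2 conjI exI[of _ \<tau>] ballI impI) simp_all
 qed
qed

section \<open>Separations, arithmetic of the bound, and the induction\<close>

lemma (in fgraph) separated:
 assumes Z: "Z \<subseteq> V" "J \<subseteq> V" "Z \<inter> J = {}" and cl: "\<forall>e\<in>E. \<forall>z\<in>e. z \<in> Z --> e \<subseteq> Z \<union> J" shows "card E + card (ind E J) = card (ind E (V - Z)) + card (ind E (Z \<union> J))"
  "card (tri E) + card (tri (ind E J)) \<le> card (tri (ind E (V - Z))) + card (tri (ind E (Z \<union> J)))"
  "card (V - Z) + card (Z \<union> J) = card V + card J"
proof -
 have fin: "finite Z" "finite J" using Z finV finite_subset by blast+
 have finI: "finite (ind E W)" for W using finE by (simp add: ind_def)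
 have "E = ind E (V - Z) \<union> ind E (Z \<union> J)"
 proof (intro equalityI subsetI)
  fix e assume e: "e \<in> E"
  show "e \<in> ind E (V - Z) \<union> ind E (Z \<union> J)" using e cl edge by (auto simp: ind_def)
 qed (auto simp: ind_def)
 moreover have "ind E (V - Z) \<inter> ind E (Z \<union> J) = ind E J" using Z by (auto simp: ind_def)
 ultimately show "card E + card (ind E J) = card (ind E (V - Z)) + card (ind E (Z \<union> J))" using card_Un_Int[OF finI finI, of "V - Z" "Z \<union> J"] by simp
 have tI: "tri (ind E W) = {T \<in> tri E. T \<subseteq> W}" for W
 proof (intro equalityI subsetI)
  fix T assume T: "T \<in> tri (ind E W)"
  have "x \<in> W" if x: "x \<in> T" for x
  proof -
   have "card (T - {x}) = 2" using T x by (simp add: tri_def card_Diff_singleton)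
   hence "T - {x} ~= {}" by (intro notI) simp
   then obtain y where "y \<in> T" "y ~= x" by blast
   thus ?thesis using T x by (simp add: tri_def ind_def)
  qed
  thus "T \<in> {T \<in> tri E. T \<subseteq> W}" using T by (auto simp: tri_def ind_def)
 qed (auto simp: tri_def ind_def)
 have finT: "finite (tri (ind E W))" for W unfolding tI using fin_tri by simp
 have "tri E \<subseteq> tri (ind E (V - Z)) \<union> tri (ind E (Z \<union> J))"
 proof
  fix T assume T: "T \<in> tri E"
  show "T \<in> tri (ind E (V - Z)) \<union> tri (ind E (Z \<union> J))"
  proof (cases "\<exists>z\<in>T. z \<in> Z")
   case True
   then obtain z where z: "z \<in> T" "z \<in> Z" by blast
   have "x \<in> Z \<union> J" if x: "x \<in> T" for x
   proof (cases "x = z")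
    case False
    hence "{x, z} \<in> E" using T x z by (simp add: tri_def)
    thus ?thesis using cl z(2) by auto
   qed (use z in simp)
   thus ?thesis using T unfolding tI by blast
  next
   case False
   show ?thesis using tri_sub T False tI by auto
  qed
 qed
 hence "card (tri E) \<le> card (tri (ind E (V - Z)) \<union> tri (ind E (Z \<union> J)))" using finT by (intro card_mono) simp_all
 moreover have "tri (ind E J) \<subseteq> tri (ind E (V - Z)) \<inter> tri (ind E (Z \<union> J))" unfolding tI using Z by blast
 hence "card (tri (ind E J)) \<le> card (tri (ind E (V - Z)) \<inter> tri (ind E (Z \<union> J)))" using finT by (intro card_mono) simp_all
 ultimately show "card (tri E) + card (tri (ind E J)) \<le> card (tri (ind E (V - Z))) + card (tri (ind E (Z \<union> J)))"
  using card_Un_Int[OF finT finT, of "V - Z" "Z \<union> J"] by linarith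
 show "card (V - Z) + card (Z \<union> J) = card V + card J" using fin Z card_mono[OF finV Z(1)] by (simp add: card_Diff_subset card_Un_disjoint)
qed

lemma clique3:
 assumes "card J = 3" "\<forall>a\<in>J. \<forall>b\<in>J. a ~= b --> {a, b} \<in> E" and E: "\<And>e. e \<in> E ==> card e = 2" shows "card (ind E J) = 3" "J \<in> tri (ind E J)"
proof -
 have fin: "finite J" using assms(1) by (intro card_ge_0_finite) simp
 have "ind E J = {e. e \<subseteq> J \<and> card e = 2}" using assms(2) E by (auto simp: card_2_iff ind_def)
 thus "card (ind E J) = 3" using n_subsets[OF fin, of 2] assms(1) by (simp add: choose_two)
 show "J \<in> tri (ind E J)" using assms(1,2) by (simp add: tri_def ind_def)
qed

text \<open>The bound without its constant -18, which makes it superadditive.\<close>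

definition tbd :: "nat => nat" where "tbd n = 19 * (n div 3) + 5 * (n mod 3)"

lemma tbd3: "3 * tbd n + 4 * (n mod 3) = 19 * n"
proof -
 have "3 * (19 * a + 5 * b) + 4 * b = 19 * m" if "3 * a + b = m" for a b m :: nat using that by presburger
 from this[of "n div 3" "n mod 3" n] show ?thesis unfolding tbd_def by simp
qed

lemma mod3: "n mod 3 \<le> (2::nat)"
 using mod_less_divisor[of 3 n] by simp

lemma tbd_Suc: "tbd n + 5 \<le> tbd (Suc n)" "Suc n mod 3 = 0 ==> tbd n + 9 = tbd (Suc n)"
 using tbd3[of n] tbd3[of "Suc n"] by (simp_all add: mod_Suc split: if_splits)

lemma tbd_add3: "tbd (n + 3) = tbd n + 19"
 using tbd3[of n] tbd3[of "n + 3"] by simp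

lemma tbd_add: "tbd a + tbd b \<le> tbd (a + b)"
proof -
 have "(a + b) mod 3 \<le> a mod 3 + b mod 3" by (metis mod_add_eq mod_less_eq_dividend)
 thus ?thesis using tbd3[of a] tbd3[of b] tbd3[of "a + b"] unfolding distrib_left by linarith
qed

lemma tbd_add5: "b mod 3 = 0 ==> tbd (b + 5) = tbd b + 29" "b mod 3 ~= 0 ==> tbd (b + 5) = tbd b + 33"
proof -
 have e: "tbd (b + 5) = tbd (b + 2) + 19" using tbd_add3[of "b + 2"] by (simp only: add.assoc numeral_plus_numeral semiring_norm)
 have m: "(b + 2) mod 3 = (if b mod 3 = 0 then 2 else b mod 3 - 1)" by presburger
 show "tbd (b + 5) = tbd b + 29" if "b mod 3 = 0" using that tbd3[of b] tbd3[of "b + 2"] e m by simp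
 show "tbd (b + 5) = tbd b + 33" if "b mod 3 ~= 0" using that tbd3[of b] tbd3[of "b + 2"] e m by simp
qed

lemma tbd_round: "3 * t + 60 \<le> 19 * n ==> t + 18 \<le> tbd n"
 using tbd3[of n] mod3[of n] by linarith

text \<open>The second conjunct serves the gluing with the exceptional graph on 8 vertices: there
  the other side has \<open>\<delta> = 2\<close>, and if its size is a multiple of three, the bound
  grows too little to absorb the excess.\<close>

definition tri_claim :: "'a set => 'a set set => bool" where
 "tri_claim V E \<longleftrightarrow>
   (card (tri E) + 18 \<le> tbd (card V) \<or> card V = 8 \<and> card E = 24 \<and> card (tri E) \<le> 32) \<and>
   (card V mod 3 = 0 \<and> 6 \<le> card V \<and> card E + 10 \<le> 4 * card V --> card (tri E) + 20 \<le> tbd (card V))"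

lemma tri_claim_crude: "tri_claim V E ==> 3 * card (tri E) + 54 \<le> 19 * card V"
 using tbd3[of "card V"] by (auto simp: tri_claim_def)

text \<open>The exceptional graph adds five vertices and at most 31 triangles besides the shared
  one. The bound grows by 33, which is enough, or from a multiple of three by only 29, where the two
  triangles saved by \<open>tri_claim\<close> are needed.\<close>

lemma glue_exceptional:
 assumes "tri_claim V E" "card E + 10 = 4 * card V" "5 \<le> card V" "t + 1 \<le> 32 + card (tri E)" shows "t + 18 \<le> tbd (card V + 5)"
proof (cases "card V mod 3 = 0")
 case True
 thus ?thesis using assms tbd_add5(1) by (auto simp: tri_claim_def)
next
 case False
 thus ?thesis using assms tbd_add5(2)[OF False] by (auto simp: tri_claim_def)
qed

text \<open>Both sides are smaller instances. For at most two shared vertices the crude bound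
  suffices. With a shared triangle, which is counted twice, the two values of
  \<open>\<delta>\<close> sum to 2; so next to an exceptional side with \<open>\<delta> = 0\<close>
  the other one has \<open>\<delta> = 2\<close>.\<close>

lemma separable_bound:
 assumes op: "op1 V E" and cE: "card E + 9 = 4 * card V" and N: "N \<subseteq> V" "5 \<le> card N"
  and d: "\<And>v. v \<in> V ==> 4 \<le> dg E v" and sep: "separable V E N" and IH: "\<And>W. W \<subset> V ==> 3 \<le> card W ==> tri_claim W (ind E W)"
 shows "card (tri E) + 18 \<le> tbd (card V)"
proof -
 interpret G: fgraph V E by (rule op1_fgraph[OF op])
 obtain Z J where ZJ: "Z ~= {}" "Z \<subseteq> V" "Z \<inter> N = {}" "J \<subseteq> N" "card J \<le> 3"
  "\<forall>e\<in>E. \<forall>z\<in>e. z \<in> Z --> e \<subseteq> Z \<union> J" "card J = 3 --> (\<forall>a\<in>J. \<forall>b\<in>J. a ~= b --> {a, b} \<in> E)" using sep unfolding separable_def by (elim exE conjE)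
 have JV: "J \<subseteq> V" "Z \<inter> J = {}" using ZJ(3,4) N(1) by auto
 note S = G.separated[OF ZJ(2) JV ZJ(6)]
 let ?A = "V - Z" and ?B = "Z \<union> J"
 have "N \<subseteq> ?A" using N ZJ(3) by blast
 hence cA: "5 \<le> card ?A" using N(2) card_mono[of ?A N] G.finV by simp
 obtain z where z: "z \<in> Z" using ZJ(1) by blast
 have "insert z (nb E z) \<subseteq> ?B"
 proof
  fix u assume "u \<in> insert z (nb E z)"
  then consider "u = z" | "{u, z} \<in> E" by (auto simp: nb_def)
  thus "u \<in> ?B"
  proof cases
   case 2
   thus ?thesis using bspec[OF bspec[OF ZJ(6) 2], of z] z by simp
  qed (use z in simp)
 qed
 moreover have finB: "finite ?B" using finite_subset[OF _ G.finV] ZJ(2) JV(1) by blast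
 moreover have "card (insert z (nb E z)) = dg E z + 1" using G.fin_nb by (simp add: nb_def)
 ultimately have cB: "5 \<le> card ?B" using d[of z] z ZJ(2) card_mono[of ?B "insert z (nb E z)"] by auto
 have A: "?A \<subset> V" using ZJ(1,2) by auto
 have B: "?B \<subset> V" using S(3) cA ZJ(5) ZJ(2) JV(1) by auto
 have PA: "tri_claim ?A (ind E ?A)" and PB: "tri_claim ?B (ind E ?B)" using IH[OF A] IH[OF B] cA cB by simp_all
 show ?thesis
 proof (cases "card J = 3")
  case False
  hence "card J \<le> 2" using ZJ(5) by simp
  thus ?thesis using S(2,3) tri_claim_crude[OF PA] tri_claim_crude[OF PB] by (intro tbd_round) linarith
 next
  case True
  have cl: "card (ind E J) = 3" "J \<in> tri (ind E J)" using clique3[OF True _ G.edge[THEN conjunct2]] ZJ(7) True by simp_all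
  interpret I: fgraph J "ind E J" by (rule G.fgraph_ind[OF JV(1)])
  have "card (tri (ind E J)) ~= 0" using cl(2) I.fin_tri by auto
  hence t: "card (tri E) + 1 \<le> card (tri (ind E ?A)) + card (tri (ind E ?B))" using S(2) by linarith
  have n: "card ?A + card ?B = card V + 3" using S(3) True by simp
  have e: "card (ind E ?A) + card (ind E ?B) + 6 = 4 * card V" using S(1) cl(1) cE by simp
  consider (A) "card ?A = 8" "card (ind E ?A) = 24" "card (tri (ind E ?A)) \<le> 32"
   | (B) "card ?B = 8" "card (ind E ?B) = 24" "card (tri (ind E ?B)) \<le> 32"
   | (N) "card (tri (ind E ?A)) + 18 \<le> tbd (card ?A)" "card (tri (ind E ?B)) + 18 \<le> tbd (card ?B)" using PA PB unfolding tri_claim_def by blast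
  thus ?thesis
  proof cases
   case A
   have V: "card V = card ?B + 5" using n A(1) by simp
   show ?thesis using glue_exceptional PB e A cB t by (fastforce simp: V)
  next
   case B
   have V: "card V = card ?A + 5" using n B(1) by simp
   show ?thesis using glue_exceptional PA e B cA t by (fastforce simp: V)
  next
   case N
   thus ?thesis using t tbd_add[of "card ?A" "card ?B"] tbd_add3[of "card V"] unfolding n by linarith
  qed
 qed
qed

lemma choose2_mono: "m \<le> n ==> m choose 2 \<le> n choose 2"
 unfolding choose_two by (intro div_le_mono mult_le_mono diff_le_mono)

lemma tbd_small: "tbd 3 = 19" "tbd 4 = 24" "tbd 5 = 29" "tbd 6 = 38" "tbd 8 = 48" "tbd 9 = 57" "tbd 11 = 67" by (simp_all add: tbd_def)

text \<open>Binomial coefficients suffice, except for the second conjunct with six vertices: at most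
  14 edges force a vertex of degree at most 4, which leaves at most 10 + 6 triangles.\<close>

lemma tri_claim_small:
 assumes op: "op1 V E" and n: "3 \<le> card V" "card V \<le> 6" shows "tri_claim V E"
proof -
 interpret G: fgraph V E by (rule op1_fgraph[OF op])
 consider "card V = 3" | "card V = 4" | "card V = 5" | "card V = 6" using n by linarith
 thus ?thesis
 proof cases
  case 4
  have c: "card (tri E) \<le> 20" using G.card_tri_choose 4 by (simp add: choose_reduce_nat)
  have "card (tri E) \<le> 18" if "card E + 10 \<le> 24"
  proof -
   have "\<exists>v\<in>V. dg E v < 5"
   proof (rule ccontr)
    assume "\<not> ?thesis"
    hence "card V * 5 \<le> (\<Sum>v\<in>V. dg E v)" using sum_bounded_below[of V 5 "dg E"] by (simp add: not_less)
    thus False using G.sum_dg that 4 by simp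
   qed
   then obtain v where v: "v \<in> V" "dg E v < 5" by (elim bexE)
   interpret D: fgraph "V - {v}" "ind E (V - {v})" by (rule G.fgraph_ind) blast
   have "card (tri (ind E (V - {v}))) \<le> 10" using D.card_tri_choose 4 v(1) by (simp add: choose_reduce_nat)
   moreover have "dg E v choose 2 \<le> 4 choose 2" using v(2) by (intro choose2_mono) simp
   hence "en E v \<le> 6" using G.en_le_choose[of v] by (simp add: choose_two)
   ultimately show ?thesis using G.tri_delete[of v] by linarith
  qed
  thus ?thesis using c 4 by (simp add: tri_claim_def tbd_small)
 qed (use G.card_tri_choose in \<open>simp add: tri_claim_def tbd_small choose_reduce_nat\<close>)+
qed

text \<open>A further vertex raises \<open>tbd\<close> by at least 5, and by 9 when a multiple of
  three is reached, which also yields the second conjunct.\<close>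

lemma tri_claim_delete:
 assumes "fgraph V E" "v \<in> V" "en E v \<le> 5" "7 \<le> card V" and IH: "tri_claim (V - {v}) (ind E (V - {v}))" shows "tri_claim V E"
proof -
 interpret G: fgraph V E by fact
 obtain k where k: "card V = Suc k" using assms(4) by (cases "card V") auto
 have k': "card (V - {v}) = k" using k assms(2) by simp
 have t: "card (tri E) \<le> card (tri (ind E (V - {v}))) + 5" using G.tri_delete[of v] assms(3) by linarith
 from IH consider "card (tri (ind E (V - {v}))) + 18 \<le> tbd k" | "k = 8" "card (tri (ind E (V - {v}))) \<le> 32" unfolding tri_claim_def k' by blast
 thus ?thesis
 proof cases
  case 1
  have "tbd k + 9 = tbd (card V)" if "card V mod 3 = 0" using that unfolding k by (rule tbd_Suc(2))
  thus ?thesis using 1 t tbd_Suc(1)[of k] unfolding tri_claim_def k[symmetric] by linarith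
 next
  case 2
  thus ?thesis using t k by (simp add: tri_claim_def tbd_small)
 qed
qed

text \<open>By parity and the condition at degree 4, degree plus \<tau> is at least 6 at every
  vertex. At a dominating vertex the degree 7 is odd, so \<tau> is positive and the sum at least 8.
  Three such vertices give a total of 54, while 2 times 23 plus 6 is 52.\<close>

lemma tri_claim_eight:
 assumes "fgraph V E" "card V = 8" "card E = 23" and d: "\<And>v. v \<in> V ==> 4 \<le> dg E v"
  and \<tau>: "sum \<tau> V = (6 :: nat)" "\<And>v. v \<in> V ==> even (\<tau> v + dg E v)" "\<And>v. v \<in> V ==> dg E v = 4 ==> \<tau> v ~= 0"
  and D: "D \<subseteq> V" "3 \<le> card D" "\<And>v. v \<in> D ==> nb E v = V - {v}"
 shows False
proof -
 interpret G: fgraph V E by fact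
 have "6 + (if v \<in> D then 2 else 0) \<le> \<tau> v + dg E v" if v: "v \<in> V" for v
 proof (cases "v \<in> D")
  case True
  hence "dg E v = 7" using D(3)[OF True] v assms(2) G.finV by simp
  moreover have "\<tau> v ~= 0" using \<tau>(2)[OF v] calculation by (intro notI) simp
  ultimately show ?thesis by simp
 next
  case False
  have "\<tau> v + dg E v ~= 5" using \<tau>(2)[OF v] by (intro notI) simp
  moreover have "\<tau> v + dg E v ~= 4" using \<tau>(3)[OF v] d[OF v] by linarith
  ultimately show ?thesis using d[OF v] False by simp
 qed
 hence "(\<Sum>v\<in>V. 6 + (if v \<in> D then 2 else 0)) \<le> (\<Sum>v\<in>V. \<tau> v + dg E v)" by (rule sum_mono)
 moreover have "(\<Sum>v\<in>V. if v \<in> D then 2 else 0) = (2::nat) * card D" using G.finV D(1) by (simp add: sum.If_cases Int_absorb1)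
 ultimately show False using \<tau>(1) G.sum_dg assms(2,3) D(2) by (simp add: sum.distrib)
qed

text \<open>If all \<open>\<delta>\<^sub>v \<ge> 2\<close>, counting suffices. A vertex with
  \<open>\<delta>\<^sub>v = 1\<close> either yields a separation or dominates the graph; at most
  four vertices dominate, and they spoil the count only for 8 vertices, where at least three are
  needed.\<close>

lemma tri_claim_near:
 assumes op: "op1 V E" and n: "7 \<le> card V" and cE: "card E + 9 = 4 * card V"
  and d: "\<And>v. v \<in> V ==> 4 \<le> dg E v" and IH: "\<And>W. W \<subset> V ==> 3 \<le> card W ==> tri_claim W (ind E W)"
 shows "card (tri E) + 18 \<le> tbd (card V)"
proof (rule ccontr)
 assume no: "\<not> ?thesis"
 interpret G: fgraph V E by (rule op1_fgraph[OF op])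
 have n4: "4 \<le> card V" using n by simp
 have s3: "3 * (\<Sum>v\<in>V. dg E v) = 24 * card V - 54" using G.sum_dg cE by simp
 have two: "\<not> (\<forall>v\<in>V. en E v + 6 \<le> 3 * dg E v)"
 proof
  assume "\<forall>v\<in>V. en E v + 6 \<le> 3 * dg E v"
  hence "3 * card (tri E) + 6 * card V + 54 \<le> 24 * card V" using sum_mono s3 n by (fastforce simp: G.three_tri sum.distrib sum_distrib_left)
  moreover have "card V mod 3 = 2 --> 8 \<le> card V" using n by (cases "card V = 7") auto
  ultimately show False using no n tbd3[of "card V"] mod3[of "card V"] by linarith
 qed
 from op1_near_tight[OF op n4 cE] two d obtain \<tau> :: "'a => nat" where
  \<tau>: "sum \<tau> V = 6" "\<forall>v\<in>V. even (\<tau> v + dg E v) \<and> (dg E v = 4 --> \<tau> v ~= 0)"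
  and sep: "\<And>v. v \<in> V ==> en E v + 5 = 3 * dg E v ==> nb E v ~= V - {v} ==> separable V E (insert v (nb E v))" by auto
 define D where "D = {v \<in> V. en E v + 5 = 3 * dg E v}"
 have dom: "nb E v = V - {v}" if v: "v \<in> D" for v
 proof (rule ccontr)
  assume nd: "nb E v ~= V - {v}"
  have vV: "v \<in> V" "en E v + 5 = 3 * dg E v" using v by (simp_all add: D_def)
  have vn: "v \<notin> nb E v" by (simp add: nb_def)
  have "card (tri E) + 18 \<le> tbd (card V)"
  proof (rule separable_bound[OF op cE _ _ d sep[OF vV nd] IH])
   show "insert v (nb E v) \<subseteq> V" using G.nb_sub vV(1) by blast
   show "5 \<le> card (insert v (nb E v))" using G.fin_nb vn d[OF vV(1)] by simp
  qed
  thus False using no by simp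
 qed
 have DV: "D \<subseteq> V" by (auto simp: D_def)
 have "en E v + 5 + (if v \<in> D then 0 else 1) \<le> 3 * dg E v" if v: "v \<in> V" for v using en_bound[OF op v d[OF v]] v by (auto simp: D_def)
 hence "(\<Sum>v\<in>V. en E v + 5 + (if v \<in> D then 0 else 1)) \<le> (\<Sum>v\<in>V. 3 * dg E v)" by (rule sum_mono)
 moreover have "(\<Sum>v\<in>V. if v \<in> D then 0 else 1) = card V - card D" using G.finV DV by (simp add: sum.If_cases Diff_eq[symmetric] card_Diff_subset finite_subset)
 moreover have "card D \<le> card V" by (rule card_mono[OF G.finV DV])
 ultimately have s: "3 * card (tri E) + 6 * card V + 54 \<le> 24 * card V + card D" using s3 n by (simp add: G.three_tri sum.distrib sum_distrib_left[symmetric])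
 have D4: "card D \<le> 4"
 proof (rule ccontr)
  assume "\<not> card D \<le> 4"
  hence "10 * card V \<le> 2 * card E + 30" by (intro G.dominating_card[OF DV dom]) simp_all
  thus False using cE n by linarith
 qed
 have n8: "card V = 8" "3 \<le> card D"
 proof -
  have 1: "card V + 3 \<le> 4 * (card V mod 3) + card D" using s no tbd3[of "card V"] by linarith
  hence "card V mod 3 = 2" "card V \<le> 9" using D4 n mod3[of "card V"] by linarith+
  moreover hence "card V ~= 7" "card V ~= 9" by auto
  ultimately show "card V = 8" using n by linarith
  thus "3 \<le> card D" using 1 by simp
 qed
 show False by (rule tri_claim_eight[OF op1_fgraph[OF op] n8(1) _ d \<tau>(1) _ _ DV n8(2) dom]) (use \<tau>(2) cE n8(1) in auto)
qed

text \<open>\<open>\<delta>\<^sub>v \<ge> 2\<close> everywhere bounds three times the number of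
  triangles by 18n - 48. This suffices except for 7, 8 and 11 vertices: 7 is impossible since all
  degrees are at least 6, 8 is the exceptional case, and for 11 one vertex has to save one
  more.\<close>

lemma tri_claim_tight:
 assumes op: "op1 V E" and n: "7 \<le> card V" and cE: "card E + 8 = 4 * card V"
  and d: "\<And>v. v \<in> V ==> 4 \<le> dg E v"
 shows "card (tri E) + 18 \<le> tbd (card V) \<or> card V = 8 \<and> card E = 24 \<and> card (tri E) \<le> 32"
proof -
 interpret G: fgraph V E by (rule op1_fgraph[OF op])
 have n4: "4 \<le> card V" using n by simp
 note T = op1_tight[OF op n4 cE _ d]
 have s3: "3 * (\<Sum>v\<in>V. dg E v) + 48 = 24 * card V" using G.sum_dg cE by simp
 have "(\<Sum>v\<in>V. en E v + 6) \<le> (\<Sum>v\<in>V. 3 * dg E v)" using T(3) by (intro sum_mono) simp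
 hence s: "3 * card (tri E) + 48 \<le> 18 * card V" using s3 by (simp add: G.three_tri sum.distrib sum_distrib_left)
 have dle: "dg E v + 1 \<le> card V" if "v \<in> V" for v
 proof -
  have "dg E v \<le> card (V - {v})" using G.finV by (intro card_mono G.nb_sub) simp
  thus ?thesis using that G.finV n by simp
 qed
 consider "card V = 7" | "card V = 8" | "card V = 11" | "card V mod 3 = 0" "9 \<le> card V" | "card V mod 3 = 1" "10 \<le> card V"
  | "card V mod 3 = 2" "14 \<le> card V"
 proof -
  have "card V \<in> {7, 8, 9, 10, 11, 12, 13} \<or> 14 \<le> card V" using n by auto
  moreover have "card V mod 3 = 0 \<or> card V mod 3 = 1 \<or> card V mod 3 = 2" using mod3[of "card V"] by linarith
  ultimately show ?thesis using that by (elim disjE insertE emptyE) auto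
 qed
 thus ?thesis
 proof cases
  case 1
  have "card V * 6 \<le> (\<Sum>v\<in>V. dg E v)" using sum_bounded_below[of V 6 "dg E"] T(2) by simp
  thus ?thesis using G.sum_dg cE 1 by simp
 next
  case 2
  thus ?thesis using s cE by simp
 next
  case 3
  have d8: "dg E v \<le> 8" if v: "v \<in> V" for v
  proof (rule ccontr)
   assume "\<not> dg E v \<le> 8"
   moreover have "dg E v ~= 9" using T(1)[OF v] v by (intro notI) simp
   ultimately have d10: "dg E v = 10" using dle[OF v] 3 by linarith
   have "nb E v = V - {v}" using d10 3 v G.finV G.nb_sub[of v] by (intro card_subset_eq) simp_all
   hence "insert v (nb E v) = V" using v by blast
   moreover have "ind E V = E" using G.edge by (auto simp: ind_def)
   ultimately have "card E = 10 + en E v" using G.card_ind_closed_nb[of v] d10 by simp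
   thus False using T(3)[OF v v] d10 cE 3 by simp
  qed
  \<comment> \<open>Degrees are even and at most 8, and they sum to 72, more than 11 times 6. A
    vertex of degree 8 has exactly two non-neighbours, as \<open>en_far\<close> requires.\<close>
  have "\<exists>v\<in>V. dg E v = 8"
  proof (rule ccontr)
   assume no: "\<not> ?thesis"
   have "dg E v \<le> 6" if v: "v \<in> V" for v using T(1) v d8 no by fastforce
   hence "(\<Sum>v\<in>V. dg E v) \<le> card V * 6" using sum_bounded_above[of V "dg E" 6] by simp
   thus False using s3 3 by simp
  qed
  then obtain v where v: "v \<in> V" "dg E v = 8" by (elim bexE)
  have far: "en E v + 19 \<le> card E" using G.en_far[OF v(1)] v 3 T(2) by simp
  have fin: "finite (V - {v})" using G.finV by simp
  have "(\<Sum>u\<in>V - {v}. en E u + 6) \<le> (\<Sum>u\<in>V - {v}. 3 * dg E u)" using T(3) by (intro sum_mono) simp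
  moreover have "(\<Sum>u\<in>V. en E u + 6) = en E v + 6 + (\<Sum>u\<in>V - {v}. en E u + 6)" by (rule sum.remove[OF G.finV v(1)])
  moreover have "(\<Sum>u\<in>V. 3 * dg E u) = 3 * dg E v + (\<Sum>u\<in>V - {v}. 3 * dg E u)" by (rule sum.remove[OF G.finV v(1)])
  ultimately have "(\<Sum>u\<in>V. en E u + 6) + 1 \<le> (\<Sum>u\<in>V. 3 * dg E u)" using far v(2) cE 3 by linarith
  hence "3 * card (tri E) + 49 \<le> 18 * card V" using s3 by (simp add: G.three_tri sum.distrib sum_distrib_left)
  thus ?thesis using 3 by (simp add: tbd_small)
 qed (use s tbd3[of "card V"] in linarith)+
qed

theorem triangle_claim:
 assumes "op1 V E" "3 \<le> card V" shows "tri_claim V E"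
 using assms
proof (induction "card V" arbitrary: V E rule: less_induct)
 case less
 interpret G: fgraph V E by (rule op1_fgraph[OF less.prems(1)])
 have IH: "tri_claim W (ind E W)" if W: "W \<subset> V" "3 \<le> card W" for W using psubset_card_mono[OF G.finV W(1)] W
  by (intro less.hyps) (simp_all add: op1_ind[OF less.prems(1)] psubset_imp_subset)
 show ?case
 proof (cases "card V \<le> 6")
  case True
  thus ?thesis by (intro tri_claim_small less.prems)
 next
  case False
  hence n: "7 \<le> card V" by simp
  show ?thesis
  proof (cases "\<exists>v\<in>V. en E v \<le> 5")
   case True
   then obtain v where v: "v \<in> V" "en E v \<le> 5" by (elim bexE)
   have "tri_claim (V - {v}) (ind E (V - {v}))" using v n G.finV by (intro IH) auto
   thus ?thesis by (rule tri_claim_delete[OF op1_fgraph[OF less.prems(1)] v n])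
  next
   case no: False
   have d: "4 \<le> dg E v" if v: "v \<in> V" for v
   proof (rule ccontr)
    assume "\<not> ?thesis"
    hence "dg E v choose 2 \<le> 3 choose 2" by (intro choose2_mono) simp
    hence "en E v \<le> 3" using G.en_le_choose[of v] by (simp add: choose_two)
    thus False using no v by auto
   qed
   have "(\<Sum>v\<in>V. en E v + 5) \<le> (\<Sum>v\<in>V. 3 * dg E v)" using en_bound[OF less.prems(1) _ d] by (intro sum_mono) simp
   hence s: "3 * card (tri E) + 5 * card V \<le> 6 * card E" using G.sum_dg by (simp add: G.three_tri sum.distrib sum_distrib_left[symmetric])
   have "card E + 8 \<le> 4 * card V" by (rule op1_edge_bound[OF less.prems])
   then consider "card E + 8 = 4 * card V" | "card E + 9 = 4 * card V" | "card E + 10 \<le> 4 * card V" by linarith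
   thus ?thesis
   proof cases
    case 1
    thus ?thesis using tri_claim_tight[OF less.prems(1) n 1 d] by (auto simp: tri_claim_def)
   next
    case 2
    thus ?thesis using tri_claim_near[OF less.prems(1) n 2 d IH] by (auto simp: tri_claim_def)
   next
    case 3
    \<comment> \<open>\<open>\<delta>\<^sub>v \<ge> 1\<close> everywhere and
      \<open>\<delta> \<ge> 2\<close> give 6 (4n - 10) - 5n = 19n - 60.\<close>
    hence r: "3 * card (tri E) + 60 \<le> 19 * card V" using s by linarith
    hence "card (tri E) + 20 \<le> tbd (card V)" if "card V mod 3 = 0" using that tbd3[of "card V"] by linarith
    thus ?thesis using tbd_round[OF r] by (auto simp: tri_claim_def)
   qed
  qed
 qed
qed

section \<open>Families of arcs in the plane\<close>

locale arcfam =
 fixes A :: "'e set" and s t :: "'e => 'n" and \<gamma> :: "'e => real => complex" and pos :: "'n => complex" assumes finA: "finite A"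
  and arcs: "a \<in> A ==> arc (\<gamma> a)" and ends: "a \<in> A ==> pathstart (\<gamma> a) = pos (s a)" "a \<in> A ==> pathfinish (\<gamma> a) = pos (t a)"
  and pos_inj: "inj_on pos (s ` A \<union> t ` A)" and meet: "a \<in> A ==> b \<in> A ==> a ~= b ==> z \<in> path_image (\<gamma> a) ==> z \<in> path_image (\<gamma> b) ==>
   z \<in> {pos (s a), pos (t a)} \<and> z \<in> {pos (s b), pos (t b)}"
begin

abbreviation im :: "'e => complex set" where "im a == path_image (\<gamma> a)"

definition adj :: "'e set => ('n \<times> 'n) set" where
 "adj D = {(x, y). \<exists>b\<in>D. (x = s b \<and> y = t b) \<or> (x = t b \<and> y = s b)}"

text \<open>Simple paths with their edge sets and node sets as parameters, so that the union of the
  arcs and the degrees can be read off by induction.\<close>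

inductive spath :: "'e set => 'n => 'n => 'e set => 'n set => bool" for D where
 one: "b \<in> D ==> (u = s b \<and> w = t b) \<or> (u = t b \<and> w = s b) ==> spath D u w {b} {u, w}"
| step: "b \<in> D ==> (u = s b \<and> v = t b) \<or> (u = t b \<and> v = s b) ==> spath D v w B N ==> u \<notin> N ==>
  spath D u w (insert b B) (insert u N)"

lemma s_ne_t: "a \<in> A ==> s a ~= t a"
 using arcs[of a] ends[of a] arc_distinct_ends[of "\<gamma> a"] by auto

lemma pos_eq: "x \<in> s ` A \<union> t ` A ==> y \<in> s ` A \<union> t ` A ==> pos x = pos y \<longleftrightarrow> x = y"
 using pos_inj by (auto dest: inj_onD)

lemma ends_in: "a \<in> A ==> pos (s a) \<in> im a" "a \<in> A ==> pos (t a) \<in> im a"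
 using ends[of a] by (metis pathstart_in_path_image, metis pathfinish_in_path_image)

lemma spath_basic:
 assumes "spath D u w B N" shows "B \<subseteq> D" "u \<in> N" "w \<in> N" "finite B" "s ` B \<union> t ` B = N"
proof -
 have "B \<subseteq> D \<and> u \<in> N \<and> w \<in> N \<and> finite B \<and> s ` B \<union> t ` B = N" using assms
 proof induction
  case (step b u v w B N)
  hence "insert u N = insert u (insert v N)" by (simp add: insert_absorb)
  also have "\<dots> = {s b, t b} \<union> N" using step.hyps(2) by auto
  finally show ?case using step by auto
 qed auto
 thus "B \<subseteq> D" "u \<in> N" "w \<in> N" "finite B" "s ` B \<union> t ` B = N" by simp_all
qed

lemma spath_suffix: "spath D u w B N ==> x \<in> N ==> x ~= w ==> \<exists>B' N'. spath D x w B' N'"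
proof (induction rule: spath.induct)
 case (one b u w)
 thus ?case using spath.one by blast
next
 case (step b u v w B N)
 show ?case using spath.step step by blast
qed

lemma spath_exists:
 assumes "(u, w) \<in> (adj D)\<^sup>*" "u ~= w" shows "\<exists>B N. spath D u w B N"
 using assms
proof (induction rule: converse_rtrancl_induct)
 case (step u v)
 then obtain b where b: "b \<in> D" "(u = s b \<and> v = t b) \<or> (u = t b \<and> v = s b)" by (auto simp: adj_def)
 show ?case
 proof (cases "v = w")
  case True
  thus ?thesis using spath.one[OF b(1)] b(2) by blast
 next
  case False
  then obtain B N where B: "spath D v w B N" using step.IH by blast
  show ?thesis using spath_suffix B step.prems spath.step b by blast
 qed
qed simp

lemma deg_edge: "b \<in> A ==> (u = s b \<and> v = t b) \<or> (u = t b \<and> v = s b) ==> odd (deg s t {b} x) \<longleftrightarrow> (x = u) ~= (x = v)"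
 using s_ne_t[of b] by (auto simp: deg_single)

lemma spath_deg: "spath D u w B N ==> D \<subseteq> A ==> odd (deg s t B x) \<longleftrightarrow> (x = u) ~= (x = w)"
proof (induction rule: spath.induct)
 case (one b u w)
 thus ?case by (intro deg_edge) auto
next
 case (step b u v w B N)
 have B: "finite B" "s ` B \<union> t ` B = N" using spath_basic[OF step.hyps(3)] by simp_all
 have bB: "b \<notin> B" using B(2) step.hyps(2,4) by blast
 have "deg s t ({b} \<union> B) x = deg s t {b} x + deg s t B x" using B bB by (intro deg_Un) auto
 moreover have "odd (deg s t {b} x) \<longleftrightarrow> (x = u) ~= (x = v)" using step by (intro deg_edge) auto
 moreover have "odd (deg s t B x) \<longleftrightarrow> (x = v) ~= (x = w)" by (rule step.IH[OF step.prems])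
 ultimately show ?case by auto
qed

lemma spath_arc:
 "spath D u w B N ==> D \<subseteq> A ==> \<exists>g. arc g \<and> path_image g = \<Union>(im ` B) \<and> pathstart g = pos u \<and> pathfinish g = pos w"
proof (induction rule: spath.induct)
 case (one b u w)
 have b: "b \<in> A" using one by auto
 show ?case
 proof (cases "u = s b \<and> w = t b")
  case True
  thus ?thesis using arcs[OF b] ends[OF b] by (intro exI[of _ "\<gamma> b"]) simp
 next
  case False
  hence "u = t b \<and> w = s b" using one by blast
  thus ?thesis using arcs[OF b] ends[OF b] by (intro exI[of _ "reversepath (\<gamma> b)"]) (simp add: arc_reversepath)
 qed
next
 case (step b u v w B N)
 have b: "b \<in> A" using step by auto
 obtain g where g: "arc g" "path_image g = \<Union>(im ` B)" "pathstart g = pos v" "pathfinish g = pos w" using step.IH[OF step.prems] by (elim exE conjE)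
 have B: "B \<subseteq> A" "s ` B \<union> t ` B = N" "v \<in> N" using spath_basic[OF step.hyps(3)] step.prems by auto
 have bB: "b \<notin> B" using B(2) step.hyps(2,4) by blast
 have "\<exists>h. arc h \<and> path_image h = im b \<and> pathstart h = pos u \<and> pathfinish h = pos v"
 proof (cases "u = s b \<and> v = t b")
  case True
  thus ?thesis using arcs[OF b] ends[OF b] by (intro exI[of _ "\<gamma> b"]) simp
 next
  case False
  hence "u = t b \<and> v = s b" using step.hyps(2) by blast
  thus ?thesis using arcs[OF b] ends[OF b] by (intro exI[of _ "reversepath (\<gamma> b)"]) (simp add: arc_reversepath)
 qed
 then obtain h where h: "arc h" "path_image h = im b" "pathstart h = pos u" "pathfinish h = pos v" by (elim exE conjE)
 have "path_image h \<inter> path_image g \<subseteq> {pathstart g}"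
 proof
  fix z assume "z \<in> path_image h \<inter> path_image g"
  then obtain c where c: "z \<in> im b" "c \<in> B" "z \<in> im c" using h(2) g(2) by auto
  have m: "z \<in> {pos (s b), pos (t b)} \<and> z \<in> {pos (s c), pos (t c)}" using meet[OF b _ _ c(1,3)] c(2) B(1) bB by auto
  have "z ~= pos u" using m pos_eq step.hyps(2) b c(2) B(1) B(2) step.hyps(4) by blast
  thus "z \<in> {pathstart g}" using m step.hyps(2) g(3) by auto
 qed
 hence "arc (h +++ g)" using h g by (intro arc_join) auto
 moreover have "path_image (h +++ g) = \<Union>(im ` insert b B)" using h g by (simp add: path_image_join)
 ultimately show ?case using h(3) g(4) by (intro exI[of _ "h +++ g"]) simp
qed

lemma spath_loop:
 assumes a: "a \<in> A" and P: "spath (A - {a}) (s a) (t a) B N" shows "\<exists>c. simple_path c \<and> pathfinish c = pathstart c \<and> path_image c = im a \<union> \<Union>(im ` B)"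
proof -
 obtain g where g: "arc g" "path_image g = \<Union>(im ` B)" "pathstart g = pos (s a)" "pathfinish g = pos (t a)" using spath_arc[OF P] by blast
 have "simple_path (\<gamma> a +++ reversepath g)"
 proof (rule simple_path_join_loop)
  show "path_image (\<gamma> a) \<inter> path_image (reversepath g) \<subseteq> {pathstart (\<gamma> a), pathstart (reversepath g)}"
  proof
   fix z assume "z \<in> im a \<inter> path_image (reversepath g)"
   then obtain c where c: "z \<in> im a" "c \<in> B" "z \<in> im c" using g(2) by auto
   hence "z \<in> {pos (s a), pos (t a)}" using meet[OF a _ _ c(1,3)] spath_basic(1)[OF P] by blast
   thus "z \<in> {pathstart (\<gamma> a), pathstart (reversepath g)}" using ends[OF a] g by simp
  qed
 qed (use arcs[OF a] ends[OF a] g in \<open>simp_all add: arc_reversepath\<close>)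
 thus ?thesis using ends[OF a] g by (intro exI[of _ "\<gamma> a +++ reversepath g"]) (simp add: path_image_join)
qed

text \<open>Otherwise the component of \<open>s a\<close> in \<open>C - {a}\<close> would have
  \<open>s a\<close> as its only node of odd degree.\<close>

lemma cycle_closes:
 assumes C: "C \<subseteq> A" "cyc s t C" "a \<in> C" shows "(s a, t a) \<in> (adj (C - {a}))\<^sup>*"
proof (rule ccontr)
 assume no: "(s a, t a) \<notin> (adj (C - {a}))\<^sup>*"
 define K where "K = {x. (s a, x) \<in> (adj (C - {a}))\<^sup>*}"
 have finC: "finite C" by (rule finite_subset[OF C(1) finA])
 define B where "B = {b \<in> C - {a}. s b \<in> K}"
 have K: "s b \<in> K \<longleftrightarrow> t b \<in> K" if "b \<in> C - {a}" for b
 proof -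
  have "(s b, t b) \<in> adj (C - {a})" "(t b, s b) \<in> adj (C - {a})" using that by (auto simp: adj_def)
  thus ?thesis unfolding K_def mem_Collect_eq by (metis rtrancl.rtrancl_into_rtrancl)
 qed
 have dB: "deg s t B x = (if x \<in> K then deg s t (C - {a}) x else 0)" for x
 proof (cases "x \<in> K")
  case True
  have "{b \<in> B. s b = x} = {b \<in> C - {a}. s b = x}" "{b \<in> B. t b = x} = {b \<in> C - {a}. t b = x}" using True K by (auto simp: B_def)
  thus ?thesis using True by (simp add: deg_def)
 next
  case False
  have "s ` B \<union> t ` B \<subseteq> K" using K by (auto simp: B_def)
  thus ?thesis using False by (simp add: deg_outside)
 qed
 have dC: "deg s t C x = deg s t (C - {a}) x + deg s t {a} x" for x using deg_Un[of "C - {a}" "{a}" s t x] finC C(3) by (simp add: insert_absorb)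
 have od: "odd (deg s t (C - {a}) x) \<longleftrightarrow> (x = s a) ~= (x = t a)" for x
 proof -
  have "odd (deg s t {a} x) \<longleftrightarrow> (x = s a) ~= (x = t a)" using C(1,3) by (intro deg_edge) auto
  moreover have "even (deg s t C x)" using C(2) by (simp add: cyc_def)
  ultimately show ?thesis using dC[of x] by simp
 qed
 have tK: "t a \<notin> K" using no by (simp add: K_def)
 have "cyc s t B"
 proof (rule cyc_if_even_except[of _ "s a"])
  show "finite B" using finC by (simp add: B_def)
  fix x assume "x ~= s a"
  thus "even (deg s t B x)" using dB[of x] od[of x] tK by auto
 qed
 hence "even (deg s t B (s a))" by (simp add: cyc_def)
 moreover have "s a \<in> K" by (simp add: K_def)
 moreover have "s a ~= t a" using s_ne_t C by auto
 ultimately show False using dB[of "s a"] od[of "s a"] by simp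
qed

lemma compact_ims: "D \<subseteq> A ==> compact (\<Union>(im ` D))"
 using finite_subset[OF _ finA] arcs by (intro compact_UN) (auto intro!: compact_path_image arc_imp_path)

lemma connected_compl_im: "a \<in> A ==> connected (- im a)"
 using arcs by (intro connected_arc_complement) auto

text \<open>\<open>D1\<close> is the part connected with \<open>s a\<close>, \<open>D2\<close> the
  rest. Each meets the arc in at most one of its ends, which supplies the connected intersections
  for Janiszewski's theorem.\<close>

lemma split_off:
 assumes D: "D \<subseteq> A" and a: "a \<in> A" "a \<notin> D" and no: "(s a, t a) \<notin> (adj D)\<^sup>*"
 obtains D1 D2 where "D = D1 \<union> D2" "D1 \<inter> D2 = {}" "im a \<inter> \<Union>(im ` D1) \<subseteq> {pos (s a)}" "im a \<inter> \<Union>(im ` D2) \<subseteq> {pos (t a)}"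
  "\<Union>(im ` D1) \<inter> \<Union>(im ` D2) = {}" "pos (t a) \<notin> \<Union>(im ` D1)" "pos (s a) \<notin> \<Union>(im ` D2)"
proof -
 define K where "K = {x. (s a, x) \<in> (adj D)\<^sup>*}"
 have K: "s b \<in> K \<longleftrightarrow> t b \<in> K" if "b \<in> D" for b
 proof -
  have "(s b, t b) \<in> adj D" "(t b, s b) \<in> adj D" using that by (auto simp: adj_def)
  thus ?thesis unfolding K_def mem_Collect_eq by (metis rtrancl.rtrancl_into_rtrancl)
 qed
 have sK: "s a \<in> K" "t a \<notin> K" using no by (simp_all add: K_def)
 let ?D1 = "{b \<in> D. s b \<in> K}" and ?D2 = "{b \<in> D. s b \<notin> K}"
 have node: "x \<in> K \<longleftrightarrow> s b \<in> K" if "b \<in> D" "x \<in> s ` A \<union> t ` A" "pos x \<in> {pos (s b), pos (t b)}" for b x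
 proof -
  show ?thesis using that D pos_eq K by auto
 qed
 have na: "s a \<in> s ` A \<union> t ` A" "t a \<in> s ` A \<union> t ` A" using a by auto
 have ab: "z = pos (s a) \<and> s b \<in> K \<or> z = pos (t a) \<and> s b \<notin> K" if "b \<in> D" "z \<in> im a" "z \<in> im b" for b z
 proof -
  show ?thesis using meet a(1) that(2,3) that(1) D node sK by blast
 qed
 show thesis
 proof (rule that[of ?D1 ?D2])
  show "im a \<inter> \<Union>(im ` ?D1) \<subseteq> {pos (s a)}" "im a \<inter> \<Union>(im ` ?D2) \<subseteq> {pos (t a)}" using ab by blast+
  show "\<Union>(im ` ?D1) \<inter> \<Union>(im ` ?D2) = {}"
  proof (rule ccontr)
   assume "\<not> ?thesis"
   then obtain b c z where bc: "b \<in> D" "s b \<in> K" "c \<in> D" "s c \<notin> K" "z \<in> im b" "z \<in> im c" by auto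
   hence "z \<in> {pos (s b), pos (t b)} \<and> z \<in> {pos (s c), pos (t c)}" using D by (intro meet) auto
   then obtain x where x: "x \<in> {s b, t b}" "pos x \<in> {pos (s c), pos (t c)}" by auto
   have "x \<in> K" using x(1) K[OF bc(1)] bc(2) by auto
   moreover have "x \<in> s ` A \<union> t ` A" using x(1) bc(1) D by auto
   ultimately show False using node[OF bc(3) _ x(2)] bc(4) by simp
  qed
  show "pos (t a) \<notin> \<Union>(im ` ?D1)" "pos (s a) \<notin> \<Union>(im ` ?D2)" using ab[OF _ ends_in(2)[OF a(1)]] ab[OF _ ends_in(1)[OF a(1)]] pos_eq[OF na] s_ne_t[OF a(1)] by auto
 qed auto
qed

text \<open>Every arc of a forest is a bridge between two smaller forests. Its union with each of
  them has connected complement, since the intersections are at most single points.\<close>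

lemma forest_complement:
 assumes "D \<subseteq> A" "\<forall>C \<subseteq> D. cyc s t C --> C = {}" shows "connected (- \<Union>(im ` D))"
proof -
 have "finite D" by (rule finite_subset[OF assms(1) finA])
 thus ?thesis using assms
 proof (induction D rule: finite_psubset_induct)
  case (psubset D)
  show ?case
  proof (cases "D = {}")
   case False
   then obtain a where a: "a \<in> D" by blast
   have aA: "a \<in> A" using a psubset.prems by blast
   have "(s a, t a) \<notin> (adj (D - {a}))\<^sup>*"
   proof
    assume "(s a, t a) \<in> (adj (D - {a}))\<^sup>*"
    then obtain B N where P: "spath (D - {a}) (s a) (t a) B N" using spath_exists[OF _ s_ne_t[OF aA]] by blast
    have B: "B \<subseteq> D - {a}" "finite B" using spath_basic[OF P] by blast+
    have "deg s t (B \<union> {a}) x = deg s t B x + deg s t {a} x" for x using B by (intro deg_Un) auto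
    moreover have "odd (deg s t B x) \<longleftrightarrow> (x = s a) ~= (x = t a)" for x using psubset.prems(1) by (intro spath_deg[OF P]) blast
    moreover have "odd (deg s t {a} x) \<longleftrightarrow> (x = s a) ~= (x = t a)" for x by (intro deg_edge aA) simp
    ultimately have "even (deg s t (B \<union> {a}) x)" for x by (metis even_add)
    hence "cyc s t (B \<union> {a})" by (simp add: cyc_def)
    moreover have "B \<union> {a} \<subseteq> D" using B(1) a by blast
    ultimately show False using psubset.prems(2) by blast
   qed
   note no = this
   have DA: "D - {a} \<subseteq> A" using psubset.prems(1) by blast
   obtain D1 D2 where d: "D - {a} = D1 \<union> D2" "D1 \<inter> D2 = {}" "im a \<inter> \<Union>(im ` D1) \<subseteq> {pos (s a)}"
    "im a \<inter> \<Union>(im ` D2) \<subseteq> {pos (t a)}" "\<Union>(im ` D1) \<inter> \<Union>(im ` D2) = {}" by (rule split_off[OF DA aA _ no]) simp_all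
   have sub: "D1 \<subset> D" "D2 \<subset> D" using d(1) a by blast+
   have con1: "connected (- \<Union>(im ` D1))" and con2: "connected (- \<Union>(im ` D2))"
    using psubset.IH[OF sub(1)] psubset.IH[OF sub(2)] psubset.prems sub by (meson order_trans psubset_imp_subset)+
   have cl: "closed (\<Union>(im ` D1))" "closed (\<Union>(im ` D2))" "compact (im a)" using compact_ims sub psubset.prems(1) arcs[OF aA]
    by (auto intro!: compact_imp_closed compact_path_image arc_imp_path)
   have sing: "connected X" if "X \<subseteq> {x}" for X :: "complex set" and x using that by (metis connected_empty connected_sing subset_singletonD)
   have c1: "connected (- (im a \<union> \<Union>(im ` D1)))" by (rule Janiszewski_connected[OF cl(3,1) sing[OF d(3)] connected_compl_im[OF aA] con1])
   have "(im a \<union> \<Union>(im ` D1)) \<inter> \<Union>(im ` D2) = im a \<inter> \<Union>(im ` D2)" unfolding Int_Un_distrib2 d(5) by simp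
   hence c2: "connected ((im a \<union> \<Union>(im ` D1)) \<inter> \<Union>(im ` D2))" using sing[OF d(4)] by simp
   have c3: "compact (im a \<union> \<Union>(im ` D1))" using cl(3) compact_ims[of D1] sub psubset.prems(1) by (intro compact_Un) auto
   have "connected (- (im a \<union> \<Union>(im ` D1) \<union> \<Union>(im ` D2)))" by (rule Janiszewski_connected[OF c3 cl(2) c2 c1 con2])
   moreover have "im a \<union> \<Union>(im ` D1) \<union> \<Union>(im ` D2) = \<Union>(im ` D)" using d(1) a by auto
   ultimately show ?thesis by simp
  qed (simp add: connected_UNIV)
 qed
qed

end

section \<open>Cells of the complement as dual labels\<close>

context arcfam
begin

abbreviation sep :: "'e => complex set" where
 "sep a == \<Union>(im ` (A - {a})) \<union> {pos (s a), pos (t a)}"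

definition inn :: "'e => complex set" where "inn a = im a - {pos (s a), pos (t a)}"

text \<open>The surroundings of the open arc: the component containing it when all other arcs and
  its own ends are removed. The faces beside the arc are the cells in this region.\<close>

definition reg :: "'e => complex set" where
 "reg a = connected_component_set (- sep a) (\<gamma> a (1/2))"

abbreviation net :: "complex set" where "net == \<Union>(im ` A)"

lemma inn_eq: "a \<in> A ==> inn a = \<gamma> a ` {0<..<1}"
proof -
 assume a: "a \<in> A"
 have "im a = insert (\<gamma> a 0) (insert (\<gamma> a 1) (\<gamma> a ` {0<..<1}))"
 proof -
  have "{0..1::real} = insert 0 (insert 1 {0<..<1})" by auto
  thus ?thesis by (simp add: path_image_def)
 qed
 moreover have "\<gamma> a x ~= \<gamma> a 0 \<and> \<gamma> a x ~= \<gamma> a 1" if "x \<in> {0<..<1}" for x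
 proof -
  have inj: "inj_on (\<gamma> a) {0..1}" using arcs[OF a] by (simp add: arc_def)
  show ?thesis using inj_onD[OF inj, of x 0] inj_onD[OF inj, of x 1] that by auto
 qed
 ultimately show ?thesis using ends[OF a] by (auto simp: inn_def pathstart_def pathfinish_def)
qed

lemma inn_sep: "a \<in> A ==> inn a \<subseteq> - sep a"
 using meet[of a] by (auto simp: inn_def)

lemma net_eq: "a \<in> A ==> sep a \<union> im a = net"
 using ends_in[of a] by blast

lemma closed_net: "closed net" by (intro compact_imp_closed compact_ims) simp

lemma compact_sep: "compact (sep a)" by (intro compact_Un compact_ims) auto

lemma mid_inn: "a \<in> A ==> \<gamma> a (1/2) \<in> inn a" by (simp add: inn_eq)

lemma inn_reg: "a \<in> A ==> inn a \<subseteq> reg a"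
 unfolding reg_def
proof (rule connected_component_maximal)
 assume a: "a \<in> A"
 show "\<gamma> a (1/2) \<in> inn a" by (rule mid_inn[OF a])
 have "continuous_on {0<..<1} (\<gamma> a)" using arcs[OF a] by (auto simp: arc_def path_def intro: continuous_on_subset)
 thus "connected (inn a)" unfolding inn_eq[OF a] by (intro connected_continuous_image) auto
 show "inn a \<subseteq> - sep a" by (rule inn_sep[OF a])
qed

lemma open_reg: "open (reg a)"
 unfolding reg_def by (intro open_connected_component open_Compl compact_imp_closed compact_sep)

lemma connected_reg: "connected (reg a)" by (simp add: reg_def)

lemma reg_sep: "reg a \<subseteq> - sep a"
 unfolding reg_def by (rule connected_component_subset)

lemma reg_im: "a \<in> A ==> reg a - im a = reg a \<inter> - net"
 using reg_sep net_eq by blast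

lemma reg_joined: "x \<in> reg a ==> y \<in> reg a ==> connected_component (- sep a) x y"
 unfolding reg_def mem_Collect_eq by (rule connected_component_trans[OF connected_component_sym])

text \<open>At most two cells lie beside an arc. If the arc closes to a Jordan curve,
  \<open>Q\<close> is its inside: two points on one side are joined both off the curve and off the
  other arcs, hence off both by Janiszewski's theorem, because the intersection is the connected
  rest of the curve. For a bridge, the two parts of \<open>split_off\<close> show that there is one
  cell only, and \<open>Q\<close> is trivial.\<close>

lemma two_sides0:
 assumes a: "a \<in> A" shows "\<exists>Q. \<forall>x \<in> reg a \<inter> - net. \<forall>y \<in> reg a \<inter> - net. (x \<in> Q \<longleftrightarrow> y \<in> Q) --> connected_component (- net) x y"
proof (cases "(s a, t a) \<in> (adj (A - {a}))\<^sup>*")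
 case True
 then obtain B N where P: "spath (A - {a}) (s a) (t a) B N" using spath_exists[OF _ s_ne_t[OF a]] by blast
 obtain c where c: "simple_path c" "pathfinish c = pathstart c" "path_image c = im a \<union> \<Union>(im ` B)" using spath_loop[OF a P] by (elim exE conjE)
 obtain g where g: "arc g" "path_image g = \<Union>(im ` B)" "pathstart g = pos (s a)" "pathfinish g = pos (t a)" using spath_arc[OF P] by blast
 have B: "B \<subseteq> A - {a}" by (rule spath_basic(1)[OF P])
 have Bs: "\<Union>(im ` B) \<subseteq> sep a" using B by blast
 have "{pos (s a), pos (t a)} \<subseteq> \<Union>(im ` B)" using g by (metis pathfinish_in_path_image pathstart_in_path_image empty_subsetI insert_subset)
 moreover have "sep a \<inter> im a = {pos (s a), pos (t a)}" using inn_sep[OF a] ends_in[OF a] by (auto simp: inn_def)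
 ultimately have "sep a \<inter> path_image c = \<Union>(im ` B)" unfolding c(3) using Bs by blast
 hence con: "connected (sep a \<inter> path_image c)" using connected_arc_image[OF g(1)] g(2) by simp
 have cl: "closed (path_image c)" using c(1) by (simp add: closed_simple_path_image)
 note J = Jordan_inside_outside[OF c(1,2)]
 have un: "sep a \<union> path_image c = net" unfolding c(3) using net_eq[OF a] Bs by blast
 show ?thesis
 proof (rule exI[of _ "inside (path_image c)"], intro ballI impI)
  fix x y assume xy: "x \<in> reg a \<inter> - net" "y \<in> reg a \<inter> - net" "(x \<in> inside (path_image c)) = (y \<in> inside (path_image c))"
  have nc: "x \<notin> path_image c" "y \<notin> path_image c" using xy un by blast+
  have io: "inside (path_image c) \<union> outside (path_image c) = - path_image c"
   "connected (inside (path_image c))" "connected (outside (path_image c))" using J by simp_all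
  have "connected_component (- path_image c) x y"
  proof (cases "x \<in> inside (path_image c)")
   case True
   moreover have "y \<in> inside (path_image c)" using True xy(3) by simp
   moreover have "inside (path_image c) \<subseteq> - path_image c" using io(1) by blast
   ultimately show ?thesis using io(2) unfolding connected_component_def by blast
  next
   case False
   hence "x \<in> outside (path_image c)" "y \<in> outside (path_image c)" using io(1) nc xy(3) by blast+
   moreover have "outside (path_image c) \<subseteq> - path_image c" using io(1) by blast
   ultimately show ?thesis using io(3) unfolding connected_component_def by blast
  qed
  moreover have "connected_component (- sep a) x y" using reg_joined xy(1,2) by blast
  ultimately have "connected_component (- (sep a \<union> path_image c)) x y" using Janiszewski[OF compact_sep cl con] by blast
  thus "connected_component (- net) x y" unfolding un .
 qed
next
 case False
 obtain D1 D2 where d: "A - {a} = D1 \<union> D2" "D1 \<inter> D2 = {}" "im a \<inter> \<Union>(im ` D1) \<subseteq> {pos (s a)}"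
  "im a \<inter> \<Union>(im ` D2) \<subseteq> {pos (t a)}" "\<Union>(im ` D1) \<inter> \<Union>(im ` D2) = {}"
  "pos (t a) \<notin> \<Union>(im ` D1)" "pos (s a) \<notin> \<Union>(im ` D2)" by (rule split_off[OF _ a _ False]) auto
 let ?T1 = "insert (pos (s a)) (\<Union>(im ` D1))" and ?T2 = "insert (pos (t a)) (\<Union>(im ` D2))"
 have sub: "D1 \<subseteq> A" "D2 \<subseteq> A" using d(1) by blast+
 have un: "?T1 \<union> ?T2 = sep a" unfolding d(1) by blast
 have comp: "compact ?T1" "compact ?T2" "compact (im a)" using compact_ims sub arcs[OF a] by (auto intro!: compact_insert compact_path_image arc_imp_path)
 have i1: "im a \<inter> ?T1 = {pos (s a)}" using d(3) ends_in[OF a] by blast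
 have "pos (s a) ~= pos (t a)" using s_ne_t[OF a] pos_eq[of "s a" "t a"] a by auto
 hence i2: "(im a \<union> ?T1) \<inter> ?T2 = {pos (t a)}" using d(5,6,7) d(4) ends_in a by auto
 show ?thesis
 proof (rule exI[of _ UNIV], intro ballI impI)
  fix x y assume xy: "x \<in> reg a \<inter> - net" "y \<in> reg a \<inter> - net"
  have j: "connected_component (- sep a) x y" using reg_joined xy by blast
  have c1: "connected_component (- ?T1) x y" and c2: "connected_component (- ?T2) x y" by (rule connected_component_of_subset[OF j], use un in blast)+
  have c0: "connected_component (- im a) x y" using xy a connected_compl_im by (simp add: connected_iff_connected_component)
  have c3: "connected_component (- (im a \<union> ?T1)) x y" by (rule Janiszewski[OF comp(3) compact_imp_closed[OF comp(1)] _ c0 c1]) (simp add: i1)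
  have "connected_component (- (im a \<union> ?T1 \<union> ?T2)) x y"
   by (rule Janiszewski[OF compact_Un[OF comp(3,1)] compact_imp_closed[OF comp(2)] _ c3 c2]) (simp only: i2 connected_sing)
  moreover have "im a \<union> ?T1 \<union> ?T2 = net" using un net_eq[OF a] by blast
  ultimately show "connected_component (- net) x y" by simp
 qed
qed

definition cell :: "complex => complex set" where "cell x = connected_component_set (- net) x"

lemma two_sides:
 assumes a: "a \<in> A" shows "\<exists>x y. (cell x = {} \<longleftrightarrow> cell y = {}) \<and> cell x \<union> cell y = reg a \<inter> - net"
proof (cases "reg a \<inter> - net = {}")
 case True
 have "\<gamma> a (1/2) \<in> im a" using mid_inn[OF a] by (simp add: inn_def)
 hence "cell (\<gamma> a (1/2)) = {}" unfolding cell_def connected_component_eq_empty using a by blast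
 thus ?thesis using True by (intro exI[of _ "\<gamma> a (1/2)"]) simp
next
 case False
 then obtain x where x: "x \<in> reg a \<inter> - net" by blast
 have sub: "cell z \<subseteq> reg a \<inter> - net" if z: "z \<in> reg a \<inter> - net" for z
 proof -
  have "cell z \<subseteq> connected_component_set (- sep a) z" unfolding cell_def by (rule connected_component_mono) (use net_eq[OF a] in blast)
  also have "\<dots> = reg a" unfolding reg_def using z by (intro connected_component_eq[symmetric]) (simp add: reg_def connected_component_sym)
  finally show ?thesis using connected_component_subset[of "- net" z] by (auto simp: cell_def)
 qed
 have ne: "z \<in> cell z" if "z \<in> reg a \<inter> - net" for z using that by (simp add: cell_def)
 obtain Q where Q0: "\<forall>x \<in> reg a \<inter> - net. \<forall>y \<in> reg a \<inter> - net. (x \<in> Q \<longleftrightarrow> y \<in> Q) --> connected_component (- net) x y" using two_sides0[OF a] by (elim exE)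
 have Q: "\<And>x y. x \<in> reg a \<inter> - net ==> y \<in> reg a \<inter> - net ==> (x \<in> Q \<longleftrightarrow> y \<in> Q) ==> connected_component (- net) x y" by (rule mp[OF bspec[OF bspec[OF Q0]]])
 show ?thesis
 proof (cases "reg a \<inter> - net \<subseteq> cell x")
  case True
  thus ?thesis using equalityI sub x by fastforce
 next
  case False
  then obtain y where y: "y \<in> reg a \<inter> - net" "y \<notin> cell x" by blast
  have "z \<in> cell x \<union> cell y" if z: "z \<in> reg a \<inter> - net" for z
  proof -
   have "(x \<in> Q \<longleftrightarrow> y \<in> Q) ==> False" using Q[OF x y(1)] y(2) by (simp add: cell_def)
   hence "(x \<in> Q \<longleftrightarrow> z \<in> Q) \<or> (y \<in> Q \<longleftrightarrow> z \<in> Q)" by blast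
   thus ?thesis using Q[OF x z] Q[OF y(1) z] unfolding cell_def by (elim disjE) simp_all
  qed
  hence "cell x \<union> cell y = reg a \<inter> - net" by (intro equalityI Un_least sub x y(1) subsetI)
  moreover have "cell x ~= {}" "cell y ~= {}" using ne[OF x] ne[OF y(1)] by auto
  ultimately show ?thesis by (intro exI[of _ x] exI[of _ y] conjI) simp_all
 qed
qed

text \<open>\<open>cell x\<close> is empty for \<open>x\<close> on the net. The clause on emptiness
  keeps one side from being such a dummy while the other is a genuine face.\<close>

definition sided :: "('e => complex set) => ('e => complex set) => bool" where
 "sided l r \<longleftrightarrow> (\<forall>a\<in>A. (\<exists>x. l a = cell x) \<and> (\<exists>y. r a = cell y) \<and> (l a = {} \<longleftrightarrow> r a = {}) \<and> l a \<union> r a = reg a \<inter> - net)"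

lemma sided_exists: "\<exists>l r. sided l r"
proof -
 from two_sides have "\<exists>f. \<forall>a\<in>A. \<exists>y. (cell (f a) = {} \<longleftrightarrow> cell y = {}) \<and> cell (f a) \<union> cell y = reg a \<inter> - net" by (intro bchoice) blast
 then obtain f where "\<forall>a\<in>A. \<exists>y. (cell (f a) = {} \<longleftrightarrow> cell y = {}) \<and> cell (f a) \<union> cell y = reg a \<inter> - net" by (elim exE)
 then obtain g where "\<forall>a\<in>A. (cell (f a) = {} \<longleftrightarrow> cell (g a) = {}) \<and> cell (f a) \<union> cell (g a) = reg a \<inter> - net" by metis
 thus ?thesis unfolding sided_def by (intro exI[of _ "cell \<circ> f"] exI[of _ "cell \<circ> g"]) auto
qed

lemma cell_net: "cell x \<subseteq> - net" unfolding cell_def by (rule connected_component_subset)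
lemma connected_cell: "connected (cell x)" by (simp add: cell_def)
lemma open_cell: "open (cell x)"
 unfolding cell_def by (intro open_connected_component open_Compl closed_net)
lemma cell_eq: "x \<in> cell y ==> cell x = cell y"
 unfolding cell_def by (metis connected_component_eq)

text \<open>The region of an arc off the curve is connected and avoids the curve, so both its cells
  lie on the same side. Every point of the curve is a limit of both the inside and the outside, so
  the two cells at an arc of the curve lie on different sides.\<close>

lemma jordan_cut:
 assumes lr: "sided l r" and a: "a \<in> A" and P: "spath (A - {a}) (s a) (t a) B N" shows "insert a B = ecut A l r {f. f ~= {} \<and> f \<subseteq> inside (im a \<union> \<Union>(im ` B))}"
proof -
 let ?J = "im a \<union> \<Union>(im ` B)" let ?S = "{f. f ~= {} \<and> f \<subseteq> inside ?J}"
 obtain c where c: "simple_path c" "pathfinish c = pathstart c" "path_image c = ?J" using spath_loop[OF a P] by (elim exE conjE)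
 note J = Jordan_inside_outside[OF c(1,2), unfolded c(3)]
 have Jn: "?J \<subseteq> net" using a spath_basic(1)[OF P] by blast
 have io: "inside ?J \<inter> outside ?J = {}" using J by simp
 have side: "X \<subseteq> inside ?J \<or> X \<subseteq> outside ?J" if X: "connected X" "X \<subseteq> - ?J" for X
 proof -
  have "inside ?J \<inter> X = {} \<or> outside ?J \<inter> X = {}"
  proof (rule connectedD[OF X(1)])
   show "open (inside ?J)" "open (outside ?J)" using J by simp_all
   show "inside ?J \<inter> outside ?J \<inter> X = {}" using io by blast
   show "X \<subseteq> inside ?J \<union> outside ?J" using J X(2) by simp
  qed
  moreover have "X \<subseteq> inside ?J \<union> outside ?J" using J X(2) by simp
  ultimately show ?thesis by blast
 qed
 have BA: "insert a B \<subseteq> A" using a spath_basic(1)[OF P] by blast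
 have "b \<in> insert a B \<longleftrightarrow> (l b \<in> ?S) ~= (r b \<in> ?S)" if b: "b \<in> A" for b
 proof -
  obtain x y where xy: "l b = cell x" "r b = cell y" and e: "l b = {} \<longleftrightarrow> r b = {}" "l b \<union> r b = reg b \<inter> - net"
   using bspec[OF lr[unfolded sided_def] b] by (elim conjE exE)
  show ?thesis
  proof (cases "b \<in> insert a B")
   case False
   have "?J \<subseteq> sep b" using BA False by blast
   hence "reg b \<subseteq> - ?J" using reg_sep[of b] by blast
   hence "reg b \<subseteq> inside ?J \<or> reg b \<subseteq> outside ?J" by (rule side[OF connected_reg])
   thus ?thesis using e(2) e(1) io False by blast
  next
   case True
   have bJ: "im b \<subseteq> ?J" using True by blast
   let ?z = "\<gamma> b (1/2)"
   have z: "?z \<in> reg b" "?z \<in> ?J" using mid_inn[OF b] inn_reg[OF b] bJ by (auto simp: inn_def)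
   hence "?z \<in> closure (inside ?J)" "?z \<in> closure (outside ?J)" using J by (auto simp: frontier_def)
   hence "reg b \<inter> inside ?J ~= {}" "reg b \<inter> outside ?J ~= {}" using z(1) open_Int_closure_eq_empty[OF open_reg] by blast+
   then obtain u v where uv: "u \<in> reg b" "u \<in> inside ?J" "v \<in> reg b" "v \<in> outside ?J" by blast
   have "u \<notin> ?J" "v \<notin> ?J" using J uv by blast+
   hence "u \<in> reg b \<inter> - net" "v \<in> reg b \<inter> - net" using uv bJ reg_im[OF b] by blast+
   hence u: "u \<in> l b \<or> u \<in> r b" and v: "v \<in> l b \<or> v \<in> r b" using e(2) by blast+
   have "cell w \<subseteq> inside ?J \<or> cell w \<subseteq> outside ?J" for w using cell_net[of w] Jn by (intro side connected_cell) blast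
   hence "l b \<subseteq> inside ?J \<or> l b \<subseteq> outside ?J" "r b \<subseteq> inside ?J \<or> r b \<subseteq> outside ?J" using xy by simp_all
   moreover have ne: "l b ~= {}" "r b ~= {}" using u e(1) by auto
   moreover have "\<not> (l b \<subseteq> inside ?J \<and> r b \<subseteq> inside ?J)" using v uv(4) io by blast
   moreover have "\<not> (l b \<subseteq> outside ?J \<and> r b \<subseteq> outside ?J)" using u uv(2) io by blast
   moreover have "\<not> (f \<subseteq> inside ?J \<and> f \<subseteq> outside ?J)" if "f ~= {}" for f using that io by blast
   ultimately have "(l b \<subseteq> inside ?J) ~= (r b \<subseteq> inside ?J)" by metis
   thus ?thesis using ne True by simp
  qed
 qed
 thus ?thesis using BA by (auto simp: ecut_def)
qed

text \<open>A cycle is a sum of Jordan curves, and each of them is the cut by its inside.\<close>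

lemma cycle_cut:
 assumes lr: "sided l r" shows "C \<subseteq> A ==> cyc s t C ==> \<exists>S. C = ecut A l r S"
proof (induction "card C" arbitrary: C rule: less_induct)
 case less
 have finC: "finite C" by (rule finite_subset[OF less.prems(1) finA])
 show ?case
 proof (cases "C = {}")
  case True
  thus ?thesis by (intro exI[of _ "{}"]) (simp add: ecut_def)
 next
  case False
  then obtain a where a: "a \<in> C" by blast
  have aA: "a \<in> A" using a less.prems by blast
  obtain B N where P: "spath (C - {a}) (s a) (t a) B N" by (metis cycle_closes less.prems a spath_exists s_ne_t aA)
  have mono: "spath D' u w B N" if "spath D u w B N" "D \<subseteq> D'" for D D' u w B N using that by (induction rule: spath.induct) (auto intro: spath.intros)
  have PA: "spath (A - {a}) (s a) (t a) B N" using less.prems(1) by (intro mono[OF P]) blast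
  have B: "B \<subseteq> C - {a}" "finite B" using spath_basic[OF P] by blast+
  have Z: "cyc s t (insert a B)"
  proof -
   have "deg s t (B \<union> {a}) x = deg s t B x + deg s t {a} x" for x using B by (intro deg_Un) auto
   moreover have "odd (deg s t B x) \<longleftrightarrow> (x = s a) ~= (x = t a)" for x by (rule spath_deg[OF PA]) blast
   moreover have "odd (deg s t {a} x) \<longleftrightarrow> (x = s a) ~= (x = t a)" for x by (intro deg_edge aA) simp
   ultimately have "even (deg s t (B \<union> {a}) x)" for x by (metis even_add)
   thus ?thesis by (simp add: cyc_def)
  qed
  have sub: "insert a B \<subseteq> C" using B a by blast
  hence sd: "sym_diff C (insert a B) = C - insert a B" by blast
  have "cyc s t (sym_diff C (insert a B))" using B(2) by (intro cyc_sym_diff finC less.prems Z) simp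
  moreover have "card (C - insert a B) < card C" using a sub finC by (intro psubset_card_mono) auto
  ultimately obtain S where S: "C - insert a B = ecut A l r S" using less.hyps[of "C - insert a B"] less.prems(1) sd by auto
  obtain S' where S': "insert a B = ecut A l r S'" using jordan_cut[OF lr aA PA] by blast
  have "C = sym_diff (C - insert a B) (insert a B)" using sub by blast
  also have "\<dots> = ecut A l r (sym_diff S S')" unfolding cut_sym_diff S[symmetric] S'[symmetric] ..
  finally show ?thesis by (rule exI)
 qed
qed

text \<open>The arcs of the cut form a forest, so their complement is connected, even after removing
  the finitely many nodes. If the cut is nonempty, the cells in \<open>S\<close> and those outside,
  each joined with the open arcs between them, split this complement into two open sets.\<close>

lemma acyclic_cut:
 assumes lr: "sided l r" and ac: "\<forall>C \<subseteq> ecut A l r S. cyc s t C --> C = {}" shows "ecut A l r S = {}"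
proof (rule ccontr)
 let ?D = "ecut A l r S" let ?T = "pos ` (s ` A \<union> t ` A)"
 let ?G = "- \<Union>(im ` ?D) - ?T"
 assume "?D ~= {}"
 then obtain d where d: "d \<in> A" "(l d \<in> S) ~= (r d \<in> S)" by (auto simp: ecut_def)
 have DA: "?D \<subseteq> A" by (rule cut_subset)
 have con: "connected ?G"
 proof (rule connected_open_delete_finite)
  show "open (- \<Union>(im ` ?D))" by (intro open_Compl compact_imp_closed compact_ims DA)
  show "connected (- \<Union>(im ` ?D))" by (rule forest_complement[OF DA ac])
  show "finite ?T" using finA by simp
 qed simp
 have Tn: "?T \<subseteq> net" using ends_in by blast
 have L: "(\<exists>x. l a = cell x) \<and> (\<exists>y. r a = cell y) \<and> (l a = {} \<longleftrightarrow> r a = {}) \<and> l a \<union> r a = reg a \<inter> - net" if "a \<in> A" for a using lr that by (simp add: sided_def)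
 define W where "W = (\<lambda>P. \<Union>{reg b |b. b \<in> A - ?D \<and> l b \<in> P} \<union> \<Union>{cell x |x. cell x \<in> P})"
 have openW: "open (W P)" for P unfolding W_def by (intro open_Un open_Union ballI) (auto simp: open_reg open_cell)
 have cellW: "cell z \<in> P" if z: "z \<in> W P" "z \<notin> net" and P: "P = S \<or> P = - S" for z P
 proof -
  from z(1) consider b where "b \<in> A - ?D" "l b \<in> P" "z \<in> reg b" | x where "cell x \<in> P" "z \<in> cell x" unfolding W_def by blast
  thus ?thesis
  proof cases
   case 1
   hence "z \<in> l b \<or> z \<in> r b" using L[of b] z(2) by blast
   hence "cell z = l b \<or> cell z = r b" using L[of b] 1(1) cell_eq by (metis DiffD1)
   moreover have "l b \<in> S \<longleftrightarrow> r b \<in> S" using 1(1) by (simp add: ecut_def)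
   ultimately show ?thesis using P 1(2) by auto
  next
   case 2
   thus ?thesis using cell_eq by simp
  qed
 qed
 have edgeW: "\<exists>b\<in>A. l b \<in> P \<and> z \<in> reg b" if z: "z \<in> W P" "z \<in> net" for z P using z cell_net unfolding W_def by blast
 have WI: "z \<in> W P" if "cell z \<in> P" "z \<in> cell z" for z P unfolding W_def using that by (intro UnI2 UnionI[of "cell z"]) auto
 have cover: "?G \<subseteq> W S \<union> W (- S)"
 proof
  fix z assume z: "z \<in> ?G"
  show "z \<in> W S \<union> W (- S)"
  proof (cases "z \<in> net")
   case True
   then obtain b where b: "b \<in> A" "z \<in> im b" by blast
   have "b \<notin> ?D" using z b by blast
   moreover have "z \<in> reg b" using b z inn_reg[OF b(1)] by (auto simp: inn_def)
   ultimately show ?thesis using b(1) unfolding W_def by blast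
  next
   case False
   hence "z \<in> cell z" by (simp add: cell_def)
   thus ?thesis using WI[of z S] WI[of z "- S"] by (cases "cell z \<in> S") simp_all
  qed
 qed
 have disj: "W S \<inter> W (- S) \<inter> ?G = {}"
 proof (rule ccontr)
  assume "\<not> ?thesis"
  then obtain z where z: "z \<in> W S" "z \<in> W (- S)" by blast
  show False
  proof (cases "z \<in> net")
   case False
   thus False using cellW[OF z(1)] cellW[OF z(2)] by simp
  next
   case True
   obtain b where b: "b \<in> A" "l b \<in> S" "z \<in> reg b" using edgeW[OF z(1) True] by blast
   obtain b' where b': "b' \<in> A" "l b' \<notin> S" "z \<in> reg b'" using edgeW[OF z(2) True] by blast
   have "z \<in> im b" using True reg_im[OF b(1)] b(3) by blast
   moreover have "b ~= b'" using b(2) b'(2) by auto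
   ultimately show False using b(1) reg_sep b'(3) by auto
  qed
 qed
 have alt: "W S \<inter> ?G = {} \<or> W (- S) \<inter> ?G = {}" by (rule connectedD[OF con openW openW disj cover])
 obtain x y where xy: "x \<in> l d" "y \<in> r d" using L d(1) d(2) by fastforce
 have "x \<notin> net" "y \<notin> net" using xy L[OF d(1)] by blast+
 moreover have "\<Union>(im ` ?D) \<subseteq> net" by (rule Union_mono[OF image_mono[OF DA]])
 ultimately have xyG: "x \<in> ?G" "y \<in> ?G" using Tn by (meson ComplI DiffI subsetD)+
 have c: "cell x = l d" "cell y = r d" using xy L[OF d(1)] cell_eq by metis+
 have xW: "x \<in> W P" if "l d \<in> P" for P using c(1) that xy(1) by (intro WI) simp_all
 have yW: "y \<in> W P" if "r d \<in> P" for P using c(2) that xy(2) by (intro WI) simp_all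
 have ne: "W P \<inter> ?G ~= {}" if "l d \<in> P \<or> r d \<in> P" for P
 proof -
  show ?thesis using that xW xyG yW by (auto simp: disjoint_iff)
 qed
 show False using d(2) ne alt by simp
qed

text \<open>It remains to see that cuts are cycles. Among all sums of a cut with cycles, which are
  cuts again by \<open>cycle_cut\<close>, one of least size contains no cycle and is empty by
  \<open>acyclic_cut\<close>; so the cut is a cycle.\<close>

theorem arc_dual: "\<exists>l r :: 'e => complex set. dualpair A s t l r"
proof -
 obtain l r where lr: "sided l r" using sided_exists by blast
 have "cyc s t C" if C: "C = ecut A l r S" for C S
 proof -
  let ?Y = "{ecut A l r S' |S'. \<exists>C'. C' \<subseteq> A \<and> cyc s t C' \<and> ecut A l r S' = sym_diff C C'}"
  have CA: "C \<subseteq> A" unfolding C by (rule cut_subset)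
  have "C \<in> ?Y" unfolding C by (rule CollectI, rule exI[of _ S], intro conjI refl, rule exI[of _ "{}"]) simp
  hence "\<exists>D. D \<in> ?Y \<and> (\<forall>D'. D' \<in> ?Y --> card D \<le> card D')" by (rule ex_has_least_nat)
  then obtain D where D: "D \<in> ?Y" "\<forall>D'. D' \<in> ?Y --> card D \<le> card D'" by (elim exE conjE)
  then obtain S' C' where D': "D = ecut A l r S'" "C' \<subseteq> A" "cyc s t C'" "D = sym_diff C C'" by blast
  have fin: "finite X" if "X \<subseteq> A" for X using that finA by (rule finite_subset)
  have DA: "D \<subseteq> A" unfolding D'(1) by (rule cut_subset)
  have "X = {}" if X: "X \<subseteq> D" "cyc s t X" for X
  proof -
   have XA: "X \<subseteq> A" using X(1) DA by blast
   obtain S'' where S'': "X = ecut A l r S''" using cycle_cut[OF lr XA X(2)] by blast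
   have e: "ecut A l r (sym_diff S' S'') = sym_diff C (sym_diff C' X)" unfolding cut_sym_diff D'(1)[symmetric] S''[symmetric] D'(4) by blast
   have "ecut A l r (sym_diff S' S'') \<in> ?Y"
   proof (rule CollectI, rule exI[of _ "sym_diff S' S''"], intro conjI refl, rule exI[of _ "sym_diff C' X"], intro conjI)
    show "sym_diff C' X \<subseteq> A" using D'(2) XA by blast
    show "cyc s t (sym_diff C' X)" by (rule cyc_sym_diff[OF fin[OF D'(2)] fin[OF XA] D'(3) X(2)])
   qed (rule e)
   hence "card D \<le> card (ecut A l r (sym_diff S' S''))" using D(2) by blast
   also have "ecut A l r (sym_diff S' S'') = D - X" unfolding cut_sym_diff D'(1)[symmetric] S''[symmetric] using X(1) by blast
   finally have "card D \<le> card (D - X)" .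
   moreover have "card (D - X) < card D" if "X ~= {}" using that X(1) fin[OF DA] by (intro psubset_card_mono) auto
   ultimately show ?thesis by fastforce
  qed
  hence "D = {}" unfolding D'(1) by (intro acyclic_cut[OF lr]) (auto simp: D'(1))
  thus ?thesis using D'(4) D'(3) by auto
 qed
 moreover have "\<exists>S. C = ecut A l r S" if "C \<subseteq> A" "cyc s t C" for C using cycle_cut[OF lr that] .
 ultimately show ?thesis unfolding dualpair_def by blast
qed

end

lemma dualpair_nat:
 fixes l r :: "'e => 'f" assumes "dualpair A s t l r" "finite A" shows "\<exists>l r :: 'e => nat. dualpair A s t l r"
proof -
 have "finite (l ` A \<union> r ` A)" using assms(2) by simp
 from finite_imp_inj_to_nat_seg[OF this]
 obtain f :: "'f => nat" where f: "inj_on f (l ` A \<union> r ` A)" by (elim exE conjE)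
 have "ecut A l r S = ecut A (f \<circ> l) (f \<circ> r) (f ` (S \<inter> (l ` A \<union> r ` A)))" for S
 proof -
  have "f (l a) \<in> f ` (S \<inter> (l ` A \<union> r ` A)) \<longleftrightarrow> l a \<in> S" "f (r a) \<in> f ` (S \<inter> (l ` A \<union> r ` A)) \<longleftrightarrow> r a \<in> S"
   if "a \<in> A" for a using that inj_on_image_mem_iff[OF f, of "l a" "S \<inter> (l ` A \<union> r ` A)"]
    inj_on_image_mem_iff[OF f, of "r a" "S \<inter> (l ` A \<union> r ` A)"] by auto
  thus ?thesis unfolding ecut_def by (intro Collect_cong conj_cong refl) (simp only: comp_apply)
 qed
 moreover have "ecut A (f \<circ> l) (f \<circ> r) S = ecut A l r (f -` S)" for S by (auto simp: ecut_def)
 ultimately have "(\<exists>S. C = ecut A l r S) \<longleftrightarrow> (\<exists>S. C = ecut A (f \<circ> l) (f \<circ> r) S)" for C by metis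
 thus ?thesis using assms(1) unfolding dualpair_def by (intro exI[of _ "f \<circ> l"] exI[of _ "f \<circ> r"]) simp
qed

section \<open>From 1-drawings to combinatorial duality\<close>

lemma punctured_sphere:
 assumes "b \<in> S2" shows "(S2 - {b}) homeomorphic (UNIV :: complex set)"
proof -
 have "axis 1 1 ~= (0 :: real^3)" by (simp add: axis_eq_0_iff)
 hence "(S2 - {b}) homeomorphic {x :: real^3. axis 1 1 \<bullet> x = 0}" using assms by (intro homeomorphic_punctured_sphere_hyperplane) simp_all
 also have "{x :: real^3. axis 1 1 \<bullet> x = 0} homeomorphic (UNIV :: complex set)" by (rule homeomorphic_affine_sets) (simp_all add: affine_hyperplane axis_eq_0_iff)
 finally show ?thesis .
qed

text \<open>By invariance of dimension each arc has empty interior in the plane obtained by removing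
  \<open>b0\<close>, so finitely many arcs and points do not fill it. A point off all arcs is needed
  to pass from the sphere to the plane.\<close>

lemma arc_family_misses_point:
 fixes h :: "'i => real => real^3" assumes I: "finite I" and F: "finite F"
  and h: "\<And>i. i \<in> I ==> continuous_on {0..1} (h i)" "\<And>i. i \<in> I ==> inj_on (h i) {0..1}" "\<And>i. i \<in> I ==> h i ` {0..1} \<subseteq> S2"
 shows "\<exists>b\<in>S2. b \<notin> F \<and> (\<forall>i\<in>I. b \<notin> h i ` {0..1})"
proof -
 obtain b0 :: "real^3" where b0: "b0 \<in> S2" using that[of "axis 1 1"] by simp
 obtain \<theta> \<theta>' where \<theta>: "homeomorphism (S2 - {b0}) (UNIV :: complex set) \<theta> \<theta>'" using punctured_sphere[OF b0] unfolding homeomorphic_def by blast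
 define C where "C = (\<lambda>i. \<theta> ` (h i ` {0..1} - {b0}))"
 have C: "closed (C i)" "interior (C i) = {}" if i: "i \<in> I" for i
 proof -
  have comp: "compact (h i ` {0..1})" using h(1)[OF i] by (intro compact_continuous_image) auto
  hence "closedin (top_of_set (S2 - {b0})) ((S2 - {b0}) \<inter> h i ` {0..1})" using compact_imp_closed closedin_closed_Int by auto
  moreover have "(S2 - {b0}) \<inter> h i ` {0..1} = h i ` {0..1} - {b0}" using h(3)[OF i] by blast
  ultimately show "closed (C i)" using homeomorphism_imp_closed_map \<theta> by (fastforce simp: C_def)
  obtain k where k: "\<And>x. x \<in> {0..1} ==> k (h i x) = x" using h(2)[OF i] by (metis the_inv_into_f_f)
  have kc: "continuous_on (h i ` {0..1}) k" using h(1)[OF i] k by (intro continuous_on_inv) auto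
  show "interior (C i) = {}"
  proof (rule ccontr)
   assume ne: "interior (C i) ~= {}"
   have sub: "\<theta>' ` interior (C i) \<subseteq> h i ` {0..1}"
   proof
    fix z assume "z \<in> \<theta>' ` interior (C i)"
    then obtain y where y: "y \<in> h i ` {0..1} - {b0}" "z = \<theta>' (\<theta> y)" using interior_subset[of "C i"] unfolding C_def by blast
    thus "z \<in> h i ` {0..1}" using h(3) i homeomorphism_apply1 \<theta> by blast
   qed
   have "continuous_on (interior (C i)) \<theta>'" using \<theta> unfolding homeomorphism_def by (blast intro: continuous_on_subset)
   hence "continuous_on (interior (C i)) (k \<circ> \<theta>')" by (rule continuous_on_compose) (rule continuous_on_subset[OF kc sub])
   moreover have "inj_on (k \<circ> \<theta>') (interior (C i))"
   proof (rule comp_inj_on)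
    show "inj_on \<theta>' (interior (C i))" using homeomorphism_apply2[OF \<theta>] by (metis UNIV_I inj_on_inverseI)
    have "inj_on k (h i ` {0..1})" using k by (auto simp: inj_on_def)
    thus "inj_on k (\<theta>' ` interior (C i))" using sub by (rule inj_on_subset)
   qed
   ultimately show False using invariance_of_dimension ne by fastforce
  qed
 qed
 have un: "interior (\<Union>(C ` J)) = {} \<and> closed (\<Union>(C ` J))" if "finite J" "J \<subseteq> I" for J using that
 proof (induction J rule: finite_induct)
  case (insert j J)
  thus ?case using C interior_closed_Un_empty_interior by fastforce
 qed simp
 have "interior (\<Union>(C ` I) \<union> \<theta> ` (F - {b0})) = {}" using un I F interior_closed_Un_empty_interior by (fastforce simp: empty_interior_finite)
 hence "\<Union>(C ` I) \<union> \<theta> ` (F - {b0}) ~= UNIV" by (intro notI) simp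
 then obtain z where z: "z \<notin> \<Union>(C ` I)" "z \<notin> \<theta> ` (F - {b0})" by blast
 have zb: "\<theta>' z \<in> S2 - {b0}" "\<theta> (\<theta>' z) = z" using homeomorphism_image2 \<theta> homeomorphism_apply2 by blast+
 show ?thesis
 proof (rule bexI[of _ "\<theta>' z"], intro conjI ballI)
  show "\<theta>' z \<notin> F"
  proof
   assume "\<theta>' z \<in> F"
   hence "\<theta> (\<theta>' z) \<in> \<theta> ` (F - {b0})" using zb(1) by (intro imageI) simp
   thus False using z zb(2) by simp
  qed
  fix i assume i: "i \<in> I"
  show "\<theta>' z \<notin> h i ` {0..1}"
  proof
   assume "\<theta>' z \<in> h i ` {0..1}"
   thus False using zb(1) z zb(2) i by (fastforce simp: C_def)
  qed
 qed (use zb in simp)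
qed

lemma vertex_point_supp: "supp (vertex_point v) = {v}" by (auto simp: supp_def vertex_point_def)

locale drawing =
 fixes G :: "'a sgraph" and \<phi> :: "('a => real) => real^3" assumes sg: "sgraph G" and dr: "is_1_drawing G \<phi>"
begin

abbreviation R where "R == realization G"
abbreviation V where "V == verts G"
abbreviation E where "E == edges G"

lemma finV: "finite V" and edge: "e \<in> E ==> e \<subseteq> V \<and> card e = 2"
 using sg by (simp_all add: sgraph_def)

lemma cont: "continuous_on R \<phi>" and img: "\<phi> ` R \<subseteq> S2"
 and vert: "v \<in> V ==> x \<in> R ==> \<phi> (vertex_point v) = \<phi> x ==> x = vertex_point v" using dr by (simp_all add: is_1_drawing_def is_drawing_def)

lemma inner: "x \<in> inner_points G e \<longleftrightarrow> x \<in> R \<and> supp x = e" by (simp add: inner_points_def)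

lemma vertex_R: "v \<in> V ==> vertex_point v \<in> R"
 using finV by (auto simp: realization_def simplices_def vertex_point_supp) (simp_all add: vertex_point_def)

lemma double:
 assumes "x \<in> R" "y \<in> R" "x ~= y" "\<phi> x = \<phi> y" shows "supp x \<in> E" "supp y \<in> E" "supp x ~= supp y" "\<phi> x \<in> crossings G \<phi>" "preimages G \<phi> (\<phi> x) = {x, y}"
proof -
 have p: "x \<in> preimages G \<phi> (\<phi> x)" "y \<in> preimages G \<phi> (\<phi> x)" using assms by (simp_all add: preimages_def)
 show c: "\<phi> x \<in> crossings G \<phi>" using img assms(1) p assms(3) by (auto simp: crossings_def)
 have "\<forall>p \<in> crossings G \<phi>. \<exists>e \<in> E. \<exists>f \<in> E. \<exists>x \<in> inner_points G e. \<exists>y \<in> inner_points G f.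
   e ~= f \<and> preimages G \<phi> p = {x, y} \<and> cross_at (\<phi> ` edge_points G e) (\<phi> ` edge_points G f) p" using dr unfolding is_1_drawing_def is_drawing_def by (elim conjE)
 from bspec[OF this c] obtain e f x' y' where "e \<in> E" "f \<in> E" "x' \<in> inner_points G e" "y' \<in> inner_points G f"
  "e ~= f" "preimages G \<phi> (\<phi> x) = {x', y'}" by (elim bexE conjE)
 hence q: "e \<in> E" "f \<in> E" "supp x' = e" "supp y' = f" "e ~= f" "preimages G \<phi> (\<phi> x) = {x', y'}" by (simp_all add: inner)
 show "supp x \<in> E" "supp y \<in> E" "supp x ~= supp y" "preimages G \<phi> (\<phi> x) = {x, y}" using p assms(3) q by fastforce+
qed

text \<open>This is where the bound of one crossing per edge enters: both crossing points involve
  the same edge, hence coincide.\<close>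

lemma double_unique:
 assumes "x \<in> R" "y \<in> R" "x ~= y" "\<phi> x = \<phi> y" "x' \<in> R" "y' \<in> R" "x' ~= y'" "\<phi> x' = \<phi> y'" "supp x = supp x'" shows "x = x'" "y = y'"
proof -
 note d = double[OF assms(1-4)] and d' = double[OF assms(5-8)]
 have "involved_in G \<phi> (supp x) (\<phi> x)" "involved_in G \<phi> (supp x) (\<phi> x')" using d(4) d'(4) assms(1,5,9) by (auto simp: involved_in_def inner intro!: imageI)
 hence e: "{x, y} = {x', y'}" by (metis dr d(1) d(5) d'(5) is_1_drawing_def)
 thus x: "x = x'" using assms(9) d'(3) by auto
 thus "y = y'" using e assms(3) by auto
qed

definition crossed :: "'a set => bool" where
 "crossed e \<longleftrightarrow> (\<exists>p. fst p \<in> R \<and> snd p \<in> R \<and> fst p ~= snd p \<and> \<phi> (fst p) = \<phi> (snd p) \<and> supp (fst p) = e)"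
definition cp :: "'a set => ('a => real) \<times> ('a => real)" where
 "cp e = (SOME p. fst p \<in> R \<and> snd p \<in> R \<and> fst p ~= snd p \<and> \<phi> (fst p) = \<phi> (snd p) \<and> supp (fst p) = e)"
text \<open>The point at which an edge is cut into its two pieces: the midpoint is a default for
  uncrossed edges.\<close>

definition ctr :: "'a set => 'a => real" where
 "ctr e = (if crossed e then fst (cp e) else (\<lambda>v. if v \<in> e then 1/2 else 0))"
definition mt :: "'a set => 'a set" where
 "mt e = (if crossed e then supp (snd (cp e)) else e)"

lemma cp: "crossed e ==> fst (cp e) \<in> R \<and> snd (cp e) \<in> R \<and> fst (cp e) ~= snd (cp e) \<and> \<phi> (fst (cp e)) = \<phi> (snd (cp e)) \<and> supp (fst (cp e)) = e"
 unfolding crossed_def cp_def by (rule someI_ex)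

lemma double_cp:
 assumes "x \<in> R" "y \<in> R" "x ~= y" "\<phi> x = \<phi> y" shows "crossed (supp x)" "x = ctr (supp x)" "y = ctr (supp y)" "mt (supp x) = supp y" "mt (supp y) = supp x"
proof -
 have *: "crossed (supp x) \<and> cp (supp x) = (x, y)" if "x \<in> R" "y \<in> R" "x ~= y" "\<phi> x = \<phi> y" for x y
 proof -
  have c: "crossed (supp x)" unfolding crossed_def using that by (intro exI[of _ "(x, y)"]) simp
  note k = cp[OF c]
  have "fst (cp (supp x)) = x" "snd (cp (supp x)) = y" using double_unique[of "fst (cp (supp x))" "snd (cp (supp x))" x y] k that by blast+
  thus ?thesis using c by (simp add: prod_eq_iff)
 qed
 have 1: "crossed (supp x) \<and> cp (supp x) = (x, y)" by (rule *[OF assms])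
 have 2: "crossed (supp y) \<and> cp (supp y) = (y, x)" by (rule *) (use assms in auto)
 show "crossed (supp x)" "x = ctr (supp x)" "y = ctr (supp y)" "mt (supp x) = supp y" "mt (supp y) = supp x" using 1 2 by (simp_all add: ctr_def mt_def)
qed

lemma mt:
 assumes e: "e \<in> E" shows "mt e \<in> E" "mt (mt e) = e" "\<phi> (ctr (mt e)) = \<phi> (ctr e)" "mt e ~= e \<longleftrightarrow> crossed e"
proof -
 have *: "mt e \<in> E \<and> mt (mt e) = e \<and> \<phi> (ctr (mt e)) = \<phi> (ctr e) \<and> (mt e ~= e \<longleftrightarrow> crossed e)"
 proof (cases "crossed e")
  case True
  note k = cp[OF True]
  have k4: "fst (cp e) \<in> R" "snd (cp e) \<in> R" "fst (cp e) ~= snd (cp e)" "\<phi> (fst (cp e)) = \<phi> (snd (cp e))" using k by blast+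
  note d = double[OF k4] and d2 = double_cp[OF k4]
  have s: "supp (fst (cp e)) = e" using k by blast
  show ?thesis using d(2,3) d2 k4(4) True unfolding s by (simp add: mt_def[of e])
 qed (use e in \<open>simp add: mt_def\<close>)
 thus "mt e \<in> E" "mt (mt e) = e" "\<phi> (ctr (mt e)) = \<phi> (ctr e)" "mt e ~= e \<longleftrightarrow> crossed e" by blast+
qed

lemma ctr_R: "e \<in> E ==> ctr e \<in> R \<and> supp (ctr e) = e"
proof (cases "crossed e")
 case True
 thus ?thesis using cp by (simp add: ctr_def)
next
 case False
 assume e: "e \<in> E"
 have s: "supp (ctr e) = e" using False by (auto simp: ctr_def supp_def)
 have "(\<Sum>v\<in>V. if v \<in> e then 1/2 else (0::real)) = (\<Sum>v\<in>e. 1/2)" using edge[OF e] finV by (intro sum.mono_neutral_cong_right) auto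
 thus ?thesis using s e False edge[OF e] by (auto simp: realization_def simplices_def ctr_def)
qed

lemma xgraph: "xgraph V E mt"
 using finV edge mt by unfold_locales blast+

definition seg :: "'a set \<times> 'a => real => 'a => real" where
 "seg p t = (\<lambda>v. (1 - t) * vertex_point (snd p) v + t * ctr (fst p) v)"

lemma seg_ends: "seg p 0 = vertex_point (snd p)" "seg p 1 = ctr (fst p)" by (simp_all add: seg_def)

lemma seg_R:
 assumes p: "p \<in> pcs E" and t: "0 < t" "t \<le> 1" shows "seg p t \<in> R" "supp (seg p t) = fst p"
proof -
 obtain e u where eu: "p = (e, u)" "e \<in> E" "u \<in> e" using p by (cases p) simp
 note c = ctr_R[OF eu(2)]
 have u: "u \<in> V" using edge eu by blast
 have nn: "0 \<le> ctr e v" for v using c by (auto simp: realization_def)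
 have pos: "ctr e v ~= 0 \<longleftrightarrow> v \<in> e" for v using c by (auto simp: supp_def)
 have ge: "0 \<le> seg p t v" for v using t nn[of v] by (simp add: seg_def vertex_point_def eu(1))
 show s: "supp (seg p t) = fst p"
 proof (intro set_eqI)
  fix v
  show "v \<in> supp (seg p t) \<longleftrightarrow> v \<in> fst p"
  proof (cases "v \<in> e")
   case True
   hence "0 < ctr e v" using nn[of v] pos[of v] by simp
   hence "0 < t * ctr e v" using t by simp
   moreover have "0 \<le> (1 - t) * vertex_point u v" using t by (simp add: vertex_point_def)
   ultimately show ?thesis using True by (simp add: supp_def seg_def eu(1))
  next
   case False
   hence "v ~= u" using eu by auto
   thus ?thesis using False pos[of v] by (simp add: supp_def seg_def eu(1) vertex_point_def)
  qed
 qed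
 have "(\<Sum>v\<in>V. seg p t v) = (1 - t) * (\<Sum>v\<in>V. vertex_point u v) + t * (\<Sum>v\<in>V. ctr e v)" by (simp add: seg_def eu(1) sum.distrib sum_distrib_left)
 also have "(\<Sum>v\<in>V. ctr e v) = 1" using c by (simp add: realization_def)
 also have "(\<Sum>v\<in>V. vertex_point u v) = 1" using vertex_R[OF u] by (simp add: realization_def)
 finally show "seg p t \<in> R" using ge s eu by (simp add: realization_def simplices_def)
qed

lemma seg_R0: "p \<in> pcs E ==> t \<in> {0..1} ==> seg p t \<in> R"
proof (cases "t = 0")
 case True
 assume "p \<in> pcs E"
 hence "snd p \<in> V" using edge by (cases p) auto
 thus ?thesis using True by (simp add: seg_ends vertex_R)
qed (use seg_R in auto)

lemma seg_cont: "continuous_on S (seg p)"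
 unfolding seg_def by (intro continuous_on_coordinatewise_then_product continuous_intros)

lemma seg_inj:
 assumes p: "p \<in> pcs E" and t: "t \<in> {0..1}" "t' \<in> {0..1}" "\<phi> (seg p t) = \<phi> (seg p t')" shows "t = t'"
proof -
 have eq: "seg p t = seg p t'"
 proof (rule ccontr)
  assume ne: "seg p t ~= seg p t'"
  note d = double[OF seg_R0[OF p t(1)] seg_R0[OF p t(2)] ne t(3)]
  have pe: "supp (seg p s) = fst p" if s: "s \<in> {0..1}" "supp (seg p s) \<in> E" for s
  proof (cases "s = 0")
   case True
   thus ?thesis using s(2) edge by (fastforce simp: seg_ends vertex_point_supp)
  qed (use seg_R(2)[OF p] s in auto)
  show False using d(3) pe[OF t(1) d(1)] pe[OF t(2) d(2)] by simp
 qed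
 obtain e u where eu: "p = (e, u)" "e \<in> E" "u \<in> e" using p by (cases p) simp
 have "card (e - {u}) = 1" using edge[OF eu(2)] eu(3) by (simp add: card_Diff_singleton)
 then obtain w where w: "w \<in> e" "w ~= u" by (metis card_1_singletonE insertCI DiffE)
 have "ctr e w ~= 0" using ctr_R[OF eu(2)] w by (auto simp: supp_def)
 moreover have "seg p t w = seg p t' w" by (simp add: eq)
 ultimately show ?thesis using w by (simp add: seg_def eu(1) vertex_point_def)
qed

text \<open>Equal images come either from one point of the complex, which must be a common vertex or
  the centre of a common edge, or from a crossing, which by construction is the centre of both
  edges.\<close>

lemma seg_meet:
 assumes p: "p \<in> pcs E" "p' \<in> pcs E" "p ~= p'" and t: "t \<in> {0..1}" "t' \<in> {0..1}" "\<phi> (seg p t) = \<phi> (seg p' t')"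
 shows "(t = 0 \<and> t' = 0 \<and> snd p = snd p') \<or> (t = 1 \<and> t' = 1 \<and> fst p' \<in> {fst p, mt (fst p)})"
proof -
 obtain e u where eu: "p = (e, u)" "e \<in> E" "u \<in> e" using p by (cases p) simp
 obtain e' u' where eu': "p' = (e', u')" "e' \<in> E" "u' \<in> e'" using p by (cases p') simp
 have supp0: "supp (seg p s) = (if s = 0 then {snd p} else fst p)" if "s \<in> {0..1}" "p \<in> pcs E" for s p
  using seg_R(2)[OF that(2)] that(1) by (simp add: seg_ends vertex_point_supp)
 note sp = supp0[OF t(1) p(1)] supp0[OF t(2) p(2)]
 show ?thesis
 proof (cases "seg p t = seg p' t'")
  case True
  show ?thesis
  proof (cases "t = 0 \<or> t' = 0")
   case True: True
   have c: "card e ~= 1" "card e' ~= 1" using edge[OF eu(2)] edge[OF eu'(2)] by simp_all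
   have "(if t = 0 then {u} else e) = (if t' = 0 then {u'} else e')"
    using trans[OF trans[OF sp(1)[symmetric] arg_cong[OF \<open>seg p t = seg p' t'\<close>, of supp]] sp(2)] unfolding eu(1) eu'(1) fst_conv snd_conv .
   hence "t = 0 \<and> t' = 0 \<and> u = u'" using True c by (auto split: if_splits)
   thus ?thesis using eu(1) eu'(1) by simp
  next
   case False
   hence ee: "e = e'" using sp True eu(1) eu'(1) by simp
   hence uu: "u ~= u'" using p(3) eu(1) eu'(1) by simp
   have "seg p t u = seg p' t' u" "seg p t u' = seg p' t' u'" by (simp_all add: True)
   hence q: "(1 - t) + t * ctr e u = t' * ctr e u" "t * ctr e u' = (1 - t') + t' * ctr e u'" using uu ee by (simp_all add: seg_def eu(1) eu'(1) vertex_point_def)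
   have eq2: "e = {u, u'}" using edge[OF eu(2)] eu(3) eu'(3) ee uu by (intro card_subset_eq[symmetric]) (auto simp: card_ge_0_finite)
   have s1: "ctr e u + ctr e u' = 1"
   proof -
    have "(\<Sum>v\<in>V. ctr e v) = (\<Sum>v\<in>e. ctr e v)" using ctr_R[OF eu(2)] edge[OF eu(2)] finV by (intro sum.mono_neutral_right) (auto simp: supp_def)
    moreover have "(\<Sum>v\<in>V. ctr e v) = 1" using ctr_R[OF eu(2)] by (simp add: realization_def)
    ultimately show ?thesis using eq2 uu by simp
   qed
   have p0: "0 < ctr e u" "0 < ctr e u'"
   proof -
    have "0 \<le> ctr e v" for v using ctr_R[OF eu(2)] by (simp add: realization_def)
    moreover have "ctr e u ~= 0" "ctr e u' ~= 0" using ctr_R[OF eu(2)] eu(3) eu'(3) ee by (auto simp: supp_def)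
    ultimately show "0 < ctr e u" "0 < ctr e u'" by (simp_all add: less_le)
   qed
   \<comment> \<open>For the two halves of one edge, the coordinates at \<open>u\<close> and
     \<open>u'\<close> give opposite inequalities between \<open>t\<close> and \<open>t'\<close>, so
     the common point is the centre.\<close>
   have a1: "(t' - t) * ctr e u = 1 - t" "(t - t') * ctr e u' = 1 - t'" using q by (simp_all add: algebra_simps)
   have "t \<le> t'"
   proof (rule ccontr)
    assume "\<not> t \<le> t'"
    hence "(t' - t) * ctr e u < 0" using p0 by (simp add: mult_neg_pos)
    thus False using a1(1) t by simp
   qed
   moreover have "t' \<le> t"
   proof (rule ccontr)
    assume "\<not> t' \<le> t"
    hence "(t - t') * ctr e u' < 0" using p0 by (simp add: mult_neg_pos)
    thus False using a1(2) t by simp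
   qed
   ultimately show ?thesis using a1 eu(1) eu'(1) ee by simp
  qed
 next
  case False
  note d = double[OF seg_R0[OF p(1) t(1)] seg_R0[OF p(2) t(2)] False t(3)]
  note c = double_cp[OF seg_R0[OF p(1) t(1)] seg_R0[OF p(2) t(2)] False t(3)]
  have nz: "t ~= 0" "t' ~= 0" using d(1,2) sp edge by (fastforce split: if_splits)+
  hence s: "supp (seg p t) = fst p" "supp (seg p' t') = fst p'" using sp by simp_all
  have "\<phi> (seg p t) = \<phi> (seg p 1)" "\<phi> (seg p' t') = \<phi> (seg p' 1)" using c(2,3) s by (simp_all add: seg_ends)
  hence "t = 1" "t' = 1" using seg_inj[OF p(1) t(1), of 1] seg_inj[OF p(2) t(2), of 1] by simp_all
  thus ?thesis using c(4) s by simp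
 qed
qed

end

context drawing
begin

theorem op1_drawing: "op1 V E"
proof -
 interpret X: xgraph V E mt by (rule xgraph)
 have sc: "continuous_on {0..1} (\<phi> \<circ> seg p)" if "p \<in> pcs E" for p
 proof (rule continuous_on_compose[OF seg_cont])
  show "continuous_on (seg p ` {0..1}) \<phi>" by (rule continuous_on_subset[OF cont]) (use seg_R0[OF that] in blast)
 qed
 have si: "inj_on (\<phi> \<circ> seg p) {0..1}" if "p \<in> pcs E" for p using seg_inj[OF that] by (intro inj_onI) simp
 have sS: "(\<phi> \<circ> seg p) ` {0..1} \<subseteq> S2" if "p \<in> pcs E" for p
 proof (rule image_subsetI)
  fix t :: real assume "t \<in> {0..1}"
  thus "(\<phi> \<circ> seg p) t \<in> S2" by (metis subsetD img imageI seg_R0 that comp_apply)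
 qed
 have "\<exists>b\<in>S2. b \<notin> {} \<and> (\<forall>p\<in>pcs E. b \<notin> (\<phi> \<circ> seg p) ` {0..1})" by (rule arc_family_misses_point[OF X.finP finite.emptyI]) (rule sc si sS; assumption)+
 then obtain b where b: "b \<in> S2" "\<And>p. p \<in> pcs E ==> b \<notin> (\<phi> \<circ> seg p) ` {0..1}" by blast
 obtain \<theta> \<theta>' where \<theta>: "homeomorphism (S2 - {b}) (UNIV :: complex set) \<theta> \<theta>'" using punctured_sphere[OF b(1)] unfolding homeomorphic_def by blast
 have \<theta>i: "inj_on \<theta> (S2 - {b})" using homeomorphism_apply1[OF \<theta>] by (rule inj_on_inverseI)
 have sSb: "(\<phi> \<circ> seg p) ` {0..1} \<subseteq> S2 - {b}" if "p \<in> pcs E" for p using sS[OF that] b(2)[OF that] by blast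
 define \<gamma> where "\<gamma> = (\<lambda>p. \<theta> \<circ> (\<phi> \<circ> seg p))"
 have \<theta>eq: "\<phi> (seg p t) = \<phi> (seg p' t')" if "p \<in> pcs E" "p' \<in> pcs E" "t \<in> {0..1}" "t' \<in> {0..1}" "\<gamma> p t = \<gamma> p' t'" for p p' t t'
 proof (rule inj_onD[OF \<theta>i])
  show "\<theta> (\<phi> (seg p t)) = \<theta> (\<phi> (seg p' t'))" using that(5) by (simp add: \<gamma>_def)
  show "\<phi> (seg p t) \<in> S2 - {b}" using sSb[OF that(1)] that(3) by (auto simp: image_subset_iff)
  show "\<phi> (seg p' t') \<in> S2 - {b}" using sSb[OF that(2)] that(4) by (auto simp: image_subset_iff)
 qed
 \<comment> \<open>The node of a class is placed at the centre of any of its edges; crossing edges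
   have centres with the same image.\<close>
 define pos :: "'a + 'a set set => complex" where
  "pos = case_sum (\<lambda>u. \<theta> (\<phi> (vertex_point u))) (\<lambda>X. \<theta> (\<phi> (ctr (SOME e. e \<in> X))))"
 have posl: "pos (psrc p) = \<gamma> p 0" if "p \<in> pcs E" for p by (simp add: pos_def psrc_def \<gamma>_def seg_ends)
 have posr: "pos (ptgt mt p) = \<gamma> p 1" if "p \<in> pcs E" for p
 proof -
  have e: "fst p \<in> E" using that by (simp add: pcs_def)
  have "(SOME e. e \<in> {fst p, mt (fst p)}) \<in> {fst p, mt (fst p)}" by (rule someI[of _ "fst p"]) simp
  thus ?thesis using mt(3) e by (auto simp: pos_def ptgt_def \<gamma>_def seg_ends)
 qed
 have arcfam: "arcfam (pcs E) psrc (ptgt mt) \<gamma> pos"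
 proof
  show "finite (pcs E)" by (rule X.finP)
  fix p assume p: "p \<in> pcs E"
  have "continuous_on {0..1} (\<gamma> p)" unfolding \<gamma>_def by (rule continuous_on_compose[OF sc[OF p]], rule continuous_on_subset[OF homeomorphism_cont1[OF \<theta>] sSb[OF p]])
  moreover have "inj_on (\<gamma> p) {0..1}" unfolding \<gamma>_def by (rule comp_inj_on[OF si[OF p]], rule inj_on_subset[OF \<theta>i sSb[OF p]])
  ultimately show "arc (\<gamma> p)" by (simp add: arc_def path_def)
  show "pathstart (\<gamma> p) = pos (psrc p)" "pathfinish (\<gamma> p) = pos (ptgt mt p)" using posl[OF p] posr[OF p] by (simp_all add: pathstart_def pathfinish_def)
 next
  show "inj_on pos (psrc ` pcs E \<union> ptgt mt ` pcs E)"
  proof (rule inj_onI)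
   have ll: "psrc p = psrc p'" if p: "p \<in> pcs E" "p' \<in> pcs E" "pos (psrc p) = pos (psrc p')" for p p'
   proof -
    have "\<phi> (seg p 0) = \<phi> (seg p' 0)" using p posl by (intro \<theta>eq) simp_all
    moreover have "snd p \<in> V" "seg p' 0 \<in> R" using p edge seg_R0[OF p(2)] by (auto simp: pcs_def)
    ultimately have "vertex_point (snd p') = vertex_point (snd p)" using vert[of "snd p" "seg p' 0"] by (simp add: seg_ends)
    hence "{snd p'} = {snd p}" by (metis vertex_point_supp)
    thus ?thesis by (simp add: psrc_def)
   qed
   have lr: False if p: "p \<in> pcs E" "p' \<in> pcs E" "pos (psrc p) = pos (ptgt mt p')" for p p'
   proof -
    have "\<phi> (seg p 0) = \<phi> (seg p' 1)" using p posl posr by (intro \<theta>eq) simp_all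
    moreover have "snd p \<in> V" "seg p' 1 \<in> R" using p edge seg_R0[OF p(2)] by (auto simp: pcs_def)
    ultimately have "supp (ctr (fst p')) = {snd p}" by (metis vert seg_ends vertex_point_supp)
    moreover have "fst p' \<in> E" using p(2) by (simp add: pcs_def)
    ultimately show False using ctr_R edge by fastforce
   qed
   have rr: "ptgt mt p = ptgt mt p'" if p: "p \<in> pcs E" "p' \<in> pcs E" "pos (ptgt mt p) = pos (ptgt mt p')" for p p'
   proof -
    have e: "fst p \<in> E" "fst p' \<in> E" using p by (simp_all add: pcs_def)
    have q: "\<phi> (seg p 1) = \<phi> (seg p' 1)" using p posr by (intro \<theta>eq) simp_all
    show ?thesis
    proof (cases "ctr (fst p) = ctr (fst p')")
     case True
     thus ?thesis by (metis ctr_R e(1) e(2) ptgt_def)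
    next
     case False
     have "mt (supp (ctr (fst p))) = supp (ctr (fst p'))" "mt (supp (ctr (fst p'))) = supp (ctr (fst p))"
      using double_cp(4,5)[of "ctr (fst p)" "ctr (fst p')"] ctr_R[OF e(1)] ctr_R[OF e(2)] False q by (simp_all add: seg_ends)
     thus ?thesis using ctr_R e(1) e(2) by (simp add: ptgt_def insert_commute)
    qed
   qed
   fix x y assume "x \<in> psrc ` pcs E \<union> ptgt mt ` pcs E" "y \<in> psrc ` pcs E \<union> ptgt mt ` pcs E" "pos x = pos y"
   thus "x = y" using ll lr rr by (elim UnE imageE) (simp; metis)+
  qed
 next
  fix p p' z assume p: "p \<in> pcs E" "p' \<in> pcs E" "p ~= p'" and z: "z \<in> path_image (\<gamma> p)" "z \<in> path_image (\<gamma> p')"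
  obtain t where t: "t \<in> {0..1}" "z = \<gamma> p t" using z(1) by (auto simp: path_image_def)
  obtain t' where t': "t' \<in> {0..1}" "z = \<gamma> p' t'" using z(2) by (auto simp: path_image_def)
  have "\<phi> (seg p t) = \<phi> (seg p' t')" using p t t' by (intro \<theta>eq) simp_all
  then consider "t = 0" "t' = 0" | "t = 1" "t' = 1" using seg_meet[OF p t(1) t'(1)] by blast
  thus "z \<in> {pos (psrc p), pos (ptgt mt p)} \<and> z \<in> {pos (psrc p'), pos (ptgt mt p')}"
   using t(2) t'(2) posl[OF p(1)] posl[OF p(2)] posr[OF p(1)] posr[OF p(2)] by cases simp_all
 qed
 then obtain l r where "dualpair (pcs E) psrc (ptgt mt) (l :: 'a set \<times> 'a => complex set) r" using arcfam.arc_dual by blast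
 from dualpair_nat[OF this X.finP] obtain l r where "dualpair (pcs E) psrc (ptgt mt) (l :: 'a set \<times> 'a => nat) r" by (elim exE)
 thus ?thesis using xgraph by (auto simp: oneplane_def oneplane_axioms_def op1_def)
qed

end

lemma one_planar_op1: "one_planar G ==> op1 (verts G) (edges G)"
 unfolding one_planar_def using drawing.op1_drawing drawing.intro by blast

section \<open>Copies of the triangle and the upper bound\<close>

text \<open>A copy of the triangle contains all pairs of its three vertices and is therefore
  determined by its vertex set.\<close>

lemma num_triangles:
 assumes G: "sgraph G" shows "num_subgraphs_iso (complete_graph 3) G = card (tri (edges G))"
proof -
 have G2: "e \<subseteq> verts G \<and> card e = 2" if "e \<in> edges G" for e using G that by (simp add: sgraph_def)
 define K where "K = (\<lambda>T :: 'a set. \<lparr>verts = T, edges = {e. e \<subseteq> T \<and> card e = 2}\<rparr>)"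
 have pair: "card {u, v} = 2 \<longleftrightarrow> u ~= v" for u v :: 'b by auto
 have iso: "isomorphic (K T) (complete_graph 3)" if T: "card T = 3" for T
 proof -
  have "finite T" using T by (intro card_ge_0_finite) simp
  then obtain f where f: "bij_betw f T {..<3::nat}" using ex_bij_betw_finite_nat[of T] T by (auto simp: lessThan_atLeast0)
  have "{u, v} \<in> edges (K T) \<longleftrightarrow> {f u, f v} \<in> edges (complete_graph 3)" if "u \<in> T" "v \<in> T" for u v
  proof -
   show ?thesis using f that by (auto simp: bij_betw_def inj_on_def K_def complete_graph_def card_2_iff doubleton_eq_iff)
  qed
  thus ?thesis unfolding isomorphic_def using f by (intro exI[of _ f]) (simp add: K_def complete_graph_def)
 qed
 have "{H. subgraph H G \<and> isomorphic H (complete_graph 3)} = K ` tri (edges G)"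
 proof (intro equalityI subsetI)
  fix H assume "H \<in> {H. subgraph H G \<and> isomorphic H (complete_graph 3)}"
  hence H: "sgraph H" "edges H \<subseteq> edges G" and iso: "isomorphic H (complete_graph 3)" by (simp_all add: subgraph_def)
  obtain f where f: "bij_betw f (verts H) {..<3::nat}"
   "\<And>u v. u \<in> verts H ==> v \<in> verts H ==> {u, v} \<in> edges H \<longleftrightarrow> {f u, f v} \<in> edges (complete_graph 3)"
   using iso unfolding isomorphic_def by (auto simp: complete_graph_def)
  have c: "card (verts H) = 3" using bij_betw_same_card[OF f(1)] by simp
  have e: "{u, v} \<in> edges H" if uv: "u \<in> verts H" "v \<in> verts H" "u ~= v" for u v
  proof -
   have "f u < 3" "f v < 3" "f u ~= f v" using f(1) uv by (auto simp: bij_betw_def inj_on_def)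
   thus ?thesis using f(2)[OF uv(1,2)] by (simp add: complete_graph_def)
  qed
  have "edges H = {e. e \<subseteq> verts H \<and> card e = 2}"
  proof (intro equalityI subsetI)
   fix d assume "d \<in> {e. e \<subseteq> verts H \<and> card e = 2}"
   then obtain u v where "d = {u, v}" "u ~= v" "u \<in> verts H" "v \<in> verts H" by (auto simp: card_2_iff)
   thus "d \<in> edges H" using e by simp
  qed (use H(1) in \<open>auto simp: sgraph_def\<close>)
  hence "H = K (verts H)" by (simp add: K_def)
  moreover have "verts H \<in> tri (edges G)" using c e H(2) by (auto simp: tri_def)
  ultimately show "H \<in> K ` tri (edges G)" by (rule image_eqI)
 next
  fix H assume "H \<in> K ` tri (edges G)"
  then obtain T where T: "T \<in> tri (edges G)" "H = K T" by blast
  have T3: "card T = 3" "\<And>x y. x \<in> T ==> y \<in> T ==> x ~= y ==> {x, y} \<in> edges G" using T(1) by (simp_all add: tri_def)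
  interpret F: fgraph "verts G" "edges G" using G G2 by unfold_locales (simp_all add: sgraph_def)
  have TV: "T \<subseteq> verts G" using F.tri_sub T(1) by blast
  have "{e. e \<subseteq> T \<and> card e = 2} \<subseteq> edges G" using T3(2) by (auto simp: card_2_iff)
  moreover have "finite T" using T3(1) by (intro card_ge_0_finite) simp
  ultimately have "subgraph H G" using TV by (auto simp: T(2) K_def subgraph_def sgraph_def)
  thus "H \<in> {H. subgraph H G \<and> isomorphic H (complete_graph 3)}" using iso[OF T3(1)] T(2) by simp
 qed
 moreover have "inj_on K (tri (edges G))" by (rule inj_onI) (simp add: K_def)
 ultimately show ?thesis unfolding num_subgraphs_iso_def by (simp add: card_image)
qed

theorem triangle_bound:
 assumes "one_planar G" "card (verts G) = 3 * k + s" "2 \<le> k" "s \<le> 2"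
 shows "num_subgraphs_iso (complete_graph 3) G \<le> (if 3 * k + s = 8 then 32 else 19 * k + 5 * s - 18)"
proof -
 have sg: "sgraph G" using assms(1) by (simp add: one_planar_def)
 have "tri_claim (verts G) (edges G)" using assms by (intro triangle_claim one_planar_op1) simp_all
 moreover have "tbd (3 * k + s) = 19 * k + 5 * s" using assms(4) by (simp add: tbd_def)
 ultimately show ?thesis unfolding num_triangles[OF sg] tri_claim_def assms(2) by auto
qed

section \<open>Straight-line drawings and radial projection\<close>

definition crosses :: "'b::real_vector set => 'b set => bool" where
 "crosses e f \<longleftrightarrow> e \<inter> f = {} \<and> convex hull e \<inter> convex hull f ~= {}"

definition geo :: "'b::real_vector set => 'b set set => bool" where
 "geo V E \<longleftrightarrow> finite V \<and> (\<forall>e\<in>E. e \<subseteq> V \<and> card e = 2) \<and> (\<forall>e\<in>E. \<forall>v\<in>V. v \<in> convex hull e --> v \<in> e) \<and>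
   (\<forall>e\<in>E. \<forall>f\<in>E. \<forall>g\<in>E. crosses e f --> crosses e g --> f = g)"

lemma crosses_sym: "crosses e f ==> crosses f e" by (auto simp: crosses_def)

lemma seg_param:
 fixes a b p q :: "'b::real_vector" assumes "p \<in> closed_segment a b" "q \<in> closed_segment a b" "p ~= q"
 shows "\<exists>\<alpha> \<beta>. \<alpha> \<le> 0 \<and> 1 \<le> \<beta> \<and> {a, b} = {p + \<alpha> *\<^sub>R (q - p), p + \<beta> *\<^sub>R (q - p)}"
proof -
 have main: "\<exists>\<alpha> \<beta>. \<alpha> \<le> 0 \<and> 1 \<le> \<beta> \<and> a = p + \<alpha> *\<^sub>R (q - p) \<and> b = p + \<beta> *\<^sub>R (q - p)"
  if s: "0 \<le> s" "s < t" "t \<le> 1" "p = a + s *\<^sub>R (b - a)" "q = a + t *\<^sub>R (b - a)" for a b :: 'b and s t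
 proof (intro exI conjI)
  let ?\<alpha> = "- s / (t - s)" and ?\<beta> = "(1 - s) / (t - s)"
  have "q - p = (a + t *\<^sub>R (b - a)) - (a + s *\<^sub>R (b - a))" by (simp only: s(4,5))
  hence q: "q - p = (t - s) *\<^sub>R (b - a)" by (simp add: algebra_simps)
  show "?\<alpha> \<le> 0" "1 \<le> ?\<beta>" using s by (simp_all add: divide_simps)
  have e: "?\<alpha> * (t - s) = - s" "?\<beta> * (t - s) = 1 - s" using s by simp_all
  have "p + ?\<alpha> *\<^sub>R (q - p) = p + (- s) *\<^sub>R (b - a)" "p + ?\<beta> *\<^sub>R (q - p) = p + (1 - s) *\<^sub>R (b - a)" by (simp_all only: q scaleR_scaleR e)
  thus "a = p + ?\<alpha> *\<^sub>R (q - p)" "b = p + ?\<beta> *\<^sub>R (q - p)" by (simp_all only:) (simp_all only: s(4), simp_all add: algebra_simps)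
 qed
 obtain s where s: "0 \<le> s" "s \<le> 1" "p = (1 - s) *\<^sub>R a + s *\<^sub>R b" using assms(1) by (auto simp: closed_segment_def)
 obtain t where t: "0 \<le> t" "t \<le> 1" "q = (1 - t) *\<^sub>R a + t *\<^sub>R b" using assms(2) by (auto simp: closed_segment_def)
 have "s ~= t" using assms(3) s t by auto
 then consider "s < t" | "t < s" by linarith
 thus ?thesis
 proof cases
  case 1
  hence "\<exists>\<alpha> \<beta>. \<alpha> \<le> 0 \<and> 1 \<le> \<beta> \<and> a = p + \<alpha> *\<^sub>R (q - p) \<and> b = p + \<beta> *\<^sub>R (q - p)" using s t by (intro main[of s t a b]) (simp_all add: algebra_simps)
  thus ?thesis by blast
 next
  case 2
  hence "\<exists>\<alpha> \<beta>. \<alpha> \<le> 0 \<and> 1 \<le> \<beta> \<and> b = p + \<alpha> *\<^sub>R (q - p) \<and> a = p + \<beta> *\<^sub>R (q - p)" using s t by (intro main[of "1 - s" "1 - t" b a]) (simp_all add: algebra_simps)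
  thus ?thesis by (metis insert_commute)
 qed
qed

text \<open>Both segments lie on the line through \<open>p\<close> and \<open>q\<close> and contain
  the part between them, so an end of one of them lies in the other.\<close>

lemma segs_overlap:
 fixes a b c d p q :: "'b::real_vector" assumes "p \<in> closed_segment a b \<inter> closed_segment c d" "q \<in> closed_segment a b \<inter> closed_segment c d" "p ~= q"
 shows "a \<in> closed_segment c d \<or> b \<in> closed_segment c d \<or> c \<in> closed_segment a b \<or> d \<in> closed_segment a b"
proof -
 obtain \<alpha> \<beta> where ab: "\<alpha> \<le> 0" "1 \<le> \<beta>" "{a, b} = {p + \<alpha> *\<^sub>R (q - p), p + \<beta> *\<^sub>R (q - p)}" using seg_param[of p a b q] assms by blast
 obtain \<gamma> \<delta> where cd: "\<gamma> \<le> 0" "1 \<le> \<delta>" "{c, d} = {p + \<gamma> *\<^sub>R (q - p), p + \<delta> *\<^sub>R (q - p)}" using seg_param[of p c d q] assms by blast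
 have hull: "p + x *\<^sub>R (q - p) \<in> convex hull {p + y *\<^sub>R (q - p), p + z *\<^sub>R (q - p)}" if "y \<le> x" "x \<le> z" "y < z" for x y z
 proof -
  let ?u = "(x - y) / (z - y)"
  have u01: "0 \<le> ?u" "?u \<le> 1" using that by (simp_all add: divide_simps)
  have "y + ?u * (z - y) = x" using that by simp
  moreover have "(1 - u) * y + u * z = y + u * (z - y)" for u by (simp add: algebra_simps)
  ultimately have "(1 - ?u) * y + ?u * z = x" by (simp only:)
  moreover have "(1 - u) *\<^sub>R (p + y *\<^sub>R w) + u *\<^sub>R (p + z *\<^sub>R w) = p + ((1 - u) * y + u * z) *\<^sub>R w" for u and w :: 'b by (simp add: algebra_simps)
  ultimately have "p + x *\<^sub>R (q - p) = (1 - ?u) *\<^sub>R (p + y *\<^sub>R (q - p)) + ?u *\<^sub>R (p + z *\<^sub>R (q - p))" by (simp only:)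
  thus ?thesis unfolding segment_convex_hull[symmetric] closed_segment_def using u01 by blast
 qed
 have "p + \<gamma> *\<^sub>R (q - p) \<in> convex hull {a, b} \<or> p + \<alpha> *\<^sub>R (q - p) \<in> convex hull {c, d}"
 proof (cases "\<alpha> \<le> \<gamma>")
  case True
  thus ?thesis unfolding ab(3) using ab cd by (intro disjI1 hull) linarith+
 next
  case False
  thus ?thesis unfolding cd(3) using ab cd by (intro disjI2 hull) linarith+
 qed
 moreover have "p + \<gamma> *\<^sub>R (q - p) \<in> {c, d}" "p + \<alpha> *\<^sub>R (q - p) \<in> {a, b}" using ab(3) cd(3) by blast+
 ultimately show ?thesis unfolding segment_convex_hull by auto
qed

text \<open>Two common points would put an end of one edge onto the other. For edges with a common
  end \<open>z\<close>, the shorter of two segments on the same ray from \<open>z\<close> ends on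
  the longer one.\<close>

lemma geo_meet:
 assumes g: "geo V E" and e: "e \<in> E" "f \<in> E" "e ~= f" and p: "p \<in> convex hull e \<inter> convex hull f" "q \<in> convex hull e \<inter> convex hull f" shows "p = q"
proof (rule ccontr)
 assume pq: "p ~= q"
 have c: "card e = 2" "card f = 2" "e \<subseteq> V" "f \<subseteq> V" using g e by (auto simp: geo_def)
 obtain a b where ab: "e = {a, b}" "a ~= b" using c by (auto simp: card_2_iff)
 obtain c d where cd: "f = {c, d}" "c ~= d" using c by (auto simp: card_2_iff)
 have v: "x \<in> g" if "g \<in> {e, f}" "x \<in> e \<union> f" "x \<in> convex hull g" for x g
 proof -
  have "g \<in> E" "x \<in> V" using that(1,2) e c(3,4) by auto
  moreover have "\<forall>e\<in>E. \<forall>v\<in>V. v \<in> convex hull e --> v \<in> e" using g unfolding geo_def by (elim conjE)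
  ultimately show ?thesis using that(3) by simp
 qed
 show False
 proof (cases "e \<inter> f = {}")
  case True
  have "a \<in> closed_segment c d \<or> b \<in> closed_segment c d \<or> c \<in> closed_segment a b \<or> d \<in> closed_segment a b"
   using p pq unfolding ab cd segment_convex_hull[symmetric] by (rule segs_overlap)
  thus False using v[of f a] v[of f b] v[of e c] v[of e d] True unfolding segment_convex_hull ab cd by auto
 next
  case False
  then obtain z where z: "z \<in> e" "z \<in> f" by blast
  have "card (e - {z}) = 1" "card (f - {z}) = 1" using c z by (simp_all add: card_Diff_singleton)
  then obtain x y where xy: "e - {z} = {x}" "f - {z} = {y}" by (metis card_1_singletonE)
  hence ef: "e = {z, x}" "f = {z, y}" "x ~= z" "y ~= z" using z by blast+
  define r where "r = (if p = z then q else p)"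
  have r: "r ~= z" "r \<in> closed_segment z x" "r \<in> closed_segment z y" using p pq unfolding r_def ef segment_convex_hull by auto
  have "y \<in> closed_segment z x \<or> x \<in> closed_segment z y"
  proof -
   obtain s where s: "0 \<le> s" "s \<le> 1" "r = (1 - s) *\<^sub>R z + s *\<^sub>R x" using r(2) by (auto simp: closed_segment_def)
   obtain t where t: "0 \<le> t" "t \<le> 1" "r = (1 - t) *\<^sub>R z + t *\<^sub>R y" using r(3) by (auto simp: closed_segment_def)
   have eq: "s *\<^sub>R (x - z) = t *\<^sub>R (y - z)" using s(3) t(3) by (simp add: algebra_simps)
   have nz: "s ~= 0" "t ~= 0" using r(1) s(3) t(3) by auto
   have *: "u \<in> closed_segment z w" if "0 < a" "a \<le> b" "b *\<^sub>R (u - z) = a *\<^sub>R (w - z)" for u w a b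
   proof -
    have "u - z = inverse b *\<^sub>R (b *\<^sub>R (u - z))" using that(1,2) by simp
    also have "\<dots> = (a / b) *\<^sub>R (w - z)" by (simp only: that(3) scaleR_scaleR divide_inverse mult.commute)
    finally have "u = (1 - a / b) *\<^sub>R z + (a / b) *\<^sub>R w" by (simp add: algebra_simps)
    moreover have "0 \<le> a / b" "a / b \<le> 1" using that by (simp_all add: divide_simps)
    ultimately show ?thesis unfolding closed_segment_def by blast
   qed
   show ?thesis using *[of s t y x] *[of t s x y] eq s(1) t(1) nz by fastforce
  qed
  hence "y \<in> e \<or> x \<in> f" using v[of e y] v[of f x] ef unfolding segment_convex_hull by blast
  thus False using ef e(3) by auto
 qed
qed

text \<open>A component of \<open>D' - A\<close> on which \<open>g\<close> takes both signs would
  contain a zero of \<open>g\<close>, that is, a point of \<open>A\<close>.\<close>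

lemma cross_atI:
 assumes D: "openin (top_of_set S2) D" "p \<in> D" and g: "continuous_on D g" and A: "\<And>x. x \<in> D ==> g x = (0 :: real) \<longleftrightarrow> x \<in> A"
  and B: "\<And>D'. openin (top_of_set S2) D' ==> D' \<subseteq> D ==> p \<in> D' ==> \<exists>x\<in>D' \<inter> B. \<exists>y\<in>D' \<inter> B. g x < 0 \<and> 0 < g y"
 shows "cross_at A B p"
 unfolding cross_at_def
proof (intro exI conjI allI impI)
 fix D' assume D': "openin (top_of_set S2) D' \<and> D' \<subseteq> D \<and> p \<in> D'"
 hence sub: "D' \<subseteq> D" by blast
 obtain x y where xy: "x \<in> D'" "x \<in> B" "y \<in> D'" "y \<in> B" "g x < 0" "0 < g y" using B[of D'] D' by blast
 let ?C = "connected_component_set (D' - A)"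
 have nA: "x \<notin> A" "y \<notin> A" using A[of x] A[of y] xy sub by auto
 have xC: "x \<in> ?C x" "y \<in> ?C y" using xy nA by simp_all
 have "?C x ~= ?C y"
 proof
  assume eq: "?C x = ?C y"
  have cs: "?C x \<subseteq> D' - A" by (rule connected_component_subset)
  have "connected (g ` ?C x)" using cs sub by (intro connected_continuous_image continuous_on_subset[OF g]) auto
  moreover have "g x \<in> g ` ?C x" "g y \<in> g ` ?C x" using xC eq by blast+
  ultimately have "0 \<in> g ` ?C x" using xy(5,6) connected_contains_Icc[of "g ` ?C x" "g x" "g y"] by auto
  then obtain w where "w \<in> ?C x" "g w = 0" by auto
  thus False using A[of w] cs sub by blast
 qed
 moreover have "?C x \<in> components (D' - A)" "?C y \<in> components (D' - A)" using xy nA by (auto simp: components_def)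
 moreover have "?C x \<inter> B ~= {}" "?C y \<inter> B ~= {}" by (rule ex_in_conv[THEN iffD1], rule exI, rule IntI[OF xC(1) xy(2)])
   (rule ex_in_conv[THEN iffD1], rule exI, rule IntI[OF xC(2) xy(4)])
 ultimately have "separates D' A B" unfolding separates_def by (intro bexI[of _ "?C x"] bexI[of _ "?C y"] conjI)
 thus "separates D' A B \<or> separates D' B A" ..
qed (use D in auto)

text \<open>The realization is mapped affinely into \<open>M\<close> by the positions of the
  vertices and then injectively to the sphere, so images coincide only where straight segments
  cross. \<open>cross\<close> is the one condition that depends on the map to the sphere.\<close>

locale straight =
 fixes G :: "'a sgraph" and h :: "'a => 'b::euclidean_space" and \<Theta> :: "'b => real^3" and M :: "'b set"
 assumes sg: "sgraph G" and hi: "inj_on h (verts G)" and g: "geo (h ` verts G) ((`) h ` edges G)"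
  and M: "\<And>e. e \<in> edges G ==> convex hull (h ` e) \<subseteq> M" "h ` verts G \<subseteq> M" and \<Theta>: "continuous_on M \<Theta>" "inj_on \<Theta> M" "\<Theta> ` M \<subseteq> S2"
  and cross: "\<And>e f P. e \<in> edges G ==> f \<in> edges G ==> crosses (h ` e) (h ` f) ==> P \<in> convex hull (h ` e) ==>
   P \<in> convex hull (h ` f) ==> cross_at (\<Theta> ` (convex hull (h ` e))) (\<Theta> ` (convex hull (h ` f))) (\<Theta> P)"
begin

abbreviation R where "R == realization G"
abbreviation V where "V == verts G"
abbreviation E where "E == edges G"

definition L :: "('a => real) => 'b" where "L x = (\<Sum>v\<in>V. x v *\<^sub>R h v)"

lemma finV: "finite V" and edge: "e \<in> E ==> e \<subseteq> V \<and> card e = 2"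
 using sg by (simp_all add: sgraph_def)

lemma finE: "finite E"
 using edge finV by (intro finite_subset[of E "Pow V"]) auto

lemma R_supp: "x \<in> R ==> supp x \<subseteq> V" "x \<in> R ==> supp x \<in> E \<or> (\<exists>v\<in>V. supp x = {v})"
 using edge by (auto simp: realization_def simplices_def)

lemma L_supp: "x \<in> R ==> L x = (\<Sum>v\<in>supp x. x v *\<^sub>R h v)" "x \<in> R ==> (\<Sum>v\<in>supp x. x v) = 1"
proof -
 assume x: "x \<in> R"
 show "L x = (\<Sum>v\<in>supp x. x v *\<^sub>R h v)" unfolding L_def using finV R_supp(1)[OF x] by (intro sum.mono_neutral_right) (auto simp: supp_def)
 have "(\<Sum>v\<in>V. x v) = (\<Sum>v\<in>supp x. x v)" using finV R_supp(1)[OF x] by (intro sum.mono_neutral_right) (auto simp: supp_def)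
 thus "(\<Sum>v\<in>supp x. x v) = 1" using x by (simp add: realization_def)
qed

lemma L_hull: "x \<in> R ==> L x \<in> convex hull (h ` supp x)"
 unfolding L_supp(1)
proof (rule convex_sum)
 assume x: "x \<in> R"
 show "finite (supp x)" by (rule finite_subset[OF R_supp(1)[OF x] finV])
 show "(\<Sum>v\<in>supp x. x v) = 1" by (rule L_supp(2)[OF x])
 show "0 \<le> x v" for v using x by (simp add: realization_def)
 show "h v \<in> convex hull (h ` supp x)" if "v \<in> supp x" for v using that by (intro hull_inc) simp
qed simp

lemma L_vertex: "x \<in> R ==> supp x = {v} ==> L x = h v"
 using L_supp[of x] by simp

lemma same_vertex: "x \<in> R ==> y \<in> R ==> supp x = {v} ==> supp y = {v} ==> x = y"
proof
 fix u assume xy: "x \<in> R" "y \<in> R" "supp x = {v}" "supp y = {v}"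
 have "x v = 1" "y v = 1" using L_supp(2)[OF xy(1)] L_supp(2)[OF xy(2)] xy(3,4) by simp_all
 moreover have "x u = 0" "y u = 0" if "u ~= v" using xy(3,4) that by (auto simp: supp_def)
 ultimately show "x u = y u" by (cases "u = v") simp_all
qed

lemma pair_coords:
 assumes "x \<in> R" "supp x = {u, w}" "u ~= w" shows "L x = h w + x u *\<^sub>R (h u - h w)" "x w = 1 - x u" "x u ~= 0" "x w ~= 0" "v \<notin> {u, w} ==> x v = 0"
proof -
 have s: "L x = x u *\<^sub>R h u + x w *\<^sub>R h w" "x u + x w = 1" using L_supp[OF assms(1)] assms(2,3) by simp_all
 thus w: "x w = 1 - x u" by simp
 show "L x = h w + x u *\<^sub>R (h u - h w)" unfolding s(1) w by (simp add: algebra_simps)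
 show "x u ~= 0" "x w ~= 0" using assms(2) by (auto simp: supp_def)
 show "x v = 0" if "v \<notin> {u, w}" using that unfolding assms(2)[symmetric] by (simp add: supp_def)
qed

lemma no_vertex: "e \<in> E ==> v \<in> V ==> h v \<in> convex hull (h ` e) ==> v \<in> e"
proof -
 assume e: "e \<in> E" "v \<in> V" "h v \<in> convex hull (h ` e)"
 have "\<forall>e\<in>(`) h ` E. \<forall>v\<in>h ` V. v \<in> convex hull e --> v \<in> e" using g unfolding geo_def by (elim conjE)
 hence "h v \<in> h ` e" using e by simp
 thus "v \<in> e" using inj_on_image_mem_iff[OF hi e(2)] edge[OF e(1)] by simp
qed

lemma L_vertex_inj:
 assumes "x \<in> R" "y \<in> R" "L x = L y" "supp x = {v}" shows "x = y"
proof -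
 have v: "v \<in> V" using R_supp(1)[OF assms(1)] assms(4) by simp
 have Lv: "L y = h v" using L_vertex assms by simp
 from R_supp(2)[OF assms(2)] show ?thesis
 proof (elim disjE bexE)
  fix w assume w: "w \<in> V" "supp y = {w}"
  hence "h w = h v" using L_vertex[OF assms(2)] Lv by simp
  thus ?thesis by (metis hi v inj_onD same_vertex assms w)
 next
  assume e: "supp y \<in> E"
  have "v \<in> supp y" using no_vertex[OF e v] L_hull[OF assms(2)] Lv by simp
  moreover have c: "card (supp y) = 2" using edge[OF e] by simp
  ultimately have "card (supp y - {v}) = 1" by (simp add: card_Diff_singleton)
  then obtain w where w: "supp y - {v} = {w}" by (rule card_1_singletonE)
  hence s: "supp y = {w, v}" "w ~= v" using \<open>v \<in> supp y\<close> by blast+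
  have "h w ~= h v" using R_supp(1) assms(2) s(1) hi s(2) inj_onD by fastforce
  moreover have "y w *\<^sub>R (h w - h v) = 0" using pair_coords(1)[OF assms(2) s] Lv by simp
  ultimately show ?thesis using pair_coords(3)[OF assms(2) s] by simp
 qed
qed

lemma vertex_pt: "v \<in> V ==> vertex_point v \<in> R"
 using finV by (auto simp: realization_def simplices_def vertex_point_supp) (simp_all add: vertex_point_def)

lemma hull_eqD:
 assumes "e \<in> E" "f \<in> E" "e ~= f" "P \<in> convex hull (h ` e) \<inter> convex hull (h ` f)" "Q \<in> convex hull (h ` e) \<inter> convex hull (h ` f)" shows "P = Q"
proof (rule geo_meet[OF g])
 show "h ` e \<in> (`) h ` E" "h ` f \<in> (`) h ` E" using assms by simp_all
 show "h ` e ~= h ` f" using assms(3) inj_on_image_eq_iff[OF hi conjunct1[OF edge[OF assms(1)]] conjunct1[OF edge[OF assms(2)]]] by simp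
qed (rule assms)+

lemma L_inj:
 assumes "x \<in> R" "y \<in> R" "L x = L y" "x ~= y" shows "supp x \<in> E" "supp y \<in> E" "supp x ~= supp y" "crosses (h ` supp x) (h ` supp y)"
proof -
 have nv: "supp x ~= {v}" "supp y ~= {v}" for v using L_vertex_inj[OF assms(1-3)] L_vertex_inj[OF assms(2,1) assms(3)[symmetric]] assms(4) by blast+
 show e: "supp x \<in> E" "supp y \<in> E" using R_supp(2)[OF assms(1)] R_supp(2)[OF assms(2)] nv by blast+
 show ne: "supp x ~= supp y"
 proof
  assume eq: "supp x = supp y"
  obtain u w where uw: "supp x = {u, w}" "u ~= w" using edge[OF e(1)] by (auto simp: card_2_iff)
  have uw': "supp y = {u, w}" using uw eq by simp
  have "h u - h w ~= 0" using R_supp(1) assms(1) uw hi inj_onD by fastforce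
  moreover have "(x u - y u) *\<^sub>R (h u - h w) = 0" using pair_coords(1)[OF assms(1) uw] pair_coords(1)[OF assms(2) uw' uw(2)] assms(3) by (simp add: algebra_simps)
  ultimately have xu: "x u = y u" by simp
  have "x v = y v" for v
  proof (cases "v \<in> {u, w}")
   case True
   thus ?thesis using xu pair_coords(2)[OF assms(1) uw] pair_coords(2)[OF assms(2) uw' uw(2)] by auto
  next
   case False
   thus ?thesis using pair_coords(5)[OF assms(1) uw False] pair_coords(5)[OF assms(2) uw' uw(2) False] by simp
  qed
  thus False using assms(4) by blast
 qed
 have P: "L x \<in> convex hull (h ` supp x) \<inter> convex hull (h ` supp y)" using L_hull[OF assms(1)] L_hull[OF assms(2)] assms(3) by simp
 have "h ` supp x \<inter> h ` supp y = {}"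
 proof (rule ccontr)
  assume "h ` supp x \<inter> h ` supp y ~= {}"
  then obtain z where z: "z \<in> h ` supp x" "z \<in> h ` supp y" by blast
  then obtain v where v: "v \<in> supp x" "z = h v" by blast
  have "L x = h v" by (metis z IntI hull_inc hull_eqD e ne P v(2))
  moreover have vV: "v \<in> V" using R_supp(1)[OF assms(1)] v(1) by blast
  ultimately have "L (vertex_point v) = L x" using L_vertex[OF vertex_pt[OF vV] vertex_point_supp] by simp
  thus False by (metis L_vertex_inj vertex_pt vV assms(1) vertex_point_supp nv(1))
 qed
 thus "crosses (h ` supp x) (h ` supp y)" unfolding crosses_def using P by blast
qed

lemma edge_image:
 assumes e: "e \<in> E" shows "L ` edge_points G e = convex hull (h ` e)"
proof (intro equalityI subsetI)
 fix P assume "P \<in> L ` edge_points G e"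
 then obtain x where x: "x \<in> R" "supp x \<subseteq> e" "P = L x" by (auto simp: edge_points_def)
 thus "P \<in> convex hull (h ` e)" using L_hull[OF x(1)] hull_mono[of "h ` supp x" "h ` e"] by blast
next
 fix P assume P: "P \<in> convex hull (h ` e)"
 obtain u w where uw: "e = {u, w}" "u ~= w" using edge[OF e] by (auto simp: card_2_iff)
 have V: "u \<in> V" "w \<in> V" using edge[OF e] uw by auto
 obtain t where t: "0 \<le> t" "t \<le> 1" "P = (1 - t) *\<^sub>R h u + t *\<^sub>R h w" using P unfolding uw(1) by (auto simp: segment_convex_hull[symmetric] closed_segment_def)
 define x where "x = (\<lambda>v. if v = u then 1 - t else if v = w then t else 0)"
 have s: "supp x = (if t = 0 then {u} else if t = 1 then {w} else e)" using uw by (auto simp: supp_def x_def)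
 have "(\<Sum>v\<in>V. x v) = (\<Sum>v\<in>{u, w}. x v)" using finV V by (intro sum.mono_neutral_right) (auto simp: x_def)
 also have "\<dots> = 1" using uw(2) by (simp add: x_def)
 finally have "x \<in> R" using t s e V by (auto simp: realization_def simplices_def x_def)
 moreover have "L x = P"
 proof -
  have "L x = (\<Sum>v\<in>{u, w}. x v *\<^sub>R h v)" unfolding L_def using finV V by (intro sum.mono_neutral_right) (auto simp: x_def)
  thus ?thesis using uw(2) t(3) by (simp add: x_def)
 qed
 moreover have "supp x \<subseteq> e" using s uw by auto
 ultimately show "P \<in> L ` edge_points G e" by (intro image_eqI[of _ _ x]) (simp_all add: edge_points_def)
qed

lemma L_M: "x \<in> R ==> L x \<in> M"
proof -
 assume x: "x \<in> R"
 from R_supp(2)[OF x] show ?thesis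
 proof (elim disjE bexE)
  assume "supp x \<in> E"
  thus ?thesis using M(1) L_hull[OF x] by blast
 next
  fix v assume "v \<in> V" "supp x = {v}"
  thus ?thesis using L_vertex[OF x] M(2) by auto
 qed
qed

abbreviation \<phi> where "\<phi> == \<Theta> \<circ> L"

lemma phi_eq: "x \<in> R ==> y \<in> R ==> \<phi> x = \<phi> y ==> L x = L y"
 using inj_onD[OF \<Theta>(2)] L_M by simp

lemma crossing_pair:
 assumes "p \<in> crossings G \<phi>" "x \<in> R" "\<phi> x = p" shows "\<exists>y\<in>R. y ~= x \<and> \<phi> y = p \<and> L y = L x"
proof -
 obtain a b where "a \<in> R" "b \<in> R" "\<phi> a = p" "\<phi> b = p" "a ~= b" using assms(1) by (auto simp: crossings_def preimages_def)
 note ab = this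
 define y where "y = (if a = x then b else a)"
 have y: "y \<in> R" "y ~= x" "\<phi> y = p" using ab by (auto simp: y_def)
 show ?thesis using phi_eq assms(2) assms(3) y by auto
qed

lemma third_edge: "e \<in> E ==> f \<in> E ==> f' \<in> E ==> crosses (h ` e) (h ` f) ==> crosses (h ` e) (h ` f') ==> f = f'"
proof -
 assume e: "e \<in> E" "f \<in> E" "f' \<in> E" "crosses (h ` e) (h ` f)" "crosses (h ` e) (h ` f')"
 have "\<forall>e\<in>(`) h ` E. \<forall>f\<in>(`) h ` E. \<forall>g\<in>(`) h ` E. crosses e f --> crosses e g --> f = g" using g unfolding geo_def by (elim conjE)
 hence "h ` f = h ` f'" using e by simp
 thus "f = f'" by (rule iffD1[OF inj_on_image_eq_iff[OF hi conjunct1[OF edge[OF e(2)]] conjunct1[OF edge[OF e(3)]]]])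
qed

lemma drawing1: "is_1_drawing G \<phi>"
 unfolding is_1_drawing_def is_drawing_def
proof (intro conjI ballI impI allI)
 have "continuous_on R L" unfolding L_def by (intro continuous_intros continuous_on_subset[OF continuous_on_product_coordinates]) simp
 moreover have "continuous_on (L ` R) \<Theta>" by (rule continuous_on_subset[OF \<Theta>(1)]) (use L_M in blast)
 ultimately show "continuous_on R \<phi>" by (rule continuous_on_compose)
 show "\<phi> ` R \<subseteq> S2" using L_M \<Theta>(3) by auto
 fix v x assume v: "v \<in> V" "x \<in> R" "\<phi> (vertex_point v) = \<phi> x"
 hence "L (vertex_point v) = L x" by (intro phi_eq vertex_pt)
 thus "x = vertex_point v" by (metis L_vertex_inj vertex_pt v(1) v(2) vertex_point_supp)
next
 define c where "c = (\<lambda>(e, f). \<Theta> (SOME P. P \<in> convex hull (h ` e) \<inter> convex hull (h ` f)))"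
 have "p \<in> c ` (E \<times> E)" if p: "p \<in> crossings G \<phi>" for p
 proof -
  obtain x where x: "x \<in> R" "\<phi> x = p" using p by (auto simp: crossings_def preimages_def)
  obtain y where y: "y \<in> R" "y ~= x" "L y = L x" using crossing_pair[OF p x] by blast
  note i = L_inj[OF y(1) x(1) y(3) y(2)]
  have P: "L x \<in> convex hull (h ` supp y) \<inter> convex hull (h ` supp x)" using L_hull[OF x(1)] L_hull[OF y(1)] y(3) by simp
  have "(SOME P. P \<in> convex hull (h ` supp y) \<inter> convex hull (h ` supp x)) = L x"
   by (rule hull_eqD[OF i(1,2,3) someI[of "\<lambda>P. P \<in> convex hull (h ` supp y) \<inter> convex hull (h ` supp x)", OF P] P])
  hence "p = c (supp y, supp x)" using x(2) by (simp add: c_def)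
  thus ?thesis using i by (intro image_eqI[of _ _ "(supp y, supp x)"]) simp_all
 qed
 hence "crossings G \<phi> \<subseteq> c ` (E \<times> E)" by blast
 moreover have "finite (c ` (E \<times> E))" using finE by simp
 ultimately show "finite (crossings G \<phi>)" by (rule finite_subset)
next
 fix p assume p: "p \<in> crossings G \<phi>"
 obtain x where x: "x \<in> R" "\<phi> x = p" using p by (auto simp: crossings_def preimages_def)
 obtain y where y: "y \<in> R" "y ~= x" "\<phi> y = p" "L y = L x" using crossing_pair[OF p x] by blast
 note i = L_inj[OF x(1) y(1) y(4)[symmetric] y(2)[symmetric]]
 have "z \<in> {x, y}" if z: "z \<in> R" "\<phi> z = p" for z
 proof (rule ccontr)
  assume n: "z \<notin> {x, y}"
  have Lz: "L x = L z" "L y = L z" using phi_eq x y z by simp_all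
  note i1 = L_inj[OF x(1) z(1) Lz(1)] and i2 = L_inj[OF y(1) z(1) Lz(2)]
  show False using n i1 third_edge i(1,2) i(4) i2(3) by auto
 qed
 hence pre: "preimages G \<phi> p = {x, y}" using x y by (auto simp: preimages_def)
 have "cross_at (\<Theta> ` (convex hull (h ` supp x))) (\<Theta> ` (convex hull (h ` supp y))) (\<Theta> (L x))" by (metis L_hull x(1) y(1) y(4) cross i(1,2,4))
 moreover have "\<Theta> (L x) = p" using x(2) by simp
 ultimately have ca: "cross_at (\<phi> ` edge_points G (supp x)) (\<phi> ` edge_points G (supp y)) p"
  unfolding image_comp[symmetric] edge_image[OF i(1)] edge_image[OF i(2)] by simp
 have "x \<in> inner_points G (supp x)" "y \<in> inner_points G (supp y)" using x y by (simp_all add: inner_points_def)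
 thus "\<exists>e\<in>E. \<exists>f\<in>E. \<exists>x\<in>inner_points G e. \<exists>y\<in>inner_points G f.
   e ~= f \<and> preimages G \<phi> p = {x, y} \<and> cross_at (\<phi> ` edge_points G e) (\<phi> ` edge_points G f) p"
  using i(3) pre ca by (intro bexI[OF _ i(1)] bexI[OF _ i(2)] bexI[of _ x] bexI[of _ y] conjI)
next
 fix e p q assume e: "e \<in> E" and inv: "involved_in G \<phi> e p \<and> involved_in G \<phi> e q"
 have *: "\<exists>x y. x \<in> R \<and> y \<in> R \<and> supp x = e \<and> \<phi> x = p \<and> L y = L x \<and> supp y \<in> E \<and> e ~= supp y \<and> crosses (h ` e) (h ` supp y)"
  if inv1: "involved_in G \<phi> e p" for p
 proof -
  obtain x where x: "x \<in> R" "supp x = e" "\<phi> x = p" and p: "p \<in> crossings G \<phi>" using inv1 by (auto simp: involved_in_def inner_points_def)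
  obtain y where y: "y \<in> R" "y ~= x" "L y = L x" using crossing_pair[OF p x(1,3)] by blast
  show ?thesis using L_inj[OF x(1) y(1) y(3)[symmetric] y(2)[symmetric]] x y(1,3) by (intro exI[of _ x] exI[of _ y]) simp
 qed
 obtain x y where x: "x \<in> R" "y \<in> R" "supp x = e" "\<phi> x = p" "L y = L x" "supp y \<in> E" "e ~= supp y" "crosses (h ` e) (h ` supp y)" using *[of p] inv by blast
 obtain x' y' where x': "x' \<in> R" "y' \<in> R" "supp x' = e" "\<phi> x' = q" "L y' = L x'" "supp y' \<in> E" "crosses (h ` e) (h ` supp y')" using *[of q] inv by blast
 have yy: "supp y = supp y'" by (rule third_edge[OF e x(6) x'(6) x(8) x'(7)])
 have "L x = L x'"
 proof (rule hull_eqD[OF e x(6,7)])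
  show "L x \<in> convex hull (h ` e) \<inter> convex hull (h ` supp y)" using L_hull[OF x(1)] L_hull[OF x(2)] x(3,5) by simp
  show "L x' \<in> convex hull (h ` e) \<inter> convex hull (h ` supp y)" using L_hull[OF x'(1)] L_hull[OF x'(2)] x'(3,5) yy by simp
 qed
 thus "p = q" using x(4) x'(4) by (metis comp_apply)
qed

theorem one_planar: "one_planar G"
 unfolding one_planar_def using sg drawing1 by blast

end

theorem geo_one_planar:
 fixes V :: "'b::euclidean_space set" assumes g: "geo V E" and M: "\<And>e. e \<in> E ==> convex hull e \<subseteq> M" "V \<subseteq> M"
  and \<Theta>: "continuous_on M \<Theta>" "inj_on \<Theta> M" "\<Theta> ` M \<subseteq> S2" and cross: "\<And>e f P. e \<in> E ==> f \<in> E ==> crosses e f ==> P \<in> convex hull e ==> P \<in> convex hull f ==>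
   cross_at (\<Theta> ` (convex hull e)) (\<Theta> ` (convex hull f)) (\<Theta> P)"
 shows "\<exists>G :: nat sgraph. one_planar G \<and> card (verts G) = card V \<and> card (tri E) \<le> num_subgraphs_iso (complete_graph 3) G"
proof -
 have fin: "finite V" and edge: "\<And>e. e \<in> E ==> e \<subseteq> V \<and> card e = 2" using g by (simp_all add: geo_def)
 obtain h where h: "bij_betw h {..<card V} V" using ex_bij_betw_nat_finite[OF fin] by (auto simp: lessThan_atLeast0)
 hence hi: "inj_on h {..<card V}" and hV: "h ` {..<card V} = V" by (simp_all add: bij_betw_def)
 define G where "G = \<lparr>verts = {..<card V}, edges = {e. e \<subseteq> {..<card V} \<and> h ` e \<in> E}\<rparr>"
 have pull: "\<exists>e\<subseteq>{..<card V}. h ` e = f \<and> card e = card f" if f: "f \<subseteq> V" for f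
 proof (intro exI conjI)
  let ?e = "{i \<in> {..<card V}. h i \<in> f}"
  show "?e \<subseteq> {..<card V}" by blast
  show e: "h ` ?e = f" using f hV by auto
  have "?e \<subseteq> {..<card V}" by blast
  from card_image[OF inj_on_subset[OF hi this]] show "card ?e = card f" by (simp only: e)
 qed
 have hE: "(`) h ` edges G = E"
 proof (intro equalityI subsetI)
  fix f assume f: "f \<in> E"
  obtain e where "e \<subseteq> {..<card V}" "h ` e = f" using pull[of f] edge[OF f] by blast
  thus "f \<in> (`) h ` edges G" using f by (intro image_eqI[of _ _ e]) (simp_all add: G_def)
 qed (auto simp: G_def)
 have sg: "sgraph G"
 proof -
  have "card e = 2" if "e \<subseteq> {..<card V}" "h ` e \<in> E" for e using card_image[OF inj_on_subset[OF hi that(1)]] edge[OF that(2)] by simp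
  thus ?thesis by (auto simp: sgraph_def G_def)
 qed
 interpret S: straight G h \<Theta> M
 proof
  show "sgraph G" by (rule sg)
  show "inj_on h (verts G)" using hi by (simp add: G_def)
  have vV: "h ` verts G = V" using hV by (simp add: G_def)
  show "geo (h ` verts G) ((`) h ` edges G)" unfolding vV hE by (rule g)
  show "h ` verts G \<subseteq> M" unfolding vV by (rule M(2))
  have eE: "h ` e \<in> E" if "e \<in> edges G" for e using that by (simp add: G_def)
  show "convex hull (h ` e) \<subseteq> M" if "e \<in> edges G" for e by (rule M(1)[OF eE[OF that]])
  show "continuous_on M \<Theta>" "inj_on \<Theta> M" "\<Theta> ` M \<subseteq> S2" by (rule \<Theta>)+
  show "cross_at (\<Theta> ` (convex hull (h ` e))) (\<Theta> ` (convex hull (h ` f))) (\<Theta> P)"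
   if "e \<in> edges G" "f \<in> edges G" "crosses (h ` e) (h ` f)" "P \<in> convex hull (h ` e)" "P \<in> convex hull (h ` f)" for e f P
   by (rule cross[OF eE[OF that(1)] eE[OF that(2)] that(3-5)])
 qed
 interpret F: fgraph V E using fin edge by unfold_locales
 interpret FG: fgraph "verts G" "edges G" using sg by unfold_locales (simp_all add: sgraph_def)
 have "tri E \<subseteq> (`) h ` tri (edges G)"
 proof
  fix T assume T: "T \<in> tri E"
  hence "T \<subseteq> V" "card T = 3" using F.tri_sub by blast+
  then obtain T' where T': "T' \<subseteq> {..<card V}" "h ` T' = T" "card T' = 3" using pull[of T] by auto
  have "{x, y} \<in> edges G" if xy: "x \<in> T'" "y \<in> T'" "x ~= y" for x y
  proof -
   have "h x ~= h y" using inj_onD[OF hi, of x y] xy T'(1) by blast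
   moreover have "h x \<in> T" "h y \<in> T" using T'(2) xy by blast+
   ultimately show ?thesis using T xy T'(1) by (auto simp: tri_def G_def)
  qed
  thus "T \<in> (`) h ` tri (edges G)" using T'(3) T'(2) by (auto simp: tri_def)
 qed
 thus ?thesis using surj_card_le FG.fin_tri S.one_planar num_triangles sg by (fastforce simp: G_def)
qed

section \<open>Radial projection to the sphere\<close>

definition cr :: "complex => complex => real" where "cr u v = Re u * Im v - Im u * Re v"

lemma cr_simps: "cr u (v + w) = cr u v + cr u w" "cr u (v - w) = cr u v - cr u w" "cr u (r *\<^sub>R v) = r * cr u v" "cr u u = 0" by (simp_all add: cr_def algebra_simps)

text \<open>Applied in both directions, \<open>le\<close> says that each ray from the origin meets
  \<open>M\<close> at most once.\<close>

lemma inj_on_sgn: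
 fixes M :: "'b::real_normed_vector set" assumes "0 \<notin> M" and le: "\<And>x c. x \<in> M ==> c *\<^sub>R x \<in> M ==> 0 < c ==> c \<le> 1" shows "inj_on sgn M"
proof (rule inj_onI)
 fix x y assume xy: "x \<in> M" "y \<in> M" "sgn x = sgn y"
 hence n: "0 < norm x" "0 < norm y" using assms(1) by auto
 have e: "v = (norm v / norm w) *\<^sub>R w" if "sgn v = sgn w" "0 < norm v" for v w :: 'b
 proof -
  have "norm v *\<^sub>R sgn v = norm v *\<^sub>R sgn w" by (simp only: that(1))
  thus ?thesis using that(2) by (simp add: sgn_div_norm divide_inverse)
 qed
 note yx = e[OF xy(3)[symmetric] n(2)] and xy' = e[OF xy(3) n(1)]
 have "norm y / norm x \<le> 1" using yx xy(2) n by (intro le[OF xy(1)]) simp_all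
 moreover have "norm x / norm y \<le> 1" using xy' xy(1) n by (intro le[OF xy(2)]) simp_all
 ultimately have "norm x = norm y" using n by (simp add: divide_simps)
 thus "x = y" using yx n by simp
qed

text \<open>The expansion of \<open>y\<close> along \<open>a\<close>, \<open>b\<close> and their
  cross product, multiplied by the squared length of the latter.\<close>

lemma cross3_decomp: "(cross3 a b \<bullet> cross3 a b) *\<^sub>R y =
  (cross3 a b \<bullet> cross3 y b) *\<^sub>R a + (cross3 a b \<bullet> cross3 a y) *\<^sub>R b + (cross3 a b \<bullet> y) *\<^sub>R cross3 a b"
 by (simp add: vec_eq_iff forall_3 inner_vec_def sum_3 cross3_def) algebra

text \<open>The test function for \<open>cross_atI\<close> is the inner product with the normal
  \<open>n\<close> of the plane through the origin and \<open>e\<close>. Up to the factor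
  \<open>N\<close>, \<alpha> and \<beta> are the coordinates along \<open>a\<close> and
  \<open>b\<close>; where both are positive, the plane is the open cone over \<open>e\<close>. Along
  \<open>f\<close> the function is linear with slope \<open>k\<close>.\<close>

lemma sgn_cross_at:
 fixes M :: "(real^3) set" assumes g: "geo V E" and M: "0 \<notin> M" "inj_on sgn M" "\<And>e. e \<in> E ==> convex hull e \<subseteq> M"
  and ef: "e \<in> E" "f \<in> E" "crosses e f" and P: "P \<in> convex hull e" "P \<in> convex hull f"
 shows "cross_at (sgn ` (convex hull e)) (sgn ` (convex hull f)) (sgn P)"
proof -
 have nv: "\<forall>e\<in>E. \<forall>v\<in>V. v \<in> convex hull e --> v \<in> e" and ed: "\<forall>e\<in>E. e \<subseteq> V \<and> card e = 2" using g by (simp_all add: geo_def)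
 have disj: "e \<inter> f = {}" using ef(3) by (simp add: crosses_def)
 have nend: "v ~= P" if "v \<in> e \<union> f" for v
 proof
  assume "v = P"
  hence "v \<in> e" "v \<in> f" using that P bspec[OF bspec[OF nv ef(1)], of v] bspec[OF bspec[OF nv ef(2)], of v]
    bspec[OF ed ef(1)] bspec[OF ed ef(2)] by blast+
  thus False using disj by blast
 qed
 have param: "\<exists>a b t. h = {a, b} \<and> a ~= b \<and> 0 < t \<and> t < 1 \<and> P = a + t *\<^sub>R (b - a)"
  if h: "h \<in> E" "P \<in> convex hull h" "h \<subseteq> e \<union> f" for h
 proof -
  obtain a b where ab: "h = {a, b}" "a ~= b" using bspec[OF ed h(1)] by (auto simp: card_2_iff)
  obtain t where t: "0 \<le> t" "t \<le> 1" "P = (1 - t) *\<^sub>R a + t *\<^sub>R b" using h(2) unfolding ab(1) segment_convex_hull[symmetric] by (auto simp: closed_segment_def)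
  have "t ~= 0" "t ~= 1" using t(3) nend[of a] nend[of b] h(3) ab(1) by auto
  thus ?thesis using t ab by (intro exI[of _ a] exI[of _ b] exI[of _ t]) (simp add: algebra_simps)
 qed
 obtain a b t where ab: "e = {a, b}" "a ~= b" and t: "0 < t" "t < 1" "P = a + t *\<^sub>R (b - a)" using param[OF ef(1) P(1)] by blast
 obtain c d u where cd: "f = {c, d}" "c ~= d" and u: "0 < u" "u < 1" "P = c + u *\<^sub>R (d - c)" using param[OF ef(2) P(2)] by blast
 have seg: "x + s *\<^sub>R (y - x) \<in> convex hull {x, y}" if "0 \<le> s" "s \<le> 1" for x y :: "real^3" and s
  unfolding segment_convex_hull[symmetric] closed_segment_def using that by (intro CollectI exI[of _ s]) (simp add: algebra_simps)
 note eM = subsetD[OF M(3)[OF ef(1)]] and fM = subsetD[OF M(3)[OF ef(2)]]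
 have aM: "a \<in> M" "b \<in> M" using eM seg[of 0 a b] seg[of 1 a b] by (simp_all add: ab(1))
 define n where "n = cross3 a b"
 define \<alpha> where "\<alpha> = (\<lambda>y. n \<bullet> cross3 y b)"
 define \<beta> where "\<beta> = (\<lambda>y. n \<bullet> cross3 a y)"
 have n0: "n ~= 0"
 proof
  assume "n = 0"
  then obtain r where r: "b = r *\<^sub>R a" by (metis aM M(1) collinear_lemma n_def cross_eq_0)
  show False
  proof (cases "0 < r")
   case True
   thus False using inj_onD M(2) aM ab(2) by (fastforce simp: r sgn_scaleR)
  next
   case False
   hence "(1 / (1 - r)) * (r - 1) = - 1" by (simp add: field_simps)
   hence "a + (1 / (1 - r)) *\<^sub>R (b - a) = 0" unfolding r by (metis add.right_inverse scaleR_left_diff_distrib scaleR_minus1_left scaleR_one scaleR_scaleR)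
   thus False using seg[of "1 / (1 - r)" a b] False eM[of 0] M(1) by (simp add: ab(1))
  qed
 qed
 define N where "N = n \<bullet> n"
 have N: "0 < N" using n0 by (simp add: N_def)
 have lin: "\<alpha> (x + s *\<^sub>R y) = \<alpha> x + s * \<alpha> y" "\<beta> (x + s *\<^sub>R y) = \<beta> x + s * \<beta> y" for x y s by (simp_all add: \<alpha>_def \<beta>_def cross3_simps inner_vec_def sum_3)
 have ab0: "\<alpha> a = N" "\<alpha> b = 0" "\<beta> a = 0" "\<beta> b = N" by (simp_all add: \<alpha>_def \<beta>_def N_def n_def)
 have \<alpha>P: "0 < \<alpha> P" "0 < \<beta> P" using lin(1)[of a t "b - a"] lin(1)[of b "-1" a] lin(2)[of a t "b - a"] lin(2)[of b "-1" a] ab0 t N by simp_all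
 have ne: "n \<bullet> z = 0" if z: "z \<in> convex hull e" for z
 proof -
  obtain s where "0 \<le> s" "s \<le> 1" "z = (1 - s) *\<^sub>R a + s *\<^sub>R b" using z unfolding ab(1) segment_convex_hull[symmetric] by (auto simp: closed_segment_def)
  thus ?thesis by (simp add: inner_add_right n_def dot_cross_self)
 qed
 have cone: "\<exists>r>0. \<exists>z\<in>convex hull e. y = r *\<^sub>R z" if y: "n \<bullet> y = 0" "0 < \<alpha> y" "0 < \<beta> y" for y
 proof -
  let ?s = "\<alpha> y + \<beta> y"
  have "N *\<^sub>R y = \<alpha> y *\<^sub>R a + \<beta> y *\<^sub>R b" using cross3_decomp[of a b y] y(1) by (simp add: N_def \<alpha>_def \<beta>_def n_def)
  moreover have "?s *\<^sub>R (a + (\<beta> y / ?s) *\<^sub>R (b - a)) = ?s *\<^sub>R a + \<beta> y *\<^sub>R (b - a)" using y(2,3) by (simp add: scaleR_add_right)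
  ultimately have "N *\<^sub>R y = ?s *\<^sub>R (a + (\<beta> y / ?s) *\<^sub>R (b - a))" by (simp add: algebra_simps)
  hence "inverse N *\<^sub>R (N *\<^sub>R y) = inverse N *\<^sub>R (?s *\<^sub>R (a + (\<beta> y / ?s) *\<^sub>R (b - a)))" by (simp only:)
  hence "y = (inverse N * ?s) *\<^sub>R (a + (\<beta> y / ?s) *\<^sub>R (b - a))" using N by (simp only: scaleR_scaleR) simp
  moreover have "a + (\<beta> y / ?s) *\<^sub>R (b - a) \<in> convex hull e" unfolding ab(1) using y(2,3) by (intro seg) simp_all
  ultimately show ?thesis using y(2,3) N by (intro exI[of _ "inverse N * ?s"] conjI) auto
 qed
 define q where "q = (\<lambda>x. c + x *\<^sub>R (d - c))"
 have qf: "q x \<in> convex hull f" if "x \<in> {0<..<1}" for x using that unfolding q_def cd(1) by (intro seg) simp_all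
 have q0: "q x ~= 0" if "x \<in> {0<..<1}" for x using fM[OF qf[OF that]] M(1) by metis
 have cq: "continuous_on S q" for S unfolding q_def by (intro continuous_intros)
 have qu: "q u = P" by (simp add: q_def u(3))
 define k where "k = n \<bullet> (d - c)"
 have nq: "n \<bullet> q x = (x - u) * k" for x
 proof -
  have "q x = P + (x - u) *\<^sub>R (d - c)" by (simp add: q_def u(3) algebra_simps)
  thus ?thesis using ne[OF P(1)] by (simp add: inner_add_right k_def)
 qed
 let ?U = "{y. 0 < \<alpha> y \<and> 0 < \<beta> y}"
 have oU: "open ?U" unfolding \<alpha>_def \<beta>_def by (intro open_Collect_conj open_Collect_less continuous_intros continuous_on_cross)
 have pick: "\<exists>\<epsilon>>0. ball u \<epsilon> \<subseteq> {0<..<1} \<and> (\<forall>x\<in>ball u \<epsilon>. h (q x) \<in> W)"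
  if W: "openin (top_of_set S) W" "h P \<in> W" and h: "continuous_on (q ` {0<..<1}) h" "h ` q ` {0<..<1} \<subseteq> S" for h and S W :: "(real^3) set"
 proof -
  have c: "continuous_on {0<..<1} (\<lambda>x. h (q x))" by (rule continuous_on_compose2[OF h(1) cq]) simp
  moreover have "(\<lambda>x. h (q x)) \<in> {0<..<1} \<rightarrow> S" using h(2) by auto
  ultimately have "open ({0<..<1} \<inter> (\<lambda>x. h (q x)) -` W)" using W(1) by (simp add: continuous_on_open_gen openin_open_eq)
  moreover have "u \<in> {0<..<1} \<inter> (\<lambda>x. h (q x)) -` W" using u W(2) by (simp add: qu)
  ultimately obtain \<epsilon> where "0 < \<epsilon>" "ball u \<epsilon> \<subseteq> {0<..<1} \<inter> (\<lambda>x. h (q x)) -` W" by (metis open_contains_ball)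
  thus ?thesis by (intro exI[of _ \<epsilon>]) auto
 qed
 have near: "u + \<epsilon> / 2 \<in> ball u \<epsilon>" "u - \<epsilon> / 2 \<in> ball u \<epsilon>" if "0 < \<epsilon>" for \<epsilon> using that by (simp_all add: dist_real_def)
 \<comment> \<open>If \<open>f\<close> ran in the plane of \<open>e\<close>, a second point of
   \<open>f\<close> near \<open>P\<close> would lie in the cone over \<open>e\<close>, hence on
   \<open>e\<close> since rays meet \<open>M\<close> only once, against
   \<open>geo_meet\<close>.\<close>
 have k: "k ~= 0"
 proof
  assume k0: "k = 0"
  obtain \<epsilon> where \<epsilon>: "0 < \<epsilon>" "ball u \<epsilon> \<subseteq> {0<..<1}" "\<forall>x\<in>ball u \<epsilon>. q x \<in> ?U" using pick[of UNIV ?U "\<lambda>y. y"] oU \<alpha>P by auto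
  let ?x = "u + \<epsilon> / 2"
  have qx: "q ?x \<in> convex hull f" "q ?x \<in> ?U" using near(1)[OF \<epsilon>(1)] \<epsilon> qf by blast+
  obtain r z where z: "0 < r" "z \<in> convex hull e" "q ?x = r *\<^sub>R z" using cone[of "q ?x"] nq k0 qx(2) by auto
  have "sgn (q ?x) = sgn z" using z(1) by (simp add: z(3) sgn_scaleR)
  hence "q ?x = z" by (rule inj_onD[OF M(2) _ fM[OF qx(1)] eM[OF z(2)]])
  moreover have "e ~= f" using disj ab(1) by auto
  ultimately have "q ?x = P" using geo_meet[OF g ef(1,2), of "q ?x" P] z(2) qx(1) P by simp
  thus False using qu \<epsilon>(1) cd(2) by (auto simp: q_def)
 qed
 have sgP: "0 < \<alpha> (sgn y) \<longleftrightarrow> 0 < \<alpha> y" "0 < \<beta> (sgn y) \<longleftrightarrow> 0 < \<beta> y" if "y ~= 0" for y using lin(1)[of 0 "inverse (norm y)" y] lin(2)[of 0 "inverse (norm y)" y] that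
  by (simp_all add: sgn_div_norm \<alpha>_def \<beta>_def zero_less_mult_iff)
 have P0: "P ~= 0" using eM[OF P(1)] M(1) by metis
 show ?thesis
 proof (rule cross_atI[where D = "S2 \<inter> ?U" and g = "\<lambda>y. n \<bullet> y"])
  show "openin (top_of_set S2) (S2 \<inter> ?U)" by (rule openin_open_Int[OF oU])
  show "sgn P \<in> S2 \<inter> ?U" using P0 \<alpha>P sgP[OF P0] by (simp add: norm_sgn)
  show "continuous_on (S2 \<inter> ?U) (\<lambda>y. n \<bullet> y)" by (intro continuous_intros)
  fix y assume y: "y \<in> S2 \<inter> ?U"
  show "n \<bullet> y = 0 \<longleftrightarrow> y \<in> sgn ` (convex hull e)"
  proof
   assume "n \<bullet> y = 0"
   then obtain r z where z: "0 < r" "z \<in> convex hull e" "y = r *\<^sub>R z" using cone[of y] y by auto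
   have "sgn y = sgn z" using z(1) by (simp add: z(3) sgn_scaleR)
   moreover have "sgn y = y" using y by (simp add: sgn_div_norm)
   ultimately show "y \<in> sgn ` (convex hull e)" using z(2) by (metis imageI)
  next
   assume "y \<in> sgn ` (convex hull e)"
   thus "n \<bullet> y = 0" using ne by (auto simp: sgn_div_norm)
  qed
 next
  fix D' assume D': "openin (top_of_set S2) D'" "sgn P \<in> D'"
  have "continuous_on (q ` {0<..<1}) sgn" using q0 by (intro continuous_on_sgn continuous_on_id) auto
  moreover have "sgn ` q ` {0<..<1} \<subseteq> S2" using q0 by (auto simp: norm_sgn)
  ultimately obtain \<epsilon> where \<epsilon>: "0 < \<epsilon>" "ball u \<epsilon> \<subseteq> {0<..<1}" "\<forall>x\<in>ball u \<epsilon>. sgn (q x) \<in> D'" using pick[of S2 D' sgn, OF D'] by blast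
  have q: "sgn (q x) \<in> D' \<inter> sgn ` (convex hull f)" if "x \<in> ball u \<epsilon>" for x using that \<epsilon>(2,3) qf by blast
  have v: "n \<bullet> sgn (q x) = (x - u) * k / norm (q x)" for x by (simp add: sgn_div_norm nq divide_inverse)
  note nr = near[OF \<epsilon>(1)]
  note pos = q0[OF subsetD[OF \<epsilon>(2) nr(1)]] q0[OF subsetD[OF \<epsilon>(2) nr(2)]]
  show "\<exists>x\<in>D' \<inter> sgn ` (convex hull f). \<exists>y\<in>D' \<inter> sgn ` (convex hull f). n \<bullet> x < 0 \<and> 0 < n \<bullet> y"
  proof (cases "0 < k")
   case True
   show ?thesis by (rule bexI[OF bexI[OF _ q[OF nr(1)]] q[OF nr(2)]]) (use True \<epsilon>(1) pos in \<open>simp_all add: v divide_neg_pos mult_neg_pos\<close>)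
  next
   case False
   hence "k < 0" using k by simp
   thus ?thesis by (intro bexI[OF bexI[OF _ q[OF nr(2)]] q[OF nr(1)]]) (use \<epsilon>(1) pos in \<open>simp_all add: v divide_neg_pos mult_pos_neg mult_neg_neg\<close>)
  qed
 qed
qed

theorem sgn_one_planar:
 fixes V :: "(real^3) set" assumes g: "geo V E" and M: "\<And>e. e \<in> E ==> convex hull e \<subseteq> M" "V \<subseteq> M" "0 \<notin> M" "inj_on sgn M"
 shows "\<exists>G :: nat sgraph. one_planar G \<and> card (verts G) = card V \<and> card (tri E) \<le> num_subgraphs_iso (complete_graph 3) G"
proof (rule geo_one_planar[OF g M(1,2)])
 show "continuous_on M sgn" using M(3) by (intro continuous_on_sgn continuous_on_id) auto
 show "sgn ` M \<subseteq> S2" using M(3) by (auto simp: norm_sgn)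
qed (assumption, rule M(4), rule sgn_cross_at[OF g M(3,4,1)])

section \<open>Extremal examples\<close>

lemma cr_hull:
 assumes "v \<in> convex hull {a, b}" shows "cr (b - a) (v - a) = 0" "cr u (v - w) \<in> closed_segment (cr u (a - w)) (cr u (b - w))"
proof -
 obtain x where x: "0 \<le> x" "x \<le> 1" "v = (1 - x) *\<^sub>R a + x *\<^sub>R b" using assms by (auto simp: segment_convex_hull[symmetric] closed_segment_def)
 have "v - a = x *\<^sub>R (b - a)" using x(3) by (simp add: algebra_simps)
 thus "cr (b - a) (v - a) = 0" by (simp add: cr_simps)
 have "v - w = (1 - x) *\<^sub>R (a - w) + x *\<^sub>R (b - w)" using x(3) by (simp add: algebra_simps)
 hence "cr u (v - w) = (1 - x) * cr u (a - w) + x * cr u (b - w)" by (simp only: cr_simps)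
 thus "cr u (v - w) \<in> closed_segment (cr u (a - w)) (cr u (b - w))" using x unfolding closed_segment_def by (intro CollectI exI[of _ x]) simp
qed

lemma no_cross:
 assumes "0 < cr (b - a) (c - a) * cr (b - a) (d - a)" shows "convex hull {a, b} \<inter> convex hull {c, d} = {}"
proof (rule ccontr)
 assume "\<not> ?thesis"
 then obtain z where z: "z \<in> convex hull {a, b}" "z \<in> convex hull {c, d}" by blast
 have "0 \<in> closed_segment (cr (b - a) (c - a)) (cr (b - a) (d - a))" using cr_hull(1)[OF z(1)] cr_hull(2)[OF z(2), of "b - a" a] by simp
 thus False using assms by (auto simp: closed_segment_eq_real_ivl zero_less_mult_iff split: if_splits)
qed

definition seg_of :: "('p => 'b) => 'p \<times> 'p => 'b set" where "seg_of w e = {w (fst e), w (snd e)}"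

text \<open>Prepares verification by computation: \<open>mt\<close> is any decidable test that holds
  at least whenever two edges cross, and at most one edge may pass it for each edge.\<close>

lemma geo_list:
 fixes w :: "'p => 'b::real_vector" assumes "inj w" and end_in: "\<And>x. x \<in> set es ==> fst x \<in> set ps \<and> snd x \<in> set ps \<and> fst x ~= snd x"
  and vx: "\<And>x v. x \<in> set es ==> v \<in> set ps ==> w v \<in> convex hull (seg_of w x) ==> v = fst x \<or> v = snd x"
  and mt: "\<And>x y. x \<in> set es ==> y \<in> set es ==> crosses (seg_of w x) (seg_of w y) ==> mt x y" and one: "\<And>x. x \<in> set es ==> length (filter (mt x) es) \<le> 1"
 shows "geo (w ` set ps) (seg_of w ` set es)"
 unfolding geo_def
proof (intro conjI ballI impI)
 fix e assume "e \<in> seg_of w ` set es"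
 then obtain x where x: "x \<in> set es" "e = seg_of w x" by blast
 show "e \<subseteq> w ` set ps" using end_in[OF x(1)] by (simp add: x(2) seg_of_def)
 show "card e = 2" using end_in[OF x(1)] assms(1) by (simp add: x(2) seg_of_def inj_eq)
 show "v \<in> e" if "v \<in> w ` set ps" "v \<in> convex hull e" for v using that vx[OF x(1)] by (auto simp: x(2) seg_of_def)
 fix f g assume "f \<in> seg_of w ` set es" "g \<in> seg_of w ` set es" and c: "crosses e f" "crosses e g"
 then obtain y z where y: "y \<in> set es" "f = seg_of w y" and z: "z \<in> set es" "g = seg_of w z" by blast
 have "y \<in> set (filter (mt x) es)" "z \<in> set (filter (mt x) es)" using mt c x y z by simp_all
 hence "y = z" using one[OF x(1)] by (cases "filter (mt x) es") (auto simp: length_Suc_conv)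
 thus "f = g" using y z by simp
qed simp

section \<open>Executable checks for integer coordinates\<close>

definition pt :: "int \<times> int => complex" where "pt p = Complex (of_int (fst p)) (of_int (snd p))"

text \<open>Twice the signed area of the triangle \<open>p\<close>, \<open>q\<close>,
  \<open>r\<close>.\<close>

definition orient :: "int \<times> int => int \<times> int => int \<times> int => int" where
 "orient p q r = (fst q - fst p) * (snd r - snd p) - (snd q - snd p) * (fst r - fst p)"

text \<open>A sufficient condition for disjointness: one segment lies strictly on one side of the
  line through the other.\<close>

definition apart :: "(int \<times> int) \<times> (int \<times> int) => (int \<times> int) \<times> (int \<times> int) => bool" where
 "apart e f \<longleftrightarrow> 0 < orient (fst e) (snd e) (fst f) * orient (fst e) (snd e) (snd f) \<or>
   0 < orient (fst f) (snd f) (fst e) * orient (fst f) (snd f) (snd e)"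

definition meets :: "(int \<times> int) \<times> (int \<times> int) => (int \<times> int) \<times> (int \<times> int) => bool" where
 "meets e f \<longleftrightarrow> fst e ~= fst f \<and> fst e ~= snd f \<and> snd e ~= fst f \<and> snd e ~= snd f \<and> \<not> apart e f"

definition ckgeo :: "(int \<times> int) list => ((int \<times> int) \<times> (int \<times> int)) list => bool" where
 "ckgeo ps es \<longleftrightarrow>
   list_all (\<lambda>e. fst e \<in> set ps \<and> snd e \<in> set ps \<and> fst e ~= snd e \<and>
    list_all (\<lambda>v. v = fst e \<or> v = snd e \<or> orient (fst e) (snd e) v ~= 0) ps \<and>
    length (filter (meets e) es) \<le> 1) es"

abbreviation pedge :: "(int \<times> int) \<times> (int \<times> int) => complex set" where "pedge == seg_of pt"

lemma pt_eq [simp]: "pt p = pt q \<longleftrightarrow> p = q" by (simp add: pt_def prod_eq_iff)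

lemma cr_pt: "cr (pt q - pt p) (pt r - pt p) = of_int (orient p q r)" by (simp add: cr_def pt_def orient_def)

lemma geo_check:
 assumes "ckgeo ps es" shows "geo (pt ` set ps) (pedge ` set es)"
proof (rule geo_list[where mt = meets])
 have ck: "fst e \<in> set ps \<and> snd e \<in> set ps \<and> fst e ~= snd e" "length (filter (meets e) es) \<le> 1"
  "\<And>v. v \<in> set ps ==> v = fst e \<or> v = snd e \<or> orient (fst e) (snd e) v ~= 0" if "e \<in> set es" for e using assms that by (auto simp: ckgeo_def list_all_iff)
 show "inj pt" by (simp add: inj_def)
 fix x assume x: "x \<in> set es"
 show "fst x \<in> set ps \<and> snd x \<in> set ps \<and> fst x ~= snd x" "length (filter (meets x) es) \<le> 1" by (rule ck[OF x])+
 show "v = fst x \<or> v = snd x" if v: "v \<in> set ps" "pt v \<in> convex hull (pedge x)" for v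
 proof -
  have "orient (fst x) (snd x) v = 0" using cr_hull(1)[OF v(2)[unfolded seg_of_def]] by (simp add: cr_pt)
  thus ?thesis using ck(3)[OF x v(1)] by simp
 qed
 show "meets x y" if xy: "crosses (pedge x) (pedge y)" for y
 proof -
  have "convex hull (pedge x) \<inter> convex hull (pedge y) ~= {}" using xy by (simp add: crosses_def)
  hence "\<not> apart x y" using no_cross[of "pt (snd x)" "pt (fst x)" "pt (fst y)" "pt (snd y)"]
    no_cross[of "pt (snd y)" "pt (fst y)" "pt (fst x)" "pt (snd x)"] by (auto simp: apart_def seg_of_def cr_pt Int_commute simp flip: of_int_mult)
  moreover have "pedge x \<inter> pedge y = {}" using xy by (simp add: crosses_def)
  ultimately show ?thesis by (auto simp: meets_def seg_of_def)
 qed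
qed

text \<open>Triples are taken in the order of \<open>ps\<close>, so an edge is recognised only in
  this orientation, which is the one that \<open>pairs\<close> produces.\<close>

definition tlist :: "'p list => ('p \<times> 'p) list => 'p list list" where
 "tlist ps es = filter (\<lambda>t. list_all (\<lambda>e. e \<in> set es) [(t ! 0, t ! 1), (t ! 0, t ! 2), (t ! 1, t ! 2)])
   (filter (\<lambda>t. length t = 3) (subseqs ps))"

lemma geo_fgraph: "geo V E ==> fgraph V E" by (rule fgraph.intro) (simp_all add: geo_def)

lemma card_tri_list:
 assumes "distinct ps" "inj w" "geo V (seg_of w ` set es)" shows "length (tlist ps es) \<le> card (tri (seg_of w ` set es))"
proof -
 let ?S = "set ` set (tlist ps es)"
 have sub: "set (tlist ps es) \<subseteq> set (subseqs ps)" by (auto simp: tlist_def)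
 have d: "distinct (tlist ps es)" "inj_on set (set (tlist ps es))" using distinct_set_subseqs assms(1) inj_on_subset by (fastforce simp: distinct_map tlist_def)+
 have t: "card t = 3 \<and> (\<forall>x\<in>t. \<forall>y\<in>t. x ~= y --> {w x, w y} \<in> seg_of w ` set es)" if tS: "t \<in> ?S" for t
 proof -
  obtain l where l: "l \<in> set (tlist ps es)" "t = set l" using tS by blast
  hence 3: "length l = 3" and m: "l \<in> set (subseqs ps)" by (auto simp: tlist_def)
  have "distinct l" using m assms(1) by (metis subseqs_distinctD)
  hence c: "card t = 3" using 3 l(2) by (simp add: distinct_card)
  obtain a b d where abd: "l = [a, b, d]" using 3 by (auto simp: numeral_3_eq_3 length_Suc_conv)
  have "(a, b) \<in> set es" "(a, d) \<in> set es" "(b, d) \<in> set es" using l(1) by (auto simp: tlist_def abd)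
  hence "seg_of w (a, b) \<in> seg_of w ` set es" "seg_of w (a, d) \<in> seg_of w ` set es" "seg_of w (b, d) \<in> seg_of w ` set es" by blast+
  thus ?thesis using c by (auto simp: l(2) abd seg_of_def insert_commute)
 qed
 interpret F: fgraph V "seg_of w ` set es" by (rule geo_fgraph[OF assms(3)])
 have "(`) w ` ?S \<subseteq> tri (seg_of w ` set es)"
 proof
  fix T assume "T \<in> (`) w ` ?S"
  then obtain t where t': "t \<in> ?S" "T = w ` t" by blast
  have "card T = card t" unfolding t'(2) by (rule card_image) (rule inj_on_subset[OF assms(2) subset_UNIV])
  thus "T \<in> tri (seg_of w ` set es)" using t[OF t'(1)] t'(2) by (auto simp: tri_def)
 qed
 hence "card ((`) w ` ?S) \<le> card (tri (seg_of w ` set es))" by (intro card_mono F.fin_tri)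
 moreover have "card ((`) w ` ?S) = card ?S" by (rule card_image, rule inj_onI) (simp add: inj_image_eq_iff[OF assms(2)])
 moreover have "card ?S = length (tlist ps es)" using d by (simp add: card_image distinct_card)
 ultimately show ?thesis by simp
qed

lemma card_tri_check: "distinct ps ==> ckgeo ps es ==> length (tlist ps es) \<le> card (tri (pedge ` set es))"
 by (rule card_tri_list[OF _ _ geo_check]) (auto simp: inj_def)

fun pairs :: "'x list => ('x \<times> 'x) list" where
 "pairs [] = []"
| "pairs (x # l) = map (Pair x) l @ pairs l"

section \<open>Building blocks around a fixed triangle and their gluing\<close>

definition std_corners :: "(int \<times> int) list" where "std_corners = [(-2,-2), (4,-2), (-2,4)]"
text \<open>Four points inside the triangle; \<open>outer_pts\<close> has four outside. In both
  cases two disjoint pairs are omitted from the complete graph on seven vertices, which leaves 35 -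
  10 = 25 triangles, the optimum for seven vertices.\<close>

definition inner_pts :: "(int \<times> int) list" where "inner_pts = std_corners @ [(2,-1), (-1,-1), (0,1), (-1,0)]"
definition outer_pts :: "(int \<times> int) list" where "outer_pts = std_corners @ [(10,-5), (-3,9), (13,-7), (-6,16)]"
text \<open>The triangle together with its double. All pairs are joined, so this is the complete
  graph on six vertices with 20 triangles.\<close>

definition ring_pts :: "(int \<times> int) list" where "ring_pts = std_corners @ [(-4,-4), (8,-4), (-4,8)]"

definition inner_edges :: "((int \<times> int) \<times> (int \<times> int)) list" where
 "inner_edges = filter (\<lambda>e. e ~= ((-2,-2), (0,1)) \<and> e ~= ((4,-2), (-1,0))) (pairs inner_pts)"
definition outer_edges :: "((int \<times> int) \<times> (int \<times> int)) list" where
 "outer_edges = filter (\<lambda>e. e ~= ((4,-2), (-6,16)) \<and> e ~= ((-2,4), (13,-7))) (pairs outer_pts)"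

lemma piece_checks:
 "ckgeo std_corners (pairs std_corners) \<and> length (tlist std_corners (pairs std_corners)) = 1"
 "ckgeo inner_pts inner_edges \<and> length (tlist inner_pts inner_edges) = 25"
 "ckgeo outer_pts outer_edges \<and> length (tlist outer_pts outer_edges) = 25"
 "ckgeo ring_pts (pairs ring_pts) \<and> length (tlist ring_pts (pairs ring_pts)) = 20" by code_simp+

definition hh :: "nat => complex => real" where
 "hh i z = (if i = 0 then - Re z else if i = 1 then - Im z else Re z + Im z)"

definition ih :: "nat => int \<times> int => int" where
 "ih i p = (if i = 0 then - fst p else if i = 1 then - snd p else fst p + snd p)"

lemma hh_pt: "hh i (pt p) = of_int (ih i p)" by (simp add: hh_def ih_def pt_def)

definition D0 :: "complex set" where "D0 = pt ` set std_corners"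

text \<open>The triangle with corners \<open>D0\<close> is the set where all three functionals \<open>hh i\<close> are at most 2.\<close>

definition std :: "complex set => complex set set => bool" where
 "std V E \<longleftrightarrow> geo V E \<and> D0 \<subseteq> V \<and> D0 \<in> tri E \<and> (\<forall>z\<in>V - D0. \<forall>i. hh i z < 2)"

text \<open>On an edge that is not a side of the triangle, some functional exceeds 2 except possibly
  at one end, a corner. So the edge meets the closed triangle in at most that corner.\<close>

definition annular :: "complex set => complex set set => bool" where
 "annular V E \<longleftrightarrow> geo V E \<and> D0 \<subseteq> V \<and> (\<forall>z\<in>V - D0. \<exists>i. 2 < hh i z) \<and>
   (\<forall>e\<in>E. e \<subseteq> D0 \<or> (\<exists>i p q. e = {p, q} \<and> 2 < hh i q \<and> (2 < hh i p \<or> p \<in> D0 \<and> hh i p = 2)))"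

definition ckann :: "(int \<times> int) list => ((int \<times> int) \<times> (int \<times> int)) list => bool" where
 "ckann ps es \<longleftrightarrow> ckgeo ps es \<and>
   list_all (\<lambda>p. p \<in> set std_corners \<or> list_ex (\<lambda>i. 2 < ih i p) [0, 1, 2]) ps \<and>
   list_all (\<lambda>e. fst e \<in> set std_corners \<and> snd e \<in> set std_corners \<or>
    list_ex (\<lambda>i. 2 < ih i (snd e) \<and> (2 < ih i (fst e) \<or> fst e \<in> set std_corners \<and> ih i (fst e) = 2)) [0, 1, 2]) es"

lemma annular_checks: "ckann outer_pts outer_edges" "ckann ring_pts (pairs ring_pts)" by code_simp+

lemma hh_2: "2 < hh i (pt p) \<longleftrightarrow> 2 < ih i p" "hh i (pt p) = 2 \<longleftrightarrow> ih i p = 2" "hh i (pt p) < 2 \<longleftrightarrow> ih i p < 2"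
 unfolding hh_pt by linarith+

lemma annular_check:
 assumes "ckann ps es" "set std_corners \<subseteq> set ps" shows "annular (pt ` set ps) (pedge ` set es)"
 unfolding annular_def
proof (intro conjI ballI)
 show "geo (pt ` set ps) (pedge ` set es)" using assms(1) by (intro geo_check) (simp add: ckann_def)
 show "D0 \<subseteq> pt ` set ps" unfolding D0_def using assms(2) by (rule image_mono)
 fix z assume z: "z \<in> pt ` set ps - D0"
 then obtain p where p: "p \<in> set ps" "z = pt p" "p \<notin> set std_corners" by (auto simp: D0_def)
 hence "list_ex (\<lambda>i. 2 < ih i p) [0, 1, 2]" using assms(1) by (auto simp: ckann_def list_all_iff)
 thus "\<exists>i. 2 < hh i z" unfolding p(2) hh_2 by auto
next
 fix e assume "e \<in> pedge ` set es"
 then obtain x where x: "x \<in> set es" "e = pedge x" by blast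
 have "fst x \<in> set std_corners \<and> snd x \<in> set std_corners \<or>
    list_ex (\<lambda>i. 2 < ih i (snd x) \<and> (2 < ih i (fst x) \<or> fst x \<in> set std_corners \<and> ih i (fst x) = 2)) [0, 1, 2]"
  using assms(1) x(1) by (simp add: ckann_def list_all_iff)
 thus "e \<subseteq> D0 \<or> (\<exists>i p q. e = {p, q} \<and> 2 < hh i q \<and> (2 < hh i p \<or> p \<in> D0 \<and> hh i p = 2))"
 proof
  assume "fst x \<in> set std_corners \<and> snd x \<in> set std_corners"
  thus ?thesis by (simp add: x(2) seg_of_def D0_def)
 next
  assume "list_ex (\<lambda>i. 2 < ih i (snd x) \<and> (2 < ih i (fst x) \<or> fst x \<in> set std_corners \<and> ih i (fst x) = 2)) [0, 1, 2]"
  then obtain i where "2 < ih i (snd x) \<and> (2 < ih i (fst x) \<or> fst x \<in> set std_corners \<and> ih i (fst x) = 2)" unfolding list_ex_iff by blast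
  hence "2 < hh i (pt (snd x)) \<and> (2 < hh i (pt (fst x)) \<or> pt (fst x) \<in> D0 \<and> hh i (pt (fst x)) = 2)" unfolding hh_2 D0_def by blast
  thus ?thesis unfolding x(2) seg_of_def by blast
 qed
qed

lemma std_check:
 assumes "ckgeo ps es" "set std_corners \<subseteq> set ps" "set (pairs std_corners) \<subseteq> set es"
  "list_all (\<lambda>p. p \<in> set std_corners \<or> list_all (\<lambda>i. ih i p < 2) [0, 1, 2]) ps"
 shows "std (pt ` set ps) (pedge ` set es)"
 unfolding std_def
proof (intro conjI ballI allI)
 show "geo (pt ` set ps) (pedge ` set es)" by (rule geo_check[OF assms(1)])
 show "D0 \<subseteq> pt ` set ps" unfolding D0_def using assms(2) by (rule image_mono)
 have "pedge x \<in> pedge ` set es" if "x \<in> set (pairs std_corners)" for x using that assms(3) by blast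
 hence "pedge ((-2,-2), (4,-2)) \<in> pedge ` set es" "pedge ((-2,-2), (-2,4)) \<in> pedge ` set es" "pedge ((4,-2), (-2,4)) \<in> pedge ` set es"
  by (simp_all add: std_corners_def)
 moreover have "card D0 = 3" unfolding D0_def by (simp add: std_corners_def)
 ultimately show "D0 \<in> tri (pedge ` set es)" by (auto simp: tri_def D0_def std_corners_def seg_of_def insert_commute)
 fix z i assume z: "z \<in> pt ` set ps - D0"
 then obtain p where p: "p \<in> set ps" "z = pt p" "p \<notin> set std_corners" by (auto simp: D0_def)
 hence "list_all (\<lambda>i. ih i p < 2) [0, 1, 2]" using assms(4) by (auto simp: list_all_iff)
 hence "ih i p < 2" by (auto simp: ih_def)
 thus "hh i z < 2" unfolding p(2) hh_2 .
qed

lemma hh_convex: "hh i ((1 - x) *\<^sub>R a + x *\<^sub>R b) = (1 - x) * hh i a + x * hh i b" by (simp add: hh_def algebra_simps)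

lemma hull_pair: "z \<in> convex hull {a, b} ==> \<exists>x. 0 \<le> x \<and> x \<le> 1 \<and> z = (1 - x) *\<^sub>R a + x *\<^sub>R b" by (auto simp: segment_convex_hull[symmetric] closed_segment_def)

lemma D0_le: "z \<in> D0 ==> hh i z \<le> 2" by (auto simp: D0_def std_corners_def hh_def pt_def)

lemma D0_side:
 assumes "a \<in> D0" "b \<in> D0" "a ~= b" shows "\<exists>i. hh i a = 2 \<and> hh i b = 2"
proof -
 have "hh 0 a = 2 \<and> hh 0 b = 2 \<or> hh 1 a = 2 \<and> hh 1 b = 2 \<or> hh 2 a = 2 \<and> hh 2 b = 2" using assms by (auto simp: D0_def std_corners_def hh_def pt_def)
 thus ?thesis by blast
qed

text \<open>Edges of \<open>E1\<close> stay in the closed triangle, while edges of \<open>E2\<close>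
  other than its sides meet it in corners only. Hence no edge of one graph crosses an edge of the
  other, and at most the triangle \<open>D0\<close> is counted twice.\<close>

lemma glue:
 assumes S: "std V1 E1" and A: "annular V2 E2" shows "geo (V1 \<union> V2) (E1 \<union> E2)" "card (V1 \<union> V2) + 3 = card V1 + card V2"
  "card (tri E1) + card (tri E2) \<le> card (tri (E1 \<union> E2)) + 1"
proof -
 have g1: "geo V1 E1" and D1: "D0 \<subseteq> V1" and i1: "\<And>z i. z \<in> V1 ==> z \<notin> D0 ==> hh i z < 2" using S by (auto simp: std_def)
 have g2: "geo V2 E2" and D2: "D0 \<subseteq> V2" and o2: "\<And>z. z \<in> V2 ==> z \<notin> D0 ==> \<exists>i. 2 < hh i z"
  and e2: "\<And>e. e \<in> E2 ==> e \<subseteq> D0 \<or> (\<exists>i p q. e = {p, q} \<and> 2 < hh i q \<and> (2 < hh i p \<or> p \<in> D0 \<and> hh i p = 2))" using A by (auto simp: annular_def)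
 have fin: "finite V1" "finite V2" using g1 g2 by (simp_all add: geo_def)
 have ed1: "e \<subseteq> V1 \<and> card e = 2" if "e \<in> E1" for e using g1 that by (simp add: geo_def)
 have ed2: "e \<subseteq> V2 \<and> card e = 2" if "e \<in> E2" for e using g2 that by (simp add: geo_def)
 have nv1: "v \<in> e" if "e \<in> E1" "v \<in> V1" "v \<in> convex hull e" for e v using g1 that unfolding geo_def by (elim conjE) simp
 have nv2: "v \<in> e" if "e \<in> E2" "v \<in> V2" "v \<in> convex hull e" for e v using g2 that unfolding geo_def by (elim conjE) simp
 have le1: "hh i z \<le> 2" if "z \<in> V1" for i z using i1[OF that, of i] D0_le[of z i] by fastforce
 have T1: "hh i z \<le> 2" if e: "e \<in> E1" and z: "z \<in> convex hull e" for i z e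
 proof -
  obtain a b where ab: "e = {a, b}" using ed1[OF e] by (auto simp: card_2_iff)
  obtain x where x: "0 \<le> x" "x \<le> 1" "z = (1 - x) *\<^sub>R a + x *\<^sub>R b" using hull_pair z unfolding ab by blast
  have "hh i a \<le> 2" "hh i b \<le> 2" using ed1[OF e] ab le1 by simp_all
  hence "(1 - x) * hh i a \<le> (1 - x) * 2" "x * hh i b \<le> x * 2" using x by (intro mult_left_mono; simp)+
  thus ?thesis unfolding x(3) hh_convex by (simp add: algebra_simps)
 qed
 have T2: "z \<in> e \<and> z \<in> D0" if e: "e \<in> E2" "\<not> e \<subseteq> D0" and z: "z \<in> convex hull e" "\<And>i. hh i z \<le> 2" for e z
 proof -
  obtain i p q where pq: "e = {p, q}" "2 < hh i q" "2 < hh i p \<or> p \<in> D0 \<and> hh i p = 2" using e2[OF e(1)] e(2) by blast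
  obtain x where x: "0 \<le> x" "x \<le> 1" "z = (1 - x) *\<^sub>R p + x *\<^sub>R q" using hull_pair z(1) unfolding pq(1) by blast
  have h: "hh i z = (1 - x) * hh i p + x * hh i q" unfolding x(3) by (rule hh_convex)
  have hp: "2 \<le> hh i p" using pq(3) by auto
  have x0: "x = 0"
  proof (rule ccontr)
   assume "x ~= 0"
   hence "x * 2 < x * hh i q" using x(1) pq(2) by simp
   moreover have "(1 - x) * 2 \<le> (1 - x) * hh i p" using x(2) hp by (intro mult_left_mono) simp_all
   ultimately have "2 < hh i z" unfolding h by (simp add: algebra_simps)
   thus False using z(2)[of i] by simp
  qed
  hence "z = p" using x(3) by simp
  thus ?thesis using pq(1,3) z(2)[of i] by auto
 qed
 have T3: "z \<in> D0" if z: "z \<in> V1" "hh i z = 2" for z i using i1[OF z(1), of i] z(2) by fastforce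
 have side: "\<exists>i. \<forall>z\<in>convex hull f. hh i z = 2" if f: "f \<subseteq> D0" "card f = 2" for f
 proof -
  obtain a b where ab: "f = {a, b}" "a ~= b" using f(2) by (auto simp: card_2_iff)
  obtain i where i: "hh i a = 2" "hh i b = 2" using D0_side[of a b] ab f(1) by auto
  have "hh i z = 2" if z: "z \<in> convex hull f" for z
  proof -
   obtain x where x: "z = (1 - x) *\<^sub>R a + x *\<^sub>R b" using hull_pair z unfolding ab by blast
   show ?thesis unfolding x hh_convex i by (simp add: algebra_simps)
  qed
  thus ?thesis by blast
 qed
 have T4: "z \<in> D0" if e: "e \<in> E1" "\<not> e \<subseteq> D0" and z: "z \<in> convex hull e" "hh i z = 2" for e z i
 proof -
  obtain p where p: "p \<in> e" "p \<notin> D0" using e(2) by blast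
  have "card (e - {p}) = 1" using ed1[OF e(1)] p(1) by (simp add: card_Diff_singleton)
  then obtain q where "e - {p} = {q}" by (rule card_1_singletonE)
  hence eq: "e = {p, q}" using p(1) by blast
  have V: "p \<in> V1" "q \<in> V1" using ed1[OF e(1)] eq by simp_all
  obtain x where x: "0 \<le> x" "x \<le> 1" "z = (1 - x) *\<^sub>R p + x *\<^sub>R q" using hull_pair z(1) unfolding eq by blast
  have h: "hh i z = (1 - x) * hh i p + x * hh i q" unfolding x(3) by (rule hh_convex)
  have x1: "x = 1"
  proof (rule ccontr)
   assume "x ~= 1"
   hence "0 < 1 - x" using x(2) by simp
   hence "(1 - x) * hh i p < (1 - x) * 2" by (rule mult_strict_left_mono[OF i1[OF V(1) p(2)]])
   moreover have "x * hh i q \<le> x * 2" using x(1) le1[OF V(2)] by (intro mult_left_mono) simp_all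
   ultimately have "hh i z < 2" unfolding h by (simp add: algebra_simps)
   thus False using z(2) by simp
  qed
  hence "z = q" using x(3) by simp
  thus ?thesis using T3[of q i] V(2) z(2) by simp
 qed
 have V12: "V1 \<inter> V2 = D0"
 proof
  show "V1 \<inter> V2 \<subseteq> D0" using o2 le1 by (metis IntE linorder_not_less subsetI)
 qed (use D1 D2 in blast)
 have no: "\<not> crosses e f" if ef: "e \<in> E1" "f \<in> E2" for e f
 proof
  assume x: "crosses e f"
  then obtain z where z: "z \<in> convex hull e" "z \<in> convex hull f" and disj: "e \<inter> f = {}" by (auto simp: crosses_def)
  have "z \<in> D0 \<or> e \<subseteq> D0 \<and> f \<subseteq> D0"
  proof (cases "f \<subseteq> D0")
   case True
   obtain i where "hh i z = 2" using side[OF True] ed2[OF ef(2)] z(2) by blast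
   thus ?thesis using T4[OF ef(1) _ z(1), of i] True by blast
  next
   case False
   thus ?thesis using T2[OF ef(2) False z(2)] T1[OF ef(1) z(1)] by blast
  qed
  thus False
  proof
   assume "z \<in> D0"
   hence "z \<in> V1" "z \<in> V2" using D1 D2 by blast+
   hence "z \<in> e" "z \<in> f" using nv1[OF ef(1) _ z(1)] nv2[OF ef(2) _ z(2)] by simp_all
   thus False using disj by blast
  next
   assume s: "e \<subseteq> D0 \<and> f \<subseteq> D0"
   \<comment> \<open>Two disjoint sides of the triangle would need four corners.\<close>
   have "card (e \<union> f) = 4" using ed1[OF ef(1)] ed2[OF ef(2)] disj fin finite_subset by (subst card_Un_disjoint) auto
   moreover have "card (e \<union> f) \<le> card D0" using s by (intro card_mono) (auto simp: D0_def)
   moreover have "card D0 \<le> 3" using card_image_le[of "set std_corners" pt] card_length[of std_corners] by (simp add: D0_def std_corners_def)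
   ultimately show False by linarith
  qed
 qed
 show "geo (V1 \<union> V2) (E1 \<union> E2)" unfolding geo_def
 proof (intro conjI ballI impI)
  show "finite (V1 \<union> V2)" using fin by simp
  show "e \<subseteq> V1 \<union> V2" if "e \<in> E1 \<union> E2" for e using that ed1 ed2 by blast
  show "card e = 2" if "e \<in> E1 \<union> E2" for e using that ed1 ed2 by blast
  show "v \<in> e" if hyp: "e \<in> E1 \<union> E2" "v \<in> V1 \<union> V2" "v \<in> convex hull e" for e v
  proof (cases "e \<in> E1")
   case True
   have "v \<in> V1"
   proof (rule ccontr)
    assume "v \<notin> V1"
    hence v: "v \<in> V2" "v \<notin> D0" using hyp(2) D1 by blast+
    then obtain i where "2 < hh i v" using o2 by blast
    thus False using T1[OF True hyp(3), of i] by simp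
   qed
   thus ?thesis by (rule nv1[OF True _ hyp(3)])
  next
   case False
   hence e: "e \<in> E2" using hyp(1) by simp
   show ?thesis
   proof (cases "v \<in> V2")
    case True
    thus ?thesis by (rule nv2[OF e _ hyp(3)])
   next
    case v: False
    hence v1: "v \<in> V1" using hyp(2) by simp
    show ?thesis
    proof (cases "e \<subseteq> D0")
     case True
     obtain i where "hh i v = 2" using side[OF True] ed2[OF e] hyp(3) by blast
     hence "v \<in> V2" using T3[OF v1] D2 by blast
     thus ?thesis using v by simp
    next
     case False
     thus ?thesis using T2[OF e False hyp(3) le1[OF v1]] by blast
    qed
   qed
  qed
  show "f = g" if hyp: "e \<in> E1 \<union> E2" "f \<in> E1 \<union> E2" "g \<in> E1 \<union> E2" "crosses e f" "crosses e g" for e f g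
  proof -
   have t1: "\<forall>e\<in>E1. \<forall>f\<in>E1. \<forall>g\<in>E1. crosses e f --> crosses e g --> f = g" using g1 unfolding geo_def by (elim conjE)
   have t2: "\<forall>e\<in>E2. \<forall>f\<in>E2. \<forall>g\<in>E2. crosses e f --> crosses e g --> f = g" using g2 unfolding geo_def by (elim conjE)
   show ?thesis
   proof (cases "e \<in> E1")
    case True
    hence "f \<in> E1" "g \<in> E1" using no[OF True] hyp by blast+
    thus ?thesis using t1 True hyp(4,5) by simp
   next
    case False
    hence e: "e \<in> E2" using hyp(1) by simp
    hence "f \<notin> E1" "g \<notin> E1" using no[of f e] no[of g e] crosses_sym[OF hyp(4)] crosses_sym[OF hyp(5)] by blast+
    thus ?thesis using t2 e hyp by simp
   qed
  qed
 qed
 have cD: "card D0 = 3" by (simp add: D0_def std_corners_def)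
 show "card (V1 \<union> V2) + 3 = card V1 + card V2" using card_Un_Int[OF fin] V12 cD by simp
 interpret F1: fgraph V1 E1 using fin(1) ed1 by unfold_locales
 interpret F2: fgraph V2 E2 using fin(2) ed2 by unfold_locales
 interpret F: fgraph "V1 \<union> V2" "E1 \<union> E2" using fin ed1 ed2 by unfold_locales (simp, blast)
 have "tri E1 \<inter> tri E2 \<subseteq> {D0}"
 proof
  fix T assume T: "T \<in> tri E1 \<inter> tri E2"
  hence "T \<subseteq> V1" "T \<subseteq> V2" "card T = 3" using F1.tri_sub F2.tri_sub by blast+
  hence "T \<subseteq> D0" using V12 by blast
  hence "T = D0" using cD \<open>card T = 3\<close> by (intro card_subset_eq) (auto simp: D0_def)
  thus "T \<in> {D0}" by simp
 qed
 hence "card (tri E1 \<inter> tri E2) \<le> 1" using card_mono[of "{D0}" "tri E1 \<inter> tri E2"] by simp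
 moreover have "tri E1 \<union> tri E2 \<subseteq> tri (E1 \<union> E2)" by (auto simp: tri_def)
 hence "card (tri E1 \<union> tri E2) \<le> card (tri (E1 \<union> E2))" by (intro card_mono F.fin_tri)
 ultimately show "card (tri E1) + card (tri E2) \<le> card (tri (E1 \<union> E2)) + 1" using card_Un_Int[OF F1.fin_tri F2.fin_tri] by linarith
qed

lemma tri_image:
 assumes "inj s" "T \<in> tri E" shows "s ` T \<in> tri ((`) s ` E)"
proof -
 have "card (s ` T) = 3" using assms card_image[OF inj_on_subset[OF assms(1) subset_UNIV], of T] by (simp add: tri_def)
 moreover have "{s x, s y} \<in> (`) s ` E" if "x \<in> T" "y \<in> T" "s x ~= s y" for x y
 proof -
  have "{x, y} \<in> E" using assms(2) that by (auto simp: tri_def)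
  hence "s ` {x, y} \<in> (`) s ` E" by (rule imageI)
  thus ?thesis by simp
 qed
 ultimately show ?thesis by (auto simp: tri_def)
qed

lemma geo_image:
 fixes s :: "'b::real_vector => 'c::real_vector" assumes g: "geo V E" and s: "inj s" and hull: "\<And>e. convex hull (s ` e) = s ` (convex hull e)"
 shows "geo (s ` V) ((`) s ` E)" "card (s ` V) = card V" "card (tri E) \<le> card (tri ((`) s ` E))"
proof -
 have x: "crosses (s ` e) (s ` f) \<longleftrightarrow> crosses e f" for e f unfolding crosses_def hull image_Int[OF s, symmetric] by simp
 have nv: "\<forall>e\<in>E. \<forall>v\<in>V. v \<in> convex hull e --> v \<in> e" and ed: "\<forall>e\<in>E. e \<subseteq> V \<and> card e = 2" and fin: "finite V"
  and th: "\<forall>e\<in>E. \<forall>f\<in>E. \<forall>g\<in>E. crosses e f --> crosses e g --> f = g" using g by (simp_all add: geo_def)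
 show g: "geo (s ` V) ((`) s ` E)" unfolding geo_def
 proof (intro conjI ballI impI)
  show "finite (s ` V)" using fin by simp
  show "e \<subseteq> s ` V" if "e \<in> (`) s ` E" for e using that ed by auto
  show "card e = 2" if "e \<in> (`) s ` E" for e using that ed card_image[OF inj_on_subset[OF s subset_UNIV]] by auto
  show "v \<in> e" if hyp: "e \<in> (`) s ` E" "v \<in> s ` V" "v \<in> convex hull e" for e v
  proof -
   obtain e' v' where e': "e' \<in> E" "e = s ` e'" "v' \<in> V" "v = s v'" using hyp by blast
   have "v' \<in> convex hull e'" using hyp(3) unfolding e'(2,4) hull inj_image_mem_iff[OF s] .
   thus ?thesis using nv e' by simp
  qed
  show "f = g" if hyp: "e \<in> (`) s ` E" "f \<in> (`) s ` E" "g \<in> (`) s ` E" "crosses e f" "crosses e g" for e f g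
  proof -
   obtain e' f' g' where e': "e' \<in> E" "e = s ` e'" "f' \<in> E" "f = s ` f'" "g' \<in> E" "g = s ` g'" using hyp(1-3) by blast
   have "crosses e' f'" "crosses e' g'" using hyp(4,5) unfolding e' x by simp_all
   hence "f' = g'" using th e' by simp
   thus ?thesis using e' by simp
  qed
 qed
 show "card (s ` V) = card V" by (rule card_image[OF inj_on_subset[OF s subset_UNIV]])
 interpret F: fgraph "s ` V" "(`) s ` E" by (rule geo_fgraph[OF g])
 have "inj_on ((`) s) (tri E)" by (rule inj_onI) (simp add: inj_image_eq_iff[OF s])
 thus "card (tri E) \<le> card (tri ((`) s ` E))" using tri_image[OF s] by (intro card_inj_on_le[of "(`) s"] F.fin_tri) blast+
qed

theorem plane_one_planar:
 fixes V :: "complex set" assumes "geo V E" shows "\<exists>G :: nat sgraph. one_planar G \<and> card (verts G) = card V \<and> card (tri E) \<le> num_subgraphs_iso (complete_graph 3) G"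
proof -
 define L :: "complex => real^3" where "L = (\<lambda>z. vector [Re z, Im z, 0])"
 \<comment> \<open>The plane is placed at height 1, so that each ray from the origin meets it at
   most once.\<close>
 define s where "s = (\<lambda>z. axis 3 1 + L z)"
 have L: "linear L" by (simp add: linear_iff L_def vec_eq_iff forall_3)
 have s3: "s z $ 3 = 1" for z by (simp add: s_def L_def axis_def)
 have inj: "inj s" by (rule injI) (simp add: s_def L_def vec_eq_iff forall_3 complex_eq_iff)
 have hull: "convex hull (s ` e) = s ` (convex hull e)" for e
 proof -
  have "s ` X = (+) (axis 3 1) ` L ` X" for X by (simp add: s_def image_image)
  thus ?thesis by (simp only: convex_hull_translation convex_hull_linear_image[OF L])
 qed
 have "\<exists>G :: nat sgraph. one_planar G \<and> card (verts G) = card (s ` V) \<and>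
   card (tri ((`) s ` E)) \<le> num_subgraphs_iso (complete_graph 3) G"
 proof (rule sgn_one_planar[OF geo_image(1)[OF assms inj hull], where M = "{x. x $ 3 = 1}"])
  show "convex hull e \<subseteq> {x. x $ 3 = 1}" if "e \<in> (`) s ` E" for e using that s3 by (auto simp: hull)
  show "s ` V \<subseteq> {x. x $ 3 = 1}" using s3 by auto
  show "inj_on sgn {x :: real^3. x $ 3 = 1}" by (rule inj_on_sgn) simp_all
 qed simp
 thus ?thesis using geo_image(2,3)[OF assms inj hull] by (metis order_trans)
qed

definition std_family :: "nat => nat => bool" where
 "std_family n t \<longleftrightarrow> (\<exists>V E. std V E \<and> card V = n \<and> t \<le> card (tri E))"

text \<open>After attaching the ring, the picture is halved, and the outer triangle becomes
  \<open>D0\<close> again. Of the 20 triangles of the ring one may have been counted before.\<close>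

lemma ring_step:
 assumes "std_family n t" shows "std_family (n + 3) (t + 19)"
proof -
 obtain V1 E1 where S: "std V1 E1" "card V1 = n" "t \<le> card (tri E1)" using assms by (auto simp: std_family_def)
 let ?V2 = "pt ` set ring_pts" and ?E2 = "pedge ` set (pairs ring_pts)"
 have A: "annular ?V2 ?E2" by (rule annular_check[OF annular_checks(2)]) (auto simp: ring_pts_def)
 note G = glue[OF S(1) A]
 define s :: "complex => complex" where "s = (\<lambda>z. (1/2) *\<^sub>R z)"
 have "linear s" by (auto simp: s_def linear_iff algebra_simps)
 hence s: "inj s" "\<And>e. convex hull (s ` e) = s ` (convex hull e)" by (simp add: s_def inj_def, rule convex_hull_linear_image[symmetric])
 let ?V = "V1 \<union> ?V2" and ?E = "E1 \<union> ?E2"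
 have c2: "card ?V2 = 6" by (subst card_image) (simp_all add: inj_on_def ring_pts_def std_corners_def)
 have t2: "20 \<le> card (tri ?E2)" using card_tri_check[of ring_pts "pairs ring_pts"] piece_checks(4) by (simp add: ring_pts_def std_corners_def)
 have "std (s ` ?V) ((`) s ` ?E)" unfolding std_def
 proof (intro conjI ballI allI)
  show "geo (s ` ?V) ((`) s ` ?E)" by (rule geo_image(1)[OF G(1) s])
  have D: "D0 = s ` (pt ` {(-4,-4), (8,-4), (-4,8)})" by (auto simp: D0_def std_corners_def s_def pt_def complex_eq_iff)
  show "D0 \<subseteq> s ` ?V" unfolding D by (intro image_mono) (auto simp: ring_pts_def std_corners_def)
  have "pt ` {(-4,-4), (8,-4), (-4,8)} \<in> tri ?E2"
  proof -
   have e: "pedge x \<in> ?E2" if "x \<in> {((-4,-4), (8,-4)), ((-4,-4), (-4,8)), ((8,-4), (-4,8))}" for x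
    using that by (intro imageI) (auto simp: ring_pts_def std_corners_def)
   have "card (pt ` {(-4,-4), (8,-4), (-4,8)}) = 3" by simp
   moreover have "pedge ((-4,-4), (8,-4)) \<in> ?E2" "pedge ((-4,-4), (-4,8)) \<in> ?E2" "pedge ((8,-4), (-4,8)) \<in> ?E2" by (rule e, simp)+
   ultimately show ?thesis unfolding tri_def by (simp add: seg_of_def insert_commute)
  qed
  hence "pt ` {(-4,-4), (8,-4), (-4,8)} \<in> tri ?E" by (auto simp: tri_def)
  thus "D0 \<in> tri ((`) s ` ?E)" unfolding D by (rule tri_image[OF s(1)])
  fix z i assume z: "z \<in> s ` ?V - D0"
  then obtain w where w: "w \<in> ?V" "z = s w" by blast
  have half: "hh i z = hh i w / 2" by (simp add: w(2) s_def hh_def)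
  show "hh i z < 2"
  proof (cases "w \<in> V1")
   case True
   have "hh i w \<le> 2"
   proof (cases "w \<in> D0")
    case False
    thus ?thesis using S(1) True by (auto simp: std_def intro: less_imp_le)
   qed (rule D0_le)
   thus ?thesis using half by simp
  next
   case False
   hence "w \<in> ?V2" using w(1) by simp
   moreover have "w \<notin> pt ` {(-4,-4), (8,-4), (-4,8)}" using z w(2) unfolding D by blast
   ultimately have "w \<in> D0" by (auto simp: ring_pts_def D0_def)
   thus ?thesis using half D0_le[of w i] by simp
  qed
 qed
 moreover have "card (s ` ?V) = n + 3" using geo_image(2)[OF G(1) s] G(2) S(2) c2 by simp
 ultimately show ?thesis using geo_image(3)[OF G(1) s] G(3) t2 S(3) unfolding std_family_def by (intro exI[of _ "s ` ?V"] exI[of _ "(`) s ` ?E"] conjI) simp_all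
qed

lemma std_base: "std_family 3 1" "std_family 7 25"
proof -
 show "std_family 3 1" unfolding std_family_def
 proof (intro exI conjI)
  show "std (pt ` set std_corners) (pedge ` set (pairs std_corners))" using piece_checks(1) by (intro std_check) (simp_all add: list_all_iff)
  show "card (pt ` set std_corners) = 3" by (simp add: std_corners_def)
  show "1 \<le> card (tri (pedge ` set (pairs std_corners)))" using card_tri_check[of std_corners "pairs std_corners"] piece_checks(1) by (simp add: std_corners_def)
 qed
 show "std_family 7 25" unfolding std_family_def
 proof (intro exI conjI)
  show "std (pt ` set inner_pts) (pedge ` set inner_edges)"
   using piece_checks(2) by (intro std_check) (simp_all add: inner_pts_def inner_edges_def std_corners_def ih_def)
  show "card (pt ` set inner_pts) = 7" by (simp add: inner_pts_def std_corners_def)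
  show "25 \<le> card (tri (pedge ` set inner_edges))" using card_tri_check[of inner_pts inner_edges] piece_checks(2) by (simp add: inner_pts_def std_corners_def)
 qed
qed

lemma std_rings: "std_family n t ==> std_family (n + 3 * j) (t + 19 * j)"
proof (induction j)
 case (Suc j)
 thus ?case using ring_step[of "n + 3 * j" "t + 19 * j"] by (simp add: algebra_simps)
qed simp

theorem plane_examples:
 assumes "2 \<le> k" "s \<le> 2" "3 * k + s ~= 8"
 shows "\<exists>G :: nat sgraph. one_planar G \<and> card (verts G) = 3 * k + s \<and> 19 * k + 5 * s - 18 \<le> num_subgraphs_iso (complete_graph 3) G"
proof -
 have *: "\<exists>G :: nat sgraph. one_planar G \<and> card (verts G) = n \<and> t \<le> num_subgraphs_iso (complete_graph 3) G"
  if "geo V E" "card V = n" "t \<le> card (tri E)" for V :: "complex set" and E n t using plane_one_planar[OF that(1)] that(2,3) by (metis order_trans)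
 have std: "\<exists>G :: nat sgraph. one_planar G \<and> card (verts G) = n \<and> t \<le> num_subgraphs_iso (complete_graph 3) G"
  if sf: "std_family n t" for n t
 proof -
  obtain V E where "std V E" "card V = n" "t \<le> card (tri E)" using sf by (auto simp: std_family_def)
  thus ?thesis using *[of V E n t] by (simp add: std_def)
 qed
 consider "s = 0" | "s = 1" | "s = 2" "3 \<le> k" using assms by fastforce
 thus ?thesis
 proof cases
  case 1
  have "std_family (3 + 3 * (k - 1)) (1 + 19 * (k - 1))" by (rule std_rings[OF std_base(1)])
  moreover have "3 + 3 * (k - 1) = 3 * k + s" "1 + 19 * (k - 1) = 19 * k + 5 * s - 18" using 1 assms(1) by simp_all
  ultimately show ?thesis using std by metis
 next
  case 2
  have "std_family (7 + 3 * (k - 2)) (25 + 19 * (k - 2))" by (rule std_rings[OF std_base(2)])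
  moreover have "7 + 3 * (k - 2) = 3 * k + s" "25 + 19 * (k - 2) = 19 * k + 5 * s - 18" using 2 assms(1) by simp_all
  ultimately show ?thesis using std by metis
 next
  case 3
  \<comment> \<open>Residue 2 is reached by extending both ends: a seven-vertex core, rings, and
    finally four vertices outside, with 25 - 1 further triangles. The smallest such graph has 11
    vertices, which leaves 8 to the cube.\<close>
  have "std_family (7 + 3 * (k - 3)) (25 + 19 * (k - 3))" by (rule std_rings[OF std_base(2)])
  then obtain V1 E1 where S: "std V1 E1" "card V1 = 7 + 3 * (k - 3)" "25 + 19 * (k - 3) \<le> card (tri E1)" by (auto simp: std_family_def)
  have A: "annular (pt ` set outer_pts) (pedge ` set outer_edges)" by (rule annular_check[OF annular_checks(1)]) (auto simp: outer_pts_def)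
  note G = glue[OF S(1) A]
  have "card (pt ` set outer_pts) = 7" by (simp add: outer_pts_def std_corners_def)
  moreover have "25 \<le> card (tri (pedge ` set outer_edges))"
   using card_tri_check[of outer_pts outer_edges] piece_checks(3) by (simp add: outer_pts_def std_corners_def)
  ultimately show ?thesis using G(2,3) S(2,3) 3 by (intro *[OF G(1)]) simp_all
 qed
qed

section \<open>The cube\<close>

definition bsg :: "bool => real" where "bsg b = (if b then 1 else - 1)"

definition cpt :: "bool \<times> bool \<times> bool => real^3" where
 "cpt p = vector [bsg (fst p), bsg (fst (snd p)), bsg (snd (snd p))]"

definition cube_pts :: "(bool \<times> bool \<times> bool) list" where
 "cube_pts = [(False, False, False), (False, False, True), (False, True, False), (False, True, True),
   (True, False, False), (True, False, True), (True, True, False), (True, True, True)]"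

text \<open>All pairs of corners except the four antipodal ones: the edges and the face diagonals of
  the cube.\<close>

definition cube_prs :: "((bool \<times> bool \<times> bool) \<times> (bool \<times> bool \<times> bool)) list" where
 "cube_prs = filter (\<lambda>(p, q). fst p = fst q \<or> snd p = snd q \<or> fst (snd p) = fst (snd q) \<or> snd (snd p) = snd (snd q)) (pairs cube_pts)"

definition cube_bd :: "(real^3) set" where
 "cube_bd = {x. (\<forall>l. \<bar>x $ l\<bar> \<le> 1) \<and> (\<exists>l. \<bar>x $ l\<bar> = 1)}"

text \<open>What one coordinate says about two segments meeting in inner points: a constant
  coordinate is extremal and must be constant with the same value on the other segment, whereas a
  changing one lies strictly between the extremes.\<close>

definition crossing_pattern :: "bool => bool => bool => bool => bool" where
 "crossing_pattern a b c d \<longleftrightarrow> (if a = b then c = a \<and> d = a else c ~= d)"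

definition cube_meets :: "(bool \<times> bool \<times> bool) \<times> (bool \<times> bool \<times> bool) => (bool \<times> bool \<times> bool) \<times> (bool \<times> bool \<times> bool) => bool" where
 "cube_meets e f \<longleftrightarrow> fst e ~= fst f \<and> fst e ~= snd f \<and>
   list_all (\<lambda>h. crossing_pattern (h (fst e)) (h (snd e)) (h (fst f)) (h (snd f))) [fst, fst \<circ> snd, snd \<circ> snd]"

lemma cpt_coord [simp]: "cpt p $ 1 = bsg (fst p)" "cpt p $ 2 = bsg (fst (snd p))" "cpt p $ 3 = bsg (snd (snd p))" by (simp_all add: cpt_def)

lemma bsg_abs [simp]: "\<bar>bsg b\<bar> = 1" by (simp add: bsg_def)

lemma inj_cpt: "inj cpt" by (rule injI) (auto simp: vec_eq_iff forall_3 bsg_def prod_eq_iff split: if_splits)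

lemma cube_prs_checks: "length (tlist cube_pts cube_prs) = 32"
 "list_all (\<lambda>e. fst e ~= snd e \<and> length (filter (cube_meets e) cube_prs) \<le> 1) cube_prs" by code_simp+

lemma hull_open:
 assumes "z \<in> convex hull (seg_of cpt e)" "z \<notin> seg_of cpt e" shows "\<exists>t. 0 < t \<and> t < 1 \<and> z = (1 - t) *\<^sub>R cpt (fst e) + t *\<^sub>R cpt (snd e)"
proof -
 obtain t where t: "0 \<le> t" "t \<le> 1" "z = (1 - t) *\<^sub>R cpt (fst e) + t *\<^sub>R cpt (snd e)" using hull_pair assms(1) unfolding seg_of_def by blast
 have "t ~= 0" "t ~= 1" using t(3) assms(2) by (auto simp: seg_of_def)
 thus ?thesis using t by (intro exI[of _ t]) simp
qed

lemma bsg_strict: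
 assumes "0 < t" "t < 1" "(1 - t) * bsg a + t * bsg b = bsg c" shows "a = c \<and> b = c"
 using assms by (auto simp: bsg_def split: if_splits)

lemma bsg_pattern:
 assumes t: "0 < t" "t < 1" and u: "0 < u" "u < 1" and e: "(1 - t) * bsg a + t * bsg b = (1 - u) * bsg c + u * bsg d" shows "crossing_pattern a b c d"
 using assms by (cases a; cases b; cases c; cases d) (simp_all add: crossing_pattern_def bsg_def)

lemma cube_vertex:
 assumes "cpt v \<in> convex hull (seg_of cpt e)" "fst e ~= snd e" shows "v = fst e \<or> v = snd e"
proof (rule ccontr)
 assume n: "\<not> ?thesis"
 hence "cpt v \<notin> seg_of cpt e" using inj_cpt by (auto simp: seg_of_def inj_eq)
 then obtain t where t: "0 < t" "t < 1" and v: "cpt v = (1 - t) *\<^sub>R cpt (fst e) + t *\<^sub>R cpt (snd e)" using hull_open[OF assms(1)] by blast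
 have c: "(1 - t) * bsg (fst (fst e)) + t * bsg (fst (snd e)) = bsg (fst v)"
  "(1 - t) * bsg (fst (snd (fst e))) + t * bsg (fst (snd (snd e))) = bsg (fst (snd v))"
  "(1 - t) * bsg (snd (snd (fst e))) + t * bsg (snd (snd (snd e))) = bsg (snd (snd v))" using v unfolding vec_eq_iff forall_3 by simp_all
 show False using n bsg_strict[OF t c(1)] bsg_strict[OF t c(2)] bsg_strict[OF t c(3)] by (simp add: prod_eq_iff)
qed

lemma cube_geo: "geo (cpt ` set cube_pts) (seg_of cpt ` set cube_prs)"
proof (rule geo_list[OF inj_cpt, where mt = cube_meets])
 have ne: "fst x ~= snd x" if "x \<in> set cube_prs" for x using cube_prs_checks(2) that by (simp add: list_all_iff)
 have mem: "p \<in> set cube_pts" for p by (cases p) (auto simp: cube_pts_def)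
 fix x assume x: "x \<in> set cube_prs"
 show "fst x \<in> set cube_pts \<and> snd x \<in> set cube_pts \<and> fst x ~= snd x" using ne[OF x] mem by simp
 show "v = fst x \<or> v = snd x" if "cpt v \<in> convex hull (seg_of cpt x)" for v by (rule cube_vertex[OF that ne[OF x]])
 show "length (filter (cube_meets x) cube_prs) \<le> 1" using cube_prs_checks(2) x by (simp add: list_all_iff)
 show "cube_meets x y" if y: "y \<in> set cube_prs" and c: "crosses (seg_of cpt x) (seg_of cpt y)" for y
 proof -
  obtain z where z: "z \<in> convex hull (seg_of cpt x)" "z \<in> convex hull (seg_of cpt y)" and disj: "seg_of cpt x \<inter> seg_of cpt y = {}"
   using c by (auto simp: crosses_def)
  have vx: "z \<in> seg_of cpt g" if h: "z \<in> seg_of cpt h" and g: "z \<in> convex hull (seg_of cpt g)" "fst g ~= snd g" for g h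
  proof -
   obtain v where v: "z = cpt v" using h unfolding seg_of_def by blast
   show ?thesis using cube_vertex[OF g(1)[unfolded v] g(2)] by (auto simp: v seg_of_def)
  qed
  have nx: "z \<notin> seg_of cpt x" using vx[OF _ z(2) ne[OF y], of x] disj by blast
  have ny: "z \<notin> seg_of cpt y" using vx[OF _ z(1) ne[OF x], of y] disj by blast
  obtain t where t: "0 < t" "t < 1" and zt: "z = (1 - t) *\<^sub>R cpt (fst x) + t *\<^sub>R cpt (snd x)" using hull_open[OF z(1) nx] by blast
  obtain u where u: "0 < u" "u < 1" and zu: "z = (1 - u) *\<^sub>R cpt (fst y) + u *\<^sub>R cpt (snd y)" using hull_open[OF z(2) ny] by blast
  have "(1 - t) *\<^sub>R cpt (fst x) + t *\<^sub>R cpt (snd x) = (1 - u) *\<^sub>R cpt (fst y) + u *\<^sub>R cpt (snd y)" using zt zu by simp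
  thus ?thesis using disj bsg_pattern[OF t u] by (auto simp: cube_meets_def seg_of_def vec_eq_iff forall_3)
 qed
qed

lemma cube_hull_bd: "convex hull e \<subseteq> cube_bd" if e: "e \<in> seg_of cpt ` set cube_prs" for e
proof
 fix z assume z: "z \<in> convex hull e"
 obtain p q where pq: "(p, q) \<in> set cube_prs" "e = {cpt p, cpt q}" using e by (auto simp: seg_of_def)
 obtain t where t: "0 \<le> t" "t \<le> 1" "z = (1 - t) *\<^sub>R cpt p + t *\<^sub>R cpt q" using hull_pair z unfolding pq(2) by blast
 have b: "\<bar>(1 - t) * bsg a + t * bsg b\<bar> \<le> 1" "a = b ==> \<bar>(1 - t) * bsg a + t * bsg b\<bar> = 1" for a b using t(1,2) by (auto simp: bsg_def)
 have "fst p = fst q \<or> fst (snd p) = fst (snd q) \<or> snd (snd p) = snd (snd q)" using pq(1) by (auto simp: cube_prs_def)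
 hence "\<exists>l. \<bar>z $ l\<bar> = 1" by (elim disjE, intro exI[of _ 1], simp add: t(3) b(2), intro exI[of _ 2], simp add: t(3) b(2), intro exI[of _ 3], simp add: t(3) b(2))
 moreover have "\<forall>l. \<bar>z $ l\<bar> \<le> 1" unfolding t(3) forall_3 by (simp add: b(1))
 ultimately show "z \<in> cube_bd" by (simp add: cube_bd_def)
qed

lemma cube_example: "\<exists>G :: nat sgraph. one_planar G \<and> card (verts G) = 8 \<and> 32 \<le> num_subgraphs_iso (complete_graph 3) G"
proof -
 have "\<exists>G :: nat sgraph. one_planar G \<and> card (verts G) = card (cpt ` set cube_pts) \<and>
   card (tri (seg_of cpt ` set cube_prs)) \<le> num_subgraphs_iso (complete_graph 3) G"
 proof (rule sgn_one_planar[OF cube_geo cube_hull_bd])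
  show "cpt ` set cube_pts \<subseteq> cube_bd" by (auto simp: cube_bd_def forall_3 intro!: exI[of _ 1])
  show "0 \<notin> cube_bd" by (auto simp: cube_bd_def)
  show "inj_on sgn cube_bd"
  proof (rule inj_on_sgn)
   fix x c assume x: "x \<in> cube_bd" "c *\<^sub>R x \<in> cube_bd" "0 < c"
   obtain l where l: "\<bar>x $ l\<bar> = 1" using x(1) by (auto simp: cube_bd_def)
   have "\<bar>(c *\<^sub>R x) $ l\<bar> \<le> 1" using x(2) unfolding cube_bd_def by blast
   thus "c \<le> 1" using l x(3) by (simp add: abs_mult)
  qed (auto simp: cube_bd_def)
 qed
 moreover have "card (cpt ` set cube_pts) = 8" by (subst card_image[OF inj_on_subset[OF inj_cpt subset_UNIV]]) (simp add: cube_pts_def)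
 moreover have "32 \<le> card (tri (seg_of cpt ` set cube_prs))" using card_tri_list[OF _ inj_cpt cube_geo, of cube_pts] cube_prs_checks(1) by (simp add: cube_pts_def)
 ultimately show ?thesis by (elim exE conjE) (rule exI, intro conjI, assumption, simp, simp)
qed

theorem theorem1p1:
  fixes k s n m :: nat
  assumes "k \<ge> 2" and "s \<in> {0, 1, 2}"
    and n: "n = 3 * k + s"
    and m: "m = (if n = 8 then 32 else 19 * k + 5 * s - 18)"
  shows "(\<exists>G :: nat sgraph. one_planar G \<and> card (verts G) = n \<and>
            num_subgraphs_iso (complete_graph 3) G = m) \<and>
         (\<forall>G :: 'a sgraph. one_planar G \<and> card (verts G) = n \<longrightarrow>
            num_subgraphs_iso (complete_graph 3) G \<le> m)"
proof (intro conjI allI impI)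
 have s: "s \<le> 2" using assms(2) by auto
 \<comment> \<open>The bound is needed for two vertex types, \<open>nat\<close> for the extremal
   graph and \<open>'a\<close> for the second claim, hence the separate type variable.\<close>
 have ub: "num_subgraphs_iso (complete_graph 3) G \<le> m" if "one_planar G \<and> card (verts G) = n" for G :: "'v sgraph"
  using triangle_bound[of G k s] that assms(1) s by (simp add: n m)
 have "\<exists>G :: nat sgraph. one_planar G \<and> card (verts G) = n \<and> m \<le> num_subgraphs_iso (complete_graph 3) G"
 proof (cases "n = 8")
  case True
  thus ?thesis using cube_example by (simp add: m)
 next
  case False
  thus ?thesis using plane_examples[of k s] assms(1) s by (simp add: m n)
 qed
 then obtain G :: "nat sgraph" where "one_planar G" "card (verts G) = n" "m \<le> num_subgraphs_iso (complete_graph 3) G" by (elim exE conjE)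
 thus "\<exists>G :: nat sgraph. one_planar G \<and> card (verts G) = n \<and> num_subgraphs_iso (complete_graph 3) G = m" using ub[of G] by (intro exI[of _ G]) simp
 show "num_subgraphs_iso (complete_graph 3) G \<le> m" if "one_planar G \<and> card (verts G) = n" for G :: "'a sgraph" by (rule ub[OF that])
qed

end
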